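(* Fix $c<1/4$. Let $k=k(n)$ be positive integers with $n>2k$ and $k<\sqrt{cn\log n}$, and let $p=p(n)\in[0,1]$, $\varphi=p\binom{n-1}{k-1}$. Suppose that there is a function $\epsilon(n)\to 0$ such that $\Pr\big(\Lambda(\Delta)>\epsilon(n)\big)\to 0$ as $n\to\infty$. Then $\Pr(\mathcal{H}_k(n,p)\text{ satisfies EKR})\to 1$ as $n\to\infty$.
   Context: $V=[n]$, $\mathcal{K}=\binom{V}{k}$. $\mathcal{H}=\mathcal{H}_k(n,p)$ is the random $k$-graph in which each member of $\mathcal{K}$ is present independently with probability $p$. A family of sets is a clique (intersecting) if no two of its members are disjoint. The star of $x$ in $\mathcal{H}$ is $\mathcal{H}_x=\{A\in\mathcal{H}:x\in A\}$. $\mathcal{H}$ satisfies EKR if every largest clique contained in $\mathcal{H}$ is a star. $\Delta$ is the maximum degree of $\mathcal{H}$ (degree of $x$ = number of edges containing $x$). $\bar m=\varphi n/k$ ($=\mathbb{E}|\mathcal{H}|$). $q=\Pr(A\cap B\neq\emptyset)$ for $A,B$ chosen uniformly and independently from $\mathcal{K}$. For $t\in\mathbb{N}$, $\Lambda(t)=\binom{\bar m}{t}q^{\binom{t}{2}}$, where $\binom{a}{b}=a(a-1)\cdots(a-b+1)/b!$ for real $a$. All quantities depend on $n$ and limits are as $n\to\infty$. *)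

theory Defs
  imports "HOL-Probability.Probability" "HOL-Probability.Product_PMF"
begin

definition ksets :: "nat \<Rightarrow> nat \<Rightarrow> nat set set" where
  "ksets n k = {A. A \<subseteq> {1..n} \<and> card A = k}"

definition random_kgraph :: "nat \<Rightarrow> nat \<Rightarrow> real \<Rightarrow> nat set set pmf" where
  "random_kgraph n k p =
     map_pmf (\<lambda>present. {A \<in> ksets n k. present A})
       (Pi_pmf (ksets n k) False (\<lambda>_. bernoulli_pmf p))"

definition clique :: "'a set set \<Rightarrow> bool" where
  "clique F \<longleftrightarrow> pairwise (\<lambda>A B. \<not> disjnt A B) F"

definition star :: "'a set set \<Rightarrow> 'a \<Rightarrow> 'a set set" where
  "star H x = {A \<in> H. x \<in> A}"

definition largest_clique :: "'a set set \<Rightarrow> 'a set set \<Rightarrow> bool" where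
  "largest_clique H F \<longleftrightarrow> is_arg_max card (\<lambda>G. G \<subseteq> H \<and> clique G) F"

definition satisfies_EKR :: "nat \<Rightarrow> nat set set \<Rightarrow> bool" where
  "satisfies_EKR n H \<longleftrightarrow> (\<forall>F. largest_clique H F \<longrightarrow> (\<exists>x\<in>{1..n}. F = star H x))"

definition max_degree :: "nat \<Rightarrow> nat set set \<Rightarrow> nat" where
  "max_degree n H = Max ((\<lambda>x. card (star H x)) ` {1..n})"

definition phi :: "nat \<Rightarrow> nat \<Rightarrow> real \<Rightarrow> real" where
  "phi n k p = p * real ((n - 1) choose (k - 1))"

definition mbar :: "nat \<Rightarrow> nat \<Rightarrow> real \<Rightarrow> real" where
  "mbar n k p = phi n k p * real n / real k"

definition meet_prob :: "nat \<Rightarrow> nat \<Rightarrow> real" where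
  "meet_prob n k =
     measure_pmf.prob (pair_pmf (pmf_of_set (ksets n k)) (pmf_of_set (ksets n k)))
       {(A, B). A \<inter> B \<noteq> {}}"

definition Lam :: "nat \<Rightarrow> nat \<Rightarrow> real \<Rightarrow> nat \<Rightarrow> real" where
  "Lam n k p t = (mbar n k p gchoose t) * meet_prob n k ^ (t choose 2)"

end

theory Submission
  imports Defs "HOL-Real_Asymp.Real_Asymp"
begin

text \<open>
  Write \<open>L = ln n\<close>, \<open>q\<close> for the probability that two random \<open>k\<close>-sets meet and \<open>r = 1 - q\<close>; the hypothesis on
  \<open>k\<close> gives \<open>r \<ge> n^(-1/4 + a)\<close> for a fixed \<open>a > 0\<close>. If EKR fails there is a nontrivial clique at least as large
  as the maximum degree \<open>\<Delta>\<close>, and \<open>\<Delta>\<close> is with high probability at least the least \<open>t\<close> with \<open>\<Lambda>(t) \<le> \<epsilon>\<close> and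
  at least the largest degree whose expected number of vertices is \<open>n^\<Omega>(1)\<close> (second moment). Three regimes are treated.

  If \<open>r \<phi>\<close> is at most a small power of \<open>n\<close> and \<open>q\<close> is not polynomially small, a first moment computation with the
  sharp count of \<open>t\<close>-sets of pairwise meeting edges of bounded degree shows that cliques of size \<open>t\<close> are essentially
  stars: all but a small fraction of the edges contain a common \<open>x\<close>. The few edges missing \<open>x\<close> cannot compensate
  for the edges at \<open>x\<close> that are disjoint from one of them.

  If \<open>q\<close> is polynomially small, nontrivial cliques of any fixed size are counted through their incidence patterns
  (covers of the pairs of indices by proper subsets); the two extreme patterns are the generic one, which is governed by
  \<open>\<Lambda>(t)\<close>, and the one in which a single vertex lies in all edges but one.

  If \<open>r \<phi>\<close> is large, the structure of cliques is pulled back from a random sparsification of \<open>\<H>\<close> that falls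
  into one of the first two regimes, and the edges missing the centre are again too few to be profitable.
\<close>

section \<open>Random subsets\<close>

text \<open>The constant 1/4 is decisive at two places. Outside the dense regime,
  \<open>r \<ge> n^(-1/4 + a)\<close> keeps \<open>phi\<close> and the relevant clique size
  \<open>t\<close> below about \<open>n^(1/4 - a)\<close>. First, a uniform \<open>k\<close>-set is
  replaced by independent choices of its vertices, which makes meeting probabilities multiply; the
  relative error is of order \<open>n^(-1/4)\<close> and has to survive multiplication by
  \<open>t\<close>. Second, each edge that a near-star has off its centre is worth a factor of about
  \<open>phi^2 * k / n\<close>, a negative power of \<open>n\<close> only if \<open>phi\<close>
  stays below \<open>n^(1/4)\<close>. The obstacle to the count is correlation: a vertex of degree
  \<open>d\<close> in a clique lets a new edge meet \<open>d\<close> members at once and is charged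
  \<open>1 + pi' * (1 / q^d - 1)\<close>. This is negligible for small \<open>d\<close> but not for
  \<open>d\<close> near \<open>t\<close>; hence cliques are separated by their largest degree. The
  hypothesis bounds \<open>Lam\<close> at a random value and gives no rate. Generic cliques are
  therefore excluded only up to a multiple of \<open>eps\<close>, and the room needed against
  near-stars comes from the degree distribution, not from \<open>Lam\<close>.\<close>

definition rsub :: "'a set \<Rightarrow> real \<Rightarrow> 'a set pmf" where
  "rsub U p = map_pmf (\<lambda>f. {x \<in> U. f x}) (Pi_pmf U False (\<lambda>_. bernoulli_pmf p))"

abbreviation Prs :: "'a set \<Rightarrow> real \<Rightarrow> ('a set \<Rightarrow> bool) \<Rightarrow> real" where
  "Prs U p Q \<equiv> measure_pmf.prob (rsub U p) {H. Q H}"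

lemma random_kgraph_eq_rsub: "random_kgraph n k p = rsub (ksets n k) p"
  by (simp add: random_kgraph_def rsub_def)

lemma rsub_empty [simp]: "rsub {} p = return_pmf {}"
  by (simp add: rsub_def)

lemma set_pmf_rsub: "H \<in> set_pmf (rsub U p) \<Longrightarrow> H \<subseteq> U"
  by (auto simp: rsub_def)

text \<open>One independent coin per element; this recursion is what the inductions over the ground
  set run on.\<close>

lemma rsub_insert:
  assumes "finite U" "x \<notin> U"
  shows "rsub (insert x U) p =
    map_pmf (\<lambda>(b, A). if b then insert x A else A) (pair_pmf (bernoulli_pmf p) (rsub U p))"
  using assms unfolding rsub_def
  by (subst Pi_pmf_insert) (auto simp: pair_map_pmf2 map_pmf_comp case_prod_unfold intro!: map_pmf_cong split: if_splits)

lemma Prs_mono: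
  assumes "\<And>H. H \<subseteq> U \<Longrightarrow> Q H \<Longrightarrow> Q' H"
  shows "Prs U p Q \<le> Prs U p Q'"
proof -
  have "Prs U p Q = measure_pmf.prob (rsub U p) ({H. Q H} \<inter> set_pmf (rsub U p))"
    by (simp add: measure_Int_set_pmf)
  also have "\<dots> \<le> Prs U p Q'"
    by (intro measure_pmf.finite_measure_mono) (auto dest: set_pmf_rsub intro: assms)
  finally show ?thesis .
qed

lemma Prs_cong:
  assumes "\<And>H. H \<subseteq> U \<Longrightarrow> Q H \<longleftrightarrow> Q' H"
  shows "Prs U p Q = Prs U p Q'"
  by (intro antisym Prs_mono) (auto simp: assms)

lemma Prs_compl: "Prs U p (\<lambda>H. \<not> Q H) = 1 - Prs U p Q"
proof -
  have "{H. \<not> Q H} = UNIV - {H. Q H}" by auto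
  then show ?thesis using measure_pmf.prob_compl[of "{H. Q H}" "rsub U p"] by simp
qed

lemma Prs_disj: "Prs U p (\<lambda>H. Q H \<or> Q' H) \<le> Prs U p Q + Prs U p Q'"
proof -
  have "{H. Q H \<or> Q' H} = {H. Q H} \<union> {H. Q' H}" by auto
  then show ?thesis by (simp add: measure_Un_le)
qed

lemma Prs_Bex:
  assumes "finite I"
  shows "Prs U p (\<lambda>H. \<exists>i\<in>I. Q i H) \<le> (\<Sum>i\<in>I. Prs U p (Q i))"
proof -
  have "{H. \<exists>i\<in>I. Q i H} = (\<Union>i\<in>I. {H. Q i H})" by auto
  then show ?thesis by (simp add: assms measure_pmf.finite_measure_subadditive_finite)
qed

lemma integrable_rsub [simp]: "finite U \<Longrightarrow> integrable (measure_pmf (rsub U p)) (f :: _ \<Rightarrow> real)"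
  by (rule integrable_measure_pmf_finite) (auto intro: finite_subset[of _ "Pow U"] dest: set_pmf_rsub)

lemma expectation_rsub_insert:
  fixes f :: "'a set \<Rightarrow> real"
  assumes "finite U" "x \<notin> U" "0 \<le> p" "p \<le> 1"
  shows "measure_pmf.expectation (rsub (insert x U) p) f =
    p * measure_pmf.expectation (rsub U p) (\<lambda>A. f (insert x A)) + (1 - p) * measure_pmf.expectation (rsub U p) f"
proof -
  have fin: "finite (set_pmf (rsub U p))"
    using assms by (auto intro: finite_subset[of _ "Pow U"] dest: set_pmf_rsub)
  have eq: "rsub (insert x U) p = bind_pmf (bernoulli_pmf p) (\<lambda>b. map_pmf (\<lambda>A. if b then insert x A else A) (rsub U p))"
    using assms by (simp add: rsub_insert map_pmf_def pair_pmf_def bind_assoc_pmf bind_return_pmf)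
  have "measure_pmf.expectation (rsub (insert x U) p) f = 
     (\<Sum>b\<in>UNIV. pmf (bernoulli_pmf p) b *\<^sub>R measure_pmf.expectation (map_pmf (\<lambda>A. if b then insert x A else A) (rsub U p)) f)"
    unfolding eq by (rule pmf_expectation_bind) (auto simp: fin)
  also have "\<dots> = p * measure_pmf.expectation (rsub U p) (\<lambda>A. f (insert x A)) + (1 - p) * measure_pmf.expectation (rsub U p) f"
    using assms by (simp add: UNIV_bool)
  finally show ?thesis .
qed

lemma Prs_insert:
  assumes "finite U" "x \<notin> U" "0 \<le> p" "p \<le> 1"
  shows "Prs (insert x U) p Q = p * Prs U p (\<lambda>A. Q (insert x A)) + (1 - p) * Prs U p Q"
proof -
  have "Prs (insert x U) p Q = measure_pmf.expectation (rsub (insert x U) p) (indicator {H. Q H})" by simp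
  also have "\<dots> = p * measure_pmf.expectation (rsub U p) (\<lambda>A. indicator {H. Q H} (insert x A)) 
     + (1 - p) * measure_pmf.expectation (rsub U p) (indicator {H. Q H})"
    by (rule expectation_rsub_insert) fact+
  also have "(\<lambda>A. indicator {H. Q H} (insert x A) :: real) = indicator {A. Q (insert x A)}"
    by (auto simp: indicator_def)
  finally show ?thesis by simp
qed

section \<open>Independence over disjoint parts of the ground set\<close>

lemma rsub_Un:
  assumes "finite U" "finite V" "U \<inter> V = {}"
  shows "rsub (U \<union> V) p = map_pmf (\<lambda>(A, B). A \<union> B) (pair_pmf (rsub U p) (rsub V p))"
  using assms(1,3)
proof (induction U rule: finite_induct)
  case empty
  then show ?case by (simp add: pair_return_pmf1 map_pmf_comp)
next
  case (insert x U)
  have "rsub (insert x U \<union> V) p = rsub (insert x (U \<union> V)) p" by simp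
  also have "\<dots> = map_pmf (\<lambda>(A, B). A \<union> B) (pair_pmf (rsub (insert x U) p) (rsub V p))"
    using insert assms(2)
    apply (simp add: rsub_insert insert.IH pair_map_pmf1 pair_map_pmf2 map_pmf_comp case_prod_unfold pair_pair_pmf)
    apply (intro map_pmf_cong) 
    apply (auto)
    done
  finally show ?case .
qed

lemma prob_pair_pmf_Times:
  "measure_pmf.prob (pair_pmf M N) (A \<times> B) = measure_pmf.prob M A * measure_pmf.prob N B"
proof -
  have "measure_pmf.prob (pair_pmf M N) (A \<times> B) = measure_pmf.prob (pair_pmf M N) (A \<times> B \<inter> set_pmf (pair_pmf M N))"
    by (rule measure_Int_set_pmf[symmetric])
  also have "A \<times> B \<inter> set_pmf (pair_pmf M N) = (A \<inter> set_pmf M) \<times> (B \<inter> set_pmf N)" by auto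
  also have "measure_pmf.prob (pair_pmf M N) \<dots> = measure_pmf.prob M (A \<inter> set_pmf M) * measure_pmf.prob N (B \<inter> set_pmf N)"
    by (rule measure_pmf_prob_product) auto
  finally show ?thesis by (simp add: measure_Int_set_pmf)
qed

text \<open>Independence is always used in this form: an event about \<open>H\<close> is written in
  terms of its traces on two disjoint sets. The remaining elements are split off as a third factor
  that carries no condition.\<close>

lemma Prs_indep:
  assumes "finite U" "S \<subseteq> U" "S' \<subseteq> U" "S \<inter> S' = {}"
  shows "Prs U p (\<lambda>H. Q (H \<inter> S) \<and> Q' (H \<inter> S')) = Prs S p Q * Prs S' p Q'"
proof -
  have fin: "finite S" "finite S'" "finite (U - S - S')" using assms finite_subset by auto
  have U: "U = S \<union> (S' \<union> (U - S - S'))" using assms by auto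
  let ?R = "U - S - S'"
  have 1: "rsub U p = map_pmf (\<lambda>(A, B, C). A \<union> (B \<union> C)) (pair_pmf (rsub S p) (pair_pmf (rsub S' p) (rsub ?R p)))"
  proof -
    have "rsub U p = rsub (S \<union> (S' \<union> ?R)) p" by (rule arg_cong[where f = "\<lambda>X. rsub X p"], rule U)
    also have "\<dots> = map_pmf (\<lambda>(A, B). A \<union> B) (pair_pmf (rsub S p) (rsub (S' \<union> ?R) p))"
      using fin assms by (intro rsub_Un) auto
    also have "rsub (S' \<union> ?R) p = map_pmf (\<lambda>(A, B). A \<union> B) (pair_pmf (rsub S' p) (rsub ?R p))"
      using fin assms by (intro rsub_Un) auto
    finally show ?thesis by (simp add: pair_map_pmf2 map_pmf_comp case_prod_unfold)
  qed
  have "Prs U p (\<lambda>H. Q (H \<inter> S) \<and> Q' (H \<inter> S')) =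
    measure_pmf.prob (pair_pmf (rsub S p) (pair_pmf (rsub S' p) (rsub ?R p)))
      {(A, B, C). Q ((A \<union> (B \<union> C)) \<inter> S) \<and> Q' ((A \<union> (B \<union> C)) \<inter> S')}"
    by (subst 1) (simp add: vimage_def case_prod_unfold)
  also have "\<dots> = measure_pmf.prob (pair_pmf (rsub S p) (pair_pmf (rsub S' p) (rsub ?R p)))
      ({A. Q A} \<times> {B. Q' B} \<times> UNIV)"
  proof (rule measure_pmf.finite_measure_eq_AE)
    show "AE x in measure_pmf (pair_pmf (rsub S p) (pair_pmf (rsub S' p) (rsub ?R p))).
         (x \<in> {(A, B, C). Q ((A \<union> (B \<union> C)) \<inter> S) \<and> Q' ((A \<union> (B \<union> C)) \<inter> S')}) =
         (x \<in> {A. Q A} \<times> {B. Q' B} \<times> UNIV)"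
    proof (intro AE_pmfI)
      fix x assume "x \<in> set_pmf (pair_pmf (rsub S p) (pair_pmf (rsub S' p) (rsub ?R p)))"
      then obtain A B C where x: "x = (A, B, C)" "A \<subseteq> S" "B \<subseteq> S'" "C \<subseteq> ?R"
        by (cases x) (auto simp: set_pmf_rsub)
      have "(A \<union> (B \<union> C)) \<inter> S = A" "(A \<union> (B \<union> C)) \<inter> S' = B" using x assms by auto
      then show "(x \<in> {(A, B, C). Q ((A \<union> (B \<union> C)) \<inter> S) \<and> Q' ((A \<union> (B \<union> C)) \<inter> S')}) =
         (x \<in> {A. Q A} \<times> {B. Q' B} \<times> UNIV)" using x by simp
    qed
  qed auto
  also have "\<dots> = Prs S p Q * Prs S' p Q'"
    by (simp add: prob_pair_pmf_Times)
  finally show ?thesis .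
qed

lemma Prs_marginal:
  assumes "finite U" "S \<subseteq> U"
  shows "Prs U p (\<lambda>H. Q (H \<inter> S)) = Prs S p Q"
  using Prs_indep[OF assms, of "{}" p Q "\<lambda>_. True"] by simp

lemma Prs_superset:
  assumes "finite U" "S \<subseteq> U" "0 \<le> p" "p \<le> 1"
  shows "Prs U p (\<lambda>H. S \<subseteq> H) = p ^ card S"
proof -
  have "finite S" using assms finite_subset by auto
  have "Prs U p (\<lambda>H. S \<subseteq> H) = Prs U p (\<lambda>H. S \<subseteq> H \<inter> S)" by (rule Prs_cong) auto
  also have "\<dots> = Prs S p (\<lambda>H. S \<subseteq> H)" by (rule Prs_marginal) fact+
  also have "\<dots> = p ^ card S" using \<open>finite S\<close>
  proof (induction S rule: finite_induct)
    case (insert x F)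
    have "Prs F p (\<lambda>A. insert x F \<subseteq> A) = Prs F p (\<lambda>A. False)"
      using insert by (intro Prs_cong) auto
    moreover have "Prs F p (\<lambda>A. insert x F \<subseteq> insert x A) = Prs F p (\<lambda>A. F \<subseteq> A)"
      using insert by (intro Prs_cong) auto
    ultimately show ?case using insert assms by (simp add: Prs_insert)
  qed simp
  finally show ?thesis .
qed

text \<open>The first moment bound, in the form in which every family of forbidden configurations is
  excluded.\<close>

lemma Prs_exists_superset:
  assumes "finite U" "finite FF" "\<And>F. F \<in> FF \<Longrightarrow> F \<subseteq> U \<and> card F = t" "0 \<le> p" "p \<le> 1"
  shows "Prs U p (\<lambda>H. \<exists>F\<in>FF. F \<subseteq> H) \<le> real (card FF) * p ^ t"
proof -
  have "Prs U p (\<lambda>H. \<exists>F\<in>FF. F \<subseteq> H) \<le> (\<Sum>F\<in>FF. Prs U p (\<lambda>H. F \<subseteq> H))"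
    by (rule Prs_Bex) fact
  also have "\<dots> = (\<Sum>F\<in>FF. p ^ t)" using assms by (intro sum.cong refl) (simp add: Prs_superset)
  finally show ?thesis by simp
qed

lemma Prs_card_binomial:
  assumes "finite U" "0 \<le> p" "p \<le> 1"
  shows "Prs U p (\<lambda>H. P (card H)) = measure_pmf.prob (binomial_pmf (card U) p) {j. P j}"
  using assms by (subst binomial_pmf_altdef'[of U, where dflt = False]) (auto simp: rsub_def vimage_def)

lemma Prs_card_eq:
  assumes "finite U" "0 \<le> p" "p \<le> 1"
  shows "Prs U p (\<lambda>H. card H = j) = real (card U choose j) * p ^ j * (1 - p) ^ (card U - j)"
proof -
  have "{i. i = j} = {j}" by auto
  then show ?thesis using assms by (simp add: Prs_card_binomial[where P = "\<lambda>i. i = j"] measure_pmf_single)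
qed

section \<open>Tail bounds for the size of a random subset\<close>

lemma choose_mult_power_le: "real (N choose j) * p ^ j \<le> (real N * p) ^ j / fact j" if "0 \<le> p"
proof -
  have "real (N choose j) * fact j \<le> real N ^ j"
  proof (cases "j \<le> N")
    case True
    have "real (N choose j) * fact j = real (fact j * (N choose j))" by simp
    also have "\<dots> \<le> real (N ^ j)"
      by (metis binomial_fact_pow mult.commute of_nat_mono of_nat_fact)
    finally show ?thesis by simp
  qed (simp add: binomial_eq_0)
  then have "real (N choose j) \<le> real N ^ j / fact j" by (simp add: field_simps)
  then have "real (N choose j) * p ^ j \<le> real N ^ j / fact j * p ^ j"
    using that by (intro mult_right_mono) auto
  then show ?thesis by (simp add: power_mult_distrib)
qed

lemma Prs_card_Int_ge:
  assumes "finite U" "S \<subseteq> U" "0 \<le> p" "p \<le> 1"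
  shows "Prs U p (\<lambda>H. j \<le> card (H \<inter> S)) \<le> (real (card S) * p) ^ j / fact j"
proof -
  have fin: "finite S" using assms finite_subset by auto
  have "Prs U p (\<lambda>H. j \<le> card (H \<inter> S)) \<le> Prs U p (\<lambda>H. \<exists>F\<in>{F. F \<subseteq> S \<and> card F = j}. F \<subseteq> H)"
  proof (rule Prs_mono)
    fix H assume "H \<subseteq> U" "j \<le> card (H \<inter> S)"
    then obtain F where "F \<subseteq> H \<inter> S" "card F = j" using obtain_subset_with_card_n by metis
    then show "\<exists>F\<in>{F. F \<subseteq> S \<and> card F = j}. F \<subseteq> H" by auto
  qed
  also have "\<dots> \<le> real (card {F. F \<subseteq> S \<and> card F = j}) * p ^ j"
    using assms fin by (intro Prs_exists_superset) (auto)
  also have "\<dots> \<le> (real (card S) * p) ^ j / fact j"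
    using fin assms by (simp add: n_subsets choose_mult_power_le)
  finally show ?thesis .
qed

text \<open>The quotient \<open>j^j / fact j\<close> is a single term of the exponential series of
  \<open>j\<close>.\<close>

lemma power_div_fact_le: "(x::real) ^ j / fact j \<le> (exp 1 * x / real j) ^ j" if "0 \<le> x" "0 < j"
proof -
  have "real j ^ j / fact j \<le> exp (real j)"
    using exp_ge_zero sum_le_suminf[of "\<lambda>i. inverse (fact i) * real j ^ i" "{j}"] summable_exp[of "real j"]
    by (auto simp: exp_def scaleR_conv_of_real field_simps)
  then have "real j ^ j \<le> exp 1 ^ j * fact j"
    by (simp add: field_simps exp_of_nat_mult[symmetric])
  then have "1 / fact j \<le> (exp 1 / real j) ^ j" using that by (simp add: field_simps power_divide)
  then have "x ^ j * (1 / fact j) \<le> x ^ j * (exp 1 / real j) ^ j" using that by (intro mult_left_mono) auto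
  then show ?thesis by (simp add: power_mult_distrib[symmetric] mult.commute)
qed

text \<open>Exponential Markov inequality by induction on the ground set with the threshold
  \<open>y\<close> free: a present element lowers the threshold by one, which multiplies the bound
  by \<open>exp (- l)\<close>.\<close>

lemma Prs_card_le_mgf:
  assumes "finite U" "0 \<le> p" "p \<le> 1" "0 \<le> l"
  shows "Prs U p (\<lambda>H. real (card H) \<le> y) \<le> exp (l * y) * (1 - p + p * exp (- l)) ^ card U"
  using assms(1)
proof (induction U arbitrary: y rule: finite_induct)
  case empty
  show ?case using assms by (cases "0 \<le> y") auto
next
  case (insert x U)
  let ?Z = "1 - p + p * exp (- l)"
  have "Prs (insert x U) p (\<lambda>H. real (card H) \<le> y) =
    p * Prs U p (\<lambda>A. real (card (insert x A)) \<le> y) + (1 - p) * Prs U p (\<lambda>H. real (card H) \<le> y)"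
    using insert assms by (intro Prs_insert)
  also have "Prs U p (\<lambda>A. real (card (insert x A)) \<le> y) = Prs U p (\<lambda>A. real (card A) \<le> y - 1)"
  proof (rule Prs_cong)
    fix H assume "H \<subseteq> U"
    then have "finite H" "x \<notin> H" using insert finite_subset by auto
    then show "real (card (insert x H)) \<le> y \<longleftrightarrow> real (card H) \<le> y - 1" by auto
  qed
  also have "p * Prs U p (\<lambda>A. real (card A) \<le> y - 1) + (1 - p) * Prs U p (\<lambda>H. real (card H) \<le> y)
     \<le> p * (exp (l * (y - 1)) * ?Z ^ card U) + (1 - p) * (exp (l * y) * ?Z ^ card U)"
    using insert.IH assms by (intro add_mono mult_left_mono) auto
  also have "\<dots> = exp (l * y) * ?Z ^ card (insert x U)"
    using insert by (simp add: algebra_simps exp_diff exp_minus divide_inverse)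
  finally show ?case .
qed

text \<open>Chernoff bound in which \<open>mu\<close> is any positive lower bound for the mean, so
  that applications only have to estimate the mean from below.\<close>

lemma Prs_card_lower_tail:
  assumes "finite U" "0 \<le> p" "p \<le> 1" "0 \<le> x" "x \<le> mu" "mu \<le> real (card U) * p" "0 < mu"
  shows "Prs U p (\<lambda>H. real (card H) \<le> mu - x) \<le> exp (- x\<^sup>2 / (2 * mu))"
proof -
  \<comment> \<open>Minimizes \<open>- l * x + mu * l^2 / 2\<close>, the exponent that remains once
    \<open>1 - exp (- l)\<close> is replaced by \<open>l - l^2 / 2\<close>.\<close>
  define l where "l = x / mu"
  have l: "0 \<le> l" "l \<le> 1" using assms by (auto simp: l_def)
  have e: "1 - exp (- l) \<ge> l - l\<^sup>2 / 2"
  proof -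
    have "exp (- l) \<le> 1 - l + l\<^sup>2 / 2"
    proof -
      have "exp l \<ge> 1 + l + l\<^sup>2 / 2"
        using exp_lower_Taylor_quadratic[OF l(1)] by simp
      have "1 \<le> (1 - l + l\<^sup>2 / 2) * (1 + l + l\<^sup>2 / 2)"
      proof -
        have "(1 - l + l\<^sup>2 / 2) * (1 + l + l\<^sup>2 / 2) = 1 + (l\<^sup>2)\<^sup>2 / 4"
          by (simp add: algebra_simps power2_eq_square)
        then show ?thesis by simp
      qed
      also have "\<dots> \<le> (1 - l + l\<^sup>2 / 2) * exp l"
        using \<open>exp l \<ge> _\<close> l by (intro mult_left_mono) auto
      finally have "1 \<le> (1 - l + l\<^sup>2 / 2) * exp l" .
      then show ?thesis by (simp add: exp_minus field_simps)
    qed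
    then show ?thesis by simp
  qed
  have "Prs U p (\<lambda>H. real (card H) \<le> mu - x) \<le> exp (l * (mu - x)) * (1 - p + p * exp (- l)) ^ card U"
    using assms l by (intro Prs_card_le_mgf) auto
  also have "(1 - p + p * exp (- l)) ^ card U \<le> exp (- p * (1 - exp (- l))) ^ card U"
  proof (rule power_mono)
    show "1 - p + p * exp (- l) \<le> exp (- p * (1 - exp (- l)))"
      using exp_ge_add_one_self[of "- p * (1 - exp (- l))"] by (simp add: algebra_simps)
  qed (use assms in \<open>auto intro!: add_nonneg_nonneg\<close>)
  also have "exp (- p * (1 - exp (- l))) ^ card U = exp (- (real (card U) * p) * (1 - exp (- l)))"
    by (simp add: exp_of_nat_mult[symmetric] algebra_simps)
  also have "\<dots> \<le> exp (- mu * (l - l\<^sup>2 / 2))"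
  proof -
    have "mu * (l - l\<^sup>2 / 2) \<le> mu * (1 - exp (- l))" using e assms by (intro mult_left_mono) auto
    also have "\<dots> \<le> (real (card U) * p) * (1 - exp (- l))" using assms l by (intro mult_right_mono) auto
    finally show ?thesis by simp
  qed
  also have "exp (l * (mu - x)) * exp (- mu * (l - l\<^sup>2 / 2)) = exp (- x\<^sup>2 / (2 * mu))"
    using assms by (simp add: exp_add[symmetric] l_def field_simps power2_eq_square)
  finally show ?thesis by (simp add: mult_left_mono)
qed

lemma Prs_card_Int_lower_tail:
  assumes "finite U" "S \<subseteq> U" "0 \<le> p" "p \<le> 1" "mu \<le> real (card S) * p" "0 < mu"
  shows "Prs U p (\<lambda>H. real (card (H \<inter> S)) \<le> mu / 2) \<le> exp (- mu / 8)"
proof -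
  have "Prs U p (\<lambda>H. real (card (H \<inter> S)) \<le> mu / 2) = Prs S p (\<lambda>H. real (card H) \<le> mu - mu / 2)"
    using Prs_marginal[OF assms(1,2), of p "\<lambda>H. real (card H) \<le> mu / 2"] by simp
  also have "\<dots> \<le> exp (- (mu/2)\<^sup>2 / (2 * mu))"
    using assms finite_subset by (intro Prs_card_lower_tail) auto
  also have "- (mu/2)\<^sup>2 / (2 * mu) = - mu / 8" using assms by (simp add: power2_eq_square field_simps)
  finally show ?thesis .
qed

section \<open>Thinning a random subset\<close>

lemma Prs_thin:
  assumes "finite U" "0 \<le> p" "p \<le> 1" "0 \<le> s" "s \<le> 1"
  shows "Prs U (p * s) Q = measure_pmf.expectation (rsub U p) (\<lambda>H. Prs H s Q)"
  using assms(1)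
proof (induction U arbitrary: Q rule: finite_induct)
  case (insert x U)
  have ps: "0 \<le> p * s" "p * s \<le> 1" using assms by (auto intro: mult_le_one)
  have "measure_pmf.expectation (rsub U p) (\<lambda>A. Prs (insert x A) s Q) =
    measure_pmf.expectation (rsub U p) (\<lambda>A. s * Prs A s (\<lambda>B. Q (insert x B)) + (1 - s) * Prs A s Q)"
  proof (intro integral_cong_AE AE_pmfI)
    fix A assume "A \<in> set_pmf (rsub U p)"
    then have "A \<subseteq> U" by (rule set_pmf_rsub)
    then have "finite A" "x \<notin> A" using insert.hyps by (auto dest: finite_subset)
    then show "Prs (insert x A) s Q = s * Prs A s (\<lambda>B. Q (insert x B)) + (1 - s) * Prs A s Q"
      using assms by (simp add: Prs_insert)
  qed auto
  also have "\<dots> = s * Prs U (p * s) (\<lambda>B. Q (insert x B)) + (1 - s) * Prs U (p * s) Q"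
    using insert by simp
  finally have E: "measure_pmf.expectation (rsub U p) (\<lambda>A. Prs (insert x A) s Q) =
      s * Prs U (p * s) (\<lambda>B. Q (insert x B)) + (1 - s) * Prs U (p * s) Q" .
  have "measure_pmf.expectation (rsub (insert x U) p) (\<lambda>H. Prs H s Q) =
    p * (s * Prs U (p * s) (\<lambda>B. Q (insert x B)) + (1 - s) * Prs U (p * s) Q) + (1 - p) * Prs U (p * s) Q"
    by (subst expectation_rsub_insert) (use insert assms E in auto)
  also have "\<dots> = Prs (insert x U) (p * s) Q"
    using insert ps by (simp add: Prs_insert algebra_simps)
  finally show ?case by simp
qed simp

text \<open>Pulls a bound back from a sparser random set: whenever the bad event holds,
  \<open>Q\<close> appears in the thinned set with probability at least 1/2, so at density
  \<open>p * s\<close> it is at least half as likely as the bad event.\<close>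

lemma Prs_thin_le:
  assumes "finite U" "0 \<le> p" "p \<le> 1" "0 \<le> s" "s \<le> 1"
    and "\<And>H. H \<subseteq> U \<Longrightarrow> Bad H \<Longrightarrow> 1/2 \<le> Prs H s Q"
  shows "Prs U p Bad \<le> 2 * Prs U (p * s) Q"
proof -
  have "Prs U p Bad = measure_pmf.expectation (rsub U p) (indicator {H. Bad H})" by simp
  also have "\<dots> \<le> measure_pmf.expectation (rsub U p) (\<lambda>H. 2 * Prs H s Q)"
  proof (intro integral_mono_AE AE_pmfI)
    fix H assume "H \<in> set_pmf (rsub U p)"
    then have "H \<subseteq> U" by (rule set_pmf_rsub)
    then show "indicator {H. Bad H} H \<le> 2 * Prs H s Q"
      using assms(6)[of H] by (cases "Bad H") auto
  qed (use assms in auto)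
  also have "\<dots> = 2 * Prs U (p * s) Q" using assms by (simp add: Prs_thin)
  finally show ?thesis .
qed

lemma Prs_card_0:
  assumes "finite U" "0 \<le> p" "p \<le> 1"
  shows "measure_pmf.prob (rsub U p) {{}} = (1 - p) ^ card U"
proof -
  have "Prs U p (\<lambda>H. H = {}) = Prs U p (\<lambda>H. card H = 0)"
    using assms by (intro Prs_cong) (auto dest: finite_subset)
  then show ?thesis using assms by (simp add: Prs_card_eq)
qed

section \<open>The probability of meeting every member of a family\<close>

lemma Prs_meet:
  assumes "finite U" "B \<subseteq> U" "0 \<le> p" "p \<le> 1"
  shows "Prs U p (\<lambda>A. A \<inter> B \<noteq> {}) = 1 - (1 - p) ^ card B"
proof -
  have "finite B" using assms finite_subset by auto
  have "Prs U p (\<lambda>A. A \<inter> B \<noteq> {}) = Prs B p (\<lambda>A. A \<noteq> {})" by (rule Prs_marginal) fact+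
  also have "\<dots> = 1 - Prs B p (\<lambda>A. A = {})" by (rule Prs_compl)
  finally show ?thesis using assms \<open>finite B\<close> by (simp add: Prs_card_0)
qed

lemma Prs_meet_all_disjoint:
  assumes "finite U" "0 \<le> p" "p \<le> 1" "finite I" "\<And>i. i \<in> I \<Longrightarrow> B i \<subseteq> U"
    and "\<And>i. i \<in> I \<Longrightarrow> card (B i) \<le> k" "disjoint_family_on B I"
  shows "Prs U p (\<lambda>A. \<forall>i\<in>I. A \<inter> B i \<noteq> {}) \<le> (1 - (1 - p) ^ k) ^ card I"
  using assms(4-)
proof (induction I rule: finite_induct)
  case (insert i I)
  let ?V = "\<Union>j\<in>I. B j"
  have dis: "B i \<inter> ?V = {}" using insert.prems(3) insert.hyps by (auto simp: disjoint_family_on_def)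
  have sub: "B i \<subseteq> U" "?V \<subseteq> U" using insert.prems by auto
  have eq: "A \<inter> ?V \<inter> B j = A \<inter> B j" if "j \<in> I" for A j using that by auto
  have "Prs U p (\<lambda>A. \<forall>j\<in>insert i I. A \<inter> B j \<noteq> {}) =
    Prs U p (\<lambda>A. A \<inter> B i \<noteq> {} \<and> (\<forall>j\<in>I. A \<inter> ?V \<inter> B j \<noteq> {}))"
    by (simp add: eq)
  also have "\<dots> = Prs (B i) p (\<lambda>A. A \<noteq> {}) * Prs ?V p (\<lambda>A. \<forall>j\<in>I. A \<inter> B j \<noteq> {})"
    by (rule Prs_indep) (use assms sub dis in auto)
  also have "Prs ?V p (\<lambda>A. \<forall>j\<in>I. A \<inter> B j \<noteq> {}) = Prs U p (\<lambda>A. \<forall>j\<in>I. A \<inter> ?V \<inter> B j \<noteq> {})"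
    by (rule Prs_marginal[symmetric]) (use assms sub in auto)
  also have "\<dots> = Prs U p (\<lambda>A. \<forall>j\<in>I. A \<inter> B j \<noteq> {})" by (simp add: eq)
  also have "Prs (B i) p (\<lambda>A. A \<noteq> {}) = Prs U p (\<lambda>A. A \<inter> B i \<noteq> {})"
    by (rule Prs_marginal[symmetric]) (use assms sub in auto)
  also have "\<dots> = 1 - (1 - p) ^ card (B i)" by (rule Prs_meet) (use assms sub in auto)
  also have "\<dots> * Prs U p (\<lambda>A. \<forall>j\<in>I. A \<inter> B j \<noteq> {}) \<le> (1 - (1 - p) ^ k) * (1 - (1 - p) ^ k) ^ card I"
  proof (rule mult_mono)
    have "(1 - p) ^ k \<le> (1 - p) ^ card (B i)" using assms insert.prems by (intro power_decreasing) auto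
    then show "1 - (1 - p) ^ card (B i) \<le> 1 - (1 - p) ^ k" by simp
    show "Prs U p (\<lambda>A. \<forall>j\<in>I. A \<inter> B j \<noteq> {}) \<le> (1 - (1 - p) ^ k) ^ card I"
      using insert by (intro insert.IH) (auto simp: disjoint_family_on_def)
    show "0 \<le> 1 - (1 - p) ^ k" using assms by (simp add: power_le_one)
  qed auto
  also have "\<dots> = (1 - (1 - p) ^ k) ^ card (insert i I)" using insert by simp
  finally show ?case .
qed simp

text \<open>The vertices of \<open>W\<close>, among them all that lie in two or more of the
  \<open>B i\<close>, are exposed one at a time. If \<open>y\<close> is chosen, the \<open>d\<close>
  sets through it are settled and the bound gains \<open>inverse (Q ^ d)\<close>; otherwise
  \<open>y\<close> is deleted from all of them. Averaging gives
  \<open>1 + p * (inverse (Q ^ d) - 1)\<close>. Once \<open>W\<close> is exhausted the sets are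
  disjoint and are met independently. Each exposure changes \<open>U\<close>, \<open>I\<close> and
  \<open>B\<close>, so all three vary in the induction.\<close>

lemma Prs_meet_all_aux:
  assumes "finite W" "finite U" "W \<subseteq> U" "0 \<le> p" "p \<le> 1" "finite I" "\<And>i. i \<in> I \<Longrightarrow> B i \<subseteq> U"
    and "\<And>i. i \<in> I \<Longrightarrow> card (B i) \<le> k" and Q: "Q = 1 - (1 - p) ^ k" "0 < Q"
    and "\<And>y. y \<in> U - W \<Longrightarrow> card {i \<in> I. y \<in> B i} \<le> 1"
  shows "Prs U p (\<lambda>A. \<forall>i\<in>I. A \<inter> B i \<noteq> {}) \<le>
    Q ^ card I * (\<Prod>y\<in>W. 1 + p * (inverse (Q ^ card {i \<in> I. y \<in> B i}) - 1))"
  using assms(1-3,6-8,11)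
proof (induction W arbitrary: U I B rule: finite_induct)
  case empty
  have "disjoint_family_on B I"
    unfolding disjoint_family_on_def
  proof (intro ballI impI, rule ccontr)
    fix i j assume ij: "i \<in> I" "j \<in> I" "i \<noteq> j" "B i \<inter> B j \<noteq> {}"
    then obtain y where y: "y \<in> B i" "y \<in> B j" by auto
    have "card {i, j} \<le> card {i \<in> I. y \<in> B i}" using ij y empty by (intro card_mono) auto
    also have "\<dots> \<le> 1" using y ij empty by auto
    finally show False using ij by simp
  qed
  then show ?case using Prs_meet_all_disjoint[of U p I B k] empty assms by simp
next
  case (insert y W)
  have Q1: "Q \<le> 1" using assms by simp
  define U' where "U' = U - {y}"
  have U: "U = insert y U'" "y \<notin> U'" "finite U'" "W \<subseteq> U'" using insert by (auto simp: U'_def)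
  define I' where "I' = {i \<in> I. y \<notin> B i}"
  define d where "d = card {i \<in> I. y \<in> B i}"
  have "card I = card (I' \<union> {i \<in> I. y \<in> B i})" by (rule arg_cong[where f = card]) (auto simp: I'_def)
  also have "\<dots> = card I' + d" unfolding d_def using insert by (intro card_Un_disjoint) (auto simp: I'_def)
  finally have cI: "card I = card I' + d" .
  let ?w = "\<lambda>z. 1 + p * (inverse (Q ^ card {i \<in> I. z \<in> B i}) - 1)"
  have w_mono: "1 + p * (inverse (Q ^ a) - 1) \<le> 1 + p * (inverse (Q ^ b) - 1)" if "a \<le> b" for a b
  proof -
    have "inverse (Q ^ a) \<le> inverse (Q ^ b)"
      using that Q Q1 by (intro le_imp_inverse_le power_decreasing) auto
    then show ?thesis using assms by (intro add_left_mono mult_left_mono) auto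
  qed
  have w1: "1 \<le> 1 + p * (inverse (Q ^ a) - 1)" for a
    using w_mono[of 0 a] by simp
  have P0: "0 \<le> (\<Prod>z\<in>W. ?w z)" by (intro prod_nonneg) (use w1 in \<open>auto intro: order_trans[of 0 1]\<close>)
  have "Prs U p (\<lambda>A. \<forall>i\<in>I. A \<inter> B i \<noteq> {}) =
     p * Prs U' p (\<lambda>A. \<forall>i\<in>I. insert y A \<inter> B i \<noteq> {}) + (1 - p) * Prs U' p (\<lambda>A. \<forall>i\<in>I. A \<inter> B i \<noteq> {})"
    unfolding U(1) by (rule Prs_insert) (use U assms in auto)
  also have "Prs U' p (\<lambda>A. \<forall>i\<in>I. insert y A \<inter> B i \<noteq> {}) = Prs U' p (\<lambda>A. \<forall>i\<in>I'. A \<inter> B i \<noteq> {})"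
    by (rule Prs_cong) (auto simp: I'_def)
  also have "\<dots> \<le> Q ^ card I' * (\<Prod>z\<in>W. 1 + p * (inverse (Q ^ card {i \<in> I'. z \<in> B i}) - 1))"
  proof (rule insert.IH)
    fix z assume "z \<in> U' - W"
    then have "card {i \<in> I. z \<in> B i} \<le> 1" using insert.prems by (auto simp: U'_def)
    moreover have "card {i \<in> I'. z \<in> B i} \<le> card {i \<in> I. z \<in> B i}"
      using insert by (intro card_mono) (auto simp: I'_def)
    ultimately show "card {i \<in> I'. z \<in> B i} \<le> 1" by linarith
  next
    fix i assume "i \<in> I'"
    then show "B i \<subseteq> U'" using insert.prems(4)[of i] by (auto simp: I'_def U'_def)
  qed (use insert U in \<open>auto simp: I'_def\<close>)
  also have "\<dots> \<le> Q ^ card I' * (\<Prod>z\<in>W. ?w z)"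
  proof (intro mult_left_mono prod_mono conjI)
    fix z assume "z \<in> W"
    show "0 \<le> 1 + p * (inverse (Q ^ card {i \<in> I'. z \<in> B i}) - 1)" using w1 by (rule order_trans[rotated]) auto
    show "1 + p * (inverse (Q ^ card {i \<in> I'. z \<in> B i}) - 1) \<le> ?w z"
      using insert by (intro w_mono card_mono) (auto simp: I'_def)
  qed (use Q in auto)
  also have "Prs U' p (\<lambda>A. \<forall>i\<in>I. A \<inter> B i \<noteq> {}) = Prs U' p (\<lambda>A. \<forall>i\<in>I. A \<inter> (B i - {y}) \<noteq> {})"
    using U by (intro Prs_cong) blast
  also have "\<dots> \<le> Q ^ card I * (\<Prod>z\<in>W. 1 + p * (inverse (Q ^ card {i \<in> I. z \<in> B i - {y}}) - 1))"
  proof (rule insert.IH)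
    fix z assume "z \<in> U' - W"
    then have "card {i \<in> I. z \<in> B i} \<le> 1" using insert.prems by (auto simp: U'_def)
    moreover have "card {i \<in> I. z \<in> B i - {y}} \<le> card {i \<in> I. z \<in> B i}"
      using insert by (intro card_mono) auto
    ultimately show "card {i \<in> I. z \<in> B i - {y}} \<le> 1" by linarith
  next
    fix i assume "i \<in> I"
    then have "B i \<subseteq> U" "card (B i) \<le> k" by (simp_all add: insert.prems)
    then have "finite (B i)" using insert.prems(1) by (auto dest: finite_subset)
    note \<open>finite (B i)\<close> \<open>card (B i) \<le> k\<close>
    then show "card (B i - {y}) \<le> k" using card_Diff1_le[of "B i" y] by simp
  next
    fix i assume "i \<in> I"
    then show "B i - {y} \<subseteq> U'" using insert.prems(4)[of i] by (auto simp: U'_def)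
  qed (use insert U in auto)
  also have "\<dots> = Q ^ card I * (\<Prod>z\<in>W. ?w z)"
  proof -
    have "{i \<in> I. z \<in> B i - {y}} = {i \<in> I. z \<in> B i}" if "z \<in> W" for z using that insert.hyps by auto
    then show ?thesis by (simp cong: prod.cong)
  qed
  finally have "Prs U p (\<lambda>A. \<forall>i\<in>I. A \<inter> B i \<noteq> {}) \<le>
     p * (Q ^ card I' * (\<Prod>z\<in>W. ?w z)) + (1 - p) * (Q ^ card I * (\<Prod>z\<in>W. ?w z))"
    using assms by (simp add: mult_left_mono add_mono)
  also have "\<dots> = Q ^ card I * (?w y * (\<Prod>z\<in>W. ?w z))"
    using Q by (simp add: cI d_def[symmetric] power_add field_simps)
  also have "?w y * (\<Prod>z\<in>W. ?w z) = (\<Prod>z\<in>insert y W. ?w z)" using insert by simp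
  finally show ?case .
qed

lemma Prs_meet_all:
  assumes "finite U" "0 \<le> p" "p \<le> 1" "finite I" "\<And>i. i \<in> I \<Longrightarrow> B i \<subseteq> U"
    and "\<And>i. i \<in> I \<Longrightarrow> card (B i) \<le> k" and Q: "Q = 1 - (1 - p) ^ k" "0 < Q"
  shows "Prs U p (\<lambda>A. \<forall>i\<in>I. A \<inter> B i \<noteq> {}) \<le>
    Q ^ card I * (\<Prod>y\<in>{y\<in>U. 2 \<le> card {i \<in> I. y \<in> B i}}. 1 + p * (inverse (Q ^ card {i \<in> I. y \<in> B i}) - 1))"
  by (rule Prs_meet_all_aux[where k = k]) (use assms in auto)

section \<open>Comparison with uniformly random sets of fixed size\<close>

lemma Prs_eq_set:
  assumes "finite U" "A \<subseteq> U" "0 \<le> p" "p \<le> 1"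
  shows "Prs U p (\<lambda>H. H = A) = p ^ card A * (1 - p) ^ (card U - card A)"
proof -
  have fin: "finite A" using assms finite_subset by auto
  have "Prs U p (\<lambda>H. H = A) = Prs U p (\<lambda>H. A \<subseteq> H \<inter> A \<and> H \<inter> (U - A) = {})"
    using assms by (intro Prs_cong) auto
  also have "\<dots> = Prs A p (\<lambda>X. A \<subseteq> X) * Prs (U - A) p (\<lambda>X. X = {})"
    by (rule Prs_indep) (use assms in auto)
  also have "\<dots> = p ^ card A * (1 - p) ^ (card U - card A)"
    using assms fin by (simp add: Prs_superset Prs_card_0 card_Diff_subset)
  finally show ?thesis .
qed

lemma Prs_card_and:
  assumes "finite U" "0 \<le> p" "p \<le> 1"
  shows "Prs U p (\<lambda>H. card H = j \<and> Q H) = real (card {A. A \<subseteq> U \<and> card A = j \<and> Q A}) * p ^ j * (1 - p) ^ (card U - j)"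
proof -
  let ?S = "{A. A \<subseteq> U \<and> card A = j \<and> Q A}"
  have fin: "finite ?S" using assms by (auto intro: finite_subset[of _ "Pow U"])
  have "Prs U p (\<lambda>H. card H = j \<and> Q H) = Prs U p (\<lambda>H. \<exists>A\<in>?S. H = A)"
    by (intro Prs_cong) auto
  also have "{H. \<exists>A\<in>?S. H = A} = ?S" by auto
  also have "measure_pmf.prob (rsub U p) ?S = (\<Sum>A\<in>?S. pmf (rsub U p) A)"
    by (rule measure_measure_pmf_finite[OF fin])
  also have "\<dots> = (\<Sum>A\<in>?S. p ^ j * (1 - p) ^ (card U - j))"
  proof (intro sum.cong refl)
    fix A assume A: "A \<in> ?S"
    have "pmf (rsub U p) A = Prs U p (\<lambda>H. H = A)" by (simp add: measure_pmf_single)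
    also have "\<dots> = p ^ card A * (1 - p) ^ (card U - card A)"
      by (rule Prs_eq_set) (use A assms in auto)
    finally show "pmf (rsub U p) A = p ^ j * (1 - p) ^ (card U - j)" using A by simp
  qed
  finally show ?thesis by simp
qed

text \<open>Double counting of pairs of an \<open>m\<close>-set satisfying \<open>Q\<close> and a
  new element: adding the element preserves \<open>Q\<close>, and a set of size \<open>Suc m\<close>
  arises from at most \<open>Suc m\<close> pairs.\<close>

lemma local_LYM:
  fixes Q :: "'a set \<Rightarrow> bool"
  assumes "finite U" "\<And>A B. A \<subseteq> B \<Longrightarrow> Q A \<Longrightarrow> Q B"
  shows "card {A. A \<subseteq> U \<and> card A = m \<and> Q A} * (card U - m) \<le> card {A. A \<subseteq> U \<and> card A = Suc m \<and> Q A} * Suc m"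
proof -
  let ?S = "\<lambda>m. {A. A \<subseteq> U \<and> card A = m \<and> Q A}"
  let ?P = "Sigma (?S m) (\<lambda>A. U - A)"
  let ?R = "Sigma (?S (Suc m)) (\<lambda>A. A)"
  have fin: "finite (?S m)" for m using assms by (auto intro: finite_subset[of _ "Pow U"])
  have finU: "finite A" if "A \<subseteq> U" for A using that assms(1) by (rule finite_subset)
  have "card ?P = (\<Sum>A\<in>?S m. card (U - A))" using fin assms by (intro card_SigmaI) auto
  also have "\<dots> = (\<Sum>A\<in>?S m. card U - m)" by (intro sum.cong refl) (auto simp: card_Diff_subset finU)
  finally have P: "card ?P = card (?S m) * (card U - m)" by simp
  have "card ?R = (\<Sum>A\<in>?S (Suc m). card A)" using fin finU by (intro card_SigmaI) auto
  also have "\<dots> = card (?S (Suc m)) * Suc m" by simp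
  finally have R: "card ?R = card (?S (Suc m)) * Suc m" .
  have "card ?P \<le> card ?R"
  proof (rule card_inj_on_le)
    show "inj_on (\<lambda>(A, x). (insert x A, x)) ?P"
    proof (rule inj_onI)
      fix u v assume uv: "u \<in> ?P" "v \<in> ?P" "(\<lambda>(A, x). (insert x A, x)) u = (\<lambda>(A, x). (insert x A, x)) v"
      obtain A x where u: "u = (A, x)" by (cases u)
      obtain B z where v: "v = (B, z)" by (cases v)
      have "z = x" "x \<notin> A" "x \<notin> B" "insert x A = insert x B" using uv u v by auto
      then show "u = v" unfolding u v by (metis Diff_insert_absorb)
    qed
    show "(\<lambda>(A, x). (insert x A, x)) ` ?P \<subseteq> ?R"
    proof -
      { fix A x assume "A \<subseteq> U" "Q A" "x \<in> U" "x \<notin> A" "m = card A"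
        then have "insert x A \<subseteq> U" "card (insert x A) = Suc m" "Q (insert x A)"
          using finU assms(2)[of A "insert x A"] by auto }
      then show ?thesis by auto
    qed
    show "finite ?R" using fin finU by (intro finite_SigmaI) auto
  qed
  then show ?thesis using P R by simp
qed

text \<open>By \<open>local_LYM\<close> the density of an increasing family among
  \<open>j\<close>-sets does not decrease with \<open>j\<close>, so at level \<open>m\<close> it is
  at most the density in the random set conditioned to have at least \<open>m\<close> elements. This
  trades a set of fixed size for independent choices, for which meeting probabilities
  factorize.\<close>

lemma uniform_le_binomial:
  fixes Q :: "'a set \<Rightarrow> bool"
  assumes "finite U" "0 \<le> p" "p \<le> 1" and mono: "\<And>A B. A \<subseteq> B \<Longrightarrow> Q A \<Longrightarrow> Q B"
  shows "real (card {A. A \<subseteq> U \<and> card A = m \<and> Q A}) * Prs U p (\<lambda>H. m \<le> card H) \<le> real (card U choose m) * Prs U p Q"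
proof -
  let ?g = "\<lambda>m. card {A. A \<subseteq> U \<and> card A = m \<and> Q A}"
  let ?N = "card U"
  have step: "real (?g m) * real (?N choose j) \<le> real (?g j) * real (?N choose m)" if "m \<le> j" "j \<le> ?N" for j
    using that
  proof (induction j rule: dec_induct)
    case (step j)
    have "real (?g j) * real (?N - j) \<le> real (?g (Suc j)) * real (Suc j)"
    proof -
      have "?g j * (?N - j) \<le> ?g (Suc j) * Suc j" by (rule local_LYM) (use assms in auto)
      then have "real (?g j * (?N - j)) \<le> real (?g (Suc j) * Suc j)" by (rule of_nat_mono)
      then show ?thesis by (simp only: of_nat_mult)
    qed
    moreover have ch: "real (?N choose Suc j) * real (Suc j) = real (?N choose j) * real (?N - j)"
    proof -
      have "Suc j * (?N choose Suc j) = (?N - j) * (?N choose j)"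
        by (simp only: binomial_absorb_comp binomial_absorption)
      then show ?thesis by (metis mult.commute of_nat_mult)
    qed
    ultimately have "real (?g m) * (real (?N choose Suc j) * real (Suc j)) \<le> real (?g (Suc j)) * real (Suc j) * real (?N choose m)"
    proof -
      have "real (?g m) * (real (?N choose j) * real (?N - j)) \<le> real (?g j) * real (?N choose m) * real (?N - j)"
        using step by (simp add: mult.assoc[symmetric] mult_right_mono)
      also have "\<dots> = (real (?g j) * real (?N - j)) * real (?N choose m)" by simp
      also have "\<dots> \<le> (real (?g (Suc j)) * real (Suc j)) * real (?N choose m)"
        using \<open>real (?g j) * real (?N - j) \<le> _\<close> by (intro mult_right_mono) auto
      finally show ?thesis by (simp only: ch)
    qed
    then have "real (Suc j) * (real (?g m) * real (?N choose Suc j)) \<le> real (Suc j) * (real (?g (Suc j)) * real (?N choose m))"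
      by (simp only: mult_ac)
    then show ?case by (simp only: mult_le_cancel_left_pos of_nat_0_less_iff zero_less_Suc)
  qed simp
  have D: "Prs U p (\<lambda>H. m \<le> card H \<and> R H) = (\<Sum>j\<in>{m..?N}. Prs U p (\<lambda>H. card H = j \<and> R H))" for R
  proof -
    have "Prs U p (\<lambda>H. m \<le> card H \<and> R H) = Prs U p (\<lambda>H. \<exists>j\<in>{m..?N}. card H = j \<and> R H)"
      using assms by (intro Prs_cong) (auto intro: card_mono)
    also have "{H. \<exists>j\<in>{m..?N}. card H = j \<and> R H} = (\<Union>j\<in>{m..?N}. {H. card H = j \<and> R H})" by auto
    also have "measure_pmf.prob (rsub U p) \<dots> = (\<Sum>j\<in>{m..?N}. Prs U p (\<lambda>H. card H = j \<and> R H))"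
      by (rule measure_pmf.finite_measure_finite_Union) (auto simp: disjoint_family_on_def)
    finally show ?thesis .
  qed
  have "real (?g m) * Prs U p (\<lambda>H. m \<le> card H) = (\<Sum>j\<in>{m..?N}. real (?g m) * (real (?N choose j) * p ^ j * (1 - p) ^ (?N - j)))"
    using D[of "\<lambda>_. True"] assms by (simp add: Prs_card_eq sum_distrib_left)
  also have "\<dots> \<le> (\<Sum>j\<in>{m..?N}. real (?N choose m) * (real (?g j) * p ^ j * (1 - p) ^ (?N - j)))"
  proof (rule sum_mono)
    fix j assume "j \<in> {m..?N}"
    then have "(real (?g m) * real (?N choose j)) * (p ^ j * (1 - p) ^ (?N - j)) \<le> (real (?g j) * real (?N choose m)) * (p ^ j * (1 - p) ^ (?N - j))"
      using step[of j] assms by (intro mult_right_mono) auto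
    then show "real (?g m) * (real (?N choose j) * p ^ j * (1 - p) ^ (?N - j)) \<le> real (?N choose m) * (real (?g j) * p ^ j * (1 - p) ^ (?N - j))"
      by (simp only: mult_ac)
  qed
  also have "\<dots> = real (?N choose m) * Prs U p (\<lambda>H. m \<le> card H \<and> Q H)"
    unfolding D using assms by (simp add: Prs_card_and sum_distrib_left)
  also have "\<dots> \<le> real (?N choose m) * Prs U p Q"
    by (intro mult_left_mono Prs_mono) auto
  finally show ?thesis .
qed

section \<open>Random uniform hypergraphs\<close>

lemma finite_ksets [simp, intro]: "finite (ksets n k)"
  unfolding ksets_def by (rule finite_subset[of _ "Pow {1..n}"]) auto

lemma card_ksets: "card (ksets n k) = n choose k"
  unfolding ksets_def using n_subsets[of "{1..n}" k] by simp

lemma ksetsD: "A \<in> ksets n k \<Longrightarrow> A \<subseteq> {1..n} \<and> card A = k \<and> finite A"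
  by (auto simp: ksets_def intro: finite_subset)

lemma card_subsets_superset:
  assumes "finite V" "S \<subseteq> V" "card S \<le> k"
  shows "card {A. A \<subseteq> V \<and> card A = k \<and> S \<subseteq> A} = (card V - card S) choose (k - card S)"
proof -
  have fS: "finite S" using assms finite_subset by auto
  have "bij_betw (\<lambda>A. A - S) {A. A \<subseteq> V \<and> card A = k \<and> S \<subseteq> A} {B. B \<subseteq> V - S \<and> card B = k - card S}"
  proof (rule bij_betwI[where g = "\<lambda>B. B \<union> S"])
    show "(\<lambda>B. B \<union> S) \<in> {B. B \<subseteq> V - S \<and> card B = k - card S} \<rightarrow> {A. A \<subseteq> V \<and> card A = k \<and> S \<subseteq> A}"
    proof
      fix B assume "B \<in> {B. B \<subseteq> V - S \<and> card B = k - card S}"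
      then have B: "B \<subseteq> V - S" "card B = k - card S" by auto
      then have "finite B" using assms finite_subset by (metis finite_Diff)
      then have "card (B \<union> S) = card B + card S" using B fS by (intro card_Un_disjoint) auto
      then show "B \<union> S \<in> {A. A \<subseteq> V \<and> card A = k \<and> S \<subseteq> A}" using B assms by auto
    qed
  qed (use assms fS in \<open>auto simp: card_Diff_subset\<close>)
  then have "card {A. A \<subseteq> V \<and> card A = k \<and> S \<subseteq> A} = card {B. B \<subseteq> V - S \<and> card B = k - card S}"
    by (rule bij_betw_same_card)
  also have "\<dots> = card (V - S) choose (k - card S)" using assms by (intro n_subsets) auto
  also have "card (V - S) = card V - card S" using assms fS by (intro card_Diff_subset) auto
  finally show ?thesis .
qed

text \<open>Each step multiplies by \<open>(k - j) / (n - j)\<close>, which is at most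
  \<open>k / n\<close>.\<close>

lemma binomial_shift_le:
  assumes "0 < k" "k \<le> n" "j \<le> k"
  shows "real ((n - j) choose (k - j)) \<le> real (n choose k) * (real k / real n) ^ j"
  using assms(3)
proof (induction j)
  case (Suc j)
  have "(k - j) * ((n - j) choose (k - j)) = (n - j) * ((n - Suc j) choose (k - Suc j))"
    using Suc times_binomial_minus1_eq[of "k - j" "n - j"] by simp
  then have "real (k - j) * real ((n - j) choose (k - j)) = real (n - j) * real ((n - Suc j) choose (k - Suc j))"
    by (metis of_nat_mult)
  moreover have "real (n - j) > 0" using Suc assms by simp
  ultimately have "real ((n - Suc j) choose (k - Suc j)) = real ((n - j) choose (k - j)) * (real (k - j) / real (n - j))"
    by (simp add: field_simps)
  also have "\<dots> \<le> (real (n choose k) * (real k / real n) ^ j) * (real k / real n)"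
  proof (rule mult_mono)
    show "real (k - j) / real (n - j) \<le> real k / real n"
    proof -
      have "real j * real k \<le> real j * real n" using assms by (intro mult_left_mono) auto
      then show ?thesis using Suc.prems assms by (simp add: field_simps of_nat_diff)
    qed
  qed (use Suc in auto)
  finally show ?case by (simp add: mult_ac)
qed simp

lemma card_ksets_superset_le:
  assumes "0 < k" "k \<le> n" "S \<subseteq> {1..n}"
  shows "real (card {A \<in> ksets n k. S \<subseteq> A}) \<le> real (n choose k) * (real k / real n) ^ card S"
proof (cases "card S \<le> k")
  case True
  have "{A \<in> ksets n k. S \<subseteq> A} = {A. A \<subseteq> {1..n} \<and> card A = k \<and> S \<subseteq> A}" by (auto simp: ksets_def)
  then show ?thesis using binomial_shift_le[OF assms(1,2) True] card_subsets_superset[of "{1..n}" S k] True assms by simp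
next
  case False
  have "\<not> S \<subseteq> A" if "A \<in> ksets n k" for A using that False card_mono[of A S] by (auto dest: ksetsD)
  then have "{A \<in> ksets n k. S \<subseteq> A} = {}" by auto
  then show ?thesis by (simp only: card.empty) simp
qed

definition kstar :: "nat \<Rightarrow> nat \<Rightarrow> nat \<Rightarrow> nat set set" where
  "kstar n k x = {A \<in> ksets n k. x \<in> A}"

lemma kstar_subset: "kstar n k x \<subseteq> ksets n k" by (auto simp: kstar_def)

lemma finite_kstar [simp, intro]: "finite (kstar n k x)" by (auto simp: kstar_def)

lemma card_kstar: "0 < k \<Longrightarrow> x \<in> {1..n} \<Longrightarrow> card (kstar n k x) = (n - 1) choose (k - 1)"
proof -
  assume "0 < k" "x \<in> {1..n}"
  moreover have "kstar n k x = {A. A \<subseteq> {1..n} \<and> card A = k \<and> {x} \<subseteq> A}" by (auto simp: ksets_def kstar_def)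
  ultimately show ?thesis using card_subsets_superset[of "{1..n}" "{x}" k] by simp
qed

lemma star_eq_Int: "H \<subseteq> ksets n k \<Longrightarrow> star H x = H \<inter> kstar n k x"
  by (auto simp: star_def kstar_def)

lemma mbar_eq:
  assumes "0 < k" "k \<le> n"
  shows "mbar n k p = p * real (n choose k)"
proof -
  have "k * (n choose k) = n * ((n - 1) choose (k - 1))"
    using assms by (intro times_binomial_minus1_eq) auto
  then have "real k * real (n choose k) = real n * real ((n - 1) choose (k - 1))" by (metis of_nat_mult)
  then show ?thesis using assms by (simp add: mbar_def phi_def field_simps)
qed

section \<open>The probability that two random \<open>k\<close>-sets are disjoint\<close>

definition dprob :: "nat \<Rightarrow> nat \<Rightarrow> real" where
  "dprob n k = real ((n - k) choose k) / real (n choose k)"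

lemma card_ksets_disjoint:
  assumes "B \<subseteq> {1..n}"
  shows "card {A \<in> ksets n k. A \<inter> B = {}} = (n - card B) choose k"
proof -
  have "{A \<in> ksets n k. A \<inter> B = {}} = {A. A \<subseteq> {1..n} - B \<and> card A = k}" by (auto simp: ksets_def)
  then show ?thesis using n_subsets[of "{1..n} - B" k] assms by (simp add: card_Diff_subset finite_subset)
qed

lemma meet_prob_eq:
  assumes "0 < k" "k \<le> n"
  shows "meet_prob n k = 1 - dprob n k"
proof -
  let ?K = "ksets n k" and ?N = "real (n choose k)"
  have N: "0 < ?N" using assms by simp
  have ne: "?K \<noteq> {}" using N card_ksets[of n k] by (metis card.empty of_nat_0 less_irrefl)
  let ?M = "pair_pmf (pmf_of_set ?K) (pmf_of_set ?K)"
  let ?D = "{(A, B). A \<inter> B = {}} \<inter> ?K \<times> ?K"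
  have set: "set_pmf ?M = ?K \<times> ?K" using ne by (simp add: set_pmf_of_set)
  have cD: "real (card ?D) = ?N * real ((n - k) choose k)"
  proof -
    have "?D = Sigma ?K (\<lambda>A. {B \<in> ?K. B \<inter> A = {}})" by auto
    then have "card ?D = (\<Sum>A\<in>?K. card {B \<in> ?K. B \<inter> A = {}})" by (simp add: card_SigmaI)
    also have "\<dots> = (\<Sum>A\<in>?K. (n - k) choose k)"
      by (intro sum.cong refl) (metis card_ksets_disjoint ksetsD)
    finally show ?thesis by (simp add: card_ksets)
  qed
  have "measure_pmf.prob ?M {(A, B). A \<inter> B = {}} = measure_pmf.prob ?M ({(A, B). A \<inter> B = {}} \<inter> set_pmf ?M)"
    by (rule measure_Int_set_pmf[symmetric])
  also have "\<dots> = (\<Sum>x\<in>?D. pmf ?M x)"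
    unfolding set by (rule measure_measure_pmf_finite) (rule finite_subset[of _ "?K \<times> ?K"], auto)
  also have "\<dots> = (\<Sum>x\<in>?D. 1 / ?N * (1 / ?N))"
    by (intro sum.cong refl) (auto simp: pmf_pair card_ksets pmf_of_set[OF ne finite_ksets])
  also have "\<dots> = dprob n k" using cD N by (simp add: dprob_def field_simps)
  finally have d: "measure_pmf.prob ?M {(A, B). A \<inter> B = {}} = dprob n k" .
  have "{(A, B). A \<inter> B \<noteq> {}} = UNIV - {(A, B :: nat set). A \<inter> B = {}}" by auto
  then show ?thesis
    using measure_pmf.prob_compl[of "{(A, B). A \<inter> B = {}}" ?M] d by (simp add: meet_prob_def)
qed

lemma dprob_prod:
  assumes "2 * k \<le> n"
  shows "dprob n k = (\<Prod>i<k. 1 - real k / real (n - i))"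
proof -
  have k: "k \<le> n - k" "k \<le> n" using assms by auto
  have "dprob n k = (\<Prod>i = 0..<k. real (n - k - i) / real (k - i)) / (\<Prod>i = 0..<k. real (n - i) / real (k - i))"
    unfolding dprob_def binomial_altdef_of_nat[OF k(1)] binomial_altdef_of_nat[OF k(2)] ..
  also have "\<dots> = (\<Prod>i = 0..<k. (real (n - k - i) / real (k - i)) / (real (n - i) / real (k - i)))"
    by (rule prod_dividef[symmetric])
  also have "\<dots> = (\<Prod>i = 0..<k. 1 - real k / real (n - i))"
  proof (intro prod.cong refl)
    fix i assume "i \<in> {0..<k}"
    then have "real (k - i) > 0" "real (n - i) > 0" "real (n - k - i) = real (n - i) - real k" using assms by auto
    then show "(real (n - k - i) / real (k - i)) / (real (n - i) / real (k - i)) = 1 - real k / real (n - i)"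
      by (simp add: diff_divide_distrib[symmetric] del: of_nat_diff) (simp add: diff_divide_distrib)
  qed
  finally show ?thesis by (simp add: atLeast0LessThan)
qed

lemma dprob_le: assumes "2 * k < n" shows "dprob n k \<le> (1 - real k / real n) ^ k"
proof -
  have "(\<Prod>i<k. 1 - real k / real (n - i)) \<le> (\<Prod>i<k. 1 - real k / real n)"
  proof (intro prod_mono conjI)
    fix i assume "i \<in> {..<k}"
    then have i: "k < n - i" "0 < n - i" "n - i \<le> n" using assms by auto
    then show "0 \<le> 1 - real k / real (n - i)" by simp
    have "real k / real n \<le> real k / real (n - i)" using i by (intro divide_left_mono mult_pos_pos) auto
    then show "1 - real k / real (n - i) \<le> 1 - real k / real n" by simp
  qed
  then show ?thesis using assms by (simp add: dprob_prod)
qed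

lemma dprob_ge: assumes "2 * k < n" shows "(1 - real k / real (n - k)) ^ k \<le> dprob n k"
proof -
  have "(\<Prod>i<k. 1 - real k / real (n - k)) \<le> (\<Prod>i<k. 1 - real k / real (n - i))"
  proof (intro prod_mono conjI)
    fix i assume "i \<in> {..<k}"
    then have i: "n - k \<le> n - i" "k \<le> n - k" "0 < n - k" using assms by auto
    then show "0 \<le> 1 - real k / real (n - k)" by simp
    have "real k / real (n - i) \<le> real k / real (n - k)" using i by (intro divide_left_mono mult_pos_pos) auto
    then show "1 - real k / real (n - k) \<le> 1 - real k / real (n - i)" by simp
  qed
  then show ?thesis using assms by (simp add: dprob_prod)
qed

lemma dprob_le_exp: assumes "2 * k < n" shows "dprob n k \<le> exp (- (real k)\<^sup>2 / real n)"
proof -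
  have "1 - real k / real n \<le> exp (- (real k / real n))" using exp_ge_add_one_self[of "- (real k / real n)"] by simp
  then have "(1 - real k / real n) ^ k \<le> exp (- (real k / real n)) ^ k"
    using assms by (intro power_mono) auto
  also have "\<dots> = exp (- (real k)\<^sup>2 / real n)" by (simp add: exp_of_nat_mult[symmetric] power2_eq_square)
  finally show ?thesis using dprob_le[OF assms] by simp
qed

lemma dprob_pos: "2 * k < n \<Longrightarrow> 0 < dprob n k"
  unfolding dprob_def by simp

lemma dprob_less_1: "0 < k \<Longrightarrow> 2 * k < n \<Longrightarrow> dprob n k < 1"
proof -
  assume a: "0 < k" "2 * k < n"
  then have "- (real k)\<^sup>2 / real n < 0" by (simp add: field_simps)
  then have "exp (- (real k)\<^sup>2 / real n) < 1" by (simp only: exp_less_one_iff)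
  then show ?thesis using dprob_le_exp[OF a(2)] by linarith
qed

lemma meet_prob_le: assumes "0 < k" "2 * k < n" shows "meet_prob n k \<le> 2 * (real k)\<^sup>2 / real n"
proof -
  have "1 + real k * (- (real k / real (n - k))) \<le> (1 + (- (real k / real (n - k)))) ^ k"
    using assms by (intro Bernoulli_inequality) (simp add: field_simps)
  then have "1 - (real k)\<^sup>2 / real (n - k) \<le> dprob n k" using dprob_ge[OF assms(2)] by (simp add: power2_eq_square)
  moreover have "(real k)\<^sup>2 / real (n - k) \<le> 2 * (real k)\<^sup>2 / real n"
  proof -
    have "(real k)\<^sup>2 * real n \<le> (real k)\<^sup>2 * (2 * real (n - k))" using assms by (intro mult_left_mono) auto
    then show ?thesis using assms by (simp add: field_simps)
  qed
  ultimately show ?thesis using assms by (simp add: meet_prob_eq)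
qed

lemma meet_prob_bounds: "0 < k \<Longrightarrow> 2 * k < n \<Longrightarrow> 0 < meet_prob n k \<and> meet_prob n k < 1"
  using dprob_pos dprob_less_1 by (simp add: meet_prob_eq)

section \<open>Counting sets that meet every member of a family\<close>

lemma sum_card_Collect:
  assumes "finite U" "finite I"
  shows "(\<Sum>y\<in>U. card {i \<in> I. y \<in> B i}) = (\<Sum>i\<in>I. card (U \<inter> B i))"
proof -
  have "(\<Sum>y\<in>U. card {i \<in> I. y \<in> B i}) = (\<Sum>y\<in>U. \<Sum>i\<in>I. if y \<in> B i then 1 else 0)"
    using assms by (intro sum.cong refl) (simp add: sum.If_cases Int_def)
  also have "\<dots> = (\<Sum>i\<in>I. \<Sum>y\<in>U. if y \<in> B i then 1 else 0)" by (rule sum.swap)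
  also have "\<dots> = (\<Sum>i\<in>I. card (U \<inter> B i))"
    using assms by (intro sum.cong refl) (simp add: sum.If_cases Int_def)
  finally show ?thesis .
qed

text \<open>Both sides count ordered pairs of distinct indices together with a common element. Later
  it is also applied with the roles of edges and vertices exchanged.\<close>

lemma sum_degree_pairs:
  assumes "finite U" "finite I" "\<And>i j. i \<in> I \<Longrightarrow> j \<in> I \<Longrightarrow> i \<noteq> j \<Longrightarrow> card (U \<inter> (B i \<inter> B j)) \<le> l"
  shows "(\<Sum>y\<in>U. card {i \<in> I. y \<in> B i} * (card {i \<in> I. y \<in> B i} - 1)) \<le> (card I)\<^sup>2 * l"
proof -
  let ?P = "{(i, j). i \<in> I \<and> j \<in> I \<and> i \<noteq> j}"
  have fP: "finite ?P" by (rule finite_subset[of _ "I \<times> I"]) (use assms in auto)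
  have "(\<Sum>y\<in>U. card {i \<in> I. y \<in> B i} * (card {i \<in> I. y \<in> B i} - 1)) = (\<Sum>y\<in>U. card {ij \<in> ?P. y \<in> B (fst ij) \<inter> B (snd ij)})"
  proof (intro sum.cong refl)
    fix y
    let ?D = "{i \<in> I. y \<in> B i}"
    have "{ij \<in> ?P. y \<in> B (fst ij) \<inter> B (snd ij)} = Sigma ?D (\<lambda>i. ?D - {i})" by auto
    also have "card \<dots> = (\<Sum>i\<in>?D. card (?D - {i}))" using assms by (intro card_SigmaI) auto
    also have "\<dots> = (\<Sum>i\<in>?D. card ?D - 1)" using assms by (intro sum.cong refl) auto
    finally show "card ?D * (card ?D - 1) = card {ij \<in> ?P. y \<in> B (fst ij) \<inter> B (snd ij)}" by simp
  qed
  also have "\<dots> = (\<Sum>ij\<in>?P. card (U \<inter> (B (fst ij) \<inter> B (snd ij))))"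
    by (rule sum_card_Collect[OF assms(1) fP])
  also have "\<dots> \<le> (\<Sum>ij\<in>?P. l)" using assms by (intro sum_mono) auto
  also have "\<dots> = card ?P * l" by simp
  also have "\<dots> \<le> card (I \<times> I) * l" using assms by (intro mult_right_mono card_mono) auto
  finally show ?thesis using assms by (simp add: power2_eq_square card_cartesian_product)
qed

lemma inverse_power_minus_1_le:
  fixes q :: real assumes "0 < q" "q \<le> 1"
  shows "inverse (q ^ d) - 1 \<le> real d * (1 - q) * inverse (q ^ d)"
proof -
  have "1 + real d * (q - 1) \<le> (1 + (q - 1)) ^ d" using assms by (intro Bernoulli_inequality) auto
  then have "1 - q ^ d \<le> real d * (1 - q)" by (simp add: algebra_simps)
  then have "(1 - q ^ d) * inverse (q ^ d) \<le> real d * (1 - q) * inverse (q ^ d)"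
    using assms by (intro mult_right_mono) auto
  then show ?thesis using assms by (simp add: algebra_simps)
qed

text \<open>A random set of density \<open>pi'\<close> has mean size \<open>k + sqrt k * L\<close>,
  about \<open>L\<close> standard deviations above \<open>k\<close>. It therefore has at least
  \<open>k\<close> elements except with probability \<open>z0\<close>, while the probability
  \<open>Q\<close> of meeting a fixed \<open>k\<close>-set exceeds \<open>q\<close> by at most
  \<open>r * e0\<close>.\<close>

locale meet_params =
  fixes n k :: nat and L pi' q r :: real
  assumes k_pos: "0 < k" and k_small: "2 * k < n" and L_def: "L = ln (real n)" and L_ge: "8 \<le> L"
    and k_le: "(real k)\<^sup>2 \<le> real n * L / 4" and k_ge: "L\<^sup>2 \<le> real k"
    and pi_def: "pi' = (real k + sqrt (real k) * L) / real n"
    and q_def: "q = meet_prob n k" and r_def: "r = dprob n k"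
begin

definition e0 :: real where "e0 = 2 * real k * sqrt (real k) * L / real n"
definition z0 :: real where "z0 = exp (- L\<^sup>2 / 16)"

lemma qr: "q = 1 - r" "0 < q" "q < 1" "0 < r" "r < 1"
  using meet_prob_bounds[of k n] dprob_pos[of k n] k_pos k_small by (auto simp: q_def r_def meet_prob_eq)

lemma sqrt_k: "1 \<le> sqrt (real k)" "sqrt (real k) \<le> real k" "sqrt (real k) * L \<le> real k" "L \<le> sqrt (real k)"
proof -
  show "1 \<le> sqrt (real k)" using k_pos by simp
  then have "sqrt (real k) * 1 \<le> sqrt (real k) * sqrt (real k)" by (intro mult_left_mono) auto
  then show "sqrt (real k) \<le> real k" by simp
  show "L \<le> sqrt (real k)" using k_ge by (intro real_le_rsqrt) auto
  then have "sqrt (real k) * L \<le> sqrt (real k) * sqrt (real k)" by (intro mult_left_mono) auto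
  then show "sqrt (real k) * L \<le> real k" by simp
qed

lemma pi_bounds: "0 \<le> pi'" "pi' \<le> 2 * real k / real n" "pi' \<le> 1" "real k / real n \<le> pi'"
proof -
  show "0 \<le> pi'" using L_ge by (simp add: pi_def)
  show "pi' \<le> 2 * real k / real n" using sqrt_k by (simp add: pi_def divide_right_mono)
  also have "\<dots> \<le> 1" using k_small by (simp add: field_simps)
  finally show "pi' \<le> 1" .
  show "real k / real n \<le> pi'" using L_ge by (simp add: pi_def divide_right_mono)
qed

abbreviation Q :: real where "Q \<equiv> 1 - (1 - pi') ^ k"

text \<open>The surplus in \<open>pi'\<close> also covers the passage from \<open>n\<close> to
  \<open>n - k\<close>, because \<open>k^2\<close> is at most \<open>n * L / 4\<close>. The
  inequality allows inverse powers of \<open>Q\<close> to be bounded by those of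
  \<open>q\<close>.\<close>

lemma Q_ge: "q \<le> Q"
proof -
  have "real k / real (n - k) \<le> pi'"
  proof -
    have "(real k)\<^sup>2 \<le> sqrt (real k) * L * real (n - k)"
    proof -
      have "(real k)\<^sup>2 \<le> real n * L / 4" by (rule k_le)
      also have "\<dots> \<le> L * real (n - k)" using L_ge k_small by (simp add: field_simps)
      also have "\<dots> \<le> sqrt (real k) * (L * real (n - k))" using sqrt_k(1) L_ge
        by (intro mult_right_mono[of 1 "sqrt (real k)" "L * real (n - k)", simplified]) auto
      finally show ?thesis by simp
    qed
    moreover have "real (n - k) = real n - real k" "0 < real n - real k" "0 < real n" using k_small by auto
    ultimately show ?thesis by (simp add: pi_def field_simps power2_eq_square)
  qed
  then have "(1 - pi') ^ k \<le> (1 - real k / real (n - k)) ^ k"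
    using pi_bounds by (intro power_mono) auto
  also have "\<dots> \<le> r" using dprob_ge[OF k_small] by (simp add: r_def)
  finally show ?thesis using qr by simp
qed

text \<open>Factor \<open>1 - pi'\<close> as \<open>a * (1 - b)\<close> with
  \<open>a = 1 - k / n\<close>. Then \<open>a ^ k\<close> is at least \<open>r\<close>, and
  Bernoulli gives \<open>(1 - b) ^ k \<ge> 1 - e0\<close>.\<close>

lemma Q_le: "Q \<le> q + r * e0"
proof -
  define a where "a = 1 - real k / real n"
  have a: "1/2 \<le> a" using k_small by (simp add: field_simps a_def)
  have api: "pi' - real k / real n \<le> a" "0 \<le> pi' - real k / real n" using pi_bounds by (auto simp: a_def)
  define b where "b = (pi' - real k / real n) / a"
  have b0: "pi' - real k / real n = sqrt (real k) * L / real n" by (simp add: pi_def add_divide_distrib)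
  have "0 \<le> b" unfolding b_def using a api by (intro divide_nonneg_nonneg) linarith+
  have "b \<le> 1"
    unfolding b_def using a api by (subst divide_le_eq_1_pos) linarith+
  have b2: "b \<le> 2 * sqrt (real k) * L / real n"
  proof -
    have "(pi' - real k / real n) / a \<le> (pi' - real k / real n) / (1/2)"
      using a api by (intro divide_left_mono) auto
    then show ?thesis by (simp add: b_def b0 mult_ac)
  qed
  have "1 - real k * b \<le> (1 - b) ^ k"
    using Bernoulli_inequality[of "-b" k] \<open>b \<le> 1\<close> by simp
  moreover have "real k * b \<le> e0" using mult_left_mono[OF b2, of "real k"] by (simp add: e0_def mult_ac)
  ultimately have 1: "1 - e0 \<le> (1 - b) ^ k" by simp
  have "a * b = pi' - real k / real n" using a by (simp add: b_def)
  moreover have "a * (1 - b) = a - a * b" by (simp add: right_diff_distrib)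
  ultimately have "1 - pi' = a * (1 - b)" by (simp add: a_def)
  then have "(1 - pi') ^ k = a ^ k * (1 - b) ^ k" by (simp add: power_mult_distrib)
  also have "\<dots> \<ge> r * (1 - b) ^ k" using dprob_le[OF k_small] \<open>b \<le> 1\<close> by (intro mult_right_mono) (auto simp: r_def a_def)
  also have "r * (1 - b) ^ k \<ge> r * (1 - e0)" using 1 qr by (intro mult_left_mono) auto
  finally show ?thesis using qr by (simp add: algebra_simps)
qed

lemma e0_nonneg: "0 \<le> e0" using L_ge by (simp add: e0_def)

text \<open>The allowance \<open>n - 1\<close> covers ground sets from which the centre of a star
  has been removed.\<close>

lemma prob_size_ge:
  assumes "finite U" "n - 1 \<le> card U" "m \<le> k"
  shows "1 - z0 \<le> Prs U pi' (\<lambda>H. m \<le> card H)"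
proof -
  let ?x = "sqrt (real k) * L / 2"
  let ?mu = "real k + ?x"
  have x: "0 \<le> ?x" "?x \<le> real k" using sqrt_k L_ge by auto
  have mean: "?mu \<le> real (card U) * pi'"
  proof -
    have "real n * pi' = real k + 2 * ?x" using k_small by (simp add: pi_def)
    moreover have "pi' \<le> ?x" using pi_bounds(3) sqrt_k(1) L_ge mult_mono[of 1 "sqrt (real k)" 8 L] by simp
    moreover have "(real n - 1) * pi' \<le> real (card U) * pi'" using assms pi_bounds by (intro mult_right_mono) auto
    ultimately show ?thesis by (simp add: algebra_simps)
  qed
  have "Prs U pi' (\<lambda>H. \<not> m \<le> card H) \<le> Prs U pi' (\<lambda>H. real (card H) \<le> ?mu - ?x)"
    using assms by (intro Prs_mono) auto
  also have "\<dots> \<le> exp (- ?x\<^sup>2 / (2 * ?mu))"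
    by (rule Prs_card_lower_tail) (use assms pi_bounds mean x k_pos in auto)
  also have "\<dots> \<le> z0"
  proof -
    have "L\<^sup>2 / 16 \<le> ?x\<^sup>2 / (2 * (real k + real k))"
      using k_pos by (simp add: power2_eq_square field_simps)
    also have "\<dots> \<le> ?x\<^sup>2 / (2 * ?mu)" using x k_pos
      by (intro divide_left_mono) (auto intro!: add_pos_nonneg mult_pos_pos)
    finally show ?thesis by (simp add: z0_def)
  qed
  finally show ?thesis by (simp add: Prs_compl)
qed

lemma z0_bounds: "0 < z0" "z0 \<le> 1/2"
proof -
  show "0 < z0" by (simp add: z0_def)
  have "exp (1::real) \<ge> 2" using exp_ge_add_one_self[of 1] by simp
  moreover have "8\<^sup>2 \<le> L\<^sup>2" using L_ge by (intro power_mono) auto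
  then have "exp 1 \<le> exp (L\<^sup>2 / 16)" by simp
  ultimately have "2 \<le> exp (L\<^sup>2 / 16)" by linarith
  then show "z0 \<le> 1/2" by (simp add: z0_def exp_minus field_simps)
qed

text \<open>The sharp count behind the clique estimates: up to error factors a random
  \<open>m\<close>-set meets the members independently with probability \<open>q\<close> each.
  Vertices outside \<open>Y\<close> have degree at most \<open>dm\<close>, and their joint effect is
  controlled by the sum of \<open>d * (d - 1)\<close>, that is, by pairwise intersections. The at
  most \<open>m1\<close> vertices of \<open>Y\<close> may have degree up to \<open>d2\<close> and
  are charged one by one.\<close>

lemma count_meet_le:
  assumes U: "finite U" "n - 1 \<le> card U" and m: "m \<le> k" and I: "finite I"
    and B: "\<And>i. i \<in> I \<Longrightarrow> B i \<subseteq> U" "\<And>i. i \<in> I \<Longrightarrow> card (B i) \<le> k"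
    and pairs: "\<And>i j. i \<in> I \<Longrightarrow> j \<in> I \<Longrightarrow> i \<noteq> j \<Longrightarrow> card (B i \<inter> B j) \<le> l"
    and Y: "\<And>y. y \<in> U - Y \<Longrightarrow> card {i \<in> I. y \<in> B i} \<le> dm" "\<And>y. y \<in> U \<inter> Y \<Longrightarrow> card {i \<in> I. y \<in> B i} \<le> d2"
    and fY: "finite Y" "card Y \<le> m1"
  shows "real (card {A. A \<subseteq> U \<and> card A = m \<and> (\<forall>i\<in>I. A \<inter> B i \<noteq> {})}) \<le>
    real (card U choose m) * (q ^ card I * exp (real (card I) * r * e0 / q + 2 * z0
       + pi' * r * inverse (q ^ dm) * (real (card I))\<^sup>2 * real l) * (1 + pi' * inverse (q ^ d2)) ^ m1)"
proof -
  let ?d = "\<lambda>y. card {i \<in> I. y \<in> B i}"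
  let ?i = "card I"
  let ?w = "\<lambda>y. 1 + pi' * (inverse (Q ^ ?d y) - 1)"
  let ?W = "{y \<in> U. 2 \<le> ?d y}"
  have q1: "q \<le> 1" using qr by simp
  have Q1: "Q \<le> 1" "0 < Q" using pi_bounds Q_ge qr by auto
  have wle: "?w y \<le> 1 + pi' * (inverse (q ^ ?d y) - 1)" for y
    using pi_bounds qr Q_ge by (intro add_left_mono mult_left_mono diff_right_mono le_imp_inverse_le power_mono) auto
  have w0: "0 \<le> ?w y" for y
  proof -
    have "1 \<le> inverse (Q ^ ?d y)" using Q1 by (intro one_le_inverse power_le_one) auto
    then show ?thesis using pi_bounds by (intro add_nonneg_nonneg mult_nonneg_nonneg) auto
  qed
  have invmono: "inverse (q ^ a) \<le> inverse (q ^ b)" if "a \<le> b" for a b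
    using that qr by (intro le_imp_inverse_le power_decreasing) auto
  define S where "S = pi' * r * inverse (q ^ dm) * (real ?i)\<^sup>2 * real l"
  have prodW: "(\<Prod>y\<in>?W. ?w y) \<le> exp S * (1 + pi' * inverse (q ^ d2)) ^ m1"
  proof -
    have "(\<Prod>y\<in>?W. ?w y) = (\<Prod>y\<in>?W - Y. ?w y) * (\<Prod>y\<in>?W \<inter> Y. ?w y)"
      using U by (subst prod.Int_Diff[of ?W _ Y]) (auto simp: mult.commute)
    also have "\<dots> \<le> exp S * (1 + pi' * inverse (q ^ d2)) ^ m1"
    proof (rule mult_mono)
      have "(\<Prod>y\<in>?W - Y. ?w y) \<le> (\<Prod>y\<in>?W - Y. exp (pi' * r * inverse (q ^ dm) * real (?d y * (?d y - 1))))"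
      proof (intro prod_mono conjI w0)
        fix y assume y: "y \<in> ?W - Y"
        have "?w y \<le> 1 + pi' * (inverse (q ^ ?d y) - 1)" by (rule wle)
        also have "\<dots> \<le> 1 + pi' * (real (?d y * (?d y - 1)) * (1 - q) * inverse (q ^ dm))"
        proof (intro add_left_mono mult_left_mono pi_bounds)
          have "inverse (q ^ ?d y) - 1 \<le> real (?d y) * (1 - q) * inverse (q ^ ?d y)"
            by (rule inverse_power_minus_1_le) (use qr in auto)
          also have "\<dots> \<le> real (?d y * (?d y - 1)) * (1 - q) * inverse (q ^ dm)"
          proof (intro mult_mono invmono)
            \<comment> \<open>Degree at least 2 allows \<open>d\<close> to be replaced by
              \<open>d * (d - 1)\<close>, whose sum \<open>sum_degree_pairs\<close>
              controls.\<close>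
            have "?d y * 1 \<le> ?d y * (?d y - 1)" using y by (intro mult_left_mono) auto
            then show "real (?d y) \<le> real (?d y * (?d y - 1))" by (simp only: of_nat_le_iff mult_1_right)
          qed (use y Y qr in auto)
          finally show "inverse (q ^ ?d y) - 1 \<le> real (?d y * (?d y - 1)) * (1 - q) * inverse (q ^ dm)" .
        qed
        also have "\<dots> \<le> exp (pi' * (real (?d y * (?d y - 1)) * (1 - q) * inverse (q ^ dm)))"
          by (rule exp_ge_add_one_self)
        also have "\<dots> = exp (pi' * r * inverse (q ^ dm) * real (?d y * (?d y - 1)))"
          using qr by (simp only: mult_ac) simp
        finally show "?w y \<le> exp (pi' * r * inverse (q ^ dm) * real (?d y * (?d y - 1)))" .
      qed
      also have "\<dots> = exp (\<Sum>y\<in>?W - Y. pi' * r * inverse (q ^ dm) * real (?d y * (?d y - 1)))"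
        using U by (simp add: exp_sum)
      also have "\<dots> \<le> exp S"
      proof -
        have "(\<Sum>y\<in>?W - Y. ?d y * (?d y - 1)) \<le> (\<Sum>y\<in>U. ?d y * (?d y - 1))"
          using U by (intro sum_mono2) auto
        also have "\<dots> \<le> ?i\<^sup>2 * l"
        proof (rule sum_degree_pairs[OF U(1) I])
          fix i j assume "i \<in> I" "j \<in> I" "i \<noteq> j"
          moreover then have "U \<inter> (B i \<inter> B j) = B i \<inter> B j" using B by auto
          ultimately show "card (U \<inter> (B i \<inter> B j)) \<le> l" using pairs by simp
        qed
        finally have "real (\<Sum>y\<in>?W - Y. ?d y * (?d y - 1)) \<le> real (?i\<^sup>2 * l)" by (rule of_nat_mono)
        then have "pi' * r * inverse (q ^ dm) * real (\<Sum>y\<in>?W - Y. ?d y * (?d y - 1)) \<le> pi' * r * inverse (q ^ dm) * real (?i\<^sup>2 * l)"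
          using pi_bounds qr by (intro mult_left_mono) auto
        then show ?thesis by (simp add: S_def sum_distrib_left mult.assoc)
      qed
      finally show "(\<Prod>y\<in>?W - Y. ?w y) \<le> exp S" .
      have one: "1 \<le> 1 + pi' * inverse (q ^ d2)" using pi_bounds qr by simp
      have "(\<Prod>y\<in>?W \<inter> Y. ?w y) \<le> (\<Prod>y\<in>?W \<inter> Y. 1 + pi' * inverse (q ^ d2))"
      proof (intro prod_mono conjI w0)
        fix y assume y: "y \<in> ?W \<inter> Y"
        have "inverse (q ^ ?d y) \<le> inverse (q ^ d2)" using y Y by (intro invmono) auto
        then have "pi' * (inverse (q ^ ?d y) - 1) \<le> pi' * inverse (q ^ d2)" using pi_bounds by (intro mult_left_mono) auto
        then show "?w y \<le> 1 + pi' * inverse (q ^ d2)" using wle[of y] by linarith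
      qed
      also have "\<dots> = (1 + pi' * inverse (q ^ d2)) ^ card (?W \<inter> Y)" by simp
      also have "\<dots> \<le> (1 + pi' * inverse (q ^ d2)) ^ m1"
      proof (intro power_increasing one)
        have "card (?W \<inter> Y) \<le> card Y" using fY by (intro card_mono) auto
        then show "card (?W \<inter> Y) \<le> m1" using fY by simp
      qed
      finally show "(\<Prod>y\<in>?W \<inter> Y. ?w y) \<le> (1 + pi' * inverse (q ^ d2)) ^ m1" .
    qed (auto intro!: prod_nonneg w0)
    finally show ?thesis .
  qed
  have QI: "Q ^ ?i \<le> q ^ ?i * exp (real ?i * r * e0 / q)"
  proof -
    have "Q ^ ?i \<le> (q + r * e0) ^ ?i" using Q_le Q1 by (intro power_mono) auto
    also have "q + r * e0 = q * (1 + r * e0 / q)" using qr by (simp add: field_simps)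
    also have "(q * (1 + r * e0 / q)) ^ ?i = q ^ ?i * (1 + r * e0 / q) ^ ?i" by (rule power_mult_distrib)
    also have "\<dots> \<le> q ^ ?i * exp (r * e0 / q) ^ ?i"
      using qr e0_nonneg exp_ge_add_one_self[of "r * e0 / q"] by (intro mult_left_mono power_mono) auto
    also have "exp (r * e0 / q) ^ ?i = exp (real ?i * r * e0 / q)" by (simp add: exp_of_nat_mult[symmetric] mult_ac)
    finally show ?thesis .
  qed
  let ?c = "real (card {A. A \<subseteq> U \<and> card A = m \<and> (\<forall>i\<in>I. A \<inter> B i \<noteq> {})})"
  let ?P = "1 + pi' * inverse (q ^ d2)"
  have P0: "0 \<le> ?P" using pi_bounds qr by simp
  have "?c * (1 - z0) \<le> ?c * Prs U pi' (\<lambda>H. m \<le> card H)"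
    by (intro mult_left_mono prob_size_ge) (use U m in auto)
  also have "\<dots> \<le> real (card U choose m) * Prs U pi' (\<lambda>A. \<forall>i\<in>I. A \<inter> B i \<noteq> {})"
    by (rule uniform_le_binomial) (use U pi_bounds in auto)
  also have "\<dots> \<le> real (card U choose m) * (Q ^ ?i * (\<Prod>y\<in>?W. ?w y))"
    by (intro mult_left_mono Prs_meet_all[where k = k]) (use U pi_bounds I B Q1 in auto)
  also have "\<dots> \<le> real (card U choose m) * ((q ^ ?i * exp (real ?i * r * e0 / q)) * (exp S * ?P ^ m1))"
    using Q1 qr by (intro mult_left_mono mult_mono QI prodW prod_nonneg w0) auto
  finally have 1: "?c * (1 - z0) \<le> real (card U choose m) * (q ^ ?i * exp (real ?i * r * e0 / q + S) * ?P ^ m1)"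
    by (simp add: exp_add mult_ac)
  have "1 \<le> (1 - z0) * exp (2 * z0)"
  proof -
    have "1 \<le> (1 - z0) * (1 + 2 * z0)" using z0_bounds by (simp add: algebra_simps)
    also have "\<dots> \<le> (1 - z0) * exp (2 * z0)" using z0_bounds exp_ge_add_one_self[of "2 * z0"] by (intro mult_left_mono) auto
    finally show ?thesis .
  qed
  then have "?c * 1 \<le> ?c * ((1 - z0) * exp (2 * z0))" by (intro mult_left_mono) auto
  also have "\<dots> = (?c * (1 - z0)) * exp (2 * z0)" by simp
  also have "\<dots> \<le> (real (card U choose m) * (q ^ ?i * exp (real ?i * r * e0 / q + S) * ?P ^ m1)) * exp (2 * z0)"
    using 1 by (intro mult_right_mono) auto
  also have "\<dots> = real (card U choose m) * (q ^ ?i * exp (real ?i * r * e0 / q + 2 * z0 + S) * ?P ^ m1)"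
    by (simp add: exp_add mult_ac)
  finally show ?thesis unfolding S_def by simp
qed

end

text \<open>A largest clique contained in a star equals that star by maximality, so one that is not
  a star has no common vertex. Stars are cliques, hence its size is at least every degree.\<close>

lemma not_EKR_nontrivial:
  assumes "H \<subseteq> ksets n k" "0 < n" "\<not> satisfies_EKR n H"
  shows "\<exists>F\<subseteq>H. clique F \<and> (\<forall>x\<in>{1..n}. \<exists>A\<in>F. x \<notin> A) \<and> max_degree n H \<le> card F"
proof -
  have finH: "finite H" using assms finite_subset by blast
  from assms(3) obtain F where F: "largest_clique H F" and nF: "\<And>x. x \<in> {1..n} \<Longrightarrow> F \<noteq> star H x"
    by (auto simp: satisfies_EKR_def)
  have F1: "F \<subseteq> H" "clique F" and F2: "\<And>G. G \<subseteq> H \<Longrightarrow> clique G \<Longrightarrow> card G \<le> card F"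
    using F by (auto simp: largest_clique_def is_arg_max_def not_less)
  have st: "star H x \<subseteq> H" "clique (star H x)" for x
    by (auto simp: star_def clique_def pairwise_def disjnt_def)
  have "\<exists>A\<in>F. x \<notin> A" if x: "x \<in> {1..n}" for x
  proof (rule ccontr)
    assume "\<not> (\<exists>A\<in>F. x \<notin> A)"
    then have "F \<subseteq> star H x" using F1 by (auto simp: star_def)
    moreover have "finite (star H x)" using st finH finite_subset by blast
    ultimately have "F = star H x" using F2[OF st] by (intro card_seteq) auto
    then show False using nF[OF x] by blast
  qed
  moreover have "max_degree n H \<le> card F"
    unfolding max_degree_def using assms F2[OF st] by (subst Max_le_iff) auto
  ultimately show ?thesis using F1 by blast
qed

lemma card_star_le_max_degree: "x \<in> {1..n} \<Longrightarrow> card (star H x) \<le> max_degree n H"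
  unfolding max_degree_def by (intro Max_ge) auto

lemma le_max_degree_iff: "0 < n \<Longrightarrow> j \<le> max_degree n H \<longleftrightarrow> (\<exists>x\<in>{1..n}. j \<le> card (star H x))"
  unfolding max_degree_def by (subst Max_ge_iff) auto

text \<open>Distinct singletons are disjoint, so cliques have at most one member. This case is
  separate because later \<open>(n - 1) choose (k - 1)\<close> is bounded below by
  \<open>n - 1\<close>, which requires \<open>2 \<le> k\<close>.\<close>

lemma satisfies_EKR_singletons:
  assumes "H \<subseteq> ksets n 1" "0 < n"
  shows "satisfies_EKR n H"
proof (rule ccontr)
  assume "\<not> ?thesis"
  from not_EKR_nontrivial[OF assms this] obtain F where F: "F \<subseteq> H" "clique F" "\<forall>x\<in>{1..n}. \<exists>A\<in>F. x \<notin> A" by blast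
  obtain A where A: "A \<in> F" using F(3) assms(2) by force
  have sing: "\<exists>b\<in>{1..n}. B = {b}" if "B \<in> F" for B
    using that F(1) assms(1) by (auto simp: ksets_def card_1_singleton_iff)
  obtain a where a: "A = {a}" "a \<in> {1..n}" using sing[OF A] by auto
  obtain B where B: "B \<in> F" "a \<notin> B" using F(3) a(2) by blast
  have "A \<noteq> B" using a B by auto
  then have "\<not> disjnt A B" using F(2) A B unfolding clique_def pairwise_def by blast
  then show False using B a by (simp add: disjnt_def)
qed

text \<open>Members are chosen one after another; every set arises in all its orders, whence the
  factorial, and closure under subsets keeps the initial segments inside the family.\<close>

lemma card_down_closed_le:
  fixes GG :: "'a set \<Rightarrow> bool" and m :: "nat \<Rightarrow> real"
  assumes "finite X" "\<And>F F'. GG F \<Longrightarrow> F' \<subseteq> F \<Longrightarrow> GG F'" "\<And>i. i < t \<Longrightarrow> 0 \<le> m i"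
    and "\<And>F. F \<subseteq> X \<Longrightarrow> GG F \<Longrightarrow> card F < t \<Longrightarrow> real (card {b \<in> X - F. GG (insert b F)}) \<le> m (card F)"
  shows "real (card {F. F \<subseteq> X \<and> card F = t \<and> GG F}) \<le> (\<Prod>i<t. m i) / fact t"
  using assms(3,4)
proof (induction t)
  case 0
  have "{F. F \<subseteq> X \<and> card F = 0 \<and> GG F} \<subseteq> {{}}" using assms(1) by (auto dest: finite_subset)
  then have "card {F. F \<subseteq> X \<and> card F = 0 \<and> GG F} \<le> card {{} :: 'a set}" by (intro card_mono) auto
  then show ?case by simp
next
  case (Suc t)
  let ?A = "\<lambda>t. {F. F \<subseteq> X \<and> card F = t \<and> GG F}"
  have fin: "finite (?A t)" for t using assms(1) by (auto intro: finite_subset[of _ "Pow X"])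
  have finF: "finite F" if "F \<subseteq> X" for F using that assms(1) by (rule finite_subset)
  let ?P = "Sigma (?A (Suc t)) (\<lambda>F. F)"
  let ?R = "Sigma (?A t) (\<lambda>F. {b \<in> X - F. GG (insert b F)})"
  have "card ?P = (\<Sum>F\<in>?A (Suc t). card F)" using fin finF by (intro card_SigmaI) auto
  also have "\<dots> = card (?A (Suc t)) * Suc t" by simp
  finally have P: "card ?P = card (?A (Suc t)) * Suc t" .
  have "card ?R = (\<Sum>F\<in>?A t. card {b \<in> X - F. GG (insert b F)})" using fin assms(1) by (intro card_SigmaI) auto
  then have "real (card ?R) = (\<Sum>F\<in>?A t. real (card {b \<in> X - F. GG (insert b F)}))" by simp
  also have "\<dots> \<le> (\<Sum>F\<in>?A t. m t)"
  proof (rule sum_mono)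
    fix F assume "F \<in> ?A t"
    then show "real (card {b \<in> X - F. GG (insert b F)}) \<le> m t" using Suc.prems(2)[of F] by auto
  qed
  also have "\<dots> = real (card (?A t)) * m t" by simp
  also have "\<dots> \<le> ((\<Prod>i<t. m i) / fact t) * m t"
    using Suc by (intro mult_right_mono Suc.IH) auto
  finally have R: "real (card ?R) \<le> (\<Prod>i<Suc t. m i) / fact t" by simp
  have "card ?P \<le> card ?R"
  proof (rule card_inj_on_le)
    show "inj_on (\<lambda>(F, b). (F - {b}, b)) ?P"
    proof (rule inj_onI)
      fix u v assume uv: "u \<in> ?P" "v \<in> ?P" "(\<lambda>(F, b). (F - {b}, b)) u = (\<lambda>(F, b). (F - {b}, b)) v"
      obtain A x where u: "u = (A, x)" by (cases u)
      obtain B z where v: "v = (B, z)" by (cases v)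
      have "z = x" "x \<in> A" "x \<in> B" "A - {x} = B - {x}" using uv u v by auto
      then show "u = v" unfolding u v by (metis insert_Diff)
    qed
    show "(\<lambda>(F, b). (F - {b}, b)) ` ?P \<subseteq> ?R"
    proof safe
      fix F b assume F: "F \<subseteq> X" "card F = Suc t" "GG F" "b \<in> F"
      show "GG (F - {b})" using F assms(2) by blast
      show "card (F - {b}) = t" using F finF[OF F(1)] by simp
      show "GG (insert b (F - {b}))" using F by (simp add: insert_absorb)
    qed auto
    show "finite ?R" using fin assms(1) by (intro finite_SigmaI) auto
  qed
  then have "real (card ?P) \<le> real (card ?R)" by (rule of_nat_mono)
  then have "real (card (?A (Suc t))) * real (Suc t) \<le> (\<Prod>i<Suc t. m i) / fact t"
    using R unfolding P of_nat_mult by (rule order_trans)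
  then have "real (card (?A (Suc t))) * (real (Suc t) * fact t) \<le> (\<Prod>i<Suc t. m i)"
    by (simp only: pos_le_divide_eq fact_gt_zero mult.assoc)
  then show ?case unfolding fact_Suc by (rule mult_imp_le_div_pos[rotated]) simp
qed

section \<open>Estimates for \<open>Lam\<close>\<close>

lemma gchoose_le_power: "0 \<le> a \<Longrightarrow> real t \<le> a + 1 \<Longrightarrow> a gchoose t \<le> a ^ t / fact t"
proof -
  assume a: "0 \<le> a" "real t \<le> a + 1"
  have "(\<Prod>i = 0..<t. a - real i) \<le> (\<Prod>i = 0..<t. a)"
    using a by (intro prod_mono) auto
  then show ?thesis by (simp add: gbinomial_prod_rev divide_right_mono)
qed

lemma power_le_gchoose: 
  assumes "0 < a" "2 * real t \<le> a"
  shows "a ^ t / fact t \<le> (a gchoose t) * exp ((real t)\<^sup>2 * 2 / a)"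
proof -
  have "a ^ t = (\<Prod>i = 0..<t. a)" by simp
  also have "\<dots> \<le> (\<Prod>i = 0..<t. (a - real i) * exp (2 * real t / a))"
  proof (intro prod_mono conjI)
    fix i assume i: "i \<in> {0..<t}"
    have x: "0 \<le> real i / a" "real i / a \<le> 1/2" "real i / a \<le> real t / a" using i assms by (auto simp: field_simps)
    have "1 \<le> (1 - real i / a) * (1 + 2 * (real i / a))"
    proof -
      define y where "y = real i / a"
      have "0 \<le> y" "y \<le> 1/2" unfolding y_def by (fact x)+
      then have "0 \<le> y * (1 - 2 * y)" by (intro mult_nonneg_nonneg) auto
      then have "1 \<le> (1 - y) * (1 + 2 * y)" by (simp add: algebra_simps)
      then show ?thesis by (simp only: y_def)
    qed
    also have "\<dots> \<le> (1 - real i / a) * exp (2 * real t / a)"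
    proof (intro mult_left_mono)
      have "1 + 2 * (real i / a) \<le> exp (2 * (real i / a))" by (rule exp_ge_add_one_self)
      also have "\<dots> \<le> exp (2 * real t / a)" using x by simp
      finally show "1 + 2 * (real i / a) \<le> exp (2 * real t / a)" .
    qed (use x(2) in linarith)
    finally have "a * 1 \<le> a * ((1 - real i / a) * exp (2 * real t / a))" using assms by (intro mult_left_mono) auto
    also have "\<dots> = (a - real i) * exp (2 * real t / a)" using assms by (simp add: field_simps)
    finally show "a \<le> (a - real i) * exp (2 * real t / a)" by simp
  qed (use assms in auto)
  also have "\<dots> = (\<Prod>i = 0..<t. a - real i) * exp (2 * real t / a) ^ t" by (simp add: prod.distrib)
  also have "exp (2 * real t / a) ^ t = exp ((real t)\<^sup>2 * 2 / a)" 
    by (simp add: exp_of_nat_mult[symmetric] power2_eq_square mult_ac)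
  finally show ?thesis by (simp add: gbinomial_prod_rev field_simps)
qed

lemma choose2_double: "2 * (t choose 2) = t * (t - 1)"
proof -
  have "2 dvd t * (t - 1)" by (cases t) auto
  then show ?thesis by (simp add: choose_two)
qed

text \<open>Squaring turns the exponent \<open>t choose 2\<close> into \<open>t * (t - 1)\<close>,
  so that a \<open>t\<close>-th root can be taken.\<close>

lemma Lam_le_imp:
  assumes "Lam n k p t \<le> 1" "0 < t" "real t \<le> mbar n k p" "0 < meet_prob n k"
  shows "(mbar n k p / real t)\<^sup>2 * meet_prob n k ^ (t - 1) \<le> 1"
proof -
  let ?m = "mbar n k p" and ?q = "meet_prob n k"
  have "(?m / real t) ^ t \<le> ?m gchoose t" using assms by (intro gbinomial_ge_n_over_k_pow_k) auto
  then have "(?m / real t) ^ t * ?q ^ (t choose 2) \<le> 1"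
  proof -
    assume "(?m / real t) ^ t \<le> ?m gchoose t"
    then have "(?m / real t) ^ t * ?q ^ (t choose 2) \<le> (?m gchoose t) * ?q ^ (t choose 2)"
      using assms(4) by (intro mult_right_mono) auto
    then show ?thesis using assms(1) unfolding Lam_def by linarith
  qed
  moreover have "0 \<le> (?m / real t) ^ t * ?q ^ (t choose 2)" using assms by auto
  ultimately have "((?m / real t) ^ t * ?q ^ (t choose 2))\<^sup>2 \<le> 1" by (simp add: power_le_one)
  also have "((?m / real t) ^ t * ?q ^ (t choose 2))\<^sup>2 = ((?m / real t)\<^sup>2 * ?q ^ (t - 1)) ^ t"
    by (simp add: power_mult_distrib power_mult[symmetric] choose2_double mult_ac)
  finally have "((?m / real t)\<^sup>2 * ?q ^ (t - 1)) ^ t \<le> 1 ^ t" by simp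
  then show ?thesis using assms by (subst (asm) power_mono_iff) auto
qed

lemma Lam_gt_imp:
  assumes "eps < Lam n k p t" "0 < eps" "eps \<le> 1" "0 < t" "real t \<le> mbar n k p + 1" "0 \<le> mbar n k p" "0 < meet_prob n k"
  shows "eps\<^sup>2 \<le> (3 * mbar n k p / real t)\<^sup>2 * meet_prob n k ^ (t - 1)"
proof -
  let ?m = "mbar n k p" and ?q = "meet_prob n k"
  have "?m gchoose t \<le> ?m ^ t / fact t" using assms by (intro gchoose_le_power) auto
  also have "\<dots> \<le> (exp 1 * ?m / real t) ^ t" using assms by (intro power_div_fact_le) auto
  also have "\<dots> \<le> (3 * ?m / real t) ^ t" using assms exp_le
    by (intro power_mono divide_right_mono mult_right_mono) auto
  finally have "?m gchoose t \<le> (3 * ?m / real t) ^ t" .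
  then have "(?m gchoose t) * ?q ^ (t choose 2) \<le> (3 * ?m / real t) ^ t * ?q ^ (t choose 2)"
    using assms(7) by (intro mult_right_mono) auto
  then have "eps \<le> (3 * ?m / real t) ^ t * ?q ^ (t choose 2)" using assms(1) unfolding Lam_def by linarith
  then have "eps\<^sup>2 \<le> ((3 * ?m / real t) ^ t * ?q ^ (t choose 2))\<^sup>2" using assms by (intro power_mono) auto
  also have "\<dots> = ((3 * ?m / real t)\<^sup>2 * ?q ^ (t - 1)) ^ t"
    by (simp add: power_mult_distrib power_mult[symmetric] choose2_double mult_ac)
  finally have 1: "eps\<^sup>2 \<le> ((3 * ?m / real t)\<^sup>2 * ?q ^ (t - 1)) ^ t" .
  show ?thesis
  proof (rule ccontr)
    assume a: "\<not> ?thesis"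
    have e1: "eps\<^sup>2 \<le> 1" using assms by (simp add: power_le_one)
    let ?b = "(3 * ?m / real t)\<^sup>2 * ?q ^ (t - 1)"
    have "0 \<le> ?b" using assms by auto
    \<comment> \<open>A base below \<open>eps^2 \<le> 1\<close> has a \<open>t\<close>-th power
      below \<open>eps^2\<close> as well, so the lower bound survives the root without any
      loss.\<close>
    then have "?b ^ t \<le> ?b ^ 1" using a e1 assms by (intro power_decreasing) auto
    then show False using a 1 by simp
  qed
qed

section \<open>First moment bounds for intersections, codegrees and degrees\<close>

context
  fixes n k :: nat and p :: real
  assumes kn: "0 < k" "2 * k < n" and p01: "0 \<le> p" "p \<le> 1"
begin


lemma phi_eq: "phi n k p = mbar n k p * real k / real n"
  using kn by (simp add: mbar_def)

lemma phi_nonneg: "0 \<le> phi n k p" using p01 by (simp add: phi_def)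
lemma mbar_nonneg: "0 \<le> mbar n k p" using p01 kn by (simp add: mbar_eq)

lemma card_large_intersection_le:
  assumes A: "A \<in> ksets n k"
  shows "real (card {B \<in> ksets n k. l \<le> card (A \<inter> B)}) \<le> real (n choose k) * (((real k)\<^sup>2 / real n) ^ l / fact l)"
proof -
  let ?K = "ksets n k" and ?N = "real (n choose k)"
  let ?T = "{T. T \<subseteq> A \<and> card T = l}"
  have fT: "finite ?T" using A by (auto dest: ksetsD)
  have "{B \<in> ?K. l \<le> card (A \<inter> B)} \<subseteq> (\<Union>T\<in>?T. {B \<in> ?K. T \<subseteq> B})"
  proof safe
    fix B assume "l \<le> card (A \<inter> B)" "B \<in> ?K"
    then obtain T where "T \<subseteq> A \<inter> B" "card T = l" using obtain_subset_with_card_n by metis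
    then show "B \<in> (\<Union>T\<in>?T. {B \<in> ?K. T \<subseteq> B})" using \<open>B \<in> ?K\<close> by auto
  qed
  then have "card {B \<in> ?K. l \<le> card (A \<inter> B)} \<le> card (\<Union>T\<in>?T. {B \<in> ?K. T \<subseteq> B})" using fT by (intro card_mono) auto
  also have "\<dots> \<le> (\<Sum>T\<in>?T. card {B \<in> ?K. T \<subseteq> B})" using fT by (rule card_UN_le)
  finally have "real (card {B \<in> ?K. l \<le> card (A \<inter> B)}) \<le> real (\<Sum>T\<in>?T. card {B \<in> ?K. T \<subseteq> B})"
    by (rule of_nat_mono)
  also have "\<dots> = (\<Sum>T\<in>?T. real (card {B \<in> ?K. T \<subseteq> B}))" by (rule of_nat_sum)
  also have "\<dots> \<le> (\<Sum>T\<in>?T. ?N * (real k / real n) ^ l)"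
  proof (rule sum_mono)
    fix T assume "T \<in> ?T"
    then show "real (card {B \<in> ?K. T \<subseteq> B}) \<le> ?N * (real k / real n) ^ l"
      using card_ksets_superset_le[of k n T] kn A by (auto dest!: ksetsD)
  qed
  also have "\<dots> = ?N * (real (k choose l) * (real k / real n) ^ l)"
    using A n_subsets[of A l] by (auto dest!: ksetsD)
  also have "\<dots> \<le> ?N * ((real k * (real k / real n)) ^ l / fact l)"
    by (intro mult_left_mono choose_mult_power_le) auto
  finally show ?thesis by (simp add: power2_eq_square)
qed

lemma prob_large_intersection:
  "Prs (ksets n k) p (\<lambda>H. \<exists>A\<in>H. \<exists>B\<in>H. A \<noteq> B \<and> l \<le> card (A \<inter> B)) \<le> (mbar n k p)\<^sup>2 * (((real k)\<^sup>2 / real n) ^ l / fact l)"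
proof -
  let ?K = "ksets n k" and ?N = "real (n choose k)"
  let ?FF = "{{A, B} | A B. A \<in> ?K \<and> B \<in> ?K \<and> A \<noteq> B \<and> l \<le> card (A \<inter> B)}"
  let ?S = "Sigma ?K (\<lambda>A. {B \<in> ?K. l \<le> card (A \<inter> B)})"
  have fS: "finite ?S" by (intro finite_SigmaI) auto
  have sub: "?FF \<subseteq> (\<lambda>(A, B). {A, B}) ` ?S" by auto
  have fFF: "finite ?FF" by (rule finite_subset[OF sub]) (use fS in auto)
  have "Prs ?K p (\<lambda>H. \<exists>A\<in>H. \<exists>B\<in>H. A \<noteq> B \<and> l \<le> card (A \<inter> B)) \<le> Prs ?K p (\<lambda>H. \<exists>F\<in>?FF. F \<subseteq> H)"
  proof (rule Prs_mono)
    fix H assume "H \<subseteq> ?K" "\<exists>A\<in>H. \<exists>B\<in>H. A \<noteq> B \<and> l \<le> card (A \<inter> B)"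
    then obtain A B where "A \<in> H" "B \<in> H" "A \<noteq> B" "l \<le> card (A \<inter> B)" by blast
    then show "\<exists>F\<in>?FF. F \<subseteq> H" using \<open>H \<subseteq> ?K\<close> by (intro bexI[of _ "{A, B}"]) auto
  qed
  also have "\<dots> \<le> real (card ?FF) * p ^ 2"
    by (rule Prs_exists_superset) (use fFF p01 in \<open>auto simp: card_2_iff\<close>)
  also have "\<dots> \<le> (?N * (?N * (((real k)\<^sup>2 / real n) ^ l / fact l))) * p ^ 2"
  proof (intro mult_right_mono)
    have "card ?FF \<le> card ((\<lambda>(A, B). {A, B}) ` ?S)" using fS sub by (intro card_mono) auto
    also have "\<dots> \<le> card ?S" using fS by (rule card_image_le)
    also have "card ?S = (\<Sum>A\<in>?K. card {B \<in> ?K. l \<le> card (A \<inter> B)})" by (intro card_SigmaI) auto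
    finally have "real (card ?FF) \<le> real (\<Sum>A\<in>?K. card {B \<in> ?K. l \<le> card (A \<inter> B)})"
      by (rule of_nat_mono)
    also have "\<dots> = (\<Sum>A\<in>?K. real (card {B \<in> ?K. l \<le> card (A \<inter> B)}))" by (rule of_nat_sum)
    also have "\<dots> \<le> (\<Sum>A\<in>?K. ?N * (((real k)\<^sup>2 / real n) ^ l / fact l))" by (intro sum_mono card_large_intersection_le)
    finally show "real (card ?FF) \<le> ?N * (?N * (((real k)\<^sup>2 / real n) ^ l / fact l))" by (simp add: card_ksets)
  qed auto
  finally show ?thesis using kn by (simp add: mbar_eq power2_eq_square mult_ac)
qed

lemma card_pair_le: 
  assumes "x \<in> {1..n}" "y \<in> {1..n}" "x \<noteq> y"
  shows "real (card (kstar n k x \<inter> kstar n k y)) * p \<le> phi n k p * real k / real n"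
proof -
  have "kstar n k x \<inter> kstar n k y = {A \<in> ksets n k. {x, y} \<subseteq> A}" by (auto simp: kstar_def)
  then have "real (card (kstar n k x \<inter> kstar n k y)) \<le> real (n choose k) * (real k / real n) ^ 2"
    using card_ksets_superset_le[of k n "{x, y}"] kn assms by (simp add: card_2_iff numeral_2_eq_2)
  then have "real (card (kstar n k x \<inter> kstar n k y)) * p \<le> real (n choose k) * (real k / real n) ^ 2 * p"
    using p01 by (intro mult_right_mono)
  also have "\<dots> = phi n k p * real k / real n" using kn by (simp add: phi_eq mbar_eq power2_eq_square field_simps)
  finally show ?thesis .
qed

lemma prob_large_codegree:
  "Prs (ksets n k) p (\<lambda>H. \<exists>x\<in>{1..n}. \<exists>y\<in>{1..n}. x \<noteq> y \<and> j \<le> card (H \<inter> (kstar n k x \<inter> kstar n k y)))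
    \<le> (real n)\<^sup>2 * ((phi n k p * real k / real n) ^ j / fact j)"
proof -
  let ?K = "ksets n k" and ?P = "{(x, y). x \<in> {1..n} \<and> y \<in> {1..n} \<and> x \<noteq> y}"
  have fP: "finite ?P" by (rule finite_subset[of _ "{1..n} \<times> {1..n}"]) auto
  have "Prs ?K p (\<lambda>H. \<exists>x\<in>{1..n}. \<exists>y\<in>{1..n}. x \<noteq> y \<and> j \<le> card (H \<inter> (kstar n k x \<inter> kstar n k y)))
     = Prs ?K p (\<lambda>H. \<exists>xy\<in>?P. j \<le> card (H \<inter> (kstar n k (fst xy) \<inter> kstar n k (snd xy))))"
  proof (rule Prs_cong)
    have "(\<exists>x\<in>V. \<exists>y\<in>V. x \<noteq> y \<and> R x y) \<longleftrightarrow> (\<exists>xy\<in>{(x, y). x \<in> V \<and> y \<in> V \<and> x \<noteq> y}. R (fst xy) (snd xy))"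
      for R :: "nat \<Rightarrow> nat \<Rightarrow> bool" and V by auto
    then show "(\<exists>x\<in>{1..n}. \<exists>y\<in>{1..n}. x \<noteq> y \<and> j \<le> card (H \<inter> (kstar n k x \<inter> kstar n k y))) \<longleftrightarrow>
      (\<exists>xy\<in>?P. j \<le> card (H \<inter> (kstar n k (fst xy) \<inter> kstar n k (snd xy))))" for H by simp
  qed
  also have "\<dots> \<le> (\<Sum>xy\<in>?P. Prs ?K p (\<lambda>H. j \<le> card (H \<inter> (kstar n k (fst xy) \<inter> kstar n k (snd xy)))))"
    by (rule Prs_Bex[OF fP])
  also have "\<dots> \<le> (\<Sum>xy\<in>?P. (phi n k p * real k / real n) ^ j / fact j)"
  proof (rule sum_mono)
    fix xy assume "xy \<in> ?P"
    then obtain x y where xy: "xy = (x, y)" "x \<in> {1..n}" "y \<in> {1..n}" "x \<noteq> y" by auto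
    have "Prs ?K p (\<lambda>H. j \<le> card (H \<inter> (kstar n k x \<inter> kstar n k y))) \<le> (real (card (kstar n k x \<inter> kstar n k y)) * p) ^ j / fact j"
      by (rule Prs_card_Int_ge) (use p01 kstar_subset in auto)
    also have "\<dots> \<le> (phi n k p * real k / real n) ^ j / fact j"
      using p01 card_pair_le[OF xy(2-4)] by (intro divide_right_mono power_mono) auto
    finally show "Prs ?K p (\<lambda>H. j \<le> card (H \<inter> (kstar n k (fst xy) \<inter> kstar n k (snd xy)))) \<le> (phi n k p * real k / real n) ^ j / fact j"
      by (simp add: xy)
  qed
  also have "\<dots> \<le> (real n)\<^sup>2 * ((phi n k p * real k / real n) ^ j / fact j)"
  proof -
    have "card ?P \<le> card ({1..n} \<times> {1..n})" by (intro card_mono) auto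
    then have "real (card ?P) \<le> (real n)\<^sup>2" by (simp add: power2_eq_square card_cartesian_product flip: of_nat_mult)
    moreover have "0 \<le> (phi n k p * real k / real n) ^ j / fact j"
      using phi_nonneg by (intro divide_nonneg_nonneg zero_le_power) auto
    ultimately show ?thesis unfolding sum_constant by (intro mult_right_mono)
  qed
  finally show ?thesis .
qed

lemma prob_max_degree_ge:
  "Prs (ksets n k) p (\<lambda>H. j \<le> max_degree n H) \<le> real n * (phi n k p ^ j / fact j)"
proof -
  have "Prs (ksets n k) p (\<lambda>H. j \<le> max_degree n H) = Prs (ksets n k) p (\<lambda>H. \<exists>x\<in>{1..n}. j \<le> card (H \<inter> kstar n k x))"
  proof (rule Prs_cong)
    fix H assume "H \<subseteq> ksets n k"
    then show "j \<le> max_degree n H \<longleftrightarrow> (\<exists>x\<in>{1..n}. j \<le> card (H \<inter> kstar n k x))"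
      using kn by (subst le_max_degree_iff) (auto simp: star_eq_Int)
  qed
  also have "\<dots> \<le> (\<Sum>x\<in>{1..n}. Prs (ksets n k) p (\<lambda>H. j \<le> card (H \<inter> kstar n k x)))"
    by (rule Prs_Bex) auto
  also have "\<dots> \<le> (\<Sum>x\<in>{1..n}. phi n k p ^ j / fact j)"
  proof (rule sum_mono)
    fix x assume x: "x \<in> {1..n}"
    have "Prs (ksets n k) p (\<lambda>H. j \<le> card (H \<inter> kstar n k x)) \<le> (real (card (kstar n k x)) * p) ^ j / fact j"
      by (rule Prs_card_Int_ge) (use p01 kstar_subset in auto)
    then show "Prs (ksets n k) p (\<lambda>H. j \<le> card (H \<inter> kstar n k x)) \<le> phi n k p ^ j / fact j"
      using x kn by (simp add: card_kstar phi_def mult.commute)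
  qed
  finally show ?thesis by simp
qed

end

section \<open>Counting cliques\<close>

lemma sum_lessThan_eq_choose: "(\<Sum>i<t. i) = t choose 2"
  by (induction t) (auto simp: numeral_2_eq_2)

lemma prod_power_lessThan: "(\<Prod>i<t. a * (q::real) ^ (d + i)) = a ^ t * q ^ (d * t) * q ^ (t choose 2)"
  by (simp add: prod.distrib power_add power_sum[symmetric] sum_lessThan_eq_choose power_mult)

definition fdeg :: "nat set set \<Rightarrow> nat \<Rightarrow> nat" where "fdeg F y = card {A \<in> F. y \<in> A}"

lemma fdeg_mono: "finite F \<Longrightarrow> F' \<subseteq> F \<Longrightarrow> fdeg F' y \<le> fdeg F y"
  unfolding fdeg_def by (intro card_mono) auto

definition sparse_clique :: "nat \<Rightarrow> nat set set \<Rightarrow> bool" where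
  "sparse_clique l F \<longleftrightarrow> clique F \<and> (\<forall>A\<in>F. \<forall>B\<in>F. A \<noteq> B \<longrightarrow> card (A \<inter> B) \<le> l)"

lemma sparse_clique_mono: "sparse_clique l F \<Longrightarrow> F' \<subseteq> F \<Longrightarrow> sparse_clique l F'"
  unfolding sparse_clique_def clique_def by (metis pairwise_subset subsetD)

context meet_params
begin

text \<open>The error factor that \<open>count_meet_le\<close> produces for one more edge when there
  are no exceptional vertices, evaluated at the final size \<open>t\<close>.\<close>

definition EE :: "nat \<Rightarrow> nat \<Rightarrow> nat \<Rightarrow> real" where
  "EE t dm l = exp (real t * r * e0 / q + 2 * z0 + pi' * r * inverse (q ^ dm) * (real t)\<^sup>2 * real l)"

lemma EE_ge: "i \<le> t \<Longrightarrow> exp (real i * r * e0 / q + 2 * z0 + pi' * r * inverse (q ^ dm) * (real i)\<^sup>2 * real l) \<le> EE t dm l"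
  unfolding EE_def using qr e0_nonneg pi_bounds
  by (auto intro!: add_mono mult_right_mono divide_right_mono mult_left_mono power_mono)

lemma EE_pos: "0 < EE t dm l" by (simp add: EE_def)

text \<open>With all degrees at most \<open>dm\<close>, a new edge meets the previous
  \<open>i\<close> ones with probability about \<open>q ^ i\<close>. The expected number of such
  cliques is thus the main term of \<open>Lam n k p t\<close>, up to
  \<open>EE t dm l ^ t\<close>.\<close>

lemma prob_generic_clique:
  assumes p01: "0 \<le> p" "p \<le> 1"
  shows "Prs (ksets n k) p (\<lambda>H. \<exists>F\<subseteq>H. card F = t \<and> sparse_clique l F \<and> (\<forall>y\<in>{1..n}. fdeg F y \<le> dm))
    \<le> mbar n k p ^ t / fact t * q ^ (t choose 2) * EE t dm l ^ t"
proof -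
  let ?K = "ksets n k" and ?N = "real (n choose k)"
  let ?G = "\<lambda>F. F \<subseteq> ?K \<and> sparse_clique l F \<and> (\<forall>y\<in>{1..n}. fdeg F y \<le> dm)"
  let ?FF = "{F. F \<subseteq> ?K \<and> card F = t \<and> ?G F}"
  have cnt: "real (card ?FF) \<le> (\<Prod>i<t. (?N * EE t dm l) * q ^ (0 + i)) / fact t"
  proof (rule card_down_closed_le)
    fix F F' assume "?G F" "F' \<subseteq> F"
    moreover then have "finite F" using finite_subset[of F ?K] by auto
    ultimately show "?G F'" using sparse_clique_mono fdeg_mono by (meson order_trans)
  next
    fix F assume F: "F \<subseteq> ?K" "?G F" "card F < t"
    have finF: "finite F" using F finite_subset[of F ?K] by auto
    have "{b \<in> ?K - F. ?G (insert b F)} \<subseteq> {A. A \<subseteq> {1..n} \<and> card A = k \<and> (\<forall>i\<in>F. A \<inter> id i \<noteq> {})}"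
    proof safe
      fix b A assume "b \<in> ?K" "b \<notin> F" "sparse_clique l (insert b F)" "A \<in> F" "b \<inter> id A = {}"
      then show False unfolding sparse_clique_def clique_def pairwise_def disjnt_def by auto
    qed (auto dest!: ksetsD)
    then have "card {b \<in> ?K - F. ?G (insert b F)} \<le> card {A. A \<subseteq> {1..n} \<and> card A = k \<and> (\<forall>i\<in>F. A \<inter> id i \<noteq> {})}"
      by (intro card_mono) (auto intro: finite_subset[of _ "Pow {1..n}"])
    then have "real (card {b \<in> ?K - F. ?G (insert b F)}) \<le> real (card {A. A \<subseteq> {1..n} \<and> card A = k \<and> (\<forall>i\<in>F. A \<inter> id i \<noteq> {})})"
      by (rule of_nat_mono)
    also have "\<dots> \<le> real (card {1..n} choose k) * (q ^ card F * exp (real (card F) * r * e0 / q + 2 * z0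
       + pi' * r * inverse (q ^ dm) * (real (card F))\<^sup>2 * real l) * (1 + pi' * inverse (q ^ 0)) ^ 0)"
    proof (rule count_meet_le[where Y = "{}"])
      fix i assume "i \<in> F"
      then have "i \<in> ?K" using F by auto
      then show "id i \<subseteq> {1..n}" "card (id i) \<le> k" using ksetsD[of i n k] by auto
    next
      fix i j assume "i \<in> F" "j \<in> F" "i \<noteq> j"
      then show "card (id i \<inter> id j) \<le> l" using F(2) by (auto simp: sparse_clique_def)
    next
      fix y assume "y \<in> {1..n} - {}"
      then show "card {i \<in> F. y \<in> id i} \<le> dm" using F(2) by (simp add: fdeg_def)
    qed (use finF in auto)
    also have "\<dots> \<le> ?N * (q ^ card F * EE t dm l)"
      using EE_ge[of "card F" t dm l] F qr by (auto intro!: mult_left_mono)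
    finally show "real (card {b \<in> ?K - F. ?G (insert b F)}) \<le> ?N * EE t dm l * q ^ (0 + card F)" by (simp add: mult_ac)
  next
    show "0 \<le> ?N * EE t dm l * q ^ (0 + i)" for i using qr EE_pos[of t dm l] by simp
  qed auto
  have "Prs ?K p (\<lambda>H. \<exists>F\<subseteq>H. card F = t \<and> sparse_clique l F \<and> (\<forall>y\<in>{1..n}. fdeg F y \<le> dm))
     \<le> Prs ?K p (\<lambda>H. \<exists>F\<in>?FF. F \<subseteq> H)" by (rule Prs_mono) auto
  also have "\<dots> \<le> real (card ?FF) * p ^ t"
    by (rule Prs_exists_superset) (use p01 in \<open>auto intro: finite_subset[of _ "Pow ?K"]\<close>)
  also have "\<dots> \<le> (\<Prod>i<t. (?N * EE t dm l) * q ^ (0 + i)) / fact t * p ^ t"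
    using cnt p01 by (intro mult_right_mono) auto
  also have "\<dots> = mbar n k p ^ t / fact t * q ^ (t choose 2) * EE t dm l ^ t"
    unfolding prod_power_lessThan using k_pos k_small by (simp add: mbar_eq power_mult_distrib mult_ac)
  finally show ?thesis .
qed

text \<open>Only \<open>x\<close> may have arbitrary degree. The other vertices of degree above
  \<open>dm\<close> are few and serve as the exceptional set \<open>Y\<close> of
  \<open>count_meet_le\<close>.\<close>

definition popular_clique :: "nat \<Rightarrow> nat \<Rightarrow> nat \<Rightarrow> nat \<Rightarrow> nat \<Rightarrow> nat set set \<Rightarrow> bool" where
  "popular_clique l dm d2 m1 x F \<longleftrightarrow> sparse_clique l F \<and> (\<forall>y\<in>{1..n} - {x}. fdeg F y \<le> d2) \<and>
     card {y \<in> {1..n} - {x}. dm < fdeg F y} \<le> m1"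

lemma popular_clique_mono:
  assumes "popular_clique l dm d2 m1 x F" "F' \<subseteq> F" "finite F"
  shows "popular_clique l dm d2 m1 x F'"
proof -
  have "card {y \<in> {1..n} - {x}. dm < fdeg F' y} \<le> card {y \<in> {1..n} - {x}. dm < fdeg F y}"
    using assms fdeg_mono[of F F'] by (intro card_mono) (auto intro: less_le_trans)
  then show ?thesis using assms fdeg_mono[of F F'] sparse_clique_mono
    unfolding popular_clique_def by (meson order_trans)
qed

text \<open>The \<open>d\<close> edges at \<open>x\<close> meet each other for free and cost only
  \<open>phi^d / fact d\<close>. The other \<open>s\<close> edges avoid \<open>x\<close> and must
  meet all earlier edges elsewhere, whence \<open>q ^ (d * s)\<close> and
  \<open>q ^ (s choose 2)\<close>.\<close>

lemma prob_popular_clique: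
  assumes p01: "0 \<le> p" "p \<le> 1"
  shows "Prs (ksets n k) p (\<lambda>H. \<exists>x\<in>{1..n}. \<exists>F\<subseteq>H. card F = d + s \<and> fdeg F x = d \<and> popular_clique l dm d2 m1 x F)
    \<le> real n * (phi n k p ^ d / fact d * (mbar n k p ^ s / fact s * q ^ (d * s) * q ^ (s choose 2) 
        * (EE (d + s) dm l * (1 + pi' * inverse (q ^ d2)) ^ m1) ^ s))"
proof -
  let ?K = "ksets n k" and ?N = "real (n choose k)"
  let ?P = "(1 + pi' * inverse (q ^ d2)) ^ m1"
  let ?c = "?N * EE (d + s) dm l * ?P"
  have P1: "0 \<le> ?P" using qr pi_bounds by simp
  have each: "Prs ?K p (\<lambda>H. \<exists>F\<subseteq>H. card F = d + s \<and> fdeg F x = d \<and> popular_clique l dm d2 m1 x F)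
    \<le> phi n k p ^ d / fact d * (mbar n k p ^ s / fact s * q ^ (d * s) * q ^ (s choose 2) * (EE (d + s) dm l * ?P) ^ s)"
    if x: "x \<in> {1..n}" for x
  proof -
    let ?X = "?K - kstar n k x"
    let ?T = "{F0. F0 \<subseteq> kstar n k x \<and> card F0 = d}"
    let ?GG = "\<lambda>F0. {G. G \<subseteq> ?X \<and> card G = s \<and> popular_clique l dm d2 m1 x (F0 \<union> G)}"
    \<comment> \<open>Repeating \<open>G \<subseteq> ?X\<close> inside the predicate makes the
      predicate imply finiteness, on which \<open>popular_clique_mono\<close> relies.\<close>
    let ?GGf = "\<lambda>F0. {G. G \<subseteq> ?X \<and> card G = s \<and> (G \<subseteq> ?X \<and> popular_clique l dm d2 m1 x (F0 \<union> G))}"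
    have fT: "finite ?T" by (auto intro: finite_subset[of _ "Pow (kstar n k x)"])
    have fG: "finite (?GG F0)" for F0 by (auto intro: finite_subset[of _ "Pow ?K"])
    have cnt: "real (card (?GG F0)) \<le> (\<Prod>i<s. ?c * q ^ (d + i)) / fact s" if F0: "F0 \<in> ?T" for F0
    proof -
      have finF0: "finite F0" and F0K: "F0 \<subseteq> ?K" using F0 kstar_subset[of n k x] by (auto intro: finite_subset[of _ "kstar n k x"])
      have finG: "finite G" if "G \<subseteq> ?X" for G using that finite_subset[of G ?K] by auto
      have "real (card (?GGf F0)) \<le> (\<Prod>i<s. ?c * q ^ (d + i)) / fact s"
      proof (rule card_down_closed_le)
        fix F F' assume F: "F \<subseteq> ?X \<and> popular_clique l dm d2 m1 x (F0 \<union> F)" "F' \<subseteq> F"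
        have "popular_clique l dm d2 m1 x (F0 \<union> F')"
          by (rule popular_clique_mono[of _ _ _ _ _ "F0 \<union> F"]) (use F finF0 finG in auto)
        then show "F' \<subseteq> ?X \<and> popular_clique l dm d2 m1 x (F0 \<union> F')" using F by auto
      next
        fix G assume G: "G \<subseteq> ?X" "G \<subseteq> ?X \<and> popular_clique l dm d2 m1 x (F0 \<union> G)" "card G < s"
        let ?I = "F0 \<union> G"
        let ?U = "{1..n} - {x}"
        have fI: "finite ?I" using finF0 finG G by auto
        have cI: "card ?I = d + card G"
          using F0 G finF0 finG[OF G(1)] by (subst card_Un_disjoint) auto
        have IK: "A \<in> ?I \<Longrightarrow> A \<subseteq> {1..n} \<and> card A = k \<and> finite A" for A using F0K G ksetsD[of A n k] by auto
        have sc: "sparse_clique l ?I" using G by (simp add: popular_clique_def)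
        have degeq: "card {i \<in> ?I. y \<in> i - {x}} = fdeg ?I y" if "y \<in> ?U" for y
          unfolding fdeg_def using that by (intro arg_cong[where f = card]) auto
        have "{b \<in> ?X - G. insert b G \<subseteq> ?X \<and> popular_clique l dm d2 m1 x (F0 \<union> insert b G)} \<subseteq>
           {A. A \<subseteq> ?U \<and> card A = k \<and> (\<forall>i\<in>?I. A \<inter> (i - {x}) \<noteq> {})}"
        proof
          fix b assume b: "b \<in> {b \<in> ?X - G. insert b G \<subseteq> ?X \<and> popular_clique l dm d2 m1 x (F0 \<union> insert b G)}"
          then have "b \<in> ?K" "x \<notin> b" by (auto simp: kstar_def)
          then have bU: "b \<subseteq> ?U" "card b = k" by (auto dest!: ksetsD)
          have cl: "clique (F0 \<union> insert b G)" using b by (simp add: popular_clique_def sparse_clique_def)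
          have bnot: "b \<notin> ?I" using b F0 by auto
          have "b \<inter> (i - {x}) \<noteq> {}" if "i \<in> ?I" for i
          proof -
            have "i \<noteq> b" using that bnot by auto
            then have "\<not> disjnt b i" using cl that unfolding clique_def pairwise_def by blast
            then show ?thesis using \<open>x \<notin> b\<close> by (auto simp: disjnt_def)
          qed
          then show "b \<in> {A. A \<subseteq> ?U \<and> card A = k \<and> (\<forall>i\<in>?I. A \<inter> (i - {x}) \<noteq> {})}" using bU by blast
        qed
        then have "card {b \<in> ?X - G. insert b G \<subseteq> ?X \<and> popular_clique l dm d2 m1 x (F0 \<union> insert b G)} \<le>
           card {A. A \<subseteq> ?U \<and> card A = k \<and> (\<forall>i\<in>?I. A \<inter> (i - {x}) \<noteq> {})}"
          by (intro card_mono) (auto intro: finite_subset[of _ "Pow {1..n}"])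
        then have "real (card {b \<in> ?X - G. insert b G \<subseteq> ?X \<and> popular_clique l dm d2 m1 x (F0 \<union> insert b G)}) \<le>
           real (card {A. A \<subseteq> ?U \<and> card A = k \<and> (\<forall>i\<in>?I. A \<inter> (i - {x}) \<noteq> {})})" by (rule of_nat_mono)
        also have "\<dots> \<le> real (card ?U choose k) * (q ^ card ?I * exp (real (card ?I) * r * e0 / q + 2 * z0
             + pi' * r * inverse (q ^ dm) * (real (card ?I))\<^sup>2 * real l) * ?P)"
        proof (rule count_meet_le[where Y = "{y \<in> ?U. dm < fdeg ?I y}"])
          fix i assume i: "i \<in> ?I"
          show "i - {x} \<subseteq> ?U" using IK[OF i] by auto
          have "card (i - {x}) \<le> card i" using IK[OF i] by (intro card_mono) auto
          then show "card (i - {x}) \<le> k" using IK[OF i] by simp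
        next
          fix i j assume ij: "i \<in> ?I" "j \<in> ?I" "i \<noteq> j"
          have "card ((i - {x}) \<inter> (j - {x})) \<le> card (i \<inter> j)" using IK[OF ij(1)] by (intro card_mono) auto
          also have "\<dots> \<le> l" using sc ij unfolding sparse_clique_def by blast
          finally show "card ((i - {x}) \<inter> (j - {x})) \<le> l" .
        next
          fix y assume "y \<in> ?U - {y \<in> ?U. dm < fdeg ?I y}"
          then have "y \<in> ?U" "fdeg ?I y \<le> dm" by auto
          then show "card {i \<in> ?I. y \<in> i - {x}} \<le> dm" by (simp only: degeq)
        next
          fix y assume "y \<in> ?U \<inter> {y \<in> ?U. dm < fdeg ?I y}"
          then have "y \<in> ?U" by auto
          then show "card {i \<in> ?I. y \<in> i - {x}} \<le> d2" using G(2) by (simp only: degeq) (simp add: popular_clique_def)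
        next
          show "card {y \<in> ?U. dm < fdeg ?I y} \<le> m1" using G(2) by (simp add: popular_clique_def)
        qed (use fI x in auto)
        also have "\<dots> \<le> ?N * (q ^ (d + card G) * EE (d + s) dm l * ?P)"
        proof (rule mult_mono)
          have "card ?U = n - 1" using x by simp
          moreover have "(n - 1) choose k \<le> n choose k" by (rule binomial_right_mono) simp
          ultimately show "real (card ?U choose k) \<le> ?N" by simp
          show "q ^ card ?I * exp (real (card ?I) * r * e0 / q + 2 * z0
             + pi' * r * inverse (q ^ dm) * (real (card ?I))\<^sup>2 * real l) * ?P \<le> q ^ (d + card G) * EE (d + s) dm l * ?P"
            using qr EE_ge[of "card ?I" "d + s" dm l] G cI P1 by (intro mult_right_mono) (auto intro!: mult_left_mono)
        qed (use qr P1 in auto)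
        finally show "real (card {b \<in> ?X - G. insert b G \<subseteq> ?X \<and> popular_clique l dm d2 m1 x (F0 \<union> insert b G)}) \<le> ?c * q ^ (d + card G)"
          by (simp add: mult_ac)
      next
        show "0 \<le> ?c * q ^ (d + i)" for i using qr EE_pos[of "d + s" dm l] P1 by simp
      qed auto
      moreover have "?GGf F0 = ?GG F0" by auto
      ultimately show ?thesis by simp
    qed
    let ?S = "Sigma ?T ?GG"
    let ?FF = "{F. F \<subseteq> ?K \<and> card F = d + s \<and> fdeg F x = d \<and> popular_clique l dm d2 m1 x F}"
    have fS: "finite ?S" using fT fG by (intro finite_SigmaI) auto
    have sub: "?FF \<subseteq> (\<lambda>(F0, G). F0 \<union> G) ` ?S"
    proof
      fix F assume F: "F \<in> ?FF"
      then have finF: "finite F" using finite_subset[of F ?K] by auto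
      let ?F0 = "{A \<in> F. x \<in> A}" and ?G = "{A \<in> F. x \<notin> A}"
      have Fe: "?F0 \<union> ?G = F" by auto
      have "card F = card ?F0 + card ?G" using finF by (subst Fe[symmetric], subst card_Un_disjoint) auto
      then have "card ?G = s" "card ?F0 = d" using F by (auto simp: fdeg_def)
      then have "(?F0, ?G) \<in> ?S" using F Fe by (auto simp: kstar_def)
      then show "F \<in> (\<lambda>(F0, G). F0 \<union> G) ` ?S" using Fe by (intro image_eqI[of _ _ "(?F0, ?G)"]) simp
    qed
    have "card ?FF \<le> card ?S" using card_mono[OF finite_imageI[OF fS] sub] card_image_le[OF fS] by (rule order_trans)
    also have "card ?S = (\<Sum>F0\<in>?T. card (?GG F0))" using fT fG by (intro card_SigmaI) auto
    finally have "real (card ?FF) \<le> real (\<Sum>F0\<in>?T. card (?GG F0))" by (rule of_nat_mono)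
    also have "\<dots> = (\<Sum>F0\<in>?T. real (card (?GG F0)))" by (rule of_nat_sum)
    also have "\<dots> \<le> (\<Sum>F0\<in>?T. (\<Prod>i<s. ?c * q ^ (d + i)) / fact s)" by (intro sum_mono cnt)
    also have "\<dots> = real (card (kstar n k x) choose d) * ((\<Prod>i<s. ?c * q ^ (d + i)) / fact s)"
      by (simp add: n_subsets)
    finally have cFF: "real (card ?FF) \<le> real (card (kstar n k x) choose d) * ((\<Prod>i<s. ?c * q ^ (d + i)) / fact s)" .
    have "Prs ?K p (\<lambda>H. \<exists>F\<subseteq>H. card F = d + s \<and> fdeg F x = d \<and> popular_clique l dm d2 m1 x F)
       \<le> Prs ?K p (\<lambda>H. \<exists>F\<in>?FF. F \<subseteq> H)" by (rule Prs_mono) auto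
    also have "\<dots> \<le> real (card ?FF) * p ^ (d + s)"
      by (rule Prs_exists_superset) (use p01 in \<open>auto intro: finite_subset[of _ "Pow ?K"]\<close>)
    also have "\<dots> \<le> (real (card (kstar n k x) choose d) * ((\<Prod>i<s. ?c * q ^ (d + i)) / fact s)) * p ^ (d + s)"
      using cFF p01 by (intro mult_right_mono) auto
    also have "\<dots> = (real (card (kstar n k x) choose d) * p ^ d) * (((\<Prod>i<s. ?c * q ^ (d + i)) / fact s) * p ^ s)"
      by (simp add: power_add)
    also have "\<dots> \<le> ((real (card (kstar n k x)) * p) ^ d / fact d) * (((\<Prod>i<s. ?c * q ^ (d + i)) / fact s) * p ^ s)"
      using p01 qr P1 EE_pos[of "d + s" dm l] by (intro mult_right_mono choose_mult_power_le mult_nonneg_nonneg divide_nonneg_nonneg prod_nonneg) auto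
    also have "((\<Prod>i<s. ?c * q ^ (d + i)) / fact s) * p ^ s = mbar n k p ^ s / fact s * q ^ (d * s) * q ^ (s choose 2) * (EE (d + s) dm l * ?P) ^ s"
      unfolding prod_power_lessThan using k_pos k_small by (simp add: mbar_eq power_mult_distrib mult_ac)
    finally show ?thesis using x k_pos by (simp add: card_kstar phi_def mult.commute)
  qed
  have "Prs ?K p (\<lambda>H. \<exists>x\<in>{1..n}. \<exists>F\<subseteq>H. card F = d + s \<and> fdeg F x = d \<and> popular_clique l dm d2 m1 x F)
    \<le> (\<Sum>x\<in>{1..n}. Prs ?K p (\<lambda>H. \<exists>F\<subseteq>H. card F = d + s \<and> fdeg F x = d \<and> popular_clique l dm d2 m1 x F))"
    by (rule Prs_Bex) auto
  also have "\<dots> \<le> (\<Sum>x\<in>{1..n}. phi n k p ^ d / fact d * (mbar n k p ^ s / fact s * q ^ (d * s) * q ^ (s choose 2) * (EE (d + s) dm l * ?P) ^ s))"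
    by (intro sum_mono each)
  finally show ?thesis by simp
qed

end

section \<open>Large cliques are close to stars\<close>

context meet_params
begin

text \<open>Take \<open>m1 + 1\<close> vertices of degree above \<open>dm\<close>. An edge
  containing \<open>c\<close> of them satisfies \<open>2 * c \<le> 2 + c * (c - 1)\<close>. Summed
  over the edges of \<open>F\<close>, the left side is at least
  \<open>2 * (m1 + 1) * (dm + 1)\<close>, while codegrees of at most 9 bound the right side by
  \<open>2 * t + 9 * (m1 + 1)^2\<close>, contrary to \<open>num\<close>.\<close>

lemma card_popular_le:
  assumes "finite F" "card F = t" "F \<subseteq> H" "finite H"
    and codeg: "\<And>x y. x \<in> {1..n} \<Longrightarrow> y \<in> {1..n} \<Longrightarrow> x \<noteq> y \<Longrightarrow> card {A \<in> H. x \<in> A \<and> y \<in> A} \<le> 9"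
    and num: "2 * t + 9 * (m1 + 1)\<^sup>2 < 2 * (m1 + 1) * (dm + 1)"
  shows "card {y \<in> {1..n} - {x}. dm < fdeg F y} \<le> m1"
proof (rule ccontr)
  assume "\<not> ?thesis"
  then have ge: "m1 + 1 \<le> card {y \<in> {1..n} - {x}. dm < fdeg F y}" by simp
  obtain Y where Y: "Y \<subseteq> {y \<in> {1..n} - {x}. dm < fdeg F y}" "card Y = m1 + 1" "finite Y"
    using obtain_subset_with_card_n[OF ge] by metis
  have "(m1 + 1) * (dm + 1) = (\<Sum>y\<in>Y. dm + 1)" using Y by simp
  also have "\<dots> \<le> (\<Sum>y\<in>Y. card {A \<in> F. A \<in> {A \<in> F. y \<in> A}})"
    using Y by (intro sum_mono) (auto simp: fdeg_def)
  also have "\<dots> = (\<Sum>y\<in>Y. card (F \<inter> {A \<in> F. y \<in> A}))" by (intro sum.cong refl arg_cong[where f = card]) auto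
  also have "\<dots> = (\<Sum>A\<in>F. card {y \<in> Y. A \<in> {A \<in> F. y \<in> A}})"
    by (rule sum_card_Collect[symmetric]) (use assms Y in auto)
  finally have 1: "(m1 + 1) * (dm + 1) \<le> (\<Sum>A\<in>F. card {y \<in> Y. A \<in> {A \<in> F. y \<in> A}})" .
  have 2: "(\<Sum>A\<in>F. card {y \<in> Y. A \<in> {A \<in> F. y \<in> A}} * (card {y \<in> Y. A \<in> {A \<in> F. y \<in> A}} - 1)) \<le> (card Y)\<^sup>2 * 9"
  proof (rule sum_degree_pairs)
    fix y z assume yz: "y \<in> Y" "z \<in> Y" "y \<noteq> z"
    have "card (F \<inter> ({A \<in> F. y \<in> A} \<inter> {A \<in> F. z \<in> A})) \<le> card {A \<in> H. y \<in> A \<and> z \<in> A}"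
      using assms by (intro card_mono) auto
    also have "\<dots> \<le> 9" using yz Y by (intro codeg) auto
    finally show "card (F \<inter> ({A \<in> F. y \<in> A} \<inter> {A \<in> F. z \<in> A})) \<le> 9" .
  qed (use assms Y in auto)
  have c: "2 * c \<le> 2 + c * (c - 1)" for c :: nat
  proof (cases c)
    case (Suc d)
    then show ?thesis by (cases d) auto
  qed simp
  have "2 * (\<Sum>A\<in>F. card {y \<in> Y. A \<in> {A \<in> F. y \<in> A}}) \<le>
     (\<Sum>A\<in>F. 2 + card {y \<in> Y. A \<in> {A \<in> F. y \<in> A}} * (card {y \<in> Y. A \<in> {A \<in> F. y \<in> A}} - 1))"
    unfolding sum_distrib_left by (intro sum_mono c)
  also have "\<dots> \<le> 2 * t + (m1 + 1)\<^sup>2 * 9"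
    unfolding sum.distrib using 2 assms(2) Y(2) by simp
  finally show False using 1 num by (simp add: algebra_simps)
qed

text \<open>In each subclique of size \<open>t\<close> the vertex of largest degree has degree above
  \<open>dh\<close>: smaller values are excluded by \<open>nogen\<close> and \<open>nopop\<close>.
  The latter applies because two degrees sum to at most \<open>t + 9\<close>, so every vertex but
  the largest has degree at most \<open>(t + 9) div 2\<close>. An exchange argument then carries the
  centre of one subclique over to all of \<open>F\<close>.\<close>

lemma structure_of_cliques:
  assumes H: "H \<subseteq> ksets n k"
    and pairs: "\<And>A B. A \<in> H \<Longrightarrow> B \<in> H \<Longrightarrow> A \<noteq> B \<Longrightarrow> card (A \<inter> B) \<le> l"
    and codeg: "\<And>x y. x \<in> {1..n} \<Longrightarrow> y \<in> {1..n} \<Longrightarrow> x \<noteq> y \<Longrightarrow> card {A \<in> H. x \<in> A \<and> y \<in> A} \<le> 9"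
    and nogen: "\<not> (\<exists>F\<subseteq>H. card F = t \<and> sparse_clique l F \<and> (\<forall>y\<in>{1..n}. fdeg F y \<le> dm))"
    and nopop: "\<And>d. dm < d \<Longrightarrow> d \<le> dh \<Longrightarrow>
       \<not> (\<exists>x\<in>{1..n}. \<exists>F\<subseteq>H. card F = d + (t - d) \<and> fdeg F x = d \<and> popular_clique l dm ((t + 9) div 2) m1 x F)"
    and num: "2 * t + 9 * (m1 + 1)\<^sup>2 < 2 * (m1 + 1) * (dm + 1)" "dh \<le> t" "t - dh + 9 \<le> dh"
    and F: "F \<subseteq> H" "clique F" "t \<le> card F"
  shows "\<exists>x\<in>{1..n}. card {A \<in> F. x \<notin> A} < t - dh"
proof -
  have finH: "finite H" using H finite_subset by blast
  have n0: "0 < n" using k_small by simp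
  have hi: "\<exists>x\<in>{1..n}. dh < fdeg F' x" if F': "F' \<subseteq> F" "card F' = t" for F'
  proof -
    have finF': "finite F'" using F' F finH finite_subset by metis
    have F'H: "F' \<subseteq> H" using F' F by auto
    have sc: "sparse_clique l F'"
    proof -
      have "clique F'" using F(2) F'(1) unfolding clique_def by (rule pairwise_subset)
      then show ?thesis using pairs F'H unfolding sparse_clique_def by (meson subsetD)
    qed
    have "Max (fdeg F' ` {1..n}) \<in> fdeg F' ` {1..n}" using n0 by (intro Max_in) auto
    then obtain x where x: "x \<in> {1..n}" "fdeg F' x = Max (fdeg F' ` {1..n})" by (metis imageE)
    have "\<exists>x\<in>{1..n}. \<forall>y\<in>{1..n}. fdeg F' y \<le> fdeg F' x"
      by (rule bexI[OF _ x(1)]) (auto simp: x(2))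
    then obtain x where x: "x \<in> {1..n}" "\<And>y. y \<in> {1..n} \<Longrightarrow> fdeg F' y \<le> fdeg F' x" by blast
    have "dm < fdeg F' x"
    proof (rule ccontr)
      assume "\<not> ?thesis"
      then have "\<forall>y\<in>{1..n}. fdeg F' y \<le> dm" using x(2) by (meson le_trans not_less)
      then show False using nogen F'H F' sc by blast
    qed
    moreover have "\<not> fdeg F' x \<le> dh"
    proof
      assume le: "fdeg F' x \<le> dh"
      have "fdeg F' y \<le> (t + 9) div 2" if y: "y \<in> {1..n} - {x}" for y
      proof -
        have "fdeg F' x + fdeg F' y = card ({A \<in> F'. x \<in> A} \<union> {A \<in> F'. y \<in> A}) + card ({A \<in> F'. x \<in> A} \<inter> {A \<in> F'. y \<in> A})"
          unfolding fdeg_def using finF' by (intro card_Un_Int) auto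
        moreover have "card ({A \<in> F'. x \<in> A} \<union> {A \<in> F'. y \<in> A}) \<le> t"
          using finF' F' by (metis (no_types, lifting) Un_subset_iff card_mono mem_Collect_eq subsetI)
        moreover have "card ({A \<in> F'. x \<in> A} \<inter> {A \<in> F'. y \<in> A}) \<le> card {A \<in> H. x \<in> A \<and> y \<in> A}"
          using finH F'H by (intro card_mono) auto
        moreover have "card {A \<in> H. x \<in> A \<and> y \<in> A} \<le> 9" using codeg x y by auto
        moreover have "fdeg F' y \<le> fdeg F' x" using x(2) y by auto
        ultimately show ?thesis by linarith
      qed
      moreover have "card {y \<in> {1..n} - {x}. dm < fdeg F' y} \<le> m1"
        by (rule card_popular_le[OF finF' F'(2) F'H finH codeg num(1)])
      ultimately have "popular_clique l dm ((t + 9) div 2) m1 x F'" using sc unfolding popular_clique_def by blast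
      moreover have "card F' = fdeg F' x + (t - fdeg F' x)" using le num F' by simp
      ultimately show False using nopop[OF \<open>dm < fdeg F' x\<close> le] x(1) F'H by blast
    qed
    ultimately show ?thesis using x by (meson not_le)
  qed
  have finF: "finite F" using F finH finite_subset by metis
  obtain F1 where F1: "F1 \<subseteq> F" "card F1 = t" using obtain_subset_with_card_n[OF F(3)] by blast
  obtain x where x: "x \<in> {1..n}" "dh < fdeg F1 x" using hi[OF F1] by blast
  show ?thesis
  proof (rule bexI[OF _ x(1)], rule ccontr)
    assume "\<not> card {A \<in> F. x \<notin> A} < t - dh"
    then have ge: "t - dh \<le> card {A \<in> F. x \<notin> A}" by simp
    \<comment> \<open>Combine \<open>t - dh\<close> members missing \<open>x\<close> with exactly
      \<open>dh\<close> members through \<open>x\<close>. Some \<open>z\<close> has degree above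
      \<open>dh\<close> in this subclique, so \<open>z\<close> differs from \<open>x\<close>; but
      then the codegree bound limits its degree to \<open>t - dh + 9\<close>, which is at most
      \<open>dh\<close>.\<close>
    obtain G where G: "G \<subseteq> {A \<in> F. x \<notin> A}" "card G = t - dh"
      using obtain_subset_with_card_n[OF ge] by metis
    obtain S where S: "S \<subseteq> {A \<in> F1. x \<in> A}" "card S = dh"
      using obtain_subset_with_card_n[OF less_imp_le[OF x(2)[unfolded fdeg_def]]] by metis
    have fin: "finite G" "finite S" using G S F1 finF by (auto intro: finite_subset)
    have c: "card (G \<union> S) = t" using G S fin num by (subst card_Un_disjoint) auto
    obtain z where z: "z \<in> {1..n}" "dh < fdeg (G \<union> S) z" using hi[of "G \<union> S"] G S F1 c by blast
    have "{A \<in> G \<union> S. x \<in> A} = S" using G S by auto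
    then have "z \<noteq> x" using z S by (auto simp: fdeg_def)
    have "{A \<in> G \<union> S. z \<in> A} \<subseteq> G \<union> {A \<in> H. x \<in> A \<and> z \<in> A}" using S F1 F by auto
    then have "fdeg (G \<union> S) z \<le> card (G \<union> {A \<in> H. x \<in> A \<and> z \<in> A})"
      unfolding fdeg_def using fin finH by (intro card_mono) auto
    also have "\<dots> \<le> card G + card {A \<in> H. x \<in> A \<and> z \<in> A}" by (rule card_Un_le)
    also have "\<dots> \<le> t - dh + 9" using codeg[of x z] x z \<open>z \<noteq> x\<close> G by simp
    finally show False using z num by linarith
  qed
qed

end

section \<open>Near-stars against full stars\<close>

lemma binomial_le_power_mult:
  assumes "e \<le> D" "0 < D"
  shows "real (e choose m) \<le> (real e / real D) ^ m * real (D choose m)"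
proof (cases "m \<le> e")
  case True
  then have mD: "m \<le> D" using assms by simp
  have "real (e choose m) = (\<Prod>i = 0..<m. real (e - i) / real (m - i))" by (rule binomial_altdef_of_nat[OF True])
  also have "\<dots> \<le> (\<Prod>i = 0..<m. (real e / real D) * (real (D - i) / real (m - i)))"
  proof (intro prod_mono conjI)
    fix i assume i: "i \<in> {0..<m}"
    have "real (e - i) * real D \<le> real e * real (D - i)"
    proof -
      have "real i * real e \<le> real i * real D" using assms by (intro mult_left_mono) auto
      then show ?thesis using i True mD by (simp add: of_nat_diff algebra_simps)
    qed
    then have "real (e - i) \<le> real e / real D * real (D - i)" using assms by (simp add: field_simps)
    then show "real (e - i) / real (m - i) \<le> (real e / real D) * (real (D - i) / real (m - i))"
      by (metis divide_right_mono of_nat_0_le_iff times_divide_eq_right)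
  qed auto
  also have "\<dots> = (real e / real D) ^ m * real (D choose m)"
    by (simp only: prod.distrib binomial_altdef_of_nat[OF mD, symmetric]) simp
  finally show ?thesis .
qed (simp add: binomial_eq_0)

lemma binomial_mult_le:
  assumes "s \<le> j" "j \<le> D"
  shows "real (D choose (j - s)) * real ((D - (j - s)) choose s) \<le> real (D choose j) * real j ^ s"
proof -
  have "(D choose j) * (j choose (j - s)) = (D choose (j - s)) * ((D - (j - s)) choose (j - (j - s)))"
    using assms by (intro choose_mult) auto
  then have "(D choose (j - s)) * ((D - (j - s)) choose s) = (D choose j) * (j choose s)"
    using assms binomial_symmetric[of s j] by simp
  then have "real (D choose (j - s)) * real ((D - (j - s)) choose s) = real (D choose j) * real (j choose s)"
    by (metis of_nat_mult)
  also have "real (j choose s) \<le> real j ^ s" using binomial_le_pow[OF assms(1)] by (metis of_nat_mono of_nat_power)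
  finally show ?thesis by (simp add: mult_left_mono)
qed

text \<open>Such a set contains \<open>j - s\<close> elements outside \<open>Mi\<close>; these are
  chosen first and the other \<open>s\<close> arbitrarily. The overcount is at most
  \<open>j ^ s\<close>, harmless against the power \<open>j - s\<close> of the density.\<close>

lemma card_few_in_part:
  assumes "finite S" "Mi \<subseteq> S" "s \<le> j" "j \<le> card S" "0 < card S"
  shows "real (card {A. A \<subseteq> S \<and> card A = j \<and> card (A \<inter> Mi) \<le> s})
    \<le> real (card S choose j) * (real j ^ s * (real (card (S - Mi)) / real (card S)) ^ (j - s))"
proof -
  let ?D = "card S" and ?m = "j - s"
  let ?B = "{B. B \<subseteq> S - Mi \<and> card B = ?m}"
  let ?C = "\<lambda>B. {C. C \<subseteq> S - B \<and> card C = s}"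
  let ?P = "Sigma ?B ?C"
  have fB: "finite ?B" using assms by auto
  have fC: "finite (?C B)" for B using assms by auto
  have fP: "finite ?P" using fB fC by (rule finite_SigmaI)
  have "{A. A \<subseteq> S \<and> card A = j \<and> card (A \<inter> Mi) \<le> s} \<subseteq> (\<lambda>(B, C). B \<union> C) ` ?P"
  proof
    fix A assume "A \<in> {A. A \<subseteq> S \<and> card A = j \<and> card (A \<inter> Mi) \<le> s}"
    then have A: "A \<subseteq> S" "card A = j" "card (A \<inter> Mi) \<le> s" by auto
    have fA: "finite A" using A assms finite_subset by auto
    have "card A = card (A \<inter> Mi) + card (A - Mi)" by (rule card_Int_Diff[OF fA])
    then have "?m \<le> card (A - Mi)" using A by simp
    then obtain B where B: "B \<subseteq> A - Mi" "card B = ?m" using obtain_subset_with_card_n by metis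
    have "card (A - B) = s" using B fA A assms by (subst card_Diff_subset) (auto intro: finite_subset[of B A])
    then have "(B, A - B) \<in> ?P" using A B by auto
    moreover have "B \<union> (A - B) = A" using B by auto
    ultimately show "A \<in> (\<lambda>(B, C). B \<union> C) ` ?P" by (intro image_eqI[of _ _ "(B, A - B)"]) auto
  qed
  then have "card {A. A \<subseteq> S \<and> card A = j \<and> card (A \<inter> Mi) \<le> s} \<le> card ((\<lambda>(B, C). B \<union> C) ` ?P)"
    by (rule card_mono[OF finite_imageI[OF fP]])
  also have "\<dots> \<le> card ?P" by (rule card_image_le[OF fP])
  also have "card ?P = (\<Sum>B\<in>?B. card (?C B))" using fB fC by (intro card_SigmaI) auto
  also have "\<dots> = (\<Sum>B\<in>?B. (?D - ?m) choose s)"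
  proof (intro sum.cong refl)
    fix B assume B: "B \<in> ?B"
    then have "finite B" "B \<subseteq> S" using assms by (auto intro: finite_subset[of B S])
    then have "card (S - B) = ?D - ?m" using B by (simp add: card_Diff_subset)
    then show "card (?C B) = (?D - ?m) choose s" using assms n_subsets[of "S - B" s] by simp
  qed
  also have "\<dots> = (card (S - Mi) choose ?m) * ((?D - ?m) choose s)" using assms by (simp add: n_subsets)
  finally have "real (card {A. A \<subseteq> S \<and> card A = j \<and> card (A \<inter> Mi) \<le> s}) \<le> real ((card (S - Mi) choose ?m) * ((?D - ?m) choose s))"
    by (rule of_nat_mono)
  also have "\<dots> = real (card (S - Mi) choose ?m) * real ((?D - ?m) choose s)" by simp
  also have "\<dots> \<le> ((real (card (S - Mi)) / real ?D) ^ ?m * real (?D choose ?m)) * real ((?D - ?m) choose s)"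
    using assms by (intro mult_right_mono binomial_le_power_mult card_mono) auto
  also have "\<dots> = (real (card (S - Mi)) / real ?D) ^ ?m * (real (?D choose ?m) * real ((?D - ?m) choose s))" by simp
  also have "\<dots> \<le> (real (card (S - Mi)) / real ?D) ^ ?m * (real (?D choose j) * real j ^ s)"
    using assms by (intro mult_left_mono binomial_mult_le) auto
  finally show ?thesis by (simp add: mult_ac)
qed

definition btail :: "nat \<Rightarrow> real \<Rightarrow> nat \<Rightarrow> real" where
  "btail N p j = measure_pmf.prob (binomial_pmf N p) {j..}"

lemma Prs_card_ge: "finite U \<Longrightarrow> 0 \<le> p \<Longrightarrow> p \<le> 1 \<Longrightarrow> Prs U p (\<lambda>H. j \<le> card H) = btail (card U) p j"
  by (simp add: Prs_card_binomial[where P = "\<lambda>i. j \<le> i"] btail_def atLeast_def)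

lemma btail_Suc: "btail N p j = pmf (binomial_pmf N p) j + btail N p (Suc j)"
proof -
  have "{j..} = {j} \<union> {Suc j..}" by auto
  then have "btail N p j = measure_pmf.prob (binomial_pmf N p) ({j} \<union> {Suc j..})" by (simp add: btail_def)
  also have "\<dots> = pmf (binomial_pmf N p) j + btail N p (Suc j)"
    unfolding btail_def by (subst measure_pmf.finite_measure_Union) (auto simp: measure_pmf_single)
  finally show ?thesis .
qed

lemma btail_nonneg [simp]: "0 \<le> btail N p j" by (simp add: btail_def)

text \<open>Consecutive point probabilities have ratio at most
  \<open>(j + 1) / ((N - j) * p)\<close>, and a point probability is at most the tail. Lowering the
  threshold near the mean thus costs only a bounded factor.\<close>

lemma btail_ratio:
  assumes "0 < p" "p \<le> 1" "j < N"
  shows "btail N p j \<le> (1 + real (Suc j) / (real (N - j) * p)) * btail N p (Suc j)"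
proof -
  let ?b = "pmf (binomial_pmf N p)"
  have "Suc j * (N choose Suc j) = (N - j) * (N choose j)" by (simp only: binomial_absorb_comp binomial_absorption)
  then have ch: "real (N choose j) * real (N - j) = real (Suc j) * real (N choose Suc j)" by (metis mult.commute of_nat_mult)
  have Nj: "N - j = Suc (N - Suc j)" using assms by simp
  have "?b j * (real (N - j) * p) = real (N choose j) * real (N - j) * (p ^ Suc j * (1 - p) ^ (N - j))"
    using assms by simp
  also have "\<dots> = real (Suc j) * ?b (Suc j) * (1 - p)"
    unfolding ch using assms by (subst Nj) (simp del: of_nat_Suc)
  also have "\<dots> \<le> real (Suc j) * ?b (Suc j) * 1" using assms by (intro mult_left_mono) auto
  also have "\<dots> \<le> real (Suc j) * btail N p (Suc j)"
    using btail_Suc[of N p "Suc j"] by (simp add: mult_left_mono)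
  finally have "?b j * (real (N - j) * p) \<le> real (Suc j) * btail N p (Suc j)" .
  then have "?b j \<le> real (Suc j) * btail N p (Suc j) / (real (N - j) * p)"
    using assms by (simp add: pos_le_divide_eq del: of_nat_Suc)
  then show ?thesis using btail_Suc[of N p j] by (simp add: distrib_right del: of_nat_Suc)
qed

lemma btail_ratio_power:
  assumes "0 < p" "p \<le> 1" "T \<le> N" "c \<le> T" "1 + real T / (real (N - T) * p) \<le> R" "T < N"
  shows "btail N p (T - c) \<le> R ^ c * btail N p T"
  using assms(4)
proof (induction c)
  case (Suc c)
  have "btail N p (T - Suc c) \<le> (1 + real (Suc (T - Suc c)) / (real (N - (T - Suc c)) * p)) * btail N p (Suc (T - Suc c))"
    by (rule btail_ratio) (use assms Suc in auto)
  also have "\<dots> \<le> R * btail N p (Suc (T - Suc c))"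
  proof (intro mult_right_mono btail_nonneg)
    have "real (Suc (T - Suc c)) / (real (N - (T - Suc c)) * p) \<le> real T / (real (N - T) * p)"
      using assms Suc by (intro frac_le mult_right_mono mult_pos_pos) auto
    then show "1 + real (Suc (T - Suc c)) / (real (N - (T - Suc c)) * p) \<le> R" using assms by linarith
  qed
  also have "Suc (T - Suc c) = T - c" using Suc by simp
  also have "R * btail N p (T - c) \<le> R * (R ^ c * btail N p T)"
  proof (rule mult_left_mono)
    have "0 \<le> real T / (real (N - T) * p)" using assms by simp
    then show "0 \<le> R" using assms by linarith
  qed (use Suc in auto)
  finally show ?case by simp
qed simp

text \<open>If \<open>G\<close> avoids \<open>x\<close>, these are the potential edges at
  \<open>x\<close> that no clique containing \<open>G\<close> can use.\<close>

definition miss :: "nat \<Rightarrow> nat \<Rightarrow> nat \<Rightarrow> nat set set \<Rightarrow> nat set set" where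
  "miss n k x G = {A \<in> kstar n k x. \<exists>B\<in>G. A \<inter> B = {}}"

lemma miss_subset: "miss n k x G \<subseteq> kstar n k x" by (auto simp: miss_def)

context meet_params
begin

text \<open>Deleting \<open>x\<close> leaves \<open>(k - 1)\<close>-subsets of the other vertices
  that meet every member of \<open>G\<close>, which \<open>count_meet_le\<close> counts with
  \<open>s\<close> as the obvious bound on all degrees.\<close>

lemma card_star_meet:
  assumes x: "x \<in> {1..n}" and G: "G \<subseteq> ksets n k" "\<And>A. A \<in> G \<Longrightarrow> x \<notin> A" "card G = s"
    and pairs: "\<And>A B. A \<in> G \<Longrightarrow> B \<in> G \<Longrightarrow> A \<noteq> B \<Longrightarrow> card (A \<inter> B) \<le> l"
  shows "real (card (kstar n k x - miss n k x G)) \<le> real ((n - 1) choose (k - 1)) * (q ^ s * EE s s l)"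
proof -
  let ?U = "{1..n} - {x}"
  let ?M = "{A. A \<subseteq> ?U \<and> card A = k - 1 \<and> (\<forall>i\<in>G. A \<inter> id i \<noteq> {})}"
  have finG: "finite G" using G finite_subset by blast
  have cU: "card ?U = n - 1" using x by simp
  have "card (kstar n k x - miss n k x G) \<le> card ?M"
  proof (rule card_inj_on_le)
    show "inj_on (\<lambda>A. A - {x}) (kstar n k x - miss n k x G)"
    proof (rule inj_onI)
      fix A B assume "A \<in> kstar n k x - miss n k x G" "B \<in> kstar n k x - miss n k x G" "A - {x} = B - {x}"
      then show "A = B" by (auto simp: kstar_def)
    qed
    show "(\<lambda>A. A - {x}) ` (kstar n k x - miss n k x G) \<subseteq> ?M"
    proof
      fix C assume "C \<in> (\<lambda>A. A - {x}) ` (kstar n k x - miss n k x G)"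
      then obtain A where A: "C = A - {x}" "A \<in> kstar n k x" "A \<notin> miss n k x G" by auto
      then have AK: "A \<subseteq> {1..n}" "card A = k" "finite A" "x \<in> A" using ksetsD[of A n k] by (auto simp: kstar_def)
      have "C \<inter> B \<noteq> {}" if "B \<in> G" for B
      proof -
        have "A \<inter> B \<noteq> {}" using A that by (auto simp: miss_def)
        then show ?thesis using G(2)[OF that] A by auto
      qed
      then show "C \<in> ?M" using A AK by auto
    qed
    show "finite ?M" by (auto intro: finite_subset[of _ "Pow {1..n}"])
  qed
  then have "real (card (kstar n k x - miss n k x G)) \<le> real (card ?M)" by (rule of_nat_mono)
  also have "\<dots> \<le> real (card ?U choose (k - 1)) * (q ^ card G * exp (real (card G) * r * e0 / q + 2 * z0
       + pi' * r * inverse (q ^ s) * (real (card G))\<^sup>2 * real l) * (1 + pi' * inverse (q ^ 0)) ^ 0)"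
  proof (rule count_meet_le[where Y = "{}"])
    fix i assume i: "i \<in> G"
    then show "id i \<subseteq> ?U" "card (id i) \<le> k" using G(1) G(2)[OF i] ksetsD[of i n k] by auto
  next
    fix i j assume "i \<in> G" "j \<in> G" "i \<noteq> j"
    then show "card (id i \<inter> id j) \<le> l" using pairs by simp
  next
    show "card {i \<in> G. y \<in> id i} \<le> s" for y using finG G(3) card_mono[of G "{i \<in> G. y \<in> id i}"] by auto
  qed (use finG x in auto)
  also have "\<dots> = real ((n - 1) choose (k - 1)) * (q ^ s * EE s s l)" using cU G(3) by (simp add: EE_def)
  finally show ?thesis .
qed

text \<open>The event is the one forced by a clique with \<open>s\<close> members \<open>G\<close>
  off its centre \<open>x\<close> that is at least as large as the star of \<open>x\<close>: the
  clique uses no edge of \<open>miss n k x G\<close>, so \<open>H\<close> has at most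
  \<open>s\<close> of those. Hence all but \<open>s\<close> edges at \<open>x\<close> meet every
  member of \<open>G\<close>, each at cost about \<open>q ^ s\<close>. The edges of \<open>G\<close>
  lie outside the star and are independent of it.\<close>

lemma prob_near_star:
  assumes p01: "0 \<le> p" "p \<le> 1" and sT: "2 * s \<le> T"
  shows "Prs (ksets n k) p (\<lambda>H. \<exists>x\<in>{1..n}. \<exists>G\<subseteq>H. card G = s \<and> (\<forall>A\<in>G. x \<notin> A) \<and>
      (\<forall>A\<in>G. \<forall>B\<in>G. A \<noteq> B \<longrightarrow> card (A \<inter> B) \<le> l) \<and> card (H \<inter> miss n k x G) \<le> s \<and>
      T \<le> card (H \<inter> kstar n k x) + s \<and> card (H \<inter> kstar n k x) \<le> J)
    \<le> real n * (mbar n k p ^ s / fact s * (real J ^ s * (q ^ s * EE s s l) ^ (T - 2 * s) * btail ((n - 1) choose (k - 1)) p (T - s)))"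
proof -
  let ?K = "ksets n k" and ?N = "real (n choose k)" and ?D = "(n - 1) choose (k - 1)"
  let ?rho = "q ^ s * EE s s l"
  let ?b = "real J ^ s * ?rho ^ (T - 2 * s) * btail ?D p (T - s)"
  have D0: "0 < ?D" using k_pos k_small by simp
  have rho0: "0 \<le> ?rho" using qr EE_pos[of s s l] by simp
  let ?E = "\<lambda>x G H. G \<subseteq> H \<and> card (H \<inter> miss n k x G) \<le> s \<and> T \<le> card (H \<inter> kstar n k x) + s \<and> card (H \<inter> kstar n k x) \<le> J"
  let ?GG = "\<lambda>x. {G. G \<subseteq> ?K - kstar n k x \<and> card G = s \<and> (\<forall>A\<in>G. \<forall>B\<in>G. A \<noteq> B \<longrightarrow> card (A \<inter> B) \<le> l)}"
  have fGG: "finite (?GG x)" for x by (auto intro: finite_subset[of _ "Pow ?K"])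
  have one: "Prs ?K p (?E x G) \<le> p ^ s * ?b" if x: "x \<in> {1..n}" and G: "G \<in> ?GG x" for x G
  proof -
    let ?S = "kstar n k x" and ?Mi = "miss n k x G"
    have cS: "card ?S = ?D" using x k_pos by (simp add: card_kstar)
    have Gx: "G \<subseteq> ?K" "\<And>A. A \<in> G \<Longrightarrow> x \<notin> A" "card G = s" using G by (auto simp: kstar_def)
    let ?R = "\<lambda>X. card (X \<inter> ?Mi) \<le> s \<and> T \<le> card X + s \<and> card X \<le> J"
    have eq: "H \<inter> ?S \<inter> ?Mi = H \<inter> ?Mi" for H using miss_subset[of n k x G] by auto
    have "Prs ?K p (?E x G) = Prs ?K p (\<lambda>H. G \<subseteq> H \<inter> (?K - ?S) \<and> ?R (H \<inter> ?S))"
      unfolding eq using G by (intro Prs_cong) auto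
    also have "\<dots> = Prs (?K - ?S) p (\<lambda>X. G \<subseteq> X) * Prs ?S p ?R"
      by (rule Prs_indep) (use kstar_subset in auto)
    also have "Prs (?K - ?S) p (\<lambda>X. G \<subseteq> X) = p ^ s"
      using G p01 by (subst Prs_superset) auto
    also have "Prs ?S p ?R \<le> ?b"
    proof -
      have "Prs ?S p ?R \<le> Prs ?S p (\<lambda>X. \<exists>j\<in>{T - s..min J ?D}. card X = j \<and> card (X \<inter> ?Mi) \<le> s)"
      proof (rule Prs_mono)
        fix X assume X: "X \<subseteq> ?S" "?R X"
        then have "card X \<le> ?D" using card_mono[of ?S X] cS by simp
        then show "\<exists>j\<in>{T - s..min J ?D}. card X = j \<and> card (X \<inter> ?Mi) \<le> s" using X by auto
      qed
      also have "\<dots> \<le> (\<Sum>j\<in>{T - s..min J ?D}. Prs ?S p (\<lambda>X. card X = j \<and> card (X \<inter> ?Mi) \<le> s))"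
        by (rule Prs_Bex) auto
      also have "\<dots> \<le> (\<Sum>j\<in>{T - s..min J ?D}. pmf (binomial_pmf ?D p) j * (real J ^ s * ?rho ^ (T - 2 * s)))"
      proof (rule sum_mono)
        fix j assume j: "j \<in> {T - s..min J ?D}"
        let ?e = "real (card (?S - ?Mi)) / real (card ?S)"
        have e1: "?e \<le> 1" using cS D0 card_mono[of ?S "?S - ?Mi"] by (simp add: field_simps)
        have e2: "?e \<le> ?rho"
          using card_star_meet[OF x Gx, of l] G cS D0 by (simp add: field_simps)
        have "Prs ?S p (\<lambda>X. card X = j \<and> card (X \<inter> ?Mi) \<le> s) = real (card {A. A \<subseteq> ?S \<and> card A = j \<and> card (A \<inter> ?Mi) \<le> s}) * p ^ j * (1 - p) ^ (card ?S - j)"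
          by (rule Prs_card_and) (use p01 in auto)
        also have "\<dots> \<le> (real (card ?S choose j) * (real j ^ s * ?e ^ (j - s))) * p ^ j * (1 - p) ^ (card ?S - j)"
          using p01 j sT cS D0 miss_subset[of n k x G] by (intro mult_right_mono card_few_in_part) auto
        also have "\<dots> = pmf (binomial_pmf ?D p) j * (real j ^ s * ?e ^ (j - s))"
          using p01 cS by (simp add: mult_ac)
        also have "\<dots> \<le> pmf (binomial_pmf ?D p) j * (real J ^ s * ?rho ^ (T - 2 * s))"
        proof (intro mult_left_mono mult_mono power_mono)
          have "?e ^ (j - s) \<le> ?e ^ (T - 2 * s)" using e1 j by (intro power_decreasing) auto
          also have "\<dots> \<le> ?rho ^ (T - 2 * s)" using e2 by (intro power_mono) auto
          finally show "?e ^ (j - s) \<le> ?rho ^ (T - 2 * s)" .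
        qed (use j in auto)
        finally show "Prs ?S p (\<lambda>X. card X = j \<and> card (X \<inter> ?Mi) \<le> s) \<le> pmf (binomial_pmf ?D p) j * (real J ^ s * ?rho ^ (T - 2 * s))" .
      qed
      also have "\<dots> = (\<Sum>j\<in>{T - s..min J ?D}. pmf (binomial_pmf ?D p) j) * (real J ^ s * ?rho ^ (T - 2 * s))"
        by (simp add: sum_distrib_right)
      also have "\<dots> \<le> btail ?D p (T - s) * (real J ^ s * ?rho ^ (T - 2 * s))"
      proof (rule mult_right_mono)
        have "(\<Sum>j\<in>{T - s..min J ?D}. pmf (binomial_pmf ?D p) j) = measure_pmf.prob (binomial_pmf ?D p) {T - s..min J ?D}"
          by (simp add: measure_measure_pmf_finite)
        also have "\<dots> \<le> btail ?D p (T - s)" unfolding btail_def by (intro measure_pmf.finite_measure_mono) auto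
        finally show "(\<Sum>j\<in>{T - s..min J ?D}. pmf (binomial_pmf ?D p) j) \<le> btail ?D p (T - s)" .
      qed (use rho0 in auto)
      finally show ?thesis by (simp add: mult_ac)
    qed
    finally show ?thesis using p01 by (simp add: mult_left_mono)
  qed
  have "Prs ?K p (\<lambda>H. \<exists>x\<in>{1..n}. \<exists>G\<subseteq>H. card G = s \<and> (\<forall>A\<in>G. x \<notin> A) \<and>
      (\<forall>A\<in>G. \<forall>B\<in>G. A \<noteq> B \<longrightarrow> card (A \<inter> B) \<le> l) \<and> card (H \<inter> miss n k x G) \<le> s \<and>
      T \<le> card (H \<inter> kstar n k x) + s \<and> card (H \<inter> kstar n k x) \<le> J)
     \<le> Prs ?K p (\<lambda>H. \<exists>x\<in>{1..n}. \<exists>G\<in>?GG x. ?E x G H)"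
  proof (rule Prs_mono)
    fix H assume H: "H \<subseteq> ?K" and "\<exists>x\<in>{1..n}. \<exists>G\<subseteq>H. card G = s \<and> (\<forall>A\<in>G. x \<notin> A) \<and>
      (\<forall>A\<in>G. \<forall>B\<in>G. A \<noteq> B \<longrightarrow> card (A \<inter> B) \<le> l) \<and> card (H \<inter> miss n k x G) \<le> s \<and>
      T \<le> card (H \<inter> kstar n k x) + s \<and> card (H \<inter> kstar n k x) \<le> J"
    then obtain x G where xG: "x \<in> {1..n}" "G \<subseteq> H" "card G = s" "\<forall>A\<in>G. x \<notin> A"
      "\<forall>A\<in>G. \<forall>B\<in>G. A \<noteq> B \<longrightarrow> card (A \<inter> B) \<le> l" "?E x G H" by blast
    have "G \<in> ?GG x" using xG H by (auto simp: kstar_def)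
    then show "\<exists>x\<in>{1..n}. \<exists>G\<in>?GG x. ?E x G H" using xG(1,6) by blast
  qed
  also have "\<dots> \<le> (\<Sum>x\<in>{1..n}. Prs ?K p (\<lambda>H. \<exists>G\<in>?GG x. ?E x G H))" by (rule Prs_Bex) auto
  also have "\<dots> \<le> (\<Sum>x\<in>{1..n}. mbar n k p ^ s / fact s * ?b)"
  proof (rule sum_mono)
    fix x assume x: "x \<in> {1..n}"
    have "Prs ?K p (\<lambda>H. \<exists>G\<in>?GG x. ?E x G H) \<le> (\<Sum>G\<in>?GG x. Prs ?K p (?E x G))" by (rule Prs_Bex[OF fGG])
    also have "\<dots> \<le> (\<Sum>G\<in>?GG x. p ^ s * ?b)" by (intro sum_mono one x)
    also have "\<dots> = (real (card (?GG x)) * p ^ s) * ?b" by simp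
    also have "\<dots> \<le> (mbar n k p ^ s / fact s) * ?b"
    proof (rule mult_right_mono)
      have "card (?GG x) \<le> card {G. G \<subseteq> ?K \<and> card G = s}" by (intro card_mono) auto
      then have "real (card (?GG x)) \<le> real ((n choose k) choose s)" by (simp add: n_subsets card_ksets)
      then have "real (card (?GG x)) * p ^ s \<le> real ((n choose k) choose s) * p ^ s" using p01 by (intro mult_right_mono) auto
      also have "\<dots> \<le> (?N * p) ^ s / fact s" using p01 by (intro choose_mult_power_le)
      finally show "real (card (?GG x)) * p ^ s \<le> mbar n k p ^ s / fact s" using k_pos k_small by (simp add: mbar_eq mult.commute)
    qed (use rho0 in auto)
    finally show "Prs ?K p (\<lambda>H. \<exists>G\<in>?GG x. ?E x G H) \<le> mbar n k p ^ s / fact s * ?b" .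
  qed
  finally show ?thesis by simp
qed

end

section \<open>Second moment for the maximum degree\<close>

lemma chebyshev_none:
  assumes "finite U" "finite V" and tau: "\<And>x. x \<in> V \<Longrightarrow> Prs U p (Z x) = tau" "0 < tau" "V \<noteq> {}"
    and pair: "\<And>x y. x \<in> V \<Longrightarrow> y \<in> V \<Longrightarrow> x \<noteq> y \<Longrightarrow> Prs U p (\<lambda>H. Z x H \<and> Z y H) \<le> tau\<^sup>2 * (1 + w)" "0 \<le> w"
  shows "Prs U p (\<lambda>H. \<forall>x\<in>V. \<not> Z x H) \<le> 1 / (real (card V) * tau) + w"
proof -
  let ?E = "measure_pmf.expectation (rsub U p)"
  let ?I = "\<lambda>x. indicator {H. Z x H} :: _ \<Rightarrow> real"
  let ?S = "\<lambda>H. \<Sum>x\<in>V. ?I x H"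
  let ?v = "real (card V)"
  define mu where "mu = ?v * tau"
  have v0: "0 < ?v" using assms by (simp add: card_gt_0_iff)
  have mu0: "0 < mu" using v0 tau by (simp add: mu_def)
  have ES: "?E ?S = mu" using assms by (simp add: mu_def)
  have ES2: "?E (\<lambda>H. (?S H)\<^sup>2) = (\<Sum>x\<in>V. \<Sum>y\<in>V. Prs U p (\<lambda>H. Z x H \<and> Z y H))"
  proof -
    have "(\<lambda>H. (?S H)\<^sup>2) = (\<lambda>H. \<Sum>x\<in>V. \<Sum>y\<in>V. indicator {H. Z x H \<and> Z y H} H)"
      by (intro ext) (auto simp: power2_eq_square sum_product indicator_def intro!: sum.cong)
    then show ?thesis using assms by simp
  qed
  have "(\<Sum>x\<in>V. \<Sum>y\<in>V. Prs U p (\<lambda>H. Z x H \<and> Z y H)) \<le> (\<Sum>x\<in>V. \<Sum>y\<in>V. (if x = y then tau else 0) + tau\<^sup>2 * (1 + w))"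
  proof (intro sum_mono)
    fix x y assume xy: "x \<in> V" "y \<in> V"
    show "Prs U p (\<lambda>H. Z x H \<and> Z y H) \<le> (if x = y then tau else 0) + tau\<^sup>2 * (1 + w)"
    proof (cases "x = y")
      case True
      then have "Prs U p (\<lambda>H. Z x H \<and> Z y H) = tau" using tau xy by simp
      then show ?thesis using True pair(2) by simp
    qed (use pair xy in auto)
  qed
  also have "\<dots> = ?v * tau + ?v\<^sup>2 * (tau\<^sup>2 * (1 + w))"
    using assms(2) by (simp add: sum.distrib power2_eq_square algebra_simps)
  finally have E2: "?E (\<lambda>H. (?S H)\<^sup>2) \<le> mu + mu\<^sup>2 * (1 + w)" unfolding ES2 by (simp add: mu_def power_mult_distrib)
  have "mu\<^sup>2 * Prs U p (\<lambda>H. \<forall>x\<in>V. \<not> Z x H) = ?E (\<lambda>H. mu\<^sup>2 * indicator {H. \<forall>x\<in>V. \<not> Z x H} H)" by simp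
  also have "\<dots> \<le> ?E (\<lambda>H. (?S H - mu)\<^sup>2)"
  proof (intro integral_mono)
    fix H show "mu\<^sup>2 * indicator {H. \<forall>x\<in>V. \<not> Z x H} H \<le> (?S H - mu)\<^sup>2"
    proof (cases "\<forall>x\<in>V. \<not> Z x H")
      case True
      then have "?S H = 0" by (intro sum.neutral) auto
      then show ?thesis using True by simp
    qed (use mu0 in auto)
  qed (use assms in auto)
  also have "(\<lambda>H. (?S H - mu)\<^sup>2) = (\<lambda>H. (?S H)\<^sup>2 - 2 * mu * ?S H + mu\<^sup>2)" by (intro ext) (simp add: power2_diff algebra_simps)
  also have "?E \<dots> = ?E (\<lambda>H. (?S H)\<^sup>2) - 2 * mu * ?E ?S + mu\<^sup>2" using assms by simp
  also have "\<dots> \<le> mu + mu\<^sup>2 * w" using E2 ES by (simp add: power2_eq_square algebra_simps)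
  finally have "Prs U p (\<lambda>H. \<forall>x\<in>V. \<not> Z x H) \<le> (mu + mu\<^sup>2 * w) / mu\<^sup>2" using mu0 by (simp add: pos_le_divide_eq mult.commute)
  also have "\<dots> = 1 / mu + w" using mu0 by (simp add: add_divide_distrib power2_eq_square)
  finally show ?thesis by (simp add: mu_def)
qed

text \<open>Two degrees interact only through the edges containing both vertices. If
  \<open>c\<close> of these are present, each tail probability grows by at most
  \<open>R ^ c\<close>; averaging \<open>R ^ (2 * c)\<close> over the binomial number
  \<open>c\<close> gives the exponential.\<close>

lemma prob_max_degree_less:
  fixes n k :: nat and p :: real
  assumes kn: "0 < k" "2 * k < n" and p01: "0 < p" "p \<le> 1"
    and T: "8 * T < (n - 1) choose (k - 1)" and R: "1 + 4 * real T / phi n k p \<le> R"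
    and tau: "tau = btail ((n - 1) choose (k - 1)) p T" "0 < tau"
  shows "Prs (ksets n k) p (\<lambda>H. \<forall>x\<in>{1..n}. \<not> T \<le> card (H \<inter> kstar n k x)) \<le> 1 / (real n * tau) + (exp (R\<^sup>2 * (phi n k p * real k / real n)) - 1)"
proof -
  let ?K = "ksets n k" and ?D = "(n - 1) choose (k - 1)"
  have D0: "0 < real ?D" using kn by simp
  have phi0: "0 < phi n k p" using p01 D0 by (simp add: phi_def)
  have R1: "1 \<le> R" using R phi0 by (intro order_trans[OF _ R]) auto
  let ?w = "exp (R\<^sup>2 * (phi n k p * real k / real n)) - 1"
  have pair: "Prs ?K p (\<lambda>H. T \<le> card (H \<inter> kstar n k x) \<and> T \<le> card (H \<inter> kstar n k y)) \<le> tau\<^sup>2 * (1 + ?w)"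
    if xy: "x \<in> {1..n}" "y \<in> {1..n}" "x \<noteq> y" for x y
  proof -
    let ?kx = "kstar n k x" and ?ky = "kstar n k y"
    define C Ax Ay where "C = ?kx \<inter> ?ky" and "Ax = ?kx - ?ky" and "Ay = ?ky - ?kx"
    have fin: "finite C" "finite Ax" "finite Ay" by (auto simp: C_def Ax_def Ay_def)
    have sub: "C \<subseteq> ?K" "Ax \<subseteq> ?K" "Ay \<subseteq> ?K" using kstar_subset by (auto simp: C_def Ax_def Ay_def)
    have pC: "real (card C) * p \<le> phi n k p * real k / real n" unfolding C_def by (rule card_pair_le) (use kn p01 xy in auto)
    have cD: "card ?kx = ?D" "card ?ky = ?D" using xy kn by (simp_all add: card_kstar)
    have cC: "2 * real (card C) \<le> real ?D"
    proof -
      have "real k / real n \<le> 1 / 2" using kn by (simp add: field_simps)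
      then have "phi n k p * (real k / real n) \<le> phi n k p * (1 / 2)" using phi0 by (intro mult_left_mono) auto
      moreover have "real (card C) * p \<le> phi n k p * (real k / real n)" using pC by simp
      ultimately have "real (card C) * p \<le> phi n k p / 2" by linarith
      then have "(2 * real (card C)) * p \<le> real ?D * p" by (simp add: phi_def mult_ac)
      then show ?thesis using p01 by simp
    qed
    have cA: "card Ax = ?D - card C" "card Ay = ?D - card C"
      unfolding Ax_def Ay_def C_def using cD by (auto simp: card_Diff_subset_Int Int_commute)
    have cA2: "real ?D / 2 \<le> real (card Ax)" "card Ay = card Ax" using cA cC by (auto simp: of_nat_diff)
    have bt: "btail (card Ax) p (T - c) \<le> R ^ c * tau" for c
    proof -
      have TA: "T < card Ax" "real ?D / 4 \<le> real (card Ax - T)" using cA2 T by auto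
      have "1 + real T / (real (card Ax - T) * p) \<le> R"
      proof -
        have "real T / (real (card Ax - T) * p) \<le> real T / (real ?D / 4 * p)"
          using TA p01 D0 by (intro divide_left_mono mult_right_mono mult_pos_pos) auto
        also have "\<dots> = 4 * real T / phi n k p" by (simp add: phi_def field_simps)
        finally have "real T / (real (card Ax - T) * p) \<le> 4 * real T / phi n k p" .
        then show ?thesis using R by (intro order_trans[OF add_left_mono R])
      qed
      \<comment> \<open>For \<open>c > T\<close> the subtraction \<open>T - c\<close> is truncated
        to 0, hence \<open>min c T\<close>.\<close>
      then have "btail (card Ax) p (T - min c T) \<le> R ^ (min c T) * btail (card Ax) p T"
        using TA p01 by (intro btail_ratio_power) auto
      also have "\<dots> \<le> R ^ c * tau"
      proof (rule mult_mono)
        have "btail (card Ax) p T = Prs Ax p (\<lambda>X. T \<le> card X)" using fin p01 by (simp add: Prs_card_ge)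
        also have "\<dots> = Prs ?kx p (\<lambda>X. T \<le> card (X \<inter> Ax))" by (rule Prs_marginal[symmetric]) (auto simp: Ax_def)
        also have "\<dots> \<le> Prs ?kx p (\<lambda>X. T \<le> card X)"
        proof (rule Prs_mono)
          fix X assume X: "X \<subseteq> ?kx" "T \<le> card (X \<inter> Ax)"
          have "finite X" using X finite_kstar finite_subset by blast
          then have "card (X \<inter> Ax) \<le> card X" by (intro card_mono) auto
          then show "T \<le> card X" using X by simp
        qed
        also have "\<dots> = tau" using p01 cD by (simp add: Prs_card_ge tau)
        finally show "btail (card Ax) p T \<le> tau" .
      qed (use R1 in \<open>auto intro: power_increasing\<close>)
      finally show ?thesis by (simp add: min_def split: if_splits)
    qed
    have "Prs ?K p (\<lambda>H. T \<le> card (H \<inter> ?kx) \<and> T \<le> card (H \<inter> ?ky)) \<le>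
       Prs ?K p (\<lambda>H. \<exists>c\<in>{..card C}. card (H \<inter> C) = c \<and> (T - c \<le> card (H \<inter> (Ax \<union> Ay) \<inter> Ax) \<and> T - c \<le> card (H \<inter> (Ax \<union> Ay) \<inter> Ay)))"
    proof (rule Prs_mono)
      fix H assume H: "T \<le> card (H \<inter> ?kx) \<and> T \<le> card (H \<inter> ?ky)"
      have "H \<inter> ?kx = (H \<inter> C) \<union> (H \<inter> (Ax \<union> Ay) \<inter> Ax)" by (auto simp: C_def Ax_def Ay_def)
      then have "card (H \<inter> ?kx) \<le> card (H \<inter> C) + card (H \<inter> (Ax \<union> Ay) \<inter> Ax)" by (metis card_Un_le)
      moreover have "H \<inter> ?ky = (H \<inter> C) \<union> (H \<inter> (Ax \<union> Ay) \<inter> Ay)" by (auto simp: C_def Ax_def Ay_def)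
      then have "card (H \<inter> ?ky) \<le> card (H \<inter> C) + card (H \<inter> (Ax \<union> Ay) \<inter> Ay)" by (metis card_Un_le)
      moreover have "card (H \<inter> C) \<le> card C" using fin by (intro card_mono) auto
      ultimately show "\<exists>c\<in>{..card C}. card (H \<inter> C) = c \<and> (T - c \<le> card (H \<inter> (Ax \<union> Ay) \<inter> Ax) \<and> T - c \<le> card (H \<inter> (Ax \<union> Ay) \<inter> Ay))"
        using H by auto
    qed
    also have "\<dots> \<le> (\<Sum>c\<in>{..card C}. Prs ?K p (\<lambda>H. card (H \<inter> C) = c \<and> (T - c \<le> card (H \<inter> (Ax \<union> Ay) \<inter> Ax) \<and> T - c \<le> card (H \<inter> (Ax \<union> Ay) \<inter> Ay))))"
      by (rule Prs_Bex) auto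
    also have "\<dots> \<le> (\<Sum>c\<in>{..card C}. tau\<^sup>2 * (real (card C choose c) * (p * R\<^sup>2) ^ c * (1 - p) ^ (card C - c)))"
    proof (rule sum_mono)
      fix c
      have "Prs ?K p (\<lambda>H. card (H \<inter> C) = c \<and> (T - c \<le> card (H \<inter> (Ax \<union> Ay) \<inter> Ax) \<and> T - c \<le> card (H \<inter> (Ax \<union> Ay) \<inter> Ay)))
        = Prs C p (\<lambda>X. card X = c) * Prs (Ax \<union> Ay) p (\<lambda>X. T - c \<le> card (X \<inter> Ax) \<and> T - c \<le> card (X \<inter> Ay))"
        by (rule Prs_indep) (use sub in \<open>auto simp: C_def Ax_def Ay_def\<close>)
      also have "Prs (Ax \<union> Ay) p (\<lambda>X. T - c \<le> card (X \<inter> Ax) \<and> T - c \<le> card (X \<inter> Ay)) = Prs Ax p (\<lambda>X. T - c \<le> card X) * Prs Ay p (\<lambda>X. T - c \<le> card X)"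
        by (rule Prs_indep) (use fin in \<open>auto simp: Ax_def Ay_def\<close>)
      also have "\<dots> = btail (card Ax) p (T - c) * btail (card Ax) p (T - c)" using fin p01 cA2 by (simp add: Prs_card_ge)
      also have "Prs C p (\<lambda>X. card X = c) * (btail (card Ax) p (T - c) * btail (card Ax) p (T - c)) \<le> Prs C p (\<lambda>X. card X = c) * ((R ^ c * tau) * (R ^ c * tau))"
        using R1 tau by (intro mult_left_mono mult_mono bt) auto
      also have "Prs C p (\<lambda>X. card X = c) = real (card C choose c) * p ^ c * (1 - p) ^ (card C - c)" using fin p01 by (simp add: Prs_card_eq)
      finally show "Prs ?K p (\<lambda>H. card (H \<inter> C) = c \<and> (T - c \<le> card (H \<inter> (Ax \<union> Ay) \<inter> Ax) \<and> T - c \<le> card (H \<inter> (Ax \<union> Ay) \<inter> Ay)))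
         \<le> tau\<^sup>2 * (real (card C choose c) * (p * R\<^sup>2) ^ c * (1 - p) ^ (card C - c))"
        using p01 by (simp add: mult_left_mono power2_eq_square power_mult_distrib mult_ac)
    qed
    also have "\<dots> = tau\<^sup>2 * (p * R\<^sup>2 + (1 - p)) ^ card C" by (simp add: binomial_ring sum_distrib_left)
    also have "\<dots> \<le> tau\<^sup>2 * exp (R\<^sup>2 * (phi n k p * real k / real n))"
    proof (rule mult_left_mono)
      have "p * R\<^sup>2 + (1 - p) \<le> exp (p * R\<^sup>2)" using exp_ge_add_one_self[of "p * R\<^sup>2"] p01 by linarith
      then have "(p * R\<^sup>2 + (1 - p)) ^ card C \<le> exp (p * R\<^sup>2) ^ card C" using p01 by (intro power_mono) auto
      also have "\<dots> = exp (R\<^sup>2 * (real (card C) * p))" by (simp add: exp_of_nat_mult[symmetric] mult_ac)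
      also have "\<dots> \<le> exp (R\<^sup>2 * (phi n k p * real k / real n))" using mult_left_mono[OF pC, of "R\<^sup>2"] by simp
      finally show "(p * R\<^sup>2 + (1 - p)) ^ card C \<le> exp (R\<^sup>2 * (phi n k p * real k / real n))" .
    qed auto
    finally show ?thesis by simp
  qed
  have "Prs ?K p (\<lambda>H. \<forall>x\<in>{1..n}. \<not> T \<le> card (H \<inter> kstar n k x)) \<le> 1 / (real (card {1..n}) * tau) + ?w"
  proof (rule chebyshev_none)
    fix x assume x: "x \<in> {1..n}"
    have "Prs ?K p (\<lambda>H. T \<le> card (H \<inter> kstar n k x)) = Prs (kstar n k x) p (\<lambda>X. T \<le> card X)"
      by (rule Prs_marginal) (use kstar_subset in auto)
    then show "Prs ?K p (\<lambda>H. T \<le> card (H \<inter> kstar n k x)) = tau" using p01 x kn by (simp add: Prs_card_ge tau card_kstar)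
  next
    show "0 \<le> ?w" using phi0 by simp
  qed (use kn tau pair in auto)
  then show ?thesis by simp
qed

section \<open>Incidence patterns of nontrivial cliques\<close>

text \<open>Elements of \<open>I\<close> index the edges of a clique and a block collects the edges
  through one vertex. Every two edges meet, so blocks cover all pairs; no vertex is common to all
  edges, so blocks are proper.\<close>

definition proper_cover :: "'a set \<Rightarrow> 'a set set \<Rightarrow> bool" where
  "proper_cover I SS \<longleftrightarrow> (\<forall>S\<in>SS. S \<subset> I \<and> 2 \<le> card S) \<and> (\<forall>i\<in>I. \<forall>j\<in>I. i \<noteq> j \<longrightarrow> (\<exists>S\<in>SS. i \<in> S \<and> j \<in> S))"

lemma proper_cover_finite: "finite I \<Longrightarrow> proper_cover I SS \<Longrightarrow> finite SS"
  by (rule finite_subset[of _ "Pow I"]) (auto simp: proper_cover_def)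

text \<open>Induction by deleting an index \<open>v\<close>. If \<open>I - {v}\<close> is a block,
  it contributes \<open>card I - 2\<close> and the blocks through \<open>v\<close> at least
  \<open>card I - 1\<close>. Otherwise the restricted cover is still proper, and \<open>v\<close>
  lies in at least two blocks, each of which loses one unit. Equality holds for
  \<open>I - {v}\<close> together with all pairs through \<open>v\<close>, the near-pencil.\<close>

lemma proper_cover_sum:
  assumes "finite I" "2 \<le> card I" "proper_cover I SS"
  shows "2 * card I - 3 \<le> (\<Sum>S\<in>SS. card S - 1)"
  using assms
proof (induction "card I" arbitrary: I SS rule: less_induct)
  case less
  note fI = less.prems(1) and pc = less.prems(3)
  have fSS: "finite SS" using proper_cover_finite[OF fI pc] .
  have sub: "S \<subset> I" "2 \<le> card S" if "S \<in> SS" for S using that pc by (auto simp: proper_cover_def)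
  have cov: "\<exists>S\<in>SS. i \<in> S \<and> j \<in> S" if "i \<in> I" "j \<in> I" "i \<noteq> j" for i j using that pc unfolding proper_cover_def by blast
  have fS: "finite S" if "S \<in> SS" for S using sub[OF that] fI finite_subset by blast
  have "I \<noteq> {}" using less.prems by auto
  then obtain v where v: "v \<in> I" by blast
  have cIv: "card (I - {v}) = card I - 1" using v fI by simp
  let ?Sv = "{S \<in> SS. v \<in> S}"
  have "I - {v} \<noteq> {}" 
  proof
    assume "I - {v} = {}"
    then have "card (I - {v}) = 0" by (simp only: card.empty)
    then show False using less.prems(2) cIv by linarith
  qed
  then obtain w where w: "w \<in> I" "w \<noteq> v" by blast
  obtain S1 where S1: "S1 \<in> SS" "v \<in> S1" "w \<in> S1" using cov[OF v w(1)] w(2) by blast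
  obtain u where u: "u \<in> I" "u \<notin> S1" using sub[OF S1(1)] by blast
  obtain S2 where S2: "S2 \<in> SS" "v \<in> S2" "u \<in> S2" using cov[OF v u(1)] u S1 by blast
  have c2: "2 \<le> card ?Sv"
  proof -
    have "card {S1, S2} \<le> card ?Sv" using S1 S2 fSS by (intro card_mono) auto
    moreover have "S1 \<noteq> S2" using u S2 by auto
    ultimately show ?thesis by simp
  qed
  have T3: "3 \<le> card I"
  proof -
    have "card {v, w, u} \<le> card I" using v w u fI by (intro card_mono) auto
    moreover have "u \<noteq> v" "u \<noteq> w" using u S1 by auto
    ultimately show ?thesis using w by simp
  qed
  show ?case
  proof (cases "I - {v} \<in> SS")
    case True
    have "card I - 1 \<le> (\<Sum>S\<in>?Sv. card S - 1)"
    proof -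
      have "I - {v} \<subseteq> (\<Union>S\<in>?Sv. S - {v})"
      proof
        fix i assume "i \<in> I - {v}"
        then obtain S where "S \<in> SS" "v \<in> S" "i \<in> S" using cov[OF v, of i] by blast
        then show "i \<in> (\<Union>S\<in>?Sv. S - {v})" using \<open>i \<in> I - {v}\<close> by auto
      qed
      then have "card (I - {v}) \<le> card (\<Union>S\<in>?Sv. S - {v})" using fSS fS by (intro card_mono) auto
      also have "\<dots> \<le> (\<Sum>S\<in>?Sv. card (S - {v}))" using fSS by (intro card_UN_le) auto
      also have "\<dots> = (\<Sum>S\<in>?Sv. card S - 1)" using fS by (intro sum.cong refl) auto
      finally show ?thesis using cIv by simp
    qed
    moreover have "(\<Sum>S\<in>insert (I - {v}) ?Sv. card S - 1) \<le> (\<Sum>S\<in>SS. card S - 1)"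
      using fSS True by (intro sum_mono2) auto
    moreover have "(\<Sum>S\<in>insert (I - {v}) ?Sv. card S - 1) = (card I - 1 - 1) + (\<Sum>S\<in>?Sv. card S - 1)"
      using fSS cIv by (subst sum.insert) auto
    ultimately show ?thesis by linarith
  next
    case False
    let ?A = "{S \<in> SS. 2 \<le> card (S - {v})}"
    let ?SS' = "(\<lambda>S. S - {v}) ` ?A"
    have pc': "proper_cover (I - {v}) ?SS'"
      unfolding proper_cover_def
    proof (intro conjI ballI impI)
      fix S' assume "S' \<in> ?SS'"
      then obtain S where S: "S \<in> SS" "S' = S - {v}" "2 \<le> card S'" by auto
      show "2 \<le> card S'" by fact
      have "S' \<noteq> I - {v}"
      proof
        assume e: "S' = I - {v}"
        then have "S = I \<or> S = I - {v}" using S sub[OF S(1)] v by blast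
        then show False using sub[OF S(1)] False S(1) by auto
      qed
      then show "S' \<subset> I - {v}" using S sub[OF S(1)] by auto
    next
      fix i j assume ij: "i \<in> I - {v}" "j \<in> I - {v}" "i \<noteq> j"
      then obtain S where S: "S \<in> SS" "i \<in> S" "j \<in> S" using cov[of i j] by auto
      have "card {i, j} \<le> card (S - {v})" using S ij fS[OF S(1)] by (intro card_mono) auto
      then have "S \<in> ?A" using S ij by simp
      then show "\<exists>S\<in>?SS'. i \<in> S \<and> j \<in> S" using S ij by (intro bexI[of _ "S - {v}"]) auto
    qed
    have "2 * card (I - {v}) - 3 \<le> (\<Sum>S\<in>?SS'. card S - 1)"
      by (rule less.hyps) (use pc' fI v T3 cIv in \<open>auto simp: card_gt_0_iff\<close>)
    also have "\<dots> \<le> (\<Sum>S\<in>?A. card (S - {v}) - 1)"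
      using fSS sum_image_le[of ?A "\<lambda>S. card S - 1" "\<lambda>S. S - {v}"] by (simp add: o_def)
    also have "\<dots> \<le> (\<Sum>S\<in>SS. card (S - {v}) - 1)" using fSS by (intro sum_mono2) auto
    finally have 1: "2 * (card I - 1) - 3 \<le> (\<Sum>S\<in>SS. card (S - {v}) - 1)" using cIv by simp
    have "(\<Sum>S\<in>SS. card S - 1) = (\<Sum>S\<in>SS. (card (S - {v}) - 1) + (if v \<in> S then 1 else 0))"
    proof (rule sum.cong[OF refl])
      fix S assume S: "S \<in> SS"
      have "card (S - {v}) = (if v \<in> S then card S - 1 else card S)" using fS[OF S] by auto
      then show "card S - 1 = (card (S - {v}) - 1) + (if v \<in> S then 1 else 0)" using sub(2)[OF S] by auto
    qed
    also have "\<dots> = (\<Sum>S\<in>SS. card (S - {v}) - 1) + card ?Sv"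
      using fSS by (simp add: sum.distrib sum.If_cases Int_def)
    finally show ?thesis using 1 c2 T3 by linarith
  qed
qed

lemma proper_cover_choose2:
  assumes "finite I" "proper_cover I SS"
  shows "card I * (card I - 1) \<le> (\<Sum>S\<in>SS. card S * (card S - 1))"
proof -
  have fSS: "finite SS" using proper_cover_finite[OF assms] .
  have fS: "finite S" if "S \<in> SS" for S using that assms finite_subset[of S I] by (auto simp: proper_cover_def)
  let ?P = "\<lambda>S. Sigma S (\<lambda>i. S - {i})"
  have cP: "card (?P S) = card S * (card S - 1)" if "finite S" for S :: "'a set"
  proof -
    have "card (?P S) = (\<Sum>i\<in>S. card (S - {i}))" using that by (intro card_SigmaI) auto
    also have "\<dots> = (\<Sum>i\<in>S. card S - 1)" using that by (intro sum.cong refl) auto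
    finally show ?thesis by simp
  qed
  have "?P I \<subseteq> (\<Union>S\<in>SS. ?P S)"
  proof
    fix ij assume "ij \<in> ?P I"
    then obtain i j where ij: "ij = (i, j)" "i \<in> I" "j \<in> I" "i \<noteq> j" by auto
    then obtain S where "S \<in> SS" "i \<in> S" "j \<in> S" using assms(2) unfolding proper_cover_def by blast
    then show "ij \<in> (\<Union>S\<in>SS. ?P S)" using ij by auto
  qed
  then have "card (?P I) \<le> card (\<Union>S\<in>SS. ?P S)" using fSS fS by (intro card_mono) auto
  also have "\<dots> \<le> (\<Sum>S\<in>SS. card (?P S))" by (rule card_UN_le[OF fSS])
  also have "\<dots> = (\<Sum>S\<in>SS. card S * (card S - 1))" using fS by (intro sum.cong refl cP)
  finally show ?thesis using cP[OF assms(1)] by simp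
qed

text \<open>The minimum compares the cover by all pairs with the near-pencil, one block of size
  \<open>T - 1\<close> and \<open>T - 1\<close> pairs. For \<open>v\<close> at least
  \<open>u * T / 2\<close> counting pairs is enough. For smaller \<open>v\<close> the argument
  splits according to whether the sum of \<open>card S - 2\<close> reaches its near-pencil value
  \<open>T - 3\<close>.\<close>

lemma proper_cover_cost:
  fixes u v :: real
  assumes "finite I" "card I = T" "3 \<le> T" "proper_cover I SS" "0 \<le> u" "u \<le> v"
  shows "min (u * (real T * (real T - 1) / 2)) (u * real T + v * (real T - 3)) \<le> u * real (card SS) + v * (\<Sum>S\<in>SS. real (card S) - 2)"
proof -
  have fSS: "finite SS" using proper_cover_finite[OF assms(1,4)] .
  have sub: "S \<subset> I" "2 \<le> card S" if "S \<in> SS" for S using that assms(4) by (auto simp: proper_cover_def)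
  have cS: "card S + 1 \<le> T" if "S \<in> SS" for S
    using psubset_card_mono[OF assms(1) sub(1)[OF that]] assms(2) by simp
  let ?m = "real (card SS)" and ?B = "\<Sum>S\<in>SS. real (card S) - 2"
  have B1: "?m + ?B \<ge> 2 * real T - 3"
  proof -
    have "real (2 * card I - 3) \<le> real (\<Sum>S\<in>SS. card S - 1)"
      using proper_cover_sum[OF assms(1) _ assms(4)] assms(2,3) by (intro of_nat_mono) auto
    also have "\<dots> = (\<Sum>S\<in>SS. (real (card S) - 2) + 1)" 
      unfolding of_nat_sum
    proof (rule sum.cong[OF refl])
      fix S assume "S \<in> SS"
      then have "1 \<le> card S" using sub(2)[of S] by linarith
      then show "real (card S - 1) = (real (card S) - 2) + 1" by (simp add: of_nat_diff)
    qed
    also have "\<dots> = ?m + ?B" by (subst sum.distrib) simp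
    finally show ?thesis using assms(2,3) by (simp add: of_nat_diff)
  qed
  \<comment> \<open>For a block of size \<open>s\<close> the excess of \<open>s choose 2\<close>
    over 1 is \<open>(s + 1) / 2 * (s - 2)\<close>, and \<open>s + 1 \<le> T\<close> for proper
    blocks.\<close>
  have conv: "u * (real T * (real T - 1) / 2) \<le> u * ?m + v' * ?B" if v': "u * real T / 2 \<le> v'" for v'
  proof -
    have "real (card I * (card I - 1)) \<le> real (\<Sum>S\<in>SS. card S * (card S - 1))"
      using proper_cover_choose2[OF assms(1,4)] by (rule of_nat_mono)
    then have "real T * (real T - 1) \<le> (\<Sum>S\<in>SS. real (card S * (card S - 1)))" using assms(2,3) by (simp add: of_nat_diff)
    also have "\<dots> = (\<Sum>S\<in>SS. real (card S) * (real (card S) - 1))"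
    proof (intro sum.cong refl)
      fix S assume "S \<in> SS"
      then have "1 \<le> card S" using sub(2)[of S] by linarith
      then have "real (card S - 1) = real (card S) - 1" by (simp add: of_nat_diff)
      then show "real (card S * (card S - 1)) = real (card S) * (real (card S) - 1)" by simp
    qed
    finally have "u * (real T * (real T - 1) / 2) \<le> u * ((\<Sum>S\<in>SS. real (card S) * (real (card S) - 1)) / 2)"
      using assms by (intro mult_left_mono) auto
    also have "\<dots> = (\<Sum>S\<in>SS. u * (real (card S) * (real (card S) - 1) / 2))" by (simp add: sum_distrib_left sum_divide_distrib)
    also have "\<dots> \<le> (\<Sum>S\<in>SS. u + v' * (real (card S) - 2))"
    proof (rule sum_mono)
      fix S assume S: "S \<in> SS"
      have "u * ((real (card S) + 1) / 2) \<le> u * (real T / 2)" using cS[OF S] assms by (intro mult_left_mono) auto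
      also have "\<dots> \<le> v'" using v' by simp
      finally have "u * ((real (card S) + 1) / 2) * (real (card S) - 2) \<le> v' * (real (card S) - 2)"
        using sub(2)[OF S] by (intro mult_right_mono) auto
      then show "u * (real (card S) * (real (card S) - 1) / 2) \<le> u + v' * (real (card S) - 2)" by (simp add: field_simps)
    qed
    also have "\<dots> = u * ?m + v' * ?B" by (simp add: sum.distrib sum_distrib_left)
    finally show ?thesis .
  qed
  show ?thesis
  proof (cases "u * real T / 2 \<le> v")
    case True
    then show ?thesis using conv[OF True] by linarith
  next
    case False
    have "u * real T + v * (real T - 3) \<le> u * ?m + v * ?B"
    proof (cases "real T - 3 \<le> ?B")
      case True
      have "u * (2 * real T - 3) \<le> u * (?m + ?B)" using B1 assms by (intro mult_left_mono) auto
      moreover have "u * (?B - (real T - 3)) \<le> v * (?B - (real T - 3))" using True assms by (intro mult_right_mono) auto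
      ultimately show ?thesis by (simp add: algebra_simps)
    next
      case B: False
      \<comment> \<open>At slope \<open>u * T / 2\<close> both extremal covers cost the same. Since
        \<open>?B\<close> is below \<open>T - 3\<close>, lowering the slope to \<open>v\<close>
        saves less for this cover than for the near-pencil.\<close>
      have "u * (real T * (real T - 1) / 2) \<le> u * ?m + (u * real T / 2) * ?B" by (rule conv) simp
      moreover have "(u * real T / 2) * (?B - (real T - 3)) \<le> v * (?B - (real T - 3))"
        using B False by (intro mult_right_mono_neg) auto
      ultimately show ?thesis by (simp add: field_simps)
    qed
    then show ?thesis by linarith
  qed
qed

text \<open>This is \<open>proper_cover_cost\<close> with \<open>u = - ln a\<close> and
  \<open>v = - ln b\<close>; the minimum of two costs becomes a maximum of two weights and is
  bounded by their sum.\<close>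

lemma proper_cover_weight:
  fixes a b :: real
  assumes "finite I" "card I = T" "3 \<le> T" "proper_cover I SS" "0 < b" "b \<le> a" "a \<le> 1"
  shows "(\<Prod>S\<in>SS. a * b ^ (card S - 2)) \<le> a ^ (T choose 2) + a ^ T * b ^ (T - 3)"
proof -
  have fSS: "finite SS" using proper_cover_finite[OF assms(1,4)] .
  have sub: "2 \<le> card S" if "S \<in> SS" for S using that assms(4) by (auto simp: proper_cover_def)
  let ?u = "- ln a" and ?v = "- ln b"
  have a0: "0 < a" using assms by simp
  have P: "(\<Prod>S\<in>SS. a * b ^ (card S - 2)) = exp (- (?u * real (card SS) + ?v * (\<Sum>S\<in>SS. real (card S) - 2)))"
  proof -
    have "(\<Prod>S\<in>SS. a * b ^ (card S - 2)) = (\<Prod>S\<in>SS. exp (ln a + (real (card S) - 2) * ln b))"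
    proof (rule prod.cong[OF refl])
      fix S assume "S \<in> SS"
      then have e: "real (card S) - 2 = real (card S - 2)" using sub[of S] by (simp add: of_nat_diff)
      have "exp (ln a + real m * ln b) = a * b ^ m" for m using a0 assms(5) by (simp add: exp_add exp_of_nat_mult)
      then show "a * b ^ (card S - 2) = exp (ln a + (real (card S) - 2) * ln b)" unfolding e by simp
    qed
    also have "\<dots> = exp (\<Sum>S\<in>SS. ln a + (real (card S) - 2) * ln b)" by (simp add: exp_sum[OF fSS])
    also have "(\<Sum>S\<in>SS. ln a + (real (card S) - 2) * ln b) = - (?u * real (card SS) + ?v * (\<Sum>S\<in>SS. real (card S) - 2))"
      by (simp add: sum.distrib sum_distrib_left mult.commute sum_negf)
    finally show ?thesis .
  qed
  have "min (?u * (real T * (real T - 1) / 2)) (?u * real T + ?v * (real T - 3)) \<le> ?u * real (card SS) + ?v * (\<Sum>S\<in>SS. real (card S) - 2)"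
    by (rule proper_cover_cost) (use assms a0 in auto)
  then consider "?u * (real T * (real T - 1) / 2) \<le> ?u * real (card SS) + ?v * (\<Sum>S\<in>SS. real (card S) - 2)"
    | "?u * real T + ?v * (real T - 3) \<le> ?u * real (card SS) + ?v * (\<Sum>S\<in>SS. real (card S) - 2)" by linarith
  then show ?thesis
  proof cases
    case 1
    have "real (T choose 2) = real T * (real T - 1) / 2"
    proof -
      have "real (2 * (T choose 2)) = real (T * (T - 1))" by (simp only: choose2_double)
      then show ?thesis using assms by (simp add: of_nat_diff)
    qed
    moreover have "a ^ (T choose 2) = exp (real (T choose 2) * ln a)" using a0 by (simp only: exp_of_nat_mult exp_ln)
    ultimately have "a ^ (T choose 2) = exp (- (?u * (real T * (real T - 1) / 2)))" by (simp add: mult.commute)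
    then have "(\<Prod>S\<in>SS. a * b ^ (card S - 2)) \<le> a ^ (T choose 2)" unfolding P using 1 by simp
    moreover have "0 \<le> a ^ T * b ^ (T - 3)" using a0 assms(5) by simp
    ultimately show ?thesis by linarith
  next
    case 2
    have "a ^ T * b ^ (T - 3) = exp (- (?u * real T + ?v * (real T - 3)))"
    proof -
      have e: "real T - 3 = real (T - 3)" using assms(3) by (simp add: of_nat_diff)
      have "- (?u * real T + ?v * (real T - 3)) = real T * ln a + real (T - 3) * ln b" unfolding e by (simp add: mult.commute)
      then have "exp (- (?u * real T + ?v * (real T - 3))) = exp (real T * ln a + real (T - 3) * ln b)" by (rule arg_cong)
      also have "\<dots> = a ^ T * b ^ (T - 3)" using a0 assms(5) by (simp only: exp_add exp_of_nat_mult exp_ln)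
      finally show ?thesis by (rule sym)
    qed
    then have "(\<Prod>S\<in>SS. a * b ^ (card S - 2)) \<le> a ^ T * b ^ (T - 3)" unfolding P using 2 by simp
    moreover have "0 \<le> a ^ (T choose 2)" using a0 by simp
    ultimately show ?thesis by linarith
  qed
qed

text \<open>Injectivity of \<open>y\<close> ensures that an edge lying in several blocks contains as
  many prescribed vertices, each of which costs a factor \<open>k / n\<close>.\<close>

definition realizes :: "nat \<Rightarrow> nat \<Rightarrow> nat \<Rightarrow> nat set set \<Rightarrow> nat set set \<Rightarrow> bool" where
  "realizes n k T SS F \<longleftrightarrow> (\<exists>A y. inj_on A {..<T} \<and> A ` {..<T} = F \<and> F \<subseteq> ksets n k \<and> inj_on y SS \<and>
     (\<forall>S\<in>SS. y S \<in> {1..n} \<and> (\<forall>i\<in>S. y S \<in> A i)))"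

text \<open>A block \<open>S\<close> offers \<open>n\<close> choices for its vertex and pays
  \<open>k / n\<close> for each of its incidences; \<open>n * (k / n) ^ card S\<close> is regrouped
  as the weight of a pair times \<open>k / n\<close> for each further edge.\<close>

lemma prob_realizes:
  fixes n k :: nat and p :: real
  assumes kn: "0 < k" "2 * k < n" and p01: "0 \<le> p" "p \<le> 1"
    and SS: "\<And>S. S \<in> SS \<Longrightarrow> S \<subseteq> {..<T} \<and> 2 \<le> card S"
  shows "Prs (ksets n k) p (\<lambda>H. \<exists>F\<subseteq>H. realizes n k T SS F)
    \<le> mbar n k p ^ T * (\<Prod>S\<in>SS. ((real k)\<^sup>2 / real n) * (real k / real n) ^ (card S - 2))"
proof -
  let ?K = "ksets n k" and ?N = "real (n choose k)" and ?b = "real k / real n"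
  have fSS: "finite SS" by (rule finite_subset[of _ "Pow {..<T}"]) (use SS in auto)
  let ?FF = "{F. realizes n k T SS F}"
  let ?YY = "{y \<in> SS \<rightarrow>\<^sub>E {1..n}. inj_on y SS}"
  let ?W = "\<lambda>y i. {A \<in> ?K. y ` {S \<in> SS. i \<in> S} \<subseteq> A}"
  let ?X = "\<Union>y\<in>?YY. Pi\<^sub>E {..<T} (?W y)"
  have fYY: "finite ?YY" using fSS by (auto intro!: finite_PiE)
  have fX: "finite ?X" using fYY by (auto intro!: finite_PiE)
  have sub: "?FF \<subseteq> (\<lambda>A. A ` {..<T}) ` ?X"
  proof
    fix F assume "F \<in> ?FF"
    then obtain A y where Ay: "inj_on A {..<T}" "A ` {..<T} = F" "F \<subseteq> ?K" "inj_on y SS"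
      "\<And>S. S \<in> SS \<Longrightarrow> y S \<in> {1..n}" "\<And>S i. S \<in> SS \<Longrightarrow> i \<in> S \<Longrightarrow> y S \<in> A i" unfolding realizes_def by blast
    have "restrict y SS \<in> ?YY" using Ay by (auto simp: inj_on_def)
    moreover have "restrict A {..<T} \<in> Pi\<^sub>E {..<T} (?W (restrict y SS))" using Ay by auto
    ultimately have "restrict A {..<T} \<in> ?X" by blast
    moreover have "F = restrict A {..<T} ` {..<T}" using Ay by auto
    ultimately show "F \<in> (\<lambda>A. A ` {..<T}) ` ?X" by blast
  qed
  have fFF: "finite ?FF" using finite_subset[OF sub] fX by blast
  have each: "real (card (Pi\<^sub>E {..<T} (?W y))) \<le> ?N ^ T * ?b ^ (\<Sum>S\<in>SS. card S)" if y: "y \<in> ?YY" for y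
  proof -
    have "real (card (Pi\<^sub>E {..<T} (?W y))) = (\<Prod>i<T. real (card (?W y i)))" by (simp add: card_PiE)
    also have "\<dots> \<le> (\<Prod>i<T. ?N * ?b ^ card {S \<in> SS. i \<in> S})"
    proof (intro prod_mono conjI)
      fix i
      have "inj_on y {S \<in> SS. i \<in> S}" using y by (auto intro: inj_on_subset)
      then have c: "card (y ` {S \<in> SS. i \<in> S}) = card {S \<in> SS. i \<in> S}" by (rule card_image)
      have "y ` {S \<in> SS. i \<in> S} \<subseteq> {1..n}" using y by auto
      then show "real (card (?W y i)) \<le> ?N * ?b ^ card {S \<in> SS. i \<in> S}"
        using card_ksets_superset_le[of k n "y ` {S \<in> SS. i \<in> S}"] kn c by simp
    qed auto
    also have "\<dots> = ?N ^ T * ?b ^ (\<Sum>i<T. card {S \<in> SS. i \<in> S})" by (simp add: prod.distrib power_sum)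
    also have "(\<Sum>i<T. card {S \<in> SS. i \<in> S}) = (\<Sum>S\<in>SS. card ({..<T} \<inter> S))"
      using sum_card_Collect[of "{..<T}" SS "\<lambda>S. S"] fSS by simp
    also have "\<dots> = (\<Sum>S\<in>SS. card S)" using SS by (intro sum.cong refl arg_cong[where f = card]) auto
    finally show ?thesis .
  qed
  have "card ?FF \<le> card ?X" using card_mono[OF finite_imageI[OF fX] sub] card_image_le[OF fX] by (rule order_trans)
  also have "\<dots> \<le> (\<Sum>y\<in>?YY. card (Pi\<^sub>E {..<T} (?W y)))" by (rule card_UN_le[OF fYY])
  finally have "real (card ?FF) \<le> real (\<Sum>y\<in>?YY. card (Pi\<^sub>E {..<T} (?W y)))" by (rule of_nat_mono)
  also have "\<dots> = (\<Sum>y\<in>?YY. real (card (Pi\<^sub>E {..<T} (?W y))))" by (rule of_nat_sum)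
  also have "\<dots> \<le> (\<Sum>y\<in>?YY. ?N ^ T * ?b ^ (\<Sum>S\<in>SS. card S))" by (intro sum_mono each)
  also have "\<dots> = real (card ?YY) * (?N ^ T * ?b ^ (\<Sum>S\<in>SS. card S))" by simp
  also have "\<dots> \<le> real n ^ card SS * (?N ^ T * ?b ^ (\<Sum>S\<in>SS. card S))"
  proof (rule mult_right_mono)
    have "card ?YY \<le> card (SS \<rightarrow>\<^sub>E {1..n})" using fSS by (intro card_mono finite_PiE) auto
    also have "\<dots> = n ^ card SS" using fSS by (simp add: card_PiE)
    finally have "real (card ?YY) \<le> real (n ^ card SS)" by (rule of_nat_mono)
    then show "real (card ?YY) \<le> real n ^ card SS" by simp
  qed auto
  finally have cFF: "real (card ?FF) \<le> ?N ^ T * (real n ^ card SS * ?b ^ (\<Sum>S\<in>SS. card S))" by (simp add: mult_ac)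
  have "Prs ?K p (\<lambda>H. \<exists>F\<subseteq>H. realizes n k T SS F) \<le> Prs ?K p (\<lambda>H. \<exists>F\<in>?FF. F \<subseteq> H)" by (rule Prs_mono) auto
  also have "\<dots> \<le> real (card ?FF) * p ^ T"
  proof (rule Prs_exists_superset)
    fix F assume "F \<in> ?FF"
    then show "F \<subseteq> ?K \<and> card F = T" by (auto simp: realizes_def card_image)
  qed (use fFF p01 in auto)
  also have "\<dots> \<le> ?N ^ T * (real n ^ card SS * ?b ^ (\<Sum>S\<in>SS. card S)) * p ^ T" using cFF p01 by (intro mult_right_mono) auto
  also have "real n ^ card SS * ?b ^ (\<Sum>S\<in>SS. card S) = (\<Prod>S\<in>SS. real n * ?b ^ card S)" by (simp add: prod.distrib power_sum)
  also have "\<dots> = (\<Prod>S\<in>SS. ((real k)\<^sup>2 / real n) * ?b ^ (card S - 2))"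
  proof (intro prod.cong refl)
    fix S assume "S \<in> SS"
    then have "card S = 2 + (card S - 2)" using SS by fastforce
    then have "?b ^ card S = ?b ^ 2 * ?b ^ (card S - 2)" by (metis power_add)
    moreover have "real n * ?b ^ 2 = (real k)\<^sup>2 / real n" using kn by (simp add: power2_eq_square field_simps)
    ultimately show "real n * ?b ^ card S = ((real k)\<^sup>2 / real n) * ?b ^ (card S - 2)" by (simp add: mult.assoc[symmetric])
  qed
  finally show ?thesis using kn by (simp add: mbar_eq power_mult_distrib mult_ac)
qed

text \<open>Every pair of edges picks a common vertex, and the block of a vertex consists of all
  indices of edges through it. Different vertices can have equal blocks; \<open>inv_into\<close>
  keeps one vertex per block, which makes \<open>y\<close> injective.\<close>

lemma nontrivial_clique_realizes:
  assumes F: "F \<subseteq> ksets n k" "clique F" "card F = T" "\<And>x. x \<in> {1..n} \<Longrightarrow> \<exists>A\<in>F. x \<notin> A"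
  shows "\<exists>SS. proper_cover {..<T} SS \<and> realizes n k T SS F"
proof -
  have finF: "finite F" using F(1) finite_subset by blast
  obtain A where A: "bij_betw A {0..<card F} F" using ex_bij_betw_nat_finite[OF finF] by blast
  then have A: "inj_on A {..<T}" "A ` {..<T} = F" using F(3) by (auto simp: bij_betw_def atLeast0LessThan)
  define z where "z i j = (SOME z. z \<in> A i \<inter> A j)" for i j
  have z: "z i j \<in> A i \<and> z i j \<in> A j" if "i < T" "j < T" "i \<noteq> j" for i j
  proof -
    have "A i \<in> F" "A j \<in> F" using that A by auto
    moreover have "A i \<noteq> A j" using that A(1) by (auto simp: inj_on_def)
    ultimately have "\<not> disjnt (A i) (A j)" using F(2) unfolding clique_def pairwise_def by blast
    then have "\<exists>z. z \<in> A i \<inter> A j" by (auto simp: disjnt_def)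
    then have "z i j \<in> A i \<inter> A j" unfolding z_def by (rule someI_ex)
    then show ?thesis by simp
  qed
  define ZZ where "ZZ = {z i j | i j. i < T \<and> j < T \<and> i \<noteq> j}"
  define bl where "bl w = {i \<in> {..<T}. w \<in> A i}" for w
  define SS where "SS = bl ` ZZ"
  define y where "y = inv_into ZZ bl"
  have y: "y S \<in> ZZ" "bl (y S) = S" if "S \<in> SS" for S
    using that f_inv_into_f[of S bl ZZ] inv_into_into[of S bl ZZ] unfolding SS_def y_def by simp_all
  have ZV: "w \<in> {1..n}" if "w \<in> ZZ" for w
  proof -
    obtain i j where "w = z i j" "i < T" "j < T" "i \<noteq> j" using \<open>w \<in> ZZ\<close> unfolding ZZ_def by blast
    then have "w \<in> A i" "A i \<in> ksets n k" using z A F(1) by auto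
    then show ?thesis using ksetsD by blast
  qed
  have "proper_cover {..<T} SS"
    unfolding proper_cover_def
  proof (intro conjI ballI impI)
    fix S assume S: "S \<in> SS"
    then obtain i j where w: "bl (z i j) = S" "i < T" "j < T" "i \<noteq> j" "z i j \<in> ZZ" unfolding SS_def ZZ_def by blast
    have "{i, j} \<subseteq> S" using z[OF w(2-4)] w by (auto simp: bl_def)
    moreover have "finite S" using w(1) by (auto simp: bl_def)
    ultimately have "card {i, j} \<le> card S" by (rule card_mono[rotated])
    then show "2 \<le> card S" using w by simp
    obtain B where B: "B \<in> F" "z i j \<notin> B" using F(4)[OF ZV[OF w(5)]] by blast
    then obtain m where "m < T" "A m = B" using A(2) by auto
    then have "m \<notin> S" using B w by (auto simp: bl_def)
    then show "S \<subset> {..<T}" using w(1) \<open>m < T\<close> by (auto simp: bl_def)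
  next
    fix i j assume "i \<in> {..<T}" "j \<in> {..<T}" "i \<noteq> j"
    then have ij: "i < T" "j < T" "i \<noteq> j" by auto
    have "i \<in> bl (z i j)" "j \<in> bl (z i j)" using z[OF ij] ij by (auto simp: bl_def)
    moreover have "bl (z i j) \<in> SS" using ij unfolding SS_def ZZ_def by blast
    ultimately show "\<exists>S\<in>SS. i \<in> S \<and> j \<in> S" by blast
  qed
  moreover have "realizes n k T SS F"
    unfolding realizes_def
  proof (intro exI conjI ballI)
    show "inj_on A {..<T}" "A ` {..<T} = F" "F \<subseteq> ksets n k" by fact+
    show "inj_on y SS" using y(2) by (metis inj_onI)
    fix S assume S: "S \<in> SS"
    show "y S \<in> {1..n}" by (rule ZV[OF y(1)[OF S]])
    fix i assume "i \<in> S"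
    then have "i \<in> bl (y S)" using y(2)[OF S] by simp
    then show "y S \<in> A i" by (simp add: bl_def)
  qed
  ultimately show ?thesis by blast
qed

text \<open>The pattern of four edges any three of which share a vertex, with four different
  vertices.\<close>

definition triples4 :: "nat set set" where "triples4 = (\<lambda>i. {..<4} - {i}) ` {..<4}"

text \<open>Pass to a minimal subfamily without a common vertex. By minimality each member
  \<open>B\<close> has a vertex that lies in all other members but not in \<open>B\<close>, so four
  members would realize \<open>triples4\<close>. Hence at most three remain, and other members of
  \<open>F\<close> can be added back up to size \<open>T\<close>.\<close>

lemma nontrivial_subclique:
  assumes F: "F \<subseteq> ksets n k" "\<And>x. x \<in> {1..n} \<Longrightarrow> \<exists>A\<in>F. x \<notin> A" and T: "3 \<le> T" "T \<le> card F"
    and no: "\<not> (\<exists>F'\<subseteq>F. realizes n k 4 triples4 F')"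
  shows "\<exists>F'\<subseteq>F. card F' = T \<and> (\<forall>x\<in>{1..n}. \<exists>A\<in>F'. x \<notin> A)"
proof -
  have finF: "finite F" using F(1) finite_subset by blast
  let ?P = "\<lambda>G. G \<subseteq> F \<and> (\<forall>x\<in>{1..n}. \<exists>A\<in>G. x \<notin> A)"
  have "?P F" using F(2) by blast
  then obtain G where G: "?P G" "\<And>G'. ?P G' \<Longrightarrow> card G \<le> card G'"
    using ex_has_least_nat[of ?P F card] by blast
  have finG: "finite G" using G finF finite_subset by blast
  have "card G \<le> T"
  proof (rule ccontr)
    assume "\<not> card G \<le> T"
    then have "4 \<le> card G" using T by simp
    then obtain Q where Q: "Q \<subseteq> G" "card Q = 4" "finite Q" using obtain_subset_with_card_n by metis
    have ex: "\<exists>y\<in>{1..n}. y \<notin> B \<and> (\<forall>A\<in>G. A \<noteq> B \<longrightarrow> y \<in> A)" if B: "B \<in> G" for B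
    proof -
      have "card (G - {B}) < card G" using B finG by (rule card_Diff1_less[rotated])
      then have "\<not> ?P (G - {B})" using G(2)[of "G - {B}"] by linarith
      then obtain y where y: "y \<in> {1..n}" "\<forall>A\<in>G - {B}. y \<in> A" using G(1) by blast
      moreover have "y \<notin> B" using G(1) y by blast
      ultimately show ?thesis by blast
    qed
    define yv where "yv B = (SOME y. y \<in> {1..n} \<and> y \<notin> B \<and> (\<forall>A\<in>G. A \<noteq> B \<longrightarrow> y \<in> A))" for B
    have yv: "yv B \<in> {1..n} \<and> yv B \<notin> B \<and> (\<forall>A\<in>G. A \<noteq> B \<longrightarrow> yv B \<in> A)" if "B \<in> G" for B
      unfolding yv_def by (rule someI_ex) (use ex[OF that] in blast)
    obtain A where "bij_betw A {0..<card Q} Q" using ex_bij_betw_nat_finite[OF Q(3)] by blast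
    then have A: "inj_on A {..<4}" "A ` {..<4} = Q" using Q(2) by (auto simp: bij_betw_def atLeast0LessThan)
    have AG: "A i \<in> G" if "i < 4" for i using that A Q by auto
    let ?g = "\<lambda>i::nat. {..<4} - {i}"
    define y where "y S = yv (A (inv_into {..<4} ?g S))" for S
    have ginj: "inj_on ?g {..<4}"
    proof (rule inj_onI)
      fix i j :: nat assume "i \<in> {..<4}" "j \<in> {..<4}" "?g i = ?g j"
      then show "i = j" by blast
    qed
    have yS: "y (?g i) = yv (A i)" if "i < 4" for i unfolding y_def using inv_into_f_f[OF ginj, of i] that by simp
    have "realizes n k 4 triples4 Q"
      unfolding realizes_def
    proof (intro exI[of _ A] exI[of _ y] conjI ballI)
      show "inj_on A {..<4}" "A ` {..<4} = Q" by fact+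
      show "Q \<subseteq> ksets n k" using Q G F by blast
      show "inj_on y triples4"
      proof (rule inj_onI)
        fix S S' assume "S \<in> triples4" "S' \<in> triples4" "y S = y S'"
        then obtain i j where ij: "i < 4" "j < 4" "S = ?g i" "S' = ?g j" "yv (A i) = yv (A j)"
          unfolding triples4_def using yS by auto
        have "A i = A j"
        proof (rule ccontr)
          assume "A i \<noteq> A j"
          then have "yv (A j) \<in> A i" using yv[OF AG[OF ij(2)]] AG[OF ij(1)] by blast
          then show False using yv[OF AG[OF ij(1)]] ij(5) by simp
        qed
        then have "i = j" using A(1) ij by (auto simp: inj_on_def)
        then show "S = S'" using ij by simp
      qed
    next
      fix S assume "S \<in> triples4"
      then obtain i where i: "i < 4" "S = ?g i" unfolding triples4_def by auto
      show "y S \<in> {1..n}" using yv[OF AG[OF i(1)]] yS[OF i(1)] i by simp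
      fix j assume "j \<in> S"
      then have j: "j < 4" "j \<noteq> i" using i by auto
      then have "A j \<noteq> A i" using A(1) i by (auto simp: inj_on_def)
      then show "y S \<in> A j" using yv[OF AG[OF i(1)]] yS[OF i(1)] i AG[OF j(1)] by simp
    qed
    then show False using no Q G by blast
  qed
  then obtain F' where F': "G \<subseteq> F'" "F' \<subseteq> F" "card F' = T"
    using exists_subset_between[OF _ T(2) conjunct1[OF G(1)] finF] by blast
  have "\<forall>x\<in>{1..n}. \<exists>A\<in>F'. x \<notin> A"
  proof
    fix x assume "x \<in> {1..n}"
    with conjunct2[OF G(1)] have "\<exists>A\<in>G. x \<notin> A" by (rule bspec)
    then obtain A where "A \<in> G" "x \<notin> A" by (rule bexE)
    from subsetD[OF F'(1) this(1)] this(2) show "\<exists>A\<in>F'. x \<notin> A" by (rule bexI[rotated])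
  qed
  with F'(2,3) show ?thesis by (intro exI conjI)
qed

section \<open>How many edges of a star a spread-out family blocks\<close>

lemma bonferroni_card:
  assumes "finite G" "\<And>B. B \<in> G \<Longrightarrow> finite (S B)" "\<And>B. B \<in> G \<Longrightarrow> a \<le> real (card (S B))"
    and "\<And>B C. B \<in> G \<Longrightarrow> C \<in> G \<Longrightarrow> B \<noteq> C \<Longrightarrow> real (card (S B \<inter> S C)) \<le> b"
  shows "real (card G) * a - (real (card G))\<^sup>2 / 2 * b \<le> real (card (\<Union>B\<in>G. S B)) \<or> b < 0"
proof (cases "b < 0")
  case False
  then have b: "0 \<le> b" by simp
  have "real (card G) * a - (real (card G))\<^sup>2 / 2 * b \<le> real (card (\<Union>B\<in>G. S B))"
    using assms
  proof (induction G rule: finite_induct)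
    case (insert B G)
    let ?U = "\<Union>B\<in>G. S B" and ?g = "real (card G)"
    have fU: "finite ?U" using insert by auto
    have "card (S B) + card ?U = card (S B \<union> ?U) + card (S B \<inter> ?U)" using insert fU by (intro card_Un_Int) auto
    then have "real (card (S B)) + real (card ?U) = real (card (S B \<union> ?U)) + real (card (S B \<inter> ?U))" by (metis of_nat_add)
    moreover have "real (card (S B \<inter> ?U)) \<le> ?g * b"
    proof -
      have "S B \<inter> ?U = (\<Union>C\<in>G. S B \<inter> S C)" by auto
      then have "card (S B \<inter> ?U) = card (\<Union>C\<in>G. S B \<inter> S C)" by (rule arg_cong)
      also have "\<dots> \<le> (\<Sum>C\<in>G. card (S B \<inter> S C))" by (rule card_UN_le[OF insert.hyps(1)])
      finally have "real (card (S B \<inter> ?U)) \<le> real (\<Sum>C\<in>G. card (S B \<inter> S C))" by (rule of_nat_mono)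
      also have "\<dots> = (\<Sum>C\<in>G. real (card (S B \<inter> S C)))" by (rule of_nat_sum)
      also have "\<dots> \<le> (\<Sum>C\<in>G. b)" using insert by (intro sum_mono) auto
      finally show ?thesis by simp
    qed
    moreover have "a \<le> real (card (S B))" using insert by simp
    moreover have "?g * a - ?g\<^sup>2 / 2 * b \<le> real (card ?U)" using insert by simp
    ultimately have "?g * a - ?g\<^sup>2 / 2 * b + a - ?g * b \<le> real (card (S B \<union> ?U))" by linarith
    moreover have "(?g + 1) * a - (?g + 1)\<^sup>2 / 2 * b \<le> ?g * a - ?g\<^sup>2 / 2 * b + a - ?g * b"
      using b by (simp add: field_simps power2_eq_square)
    moreover have "real (card (insert B G)) = ?g + 1" using insert by simp
    ultimately show ?case by simp
  qed simp
  then show ?thesis by simp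
qed simp

text \<open>Each chosen element excludes only itself and at most \<open>lam\<close> others.\<close>

lemma greedy_independent:
  assumes "finite G" "\<And>B. B \<in> G \<Longrightarrow> card {C \<in> G. C \<noteq> B \<and> R B C} \<le> lam" "u = 0 \<or> (u - 1) * (1 + lam) < card G"
    and sym: "\<And>B C. R B C \<Longrightarrow> R C B"
  shows "\<exists>G'\<subseteq>G. card G' = u \<and> (\<forall>B\<in>G'. \<forall>C\<in>G'. B \<noteq> C \<longrightarrow> \<not> R B C)"
  using assms(3)
proof (induction u)
  case 0
  show ?case by (intro exI[of _ "{}"]) auto
next
  case (Suc u)
  have "u = 0 \<or> (u - 1) * (1 + lam) < card G"
  proof (cases u)
    case (Suc v)
    have "v * (1 + lam) \<le> u * (1 + lam)" using Suc by simp
    then show ?thesis using Suc \<open>Suc u = 0 \<or> (Suc u - 1) * (1 + lam) < card G\<close> by auto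
  qed simp
  from Suc.IH[OF this] obtain G' where G': "G' \<subseteq> G" "card G' = u" "\<forall>B\<in>G'. \<forall>C\<in>G'. B \<noteq> C \<longrightarrow> \<not> R B C" by (elim exE conjE)
  have fG': "finite G'" using G'(1) assms(1) by (rule finite_subset)
  let ?N = "\<Union>B\<in>G'. insert B {C \<in> G. C \<noteq> B \<and> R B C}"
  have "card ?N \<le> (\<Sum>B\<in>G'. card (insert B {C \<in> G. C \<noteq> B \<and> R B C}))" using fG' by (rule card_UN_le)
  also have "\<dots> \<le> (\<Sum>B\<in>G'. 1 + lam)"
  proof (rule sum_mono)
    fix B assume "B \<in> G'"
    then have "card {C \<in> G. C \<noteq> B \<and> R B C} \<le> lam" using G'(1) by (intro assms(2)) auto
    then show "card (insert B {C \<in> G. C \<noteq> B \<and> R B C}) \<le> 1 + lam" using assms(1) by (simp add: card_insert_if)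
  qed
  also have "\<dots> = u * (1 + lam)" using G' by simp
  finally have "card ?N < card G" using Suc.prems by simp
  then have "\<not> G \<subseteq> ?N" using fG' assms(1) card_mono[of ?N G] by auto
  then obtain D where D: "D \<in> G" "D \<notin> ?N" by blast
  have "D \<notin> G'" using D by auto
  then have "card (insert D G') = Suc u" using fG' G' by simp
  moreover have "insert D G' \<subseteq> G" using D G' by simp
  moreover have "\<not> R D C" "\<not> R C D" if "C \<in> G'" for C
  proof -
    have "D \<notin> {E \<in> G. E \<noteq> C \<and> R C E}" "D \<noteq> C" using D(2) that by auto
    then show "\<not> R C D" using D(1) by simp
    then show "\<not> R D C" using sym[of D C] by metis
  qed
  ultimately show ?case using G'(3) by (intro exI[of _ "insert D G'"]) auto
qed

text \<open>For a fixed \<open>B\<close> the other edges are independent of the presence of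
  \<open>B\<close>, so a binomial tail bounds the number of those with a large intersection; summing
  over \<open>B\<close> gives the factor \<open>mbar n k p\<close>.\<close>

lemma prob_many_large_intersections:
  fixes n k :: nat and p :: real
  assumes kn: "0 < k" "2 * k < n" and p01: "0 \<le> p" "p \<le> 1"
  shows "Prs (ksets n k) p (\<lambda>H. \<exists>B\<in>H. j \<le> card {C \<in> H. C \<noteq> B \<and> m0 \<le> card (B \<inter> C)})
    \<le> mbar n k p * ((mbar n k p * (((real k)\<^sup>2 / real n) ^ m0 / fact m0)) ^ j / fact j)"
proof -
  let ?K = "ksets n k" and ?N = "real (n choose k)" and ?x = "((real k)\<^sup>2 / real n) ^ m0 / fact m0"
  let ?S = "\<lambda>B. {C \<in> ?K. C \<noteq> B \<and> m0 \<le> card (B \<inter> C)}"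
  have m0: "0 \<le> mbar n k p" by (rule mbar_nonneg) (use kn p01 in auto)
  have "Prs ?K p (\<lambda>H. \<exists>B\<in>H. j \<le> card {C \<in> H. C \<noteq> B \<and> m0 \<le> card (B \<inter> C)}) \<le>
     Prs ?K p (\<lambda>H. \<exists>B\<in>?K. {B} \<subseteq> H \<inter> {B} \<and> j \<le> card (H \<inter> ?S B))"
  proof (rule Prs_mono)
    fix H assume H: "H \<subseteq> ?K" "\<exists>B\<in>H. j \<le> card {C \<in> H. C \<noteq> B \<and> m0 \<le> card (B \<inter> C)}"
    from H(2) obtain B where B: "B \<in> H" "j \<le> card {C \<in> H. C \<noteq> B \<and> m0 \<le> card (B \<inter> C)}" by (elim bexE)
    have "{C \<in> H. C \<noteq> B \<and> m0 \<le> card (B \<inter> C)} = H \<inter> ?S B" using H by auto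
    then have "{B} \<subseteq> H \<inter> {B} \<and> j \<le> card (H \<inter> ?S B)" using B by simp
    moreover have "B \<in> ?K" using B(1) H(1) by (rule subsetD[rotated])
    ultimately show "\<exists>B\<in>?K. {B} \<subseteq> H \<inter> {B} \<and> j \<le> card (H \<inter> ?S B)" by (rule bexI)
  qed
  also have "\<dots> \<le> (\<Sum>B\<in>?K. Prs ?K p (\<lambda>H. {B} \<subseteq> H \<inter> {B} \<and> j \<le> card (H \<inter> ?S B)))" by (rule Prs_Bex) auto
  also have "\<dots> \<le> (\<Sum>B\<in>?K. p * ((mbar n k p * ?x) ^ j / fact j))"
  proof (rule sum_mono)
    fix B assume B: "B \<in> ?K"
    have "Prs ?K p (\<lambda>H. {B} \<subseteq> H \<inter> {B} \<and> j \<le> card (H \<inter> ?S B)) = Prs {B} p (\<lambda>X. {B} \<subseteq> X) * Prs (?S B) p (\<lambda>X. j \<le> card X)"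
      by (rule Prs_indep) (use B in auto)
    also have "Prs {B} p (\<lambda>X. {B} \<subseteq> X) = p" using Prs_superset[of "{B}" "{B}" p] p01 by simp
    also have "Prs (?S B) p (\<lambda>X. j \<le> card X) = Prs (?S B) p (\<lambda>X. j \<le> card (X \<inter> ?S B))"
      by (rule Prs_cong) (simp add: Int_absorb2)
    also have "\<dots> \<le> (real (card (?S B)) * p) ^ j / fact j" by (rule Prs_card_Int_ge) (use p01 in auto)
    also have "\<dots> \<le> (mbar n k p * ?x) ^ j / fact j"
    proof (intro divide_right_mono power_mono)
      have "card (?S B) \<le> card {C \<in> ?K. m0 \<le> card (B \<inter> C)}" by (intro card_mono) auto
      then have "real (card (?S B)) \<le> real (card {C \<in> ?K. m0 \<le> card (B \<inter> C)})" by (rule of_nat_mono)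
      also have "\<dots> \<le> ?N * ?x" by (rule card_large_intersection_le) (use kn p01 B in auto)
      finally have "real (card (?S B)) * p \<le> ?N * ?x * p" using p01(1) by (rule mult_right_mono)
      then show "real (card (?S B)) * p \<le> mbar n k p * ?x" using kn by (simp add: mbar_eq mult_ac)
    qed (use p01 in auto)
    finally show "Prs ?K p (\<lambda>H. {B} \<subseteq> H \<inter> {B} \<and> j \<le> card (H \<inter> ?S B)) \<le> p * ((mbar n k p * ?x) ^ j / fact j)"
      using p01 by (simp add: mult_left_mono)
  qed
  also have "\<dots> = mbar n k p * ((mbar n k p * ?x) ^ j / fact j)" using kn by (simp add: card_ksets mbar_eq mult_ac)
  finally show ?thesis .
qed

lemma card_star_disjoint:
  assumes "x \<in> {1..n}" "0 < k" "B \<subseteq> {1..n}" "x \<notin> B"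
  shows "card {A \<in> kstar n k x. A \<inter> B = {}} = (n - 1 - card B) choose (k - 1)"
proof -
  have fB: "finite B" using assms(3) by (rule finite_subset) auto
  have "{A \<in> kstar n k x. A \<inter> B = {}} = {A. A \<subseteq> {1..n} - B \<and> card A = k \<and> {x} \<subseteq> A}"
    by (auto simp: kstar_def ksets_def)
  also have "card \<dots> = (card ({1..n} - B) - card {x}) choose (k - card {x})"
    by (rule card_subsets_superset) (use assms in auto)
  also have "card ({1..n} - B) = n - card B" using assms fB by (simp add: card_Diff_subset)
  finally show ?thesis by simp
qed

lemma exp_neg_le_1_minus: "0 \<le> x \<Longrightarrow> x < 1 \<Longrightarrow> exp (- (x / (1 - x))) \<le> 1 - (x::real)"
proof -
  assume x: "0 \<le> x" "x < 1"
  have "1 / (1 - x) = 1 + x / (1 - x)" using x by (simp add: field_simps)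
  also have "\<dots> \<le> exp (x / (1 - x))" by (rule exp_ge_add_one_self)
  finally have "1 / (1 - x) \<le> exp (x / (1 - x))" .
  then have "1 \<le> exp (x / (1 - x)) * (1 - x)" using x by (simp add: field_simps)
  then have "exp (- (x / (1 - x))) * 1 \<le> exp (- (x / (1 - x))) * (exp (x / (1 - x)) * (1 - x))" by (intro mult_left_mono) auto
  then show ?thesis by (simp add: mult.assoc[symmetric] exp_add[symmetric])
qed

lemma dprob_ge_exp: 
  assumes "2 * k < n" 
  shows "exp (- ((real k)\<^sup>2 / (real n - 2 * real k))) \<le> dprob n k"
proof -
  let ?x = "real k / real (n - k)"
  have x: "0 \<le> ?x" "?x < 1" using assms by auto
  have "1 - ?x = (real n - 2 * real k) / real (n - k)" using assms by (simp add: of_nat_diff field_simps)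
  then have e: "?x / (1 - ?x) = real k / (real n - 2 * real k)" using assms by simp
  have "exp (- ((real k)\<^sup>2 / (real n - 2 * real k))) = exp (- (?x / (1 - ?x))) ^ k"
    unfolding e by (simp add: exp_of_nat_mult[symmetric] power2_eq_square)
  also have "\<dots> \<le> (1 - ?x) ^ k" using exp_neg_le_1_minus[OF x] by (intro power_mono) auto
  also have "\<dots> \<le> dprob n k" by (rule dprob_ge[OF assms])
  finally show ?thesis .
qed

text \<open>Bonferroni: each member of \<open>G\<close> blocks at least a fraction \<open>r\<close>
  of the star, and two members jointly at most \<open>2 * r^2\<close>, since their union has nearly
  \<open>2 * k\<close> elements. With several members the bound \<open>card G * r \<le> 1/2\<close>
  keeps the pair term at half of the main term; a single member has no pair term and allows every
  \<open>r\<close>.\<close>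

lemma card_miss_ge:
  fixes n k :: nat
  assumes kn: "0 < k" "2 * k < n" and x: "x \<in> {1..n}"
    and G: "G \<subseteq> ksets n k" "\<And>A. A \<in> G \<Longrightarrow> x \<notin> A" "\<And>A B. A \<in> G \<Longrightarrow> B \<in> G \<Longrightarrow> A \<noteq> B \<Longrightarrow> card (A \<inter> B) < m0"
    and num: "2 * real k + real m0 * real k + 4 * (real k)^3 / (real n - 2 * real k) \<le> real n / 2"
    and u: "card G = 1 \<or> real (card G) * dprob n k \<le> 1/2" "card G \<noteq> 0"
  shows "real ((n - 1) choose (k - 1)) * (real (card G) * dprob n k / 2) \<le> real (card (miss n k x G))"
proof -
  let ?D = "(n - 1) choose (k - 1)" and ?r = "dprob n k" and ?u = "real (card G)"
  let ?S = "\<lambda>B. {A \<in> kstar n k x. A \<inter> B = {}}"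
  have finG: "finite G" using G(1) finite_subset by blast
  have D0: "0 < real ?D" using kn by simp
  have r0: "0 < ?r" using dprob_pos kn by simp
  have BV: "B \<subseteq> {1..n}" "card B = k" "finite B" "x \<notin> B" if "B \<in> G" for B using that G ksetsD[of B n k] by auto
  have mU: "miss n k x G = (\<Union>B\<in>G. ?S B)" by (auto simp: miss_def)
  have s1: "real ?D * ?r \<le> real (card (?S B))" if B: "B \<in> G" for B
  proof -
    have c: "card (?S B) = (n - 1 - k) choose (k - 1)" using card_star_disjoint[OF x kn(1), of B] BV[OF B] by simp
    have "k * ((n - k) choose k) = (n - k) * ((n - k - 1) choose (k - 1))" by (rule times_binomial_minus1_eq) (use kn in auto)
    then have e1: "real k * real ((n - k) choose k) = real (n - k) * real ((n - k - 1) choose (k - 1))"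
      by (simp only: of_nat_mult[symmetric])
    have "k * (n choose k) = n * ((n - 1) choose (k - 1))" by (rule times_binomial_minus1_eq) (use kn in auto)
    then have e2: "real k * real (n choose k) = real n * real ?D" by (simp only: of_nat_mult[symmetric])
    note e = e1 e2
    have "?r = (real k * real ((n - k) choose k)) / (real k * real (n choose k))" using kn by (simp add: dprob_def)
    also have "\<dots> = (real (n - k) * real ((n - k - 1) choose (k - 1))) / (real n * real ?D)" by (simp only: e)
    finally have "real ?D * ?r = real ((n - k - 1) choose (k - 1)) * (real (n - k) / real n)" using kn D0 by (simp add: field_simps)
    also have "\<dots> \<le> real ((n - k - 1) choose (k - 1)) * 1" using kn by (intro mult_left_mono) auto
    also have "n - k - 1 = n - 1 - k" by simp
    finally show ?thesis using c by simp
  qed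
  have s2: "real (card (?S B \<inter> ?S C)) \<le> real ?D * (2 * ?r\<^sup>2)" if BC: "B \<in> G" "C \<in> G" "B \<noteq> C" for B C
  proof -
    let ?b = "card (B \<union> C)"
    have "?S B \<inter> ?S C = {A \<in> kstar n k x. A \<inter> (B \<union> C) = {}}" by auto
    then have c: "card (?S B \<inter> ?S C) = (n - 1 - ?b) choose (k - 1)"
      using card_star_disjoint[OF x kn(1), of "B \<union> C"] BV[OF BC(1)] BV[OF BC(2)] by simp
    have "card B + card C = ?b + card (B \<inter> C)" by (rule card_Un_Int) (use BV BC in auto)
    then have b: "2 * k \<le> ?b + m0" using BV BC G(3)[OF BC] by simp
    have bn: "?b \<le> n - 1"
    proof -
      have "B \<union> C \<subseteq> {1..n} - {x}" using BV[OF BC(1)] BV[OF BC(2)] by auto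
      then have "?b \<le> card ({1..n} - {x})" by (intro card_mono) auto
      then show ?thesis using x by simp
    qed
    have n1: "0 < n - 1" using kn by simp
    have "real ((n - 1 - ?b) choose (k - 1)) \<le> (real (n - 1 - ?b) / real (n - 1)) ^ (k - 1) * real ?D"
      by (rule binomial_le_power_mult) (use n1 in auto)
    also have "\<dots> \<le> exp (- (real ?b * (real k - 1) / real n)) * real ?D"
    proof (rule mult_right_mono)
      have "real (n - 1 - ?b) / real (n - 1) = 1 - real ?b / real (n - 1)" using bn n1 by (simp add: of_nat_diff field_simps)
      also have "\<dots> \<le> 1 - real ?b / real n" using n1 by (simp add: frac_le)
      also have "\<dots> \<le> exp (- (real ?b / real n))" using exp_ge_add_one_self[of "- (real ?b / real n)"] by simp
      finally have "(real (n - 1 - ?b) / real (n - 1)) ^ (k - 1) \<le> exp (- (real ?b / real n)) ^ (k - 1)" by (intro power_mono) auto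
      also have "\<dots> = exp (- (real ?b * (real k - 1) / real n))" using kn by (simp add: exp_of_nat_mult[symmetric] of_nat_diff mult_ac)
      finally show "(real (n - 1 - ?b) / real (n - 1)) ^ (k - 1) \<le> exp (- (real ?b * (real k - 1) / real n))" .
    qed auto
    also have "exp (- (real ?b * (real k - 1) / real n)) \<le> 2 * ?r\<^sup>2"
    proof -
      let ?d = "real n - 2 * real k"
      have d0: "0 < ?d" "0 < real n" using kn by auto
      have "(2 * real k - real m0) * (real k - 1) \<le> real ?b * (real k - 1)"
        using b kn by (intro mult_right_mono) auto
      moreover have "2 * (real k)\<^sup>2 - (2 * real k + real m0 * real k) \<le> (2 * real k - real m0) * (real k - 1)"
        by (simp add: algebra_simps power2_eq_square)
      ultimately have "2 * (real k)\<^sup>2 - (2 * real k + real m0 * real k) \<le> real ?b * (real k - 1)" by linarith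
      then have "2 * (real k)\<^sup>2 / real n - (2 * real k + real m0 * real k) / real n \<le> real ?b * (real k - 1) / real n"
        using d0 by (simp add: diff_divide_distrib[symmetric] divide_right_mono)
      moreover have "2 * (real k)\<^sup>2 / real n = 2 * ((real k)\<^sup>2 / ?d) - (4 * (real k)^3 / ?d) / real n"
      proof -
        define d where "d = ?d"
        have "0 < d" using d0 by (simp add: d_def)
        have e: "2 * (real k)\<^sup>2 * d = 2 * (real k)\<^sup>2 * real n - 4 * (real k)^3"
          by (simp add: d_def algebra_simps power2_eq_square power3_eq_cube)
        have "2 * ((real k)\<^sup>2 / d) - (4 * (real k)^3 / d) / real n = (2 * (real k)\<^sup>2 * real n - 4 * (real k)^3) / (d * real n)"
          using \<open>0 < d\<close> d0 by (simp add: field_simps)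
        also have "\<dots> = 2 * (real k)\<^sup>2 / real n" unfolding e[symmetric] using \<open>0 < d\<close> by simp
        finally show ?thesis by (simp add: d_def)
      qed
      \<comment> \<open>The hypothesis \<open>num\<close> is exactly what limits the total
        correction in the exponent to 1/2; then \<open>exp (1/2) \<le> 2\<close> accounts for the
        factor 2 in front of \<open>r^2\<close>.\<close>
      moreover have "(2 * real k + real m0 * real k) / real n + (4 * (real k)^3 / ?d) / real n \<le> 1/2"
      proof -
        have "(2 * real k + real m0 * real k + 4 * (real k)^3 / ?d) / real n \<le> (real n / 2) / real n"
          using num d0 by (intro divide_right_mono) auto
        moreover have "(real n / 2) / real n = 1 / 2" using d0 by simp
        ultimately show ?thesis unfolding add_divide_distrib by linarith
      qed
      ultimately have "2 * ((real k)\<^sup>2 / ?d) - 1/2 \<le> real ?b * (real k - 1) / real n" by linarith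
      then have "exp (- (real ?b * (real k - 1) / real n)) \<le> exp (1/2 - 2 * ((real k)\<^sup>2 / ?d))" by simp
      also have "\<dots> = exp (1/2) * (exp (- ((real k)\<^sup>2 / ?d)))\<^sup>2"
      proof -
        have e: "exp (1/2 - 2 * y) = exp (1/2) * (exp (- y))\<^sup>2" for y :: real
        proof -
          have "exp (1/2 - 2 * y) = exp (1/2 + (- y + - y))" by simp
          then show ?thesis by (simp only: exp_add power2_eq_square)
        qed
        show ?thesis by (rule e)
      qed
      also have "\<dots> \<le> 2 * ?r\<^sup>2"
      proof (rule mult_mono)
        have "exp (1/2::real) * exp (1/2) = exp 1" by (simp only: exp_add[symmetric]) simp
        then have "(exp (1/2::real))\<^sup>2 \<le> 2\<^sup>2" using exp_le by (simp add: power2_eq_square)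
        then show "exp (1/2::real) \<le> 2" by (rule power2_le_imp_le) simp
        show "(exp (- ((real k)\<^sup>2 / ?d)))\<^sup>2 \<le> ?r\<^sup>2" by (rule power_mono[OF dprob_ge_exp[OF kn(2)]]) simp
      qed auto
      finally show ?thesis .
    qed
    finally show ?thesis using c D0 by (simp add: mult.commute mult_right_mono)
  qed
  show ?thesis
  proof (cases "card G = 1")
    case True
    then obtain B where "G = {B}" by (auto simp: card_1_singleton_iff)
    then have "real ?D * ?r \<le> real (card (miss n k x G))" using s1[of B] mU by simp
    moreover have "real ?D * (?u * ?r / 2) \<le> real ?D * ?r" using True D0 r0 by simp
    ultimately show ?thesis by linarith
  next
    case False
    then have u2: "?u * ?r \<le> 1/2" using u by simp
    have "?u * (real ?D * ?r) - ?u\<^sup>2 / 2 * (real ?D * (2 * ?r\<^sup>2)) \<le> real (card (\<Union>B\<in>G. ?S B)) \<or> real ?D * (2 * ?r\<^sup>2) < 0"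
      by (rule bonferroni_card) (use finG s1 s2 in auto)
    moreover have "\<not> real ?D * (2 * ?r\<^sup>2) < 0" by (simp add: not_less)
    ultimately have "?u * (real ?D * ?r) - ?u\<^sup>2 / 2 * (real ?D * (2 * ?r\<^sup>2)) \<le> real (card (miss n k x G))" using mU by simp
    moreover have "real ?D * (?u * ?r / 2) \<le> ?u * (real ?D * ?r) - ?u\<^sup>2 / 2 * (real ?D * (2 * ?r\<^sup>2))"
    proof -
      have "(?u * ?r) * (?u * ?r) \<le> (?u * ?r) * (1/2)" using u2 r0 by (intro mult_left_mono) auto
      then have "real ?D * ((?u * ?r) * (?u * ?r)) \<le> real ?D * ((?u * ?r) * (1/2))" by (rule mult_left_mono[OF _ less_imp_le[OF D0]])
      then show ?thesis by (simp add: power2_eq_square algebra_simps)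
    qed
    ultimately show ?thesis by linarith
  qed
qed

text \<open>For fixed \<open>x\<close> and \<open>G\<close> the edges in \<open>miss n k x G\<close>
  are independent of those in \<open>G\<close>. Their expected number is at least
  \<open>u * r * phi / 2\<close> by \<open>card_miss_ge\<close>; Chernoff at half of this is
  followed by a union bound over all \<open>x\<close> and \<open>G\<close>.\<close>

lemma prob_few_misses:
  fixes n k :: nat and p :: real
  assumes kn: "0 < k" "2 * k < n" and p01: "0 < p" "p \<le> 1"
    and num: "2 * real k + real m0 * real k + 4 * (real k)^3 / (real n - 2 * real k) \<le> real n / 2"
    and u: "u = 1 \<or> real u * dprob n k \<le> 1/2" "u \<noteq> 0"
  shows "Prs (ksets n k) p (\<lambda>H. \<exists>x\<in>{1..n}. \<exists>G\<subseteq>H. card G = u \<and> (\<forall>A\<in>G. x \<notin> A) \<and>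
      (\<forall>A\<in>G. \<forall>B\<in>G. A \<noteq> B \<longrightarrow> card (A \<inter> B) < m0) \<and> real (card (H \<inter> miss n k x G)) \<le> real u * dprob n k * phi n k p / 4)
    \<le> real n * (mbar n k p ^ u * exp (- (real u * dprob n k * phi n k p / 16)))"
proof -
  let ?K = "ksets n k" and ?D = "(n - 1) choose (k - 1)"
  define mu where "mu = real u * dprob n k * phi n k p / 2"
  have mu0: "0 < mu" using dprob_pos[OF kn(2)] p01 kn u by (simp add: mu_def phi_def)
  let ?E = "\<lambda>x G H. G \<subseteq> H \<and> real (card (H \<inter> miss n k x G)) \<le> mu / 2"
  let ?GG = "\<lambda>x. {G. G \<subseteq> ?K - kstar n k x \<and> card G = u \<and> (\<forall>A\<in>G. \<forall>B\<in>G. A \<noteq> B \<longrightarrow> card (A \<inter> B) < m0)}"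
  have fGG: "finite (?GG x)" for x by (auto intro: finite_subset[of _ "Pow ?K"])
  have one: "Prs ?K p (?E x G) \<le> p ^ u * exp (- mu / 8)" if x: "x \<in> {1..n}" and G: "G \<in> ?GG x" for x G
  proof -
    have G': "G \<subseteq> ?K" "\<And>A. A \<in> G \<Longrightarrow> x \<notin> A" "card G = u"
      "\<And>A B. A \<in> G \<Longrightarrow> B \<in> G \<Longrightarrow> A \<noteq> B \<Longrightarrow> card (A \<inter> B) < m0" using G by (auto simp: kstar_def)
    let ?Mi = "miss n k x G"
    have sub: "?Mi \<subseteq> ?K" "?Mi \<inter> G = {}" using miss_subset[of n k x G] G by (auto simp: kstar_def)
    have "Prs ?K p (?E x G) = Prs ?K p (\<lambda>H. G \<subseteq> H \<inter> G \<and> real (card (H \<inter> ?Mi)) \<le> mu / 2)" by (intro Prs_cong) auto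
    also have "\<dots> = Prs G p (\<lambda>X. G \<subseteq> X) * Prs ?Mi p (\<lambda>X. real (card X) \<le> mu / 2)"
      by (rule Prs_indep) (use sub G' in auto)
    also have "Prs G p (\<lambda>X. G \<subseteq> X) = p ^ u" using G' p01 finite_subset[OF G'(1)] by (subst Prs_superset) auto
    also have "Prs ?Mi p (\<lambda>X. real (card X) \<le> mu / 2) = Prs ?K p (\<lambda>H. real (card (H \<inter> ?Mi)) \<le> mu / 2)"
      by (rule Prs_marginal[symmetric]) (use sub in auto)
    also have "\<dots> \<le> exp (- mu / 8)"
    proof (rule Prs_card_Int_lower_tail)
      have "real ?D * (real (card G) * dprob n k / 2) \<le> real (card ?Mi)"
        by (rule card_miss_ge[OF kn x G'(1,2,4) num]) (use u G' in auto)
      then have "real ?D * (real u * dprob n k / 2) * p \<le> real (card ?Mi) * p" using p01 G' by (intro mult_right_mono) auto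
      then show "mu \<le> real (card ?Mi) * p" by (simp add: mu_def phi_def mult_ac)
    qed (use sub p01 mu0 in auto)
    finally show ?thesis using p01 by (simp add: mult_left_mono)
  qed
  have "Prs ?K p (\<lambda>H. \<exists>x\<in>{1..n}. \<exists>G\<subseteq>H. card G = u \<and> (\<forall>A\<in>G. x \<notin> A) \<and>
      (\<forall>A\<in>G. \<forall>B\<in>G. A \<noteq> B \<longrightarrow> card (A \<inter> B) < m0) \<and> real (card (H \<inter> miss n k x G)) \<le> real u * dprob n k * phi n k p / 4)
     \<le> Prs ?K p (\<lambda>H. \<exists>x\<in>{1..n}. \<exists>G\<in>?GG x. ?E x G H)"
  proof (rule Prs_mono)
    fix H assume H: "H \<subseteq> ?K" and "\<exists>x\<in>{1..n}. \<exists>G\<subseteq>H. card G = u \<and> (\<forall>A\<in>G. x \<notin> A) \<and>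
      (\<forall>A\<in>G. \<forall>B\<in>G. A \<noteq> B \<longrightarrow> card (A \<inter> B) < m0) \<and> real (card (H \<inter> miss n k x G)) \<le> real u * dprob n k * phi n k p / 4"
    then obtain x G where xG: "x \<in> {1..n}" "G \<subseteq> H" "card G = u" "\<forall>A\<in>G. x \<notin> A"
      "\<forall>A\<in>G. \<forall>B\<in>G. A \<noteq> B \<longrightarrow> card (A \<inter> B) < m0" "real (card (H \<inter> miss n k x G)) \<le> real u * dprob n k * phi n k p / 4" by blast
    have "G \<in> ?GG x" using xG H by (auto simp: kstar_def)
    moreover have "?E x G H" using xG by (simp add: mu_def)
    ultimately show "\<exists>x\<in>{1..n}. \<exists>G\<in>?GG x. ?E x G H" using xG(1) by blast
  qed
  also have "\<dots> \<le> (\<Sum>x\<in>{1..n}. Prs ?K p (\<lambda>H. \<exists>G\<in>?GG x. ?E x G H))" by (rule Prs_Bex) auto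
  also have "\<dots> \<le> (\<Sum>x\<in>{1..n}. mbar n k p ^ u * exp (- mu / 8))"
  proof (rule sum_mono)
    fix x assume x: "x \<in> {1..n}"
    have "Prs ?K p (\<lambda>H. \<exists>G\<in>?GG x. ?E x G H) \<le> (\<Sum>G\<in>?GG x. Prs ?K p (?E x G))" by (rule Prs_Bex[OF fGG])
    also have "\<dots> \<le> (\<Sum>G\<in>?GG x. p ^ u * exp (- mu / 8))" by (intro sum_mono one x)
    also have "\<dots> = (real (card (?GG x)) * p ^ u) * exp (- mu / 8)" by simp
    also have "\<dots> \<le> mbar n k p ^ u * exp (- mu / 8)"
    proof (rule mult_right_mono)
      have "card (?GG x) \<le> card {G. G \<subseteq> ?K \<and> card G = u}" by (intro card_mono) auto
      then have "real (card (?GG x)) \<le> real ((n choose k) choose u)" by (simp add: n_subsets card_ksets)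
      then have "real (card (?GG x)) * p ^ u \<le> real ((n choose k) choose u) * p ^ u" using p01 by (intro mult_right_mono) auto
      also have "\<dots> \<le> (real (n choose k) * p) ^ u / fact u" using p01 by (intro choose_mult_power_le) auto
      also have "\<dots> \<le> (real (n choose k) * p) ^ u / 1" using p01 by (intro divide_left_mono) (auto simp: fact_ge_1)
      finally show "real (card (?GG x)) * p ^ u \<le> mbar n k p ^ u" using kn by (simp add: mbar_eq mult.commute)
    qed auto
    finally show "Prs ?K p (\<lambda>H. \<exists>G\<in>?GG x. ?E x G H) \<le> mbar n k p ^ u * exp (- mu / 8)" .
  qed
  also have "\<dots> = real n * (mbar n k p ^ u * exp (- (real u * dprob n k * phi n k p / 16)))" by (simp add: mu_def)
  finally show ?thesis .
qed

section \<open>Parameters and regimes\<close>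

text \<open>Exponents with \<open>bb a\<close> much smaller than \<open>dd2 a\<close>, \<open>dd3 a\<close>, \<open>hh a\<close> and \<open>a\<close>, in this order: \<open>dd2\<close> and \<open>dd3\<close>
  delimit the regimes, and \<open>n powr bb a\<close> absorbs constants and powers of \<open>ln n\<close>.\<close>

definition hh :: "real \<Rightarrow> real" where "hh a = a / 20"
definition dd3 :: "real \<Rightarrow> real" where "dd3 a = (hh a)^3 / 2000"
definition dd2 :: "real \<Rightarrow> real" where "dd2 a = dd3 a / 10"
definition bb :: "real \<Rightarrow> real" where "bb a = dd2 a / 10"

text \<open>From here on \<open>n\<close> is fixed and asymptotics become inequalities between
  logarithms. The unit of error is \<open>b * L\<close>: by the three size assumptions it dominates
  \<open>ln L\<close> and the logarithms of \<open>1 / eps\<close>, \<open>1 / a\<close> and every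
  constant up to \<open>10^6\<close>.\<close>

locale base =
  fixes n k :: nat and p eps a :: real
  assumes k2: "2 \<le> k" and kn: "2 * k < n" and kL: "(real k)\<^sup>2 \<le> (1/4 - 2 * a) * real n * ln (real n)"
    and p01: "0 < p" "p \<le> 1" and a01: "0 < a" "a \<le> 1/8" and eps01: "0 < eps" "eps < 1/10"
    and bigA: "ln (ln (real n)) \<le> bb a * ln (real n)"
    and bigB: "ln (10^6 / (eps * a)) \<le> bb a * ln (real n)"
    and bigC: "1000 \<le> ln (real n)"
begin

abbreviation "h \<equiv> hh a"
abbreviation "d3 \<equiv> dd3 a"
abbreviation "d2 \<equiv> dd2 a"
abbreviation "b \<equiv> bb a"
definition L :: real where "L = ln (real n)"
abbreviation "q \<equiv> meet_prob n k"
abbreviation "r \<equiv> dprob n k"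
abbreviation "ph \<equiv> phi n k p"
abbreviation "m \<equiv> mbar n k p"

lemma par: "0 < h" "h \<le> 1/160" "a = 20 * h" "0 < b" "d2 = 10 * b" "d3 = 100 * b" "b * 200000 = h^3" "b \<le> h / 1000000000" "b \<le> h\<^sup>2 / 10000000"
proof -
  show h: "0 < h" "h \<le> 1/160" "a = 20 * h" using a01 by (auto simp: hh_def)
  show "d2 = 10 * b" "d3 = 100 * b" by (auto simp: bb_def dd2_def)
  show e: "b * 200000 = h^3" by (simp add: bb_def dd2_def dd3_def)
  then have e': "b = h^3 / 200000" by simp
  show "0 < b" unfolding e' using h by simp
  have "h * h\<^sup>2 \<le> (1/160) * h\<^sup>2" using h by (intro mult_right_mono) auto
  then have h3: "h^3 \<le> h\<^sup>2 / 160" by (simp add: power3_eq_cube power2_eq_square mult.assoc)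
  then show "b \<le> h\<^sup>2 / 10000000" using e zero_le_power2[of h] by linarith
  have "h * h \<le> (1/160) * h" using h by (intro mult_right_mono) auto
  then have "h\<^sup>2 \<le> h / 160" by (simp add: power2_eq_square)
  then show "b \<le> h / 1000000000" using h3 e h(1) by linarith
qed

lemma Lpos: "1000 \<le> L" "0 < L" "exp L = real n" "0 < real n"
proof -
  show "1000 \<le> L" using bigC by (simp add: L_def)
  then show "0 < L" by simp
  show "0 < real n" using kn by simp
  then show "exp L = real n" by (simp add: L_def)
qed

lemma lnL: "ln L \<le> b * L" using bigA by (simp add: L_def)

lemma lnC: "ln (10^6 / eps) \<le> b * L" "ln (10^6 / a) \<le> b * L" "ln (10^6) \<le> b * L" "- ln eps \<le> b * L" "- ln a \<le> b * L"
proof -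
  have B: "ln (10^6 / (eps * a)) = ln (10^6) - ln eps - ln a" using a01 eps01 by (simp add: ln_div ln_mult)
  have B': "ln (10^6) - ln eps - ln a \<le> b * L" using bigB unfolding B by (simp add: L_def)
  have neg: "ln eps \<le> 0" "ln a \<le> 0" "0 \<le> ln (10^6::real)" using a01 eps01 by auto
  have d: "ln (10^6 / eps) = ln (10^6) - ln eps" "ln (10^6 / a) = ln (10^6) - ln a" using a01 eps01 by (simp_all add: ln_div)
  show "ln (10^6 / eps) \<le> b * L" "ln (10^6 / a) \<le> b * L" "ln (10^6) \<le> b * L" "- ln eps \<le> b * L" "- ln a \<le> b * L"
    using B' neg unfolding d by linarith+
qed

lemma lnc: "0 < c \<Longrightarrow> c \<le> 10^6 \<Longrightarrow> ln (c::real) \<le> b * L"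
  using lnC(3) ln_le_cancel_iff[of c "10^6"] by linarith

lemma bL: "0 < b * L" "b * L \<le> h * L / 1000000000" "h * L \<le> L / 160" "a * L = 20 * (h * L)" "0 < h * L" "b * L \<le> L / 100000000000"
proof -
  show "0 < b * L" "0 < h * L" using par Lpos by auto
  show 1: "b * L \<le> h * L / 1000000000" using mult_right_mono[OF par(8), of L] Lpos by simp
  show 2: "h * L \<le> L / 160" using mult_right_mono[OF par(2), of L] Lpos by simp
  show "a * L = 20 * (h * L)" using par by simp
  show "b * L \<le> L / 100000000000" using 1 2 Lpos by linarith
qed

lemma kpos: "0 < k" "0 < real k" "k \<le> n" using k2 kn by auto

lemma ln_k_le: "ln (real k) \<le> L / 2 + b * L"
proof -
  have "(real k)\<^sup>2 \<le> 1 * real n * ln (real n)"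
    using kL a01 Lpos by (elim order_trans) (intro mult_right_mono, auto simp: L_def)
  then have "(real k)\<^sup>2 \<le> real n * L" by (simp add: L_def)
  then have "ln ((real k)\<^sup>2) \<le> ln (real n * L)" using kpos Lpos by (subst ln_le_cancel_iff) auto
  then have "2 * ln (real k) \<le> L + ln L" using kpos Lpos by (simp add: ln_mult ln_realpow) (simp add: L_def)
  then show ?thesis using lnL bL by linarith
qed

lemma k_le_an: "real k \<le> a * real n" "8 * real k \<le> real n"
proof -
  have "ln (real k) \<le> ln (a * real n)"
  proof -
    have "ln (a * real n) = ln a + L" using a01 Lpos by (simp add: ln_mult L_def)
    then show ?thesis using ln_k_le lnC(5) bL by linarith
  qed
  then show 1: "real k \<le> a * real n" using kpos a01 Lpos by simp
  have "a * real n \<le> 1/8 * real n" using a01 by (intro mult_right_mono) auto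
  then show "8 * real k \<le> real n" using 1 by simp
qed

lemma r01: "0 < r" "r < 1" "q = 1 - r" "0 < q" "q < 1"
  using dprob_pos[of k n] dprob_less_1[of k n] meet_prob_eq[of k n] kpos kn by auto

text \<open>Half of the slack \<open>2 * a\<close> in \<open>kL\<close> is spent on replacing
  \<open>n\<close> by \<open>n - 2 * k\<close>, which is possible because
  \<open>k \<le> a * n\<close>.\<close>

lemma ln_r: "- (L / 4) + a * L \<le> ln r" "ln r < 0"
proof -
  have d: "real n - 2 * real k > 0" "real n / 2 \<le> real n - 2 * real k" using k_le_an Lpos by auto
  have "(real k)\<^sup>2 / (real n - 2 * real k) \<le> L / 4 - a * L"
  proof -
    have "(real k)\<^sup>2 \<le> (1/4 - 2 * a) * L * real n" using kL by (simp add: L_def mult_ac)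
    also have "\<dots> \<le> (1/4 - 2 * a) * L * ((1 + 4 * a) * (real n - 2 * real k))"
    proof (rule mult_left_mono)
      have "4 * a * (real n - 2 * real k) \<ge> 4 * a * (real n / 2)" using d a01 by (intro mult_left_mono) auto
      then have "4 * a * (real n - 2 * real k) \<ge> 2 * real k" using k_le_an by simp
      then show "real n \<le> (1 + 4 * a) * (real n - 2 * real k)" by (simp add: algebra_simps)
      show "0 \<le> (1/4 - 2 * a) * L" using a01 Lpos by simp
    qed
    also have "\<dots> = ((1/4 - 2 * a) * (1 + 4 * a)) * L * (real n - 2 * real k)" by simp
    also have "\<dots> \<le> (1/4 - a) * L * (real n - 2 * real k)"
    proof (intro mult_right_mono)
      have "(1/4 - 2 * a) * (1 + 4 * a) = 1/4 - a - 8 * a\<^sup>2" by (simp add: algebra_simps power2_eq_square)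
      then show "(1/4 - 2 * a) * (1 + 4 * a) \<le> 1/4 - a" by simp
    qed (use d Lpos in auto)
    finally have "(real k)\<^sup>2 / (real n - 2 * real k) \<le> (1/4 - a) * L" using d(1) by (simp only: pos_divide_le_eq)
    then show ?thesis by (simp add: left_diff_distrib)
  qed
  then have "exp (- (L / 4 - a * L)) \<le> exp (- ((real k)\<^sup>2 / (real n - 2 * real k)))" by simp
  also have "\<dots> \<le> r" by (rule dprob_ge_exp[OF kn])
  finally have "exp (- (L / 4 - a * L)) \<le> r" .
  then have "ln (exp (- (L / 4 - a * L))) \<le> ln r" using r01 by (subst ln_le_cancel_iff) auto
  then show "- (L / 4) + a * L \<le> ln r" by simp
  show "ln r < 0" using r01 by simp
qed

lemma D_ge: "real n - 1 \<le> real ((n - 1) choose (k - 1))"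
proof -
  have "n - 1 \<le> (n - 1) choose (k - 1)"
  proof -
    have "(n - 1) choose 1 \<le> (n - 1) choose (k - 1)"
      using k2 kn by (intro binomial_mono) auto
    then show ?thesis by simp
  qed
  then have "real (n - 1) \<le> real ((n - 1) choose (k - 1))" by (rule of_nat_mono)
  then show ?thesis using kn by simp
qed

lemma ph_pos: "0 < ph" "0 < m"
  using p01 kpos kn by (auto simp: phi_def mbar_eq)

lemma ln_m: "ln m = ln ph + L - ln (real k)"
  using ph_pos kpos Lpos by (simp add: mbar_def ln_mult ln_div L_def)

end

text \<open>Everything below the dense threshold. With \<open>ln_r\<close> the first assumption
  keeps \<open>phi\<close> below \<open>n^(1/4 - a)\<close> up to the error unit; the second will
  come from the fact that degree 3 typically occurs.\<close>

locale nonL = base +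
  assumes nl: "ln (dprob n k) + ln (phi n k p) \<le> dd2 a * ln (real n)"
    and ph_ge: "- (ln (real n) / 3) \<le> ln (phi n k p)"
begin

lemma ln_ph: "ln ph \<le> L / 4 - a * L + 10 * (b * L)" "- (L / 3) \<le> ln ph"
  using nl ph_ge ln_r par(5) by (auto simp: L_def)

lemma ln_m_ge: "L / 7 \<le> ln m" using ln_m ln_ph ln_k_le bL by linarith

end

text \<open>Here \<open>t\<close> is the least size at which \<open>Lam\<close> drops to
  \<open>eps\<close>. The locale is separate from \<open>Mreg\<close> because its consequence
  \<open>t_ge\<close> is used to establish the further assumption \<open>phM\<close> made
  there.\<close>

locale Mreg0 = nonL +
  fixes t :: nat
  assumes qM: "- (dd3 a * ln (real n)) \<le> ln (meet_prob n k)"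
    and t1: "Lam n k p t \<le> eps" and t2: "\<And>s. s < t \<Longrightarrow> eps < Lam n k p s" and t3: "3 \<le> t"
    and tm: "2 * real t \<le> mbar n k p"
begin

definition lq :: real where "lq = - ln q"

lemma lq: "0 < lq" "lq \<le> 100 * (b * L)" "r \<le> lq" "exp (- lq) = q"
proof -
  show "0 < lq" using r01 by (simp add: lq_def)
  show "lq \<le> 100 * (b * L)" using qM par(6) by (simp add: lq_def L_def)
  show "exp (- lq) = q" using r01 by (simp add: lq_def)
  have "ln q \<le> q - 1" using r01 by (intro ln_le_minus_one) auto
  then show "r \<le> lq" using r01 by (simp add: lq_def)
qed

lemma q_power: "q ^ j = exp (- (real j * lq))" "inverse (q ^ j) = exp (real j * lq)"
proof -
  show 1: "q ^ j = exp (- (real j * lq))" using lq(4) by (metis exp_of_nat_mult mult_minus_right)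
  show "inverse (q ^ j) = exp (real j * lq)" unfolding 1 by (simp add: exp_minus)
qed

text \<open>Smallness of \<open>Lam\<close> at \<open>t\<close>, and in \<open>t_upper\<close> its
  size at \<open>t - 1\<close>, determine \<open>q ^ (- t / 2)\<close> as about
  \<open>m / t\<close>.\<close>

lemma t_lower: "2 * ln m - 2 * ln (real t) \<le> (real t - 1) * lq"
proof -
  have "(m / real t)\<^sup>2 * q ^ (t - 1) \<le> 1"
    by (rule Lam_le_imp) (use t1 t3 tm eps01 r01 in auto)
  then have "ln ((m / real t)\<^sup>2 * q ^ (t - 1)) \<le> 0" using ph_pos t3 r01 by simp
  also have "ln ((m / real t)\<^sup>2 * q ^ (t - 1)) = 2 * ln m - 2 * ln (real t) - (real t - 1) * lq"
    using ph_pos t3 r01 by (simp add: ln_mult ln_realpow ln_div lq_def of_nat_diff algebra_simps)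
  finally show ?thesis by simp
qed

lemma t_upper: "(real t - 2) * lq \<le> 2 * ln m - 2 * ln (real t) + 4 * (b * L)"
proof -
  have "eps\<^sup>2 \<le> (3 * m / real (t - 1))\<^sup>2 * q ^ (t - 1 - 1)"
    by (rule Lam_gt_imp) (use t2[of "t - 1"] t3 tm eps01 r01 ph_pos in auto)
  then have "ln (eps\<^sup>2) \<le> ln ((3 * m / real (t - 1))\<^sup>2 * q ^ (t - 2))"
    using eps01 ph_pos t3 r01 by (subst ln_le_cancel_iff) (auto simp: numeral_2_eq_2)
  also have "\<dots> = 2 * ln 3 + 2 * ln m - 2 * ln (real t - 1) - (real t - 2) * lq"
    using ph_pos t3 r01 by (simp add: ln_mult ln_realpow ln_div lq_def of_nat_diff algebra_simps)
  finally have 1: "2 * ln eps \<le> 2 * ln 3 + 2 * ln m - 2 * ln (real t - 1) - (real t - 2) * lq" using eps01 by (simp add: ln_realpow)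
  have "ln (real t) \<le> ln (2 * (real t - 1))" using t3 by (subst ln_le_cancel_iff) auto
  also have "\<dots> = ln 2 + ln (real t - 1)" by (rule ln_mult_pos) (use t3 in auto)
  finally have 2: "ln (real t) - ln 2 \<le> ln (real t - 1)" by simp
  have "ln 2 + ln 3 - ln eps = ln (6 / eps)" using eps01 ln_mult[of 2 "3::real"] by (simp add: ln_div)
  also have "\<dots> \<le> ln (10^6 / eps)" using eps01 by (subst ln_le_cancel_iff) (auto simp: divide_right_mono)
  also have "\<dots> \<le> b * L" by (rule lnC)
  finally have 3: "ln 2 + ln 3 - ln eps \<le> b * L" .
  have "X \<le> 2 * ln m - 2 * ln (real t) + 4 * (b * L)" if "2 * ln eps \<le> 2 * ln 3 + 2 * ln m - 2 * ln (real t - 1) - X" for X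
    using that 2 3 bL(1) by linarith
  then show ?thesis using 1 .
qed

text \<open>Since \<open>q\<close> is at most \<open>2 * k^2 / n\<close>, a value of
  \<open>q\<close> that is not polynomially small forces \<open>k\<close> close to
  \<open>sqrt n\<close>.\<close>

lemma ln_k_ge: "L / 2 - 60 * (b * L) \<le> ln (real k)"
proof -
  have "q \<le> 2 * (real k)\<^sup>2 / real n" by (rule meet_prob_le) (use kpos kn in auto)
  then have "ln q \<le> ln (2 * (real k)\<^sup>2 / real n)" using r01 kpos Lpos by (subst ln_le_cancel_iff) auto
  also have "\<dots> = ln 2 + 2 * ln (real k) - L" using kpos Lpos by (simp add: ln_mult ln_div ln_realpow L_def)
  finally have "ln q \<le> ln 2 + 2 * ln (real k) - L" .
  moreover have "ln 2 \<le> b * L" by (rule lnc) auto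
  moreover have "- ln q \<le> 100 * (b * L)" using lq(2) by (simp add: lq_def)
  ultimately show ?thesis using bL(1) by linarith
qed

lemma ln_m_le: "ln m \<le> 3 / 4 * L"
  using ln_m ln_ph ln_k_ge bL by linarith

lemma ln_t_nonneg: "0 \<le> ln (real t)" using t3 by simp

lemma tlq: "(real t - 2) * lq \<le> 3 / 2 * L + 4 * (b * L)" "real t * lq \<le> 8 / 5 * L"
proof -
  show 1: "(real t - 2) * lq \<le> 3 / 2 * L + 4 * (b * L)" 
  proof (rule order_trans[OF t_upper])
    show "2 * ln m - 2 * ln (real t) + 4 * (b * L) \<le> 3 / 2 * L + 4 * (b * L)" using ln_m_le ln_t_nonneg by simp
  qed
  have "real t * lq = (real t - 2) * lq + 2 * lq" by (simp add: algebra_simps)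
  then show "real t * lq \<le> 8 / 5 * L" using 1 lq(2) bL by linarith
qed

text \<open>By \<open>t_lower\<close> the product \<open>t * lq\<close> has order \<open>L\<close>,
  whereas \<open>lq\<close> is at most \<open>100 * (b * L)\<close>. The cubic dependence of
  \<open>dd3\<close> on \<open>h\<close> is made for this step: \<open>10000 * b / h^2\<close>
  equals \<open>h / 20\<close>.\<close>

lemma t_ge: "100 / h\<^sup>2 \<le> real t"
proof (rule ccontr)
  assume "\<not> ?thesis"
  then have lt: "real t < 100 / h\<^sup>2" by simp
  have "ln (real t) \<le> ln (100 / h\<^sup>2)" using lt t3 by (subst ln_le_cancel_iff) auto
  also have "100 / h\<^sup>2 = 40000 / a\<^sup>2" by (simp add: hh_def power_divide)
  also have "ln (40000 / a\<^sup>2) = ln 40000 - 2 * ln a" using a01 by (simp add: ln_div ln_realpow)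
  also have "\<dots> \<le> 3 * (b * L)"
  proof -
    have "ln 40000 \<le> b * L" by (rule lnc) auto
    then show ?thesis using lnC(5) by linarith
  qed
  finally have lt2: "ln (real t) \<le> 3 * (b * L)" .
  have "(real t - 1) * lq \<le> (100 / h\<^sup>2) * (100 * (b * L))"
    using lt lq t3 bL by (intro mult_mono) auto
  also have "\<dots> = 10000 * b / h\<^sup>2 * L" by simp
  also have "10000 * b / h\<^sup>2 = h / 20" using par(7) par(1) by (simp add: field_simps power2_eq_square power3_eq_cube)
  finally have "(real t - 1) * lq \<le> h * L / 20" by simp
  then show False using t_lower ln_m_ge lt2 bL by linarith
qed

text \<open>As \<open>r \<le> lq\<close>, the bound on \<open>t * lq\<close> also bounds
  \<open>t * r\<close>; together with \<open>ln_r\<close> this keeps \<open>t\<close> below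
  \<open>n^(1/4 - a)\<close> up to two error units.\<close>

lemma rt: "real t * r \<le> 8 / 5 * L" "ln (real t) \<le> L / 4 - a * L + 2 * (b * L)"
proof -
  have "real t * r \<le> real t * lq" using lq by (intro mult_left_mono) auto
  then show 1: "real t * r \<le> 8 / 5 * L" using tlq by linarith
  have "ln (real t * r) \<le> ln (8 / 5 * L)" using 1 t3 r01 Lpos by (subst ln_le_cancel_iff) auto
  moreover have "ln (real t * r) = ln (real t) + ln r" by (rule ln_mult_pos) (use t3 r01 in auto)
  moreover have "ln (8 / 5 * L) = ln (8 / 5) + ln L" by (rule ln_mult_pos) (use Lpos in auto)
  ultimately have "ln (real t) + ln r \<le> ln (8/5) + ln L" by simp
  then show "ln (real t) \<le> L / 4 - a * L + 2 * (b * L)" 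
  proof -
    assume "ln (real t) + ln r \<le> ln (8/5) + ln L"
    moreover have "ln (8/5) \<le> b * L" by (rule lnc) auto
    ultimately show ?thesis using ln_r lnL by linarith
  qed
qed

end

locale Mreg = Mreg0 +
  assumes phM: "- ((hh a)\<^sup>2 / 50 * ln (real n)) \<le> ln (phi n k p)"
begin

text \<open>If \<open>q\<close> is at least 1/2, then \<open>t * r \<ge> 1\<close> and
  \<open>phi / t\<close> is at most \<open>r * phi\<close>. Otherwise \<open>r\<close> is at least
  1/2, and \<open>phi\<close> itself is bounded by \<open>2 * (r * phi)\<close>.\<close>

lemma ph_over_t: "ln ph - ln (real t) \<le> 11 * (b * L)"
proof (cases "1/2 \<le> q")
  case True
  then have "r \<le> 1/2" using r01 by simp
  have lq2: "lq \<le> 2 * r"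
  proof -
    have "exp (- (r / (1 - r))) \<le> 1 - r" using r01 by (intro exp_neg_le_1_minus) auto
    then have "- (r / (1 - r)) \<le> ln (1 - r)" using r01 by (metis exp_le_cancel_iff exp_ln diff_gt_0_iff_gt)
    moreover have "r / (1 - r) \<le> r / (1/2)" using \<open>r \<le> 1/2\<close> r01 by (intro divide_left_mono) auto
    ultimately show ?thesis using r01 by (simp add: lq_def)
  qed
  have "1 \<le> real t * r"
  proof (rule ccontr)
    assume c: "\<not> ?thesis"
    have "(real t - 1) * lq \<le> real t * lq" using lq by (intro mult_right_mono) auto
    also have "\<dots> \<le> real t * (2 * r)" using lq2 by (intro mult_left_mono) auto
    finally have "(real t - 1) * lq \<le> 2" using c by simp
    then have "2 * ln m - 2 * ln (real t) \<le> 2" using t_lower by simp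
    moreover have "ln m = ln ph + L - ln (real k)" by (rule ln_m)
    ultimately have "ln ph + L - ln (real k) - ln (real t) \<le> 1" by simp
    then have "ln ph - ln (real t) \<le> 1 - L + (L / 2 + b * L)" using ln_k_le by linarith
    moreover have "ln (real t) \<le> L / 4 - a * L + 2 * (b * L)" by (rule rt)
    moreover have "- (L / 50) \<le> ln ph"
    proof -
      have "h\<^sup>2 \<le> 1" using par(1,2) by (simp add: power_le_one)
      then have "h\<^sup>2 / 50 * L \<le> L / 50" using Lpos by (simp add: mult_right_mono)
      then show ?thesis using phM by (simp add: L_def)
    qed
    ultimately show False using bL Lpos by linarith
  qed
  then have "0 \<le> ln (real t * r)" by simp
  then have "0 \<le> ln (real t) + ln r" using t3 r01 by (simp add: ln_mult)
  then show ?thesis using nl par(5) bL by (simp add: L_def)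
next
  case False
  then have "ln (1/2) \<le> ln r" using r01 by (subst ln_le_cancel_iff) auto
  then have "- ln 2 \<le> ln r" by (simp add: ln_div)
  then have "ln ph \<le> 10 * (b * L) + ln 2" using nl par(5) by (simp add: L_def)
  moreover have "ln 2 \<le> b * L" by (rule lnc) auto
  ultimately show ?thesis using ln_t_nonneg by linarith
qed

definition pp :: real where "pp = (real k + sqrt (real k) * L) / real n"

lemma q01: "0 < q" "q < 1" "0 < r" "r < 1" by (rule r01(4) r01(5) r01(1) r01(2))+

sublocale meet_params n k L pp q r
proof
  show "(real k)\<^sup>2 \<le> real n * L / 4"
  proof -
    have "(1/4 - 2 * a) * (real n * L) \<le> 1/4 * (real n * L)" using a01 Lpos by (intro mult_right_mono) auto
    moreover have "(real k)\<^sup>2 \<le> (1/4 - 2 * a) * (real n * L)" using kL by (simp only: L_def mult.assoc)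
    ultimately have "(real k)\<^sup>2 \<le> 1/4 * (real n * L)" by (rule order_trans[rotated])
    then show ?thesis by simp
  qed
  show "L\<^sup>2 \<le> real k"
  proof -
    have "2 * ln L \<le> ln (real k)" using lnL ln_k_ge bL Lpos by linarith
    then have "ln (L\<^sup>2) \<le> ln (real k)" using Lpos by (simp add: ln_realpow)
    then show ?thesis using Lpos kpos by (subst (asm) ln_le_cancel_iff) auto
  qed
qed (use kpos kn Lpos in \<open>auto simp: L_def pp_def\<close>)

end

section \<open>Structure of cliques when two edges often meet\<close>

lemma le_expI: "0 < y \<Longrightarrow> ln y \<le> z \<Longrightarrow> (y::real) \<le> exp z"
  by (metis exp_le_cancel_iff exp_ln)

lemma ln_five:
  fixes T P R E l :: real
  assumes "0 < T" "0 < P" "0 < R" "0 < E" "0 < l"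
  shows "ln (T * (P * R * E * T\<^sup>2 * l)) = (ln T + ln R) + ln P + ln E + 2 * ln T + ln l"
  using assms by (simp add: ln_mult ln_realpow)

lemma (in base) exp_small: "z \<le> - (b * L) \<Longrightarrow> exp z \<le> eps / 10^6"
proof -
  assume z: "z \<le> - (b * L)"
  have "z \<le> ln (eps / 10^6)" using z lnC(1) eps01 by (simp add: ln_div)
  then have "exp z \<le> exp (ln (eps / 10^6))" by simp
  then show ?thesis using eps01 by simp
qed

lemma (in base) small_if: "0 < y \<Longrightarrow> ln y \<le> - (b * L) \<Longrightarrow> y \<le> eps / 10^6"
  using le_expI[of y "- (b * L)"] exp_small[of "- (b * L)"] by linarith

context Mreg
begin

text \<open>Threshold for pairwise intersections: the mean intersection \<open>k^2 / n\<close> of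
  two \<open>k\<close>-sets is at most \<open>L / 4\<close>, so more than \<open>l\<close> common
  vertices, that is at least \<open>10 * L\<close>, are so unlikely that even the union over all
  pairs of edges is harmless.\<close>

definition l :: nat where "l = nat \<lceil>10 * L\<rceil> - 1"

lemma l_bounds: "10 * L \<le> real (Suc l)" "real l \<le> 10 * L" "ln (real (Suc l)) \<le> 2 * (b * L)" "0 < l"
proof -
  have c: "10000 \<le> \<lceil>10 * L\<rceil>" using Lpos by linarith
  have s: "Suc l = nat \<lceil>10 * L\<rceil>" using c by (simp add: l_def)
  have rs: "real (Suc l) = of_int \<lceil>10 * L\<rceil>" using c s by simp
  show "10 * L \<le> real (Suc l)" unfolding rs by linarith
  have "real (Suc l) \<le> 10 * L + 1" unfolding rs by linarith
  then show "real l \<le> 10 * L" by simp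
  have "ln (real (Suc l)) \<le> ln (11 * L)" using \<open>real (Suc l) \<le> 10 * L + 1\<close> Lpos by (subst ln_le_cancel_iff) auto
  also have "\<dots> = ln 11 + ln L" using Lpos by (simp add: ln_mult)
  also have "\<dots> \<le> 2 * (b * L)"
  proof -
    have "ln 11 \<le> b * L" by (rule lnc) auto
    then show ?thesis using lnL by linarith
  qed
  finally show "ln (real (Suc l)) \<le> 2 * (b * L)" .
  show "0 < l" using c by (simp add: l_def)
qed

lemma ln_l: "ln (real l) \<le> 2 * (b * L)"
proof -
  have "ln (real l) \<le> ln (real (Suc l))" using l_bounds(4) by (subst ln_le_cancel_iff) auto
  then show ?thesis using l_bounds(3) by linarith
qed

lemma w2_le: "(real k)\<^sup>2 / real n \<le> L / 4"
proof -
  have "(real k)\<^sup>2 \<le> real n * L / 4" by (rule k_le)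
  then show ?thesis using Lpos by (simp add: field_simps)
qed

lemma prob_W1: "Prs (ksets n k) p (\<lambda>H. \<exists>A\<in>H. \<exists>B\<in>H. A \<noteq> B \<and> Suc l \<le> card (A \<inter> B)) \<le> eps / 10^6"
proof -
  let ?w = "(real k)\<^sup>2 / real n" and ?l = "Suc l"
  have w0: "0 < ?w" using kpos Lpos by simp
  have "Prs (ksets n k) p (\<lambda>H. \<exists>A\<in>H. \<exists>B\<in>H. A \<noteq> B \<and> ?l \<le> card (A \<inter> B)) \<le> m\<^sup>2 * (?w ^ ?l / fact ?l)"
    by (rule prob_large_intersection) (use kpos kn p01 in auto)
  also have "\<dots> \<le> m\<^sup>2 * (exp 1 * ?w / real ?l) ^ ?l"
    using w0 by (intro mult_left_mono power_div_fact_le) auto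
  also have "\<dots> \<le> m\<^sup>2 * exp (- 2) ^ ?l"
  proof (intro mult_left_mono power_mono)
    have "exp 1 * ?w \<le> exp 1 * (L / 4)" by (rule mult_left_mono[OF w2_le]) simp
    then have "exp 1 * ?w / real ?l \<le> exp 1 * (L / 4) / (10 * L)"
      by (rule frac_le[rotated 1]) (use l_bounds(1) Lpos in auto)
    also have "\<dots> = exp 1 / 40" using Lpos by simp
    \<comment> \<open>Amounts to \<open>e^3 \<le> 27 \<le> 40\<close>.\<close>
    also have "\<dots> \<le> exp (- 2)"
    proof -
      have "exp 1 * exp 1 * exp 1 \<le> (3::real) * 3 * 3" using exp_le by (intro mult_mono) auto
      moreover have "exp (- 2) * (exp 1 * exp 1) = (1::real)" by (simp only: exp_add[symmetric]) simp
      ultimately have "exp 1 / 40 * (exp 1 * exp 1) \<le> exp (- 2) * (exp 1 * exp 1 :: real)" by simp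
      then show ?thesis by (simp only: mult_le_cancel_right_pos exp_gt_zero mult_pos_pos)
    qed
    finally show "exp 1 * ?w / real ?l \<le> exp (- 2)" .
  qed (use w0 in auto)
  also have "\<dots> = exp (2 * ln m - 2 * real ?l)"
  proof -
    have "m\<^sup>2 = exp (2 * ln m)" using ph_pos by (metis exp_ln exp_of_nat_mult of_nat_numeral)
    moreover have "exp (- 2) ^ ?l = exp (- (2 * real ?l))" by (metis exp_of_nat_mult mult.commute mult_minus_right)
    ultimately show ?thesis by (simp add: exp_add[symmetric])
  qed
  also have "\<dots> \<le> eps / 10^6" 
  proof (rule exp_small)
    have gen: "X - Y \<le> - (b * L)" if "X \<le> 3 / 2 * L" "20 * L \<le> Y" for X Y :: real using that bL Lpos by linarith
    show "2 * ln m - 2 * real (Suc l) \<le> - (b * L)" by (rule gen) (use ln_m_le l_bounds(1) in simp_all)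
  qed
  finally show ?thesis .
qed

text \<open>A codegree has mean at most about \<open>n^(-1/4)\<close>, so ten common edges cost
  about \<open>n^(-5/2)\<close> against \<open>n^2\<close> pairs of vertices. This is the origin of
  the bound 9 in \<open>structure_of_cliques\<close>.\<close>

lemma prob_W2: "Prs (ksets n k) p (\<lambda>H. \<exists>x\<in>{1..n}. \<exists>y\<in>{1..n}. x \<noteq> y \<and> 10 \<le> card (H \<inter> (kstar n k x \<inter> kstar n k y))) \<le> eps / 10^6"
proof -
  let ?c = "ph * real k / real n"
  have c0: "0 < ?c" using ph_pos kpos Lpos by simp
  have "Prs (ksets n k) p (\<lambda>H. \<exists>x\<in>{1..n}. \<exists>y\<in>{1..n}. x \<noteq> y \<and> 10 \<le> card (H \<inter> (kstar n k x \<inter> kstar n k y))) \<le> (real n)\<^sup>2 * (?c ^ 10 / fact 10)"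
    by (rule prob_large_codegree) (use kpos kn p01 in auto)
  also have "\<dots> \<le> (real n)\<^sup>2 * (?c ^ 10 / 1)" using c0 by (intro mult_left_mono divide_left_mono) (auto simp: fact_ge_1)
  also have "\<dots> \<le> eps / 10^6"
  proof (rule small_if)
    have "ln ((real n)\<^sup>2 * (?c ^ 10 / 1)) = 10 * ln ph + 10 * ln (real k) - 8 * L"
      using c0 ph_pos kpos Lpos by (simp add: ln_mult ln_div ln_realpow L_def)
    then show "ln ((real n)\<^sup>2 * (?c ^ 10 / 1)) \<le> - (b * L)" using ln_ph ln_k_le bL Lpos by linarith
    show "0 < (real n)\<^sup>2 * (?c ^ 10 / 1)" by (intro mult_pos_pos divide_pos_pos zero_less_power) (use Lpos ph_pos kpos in auto)
  qed
  finally show ?thesis .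
qed

text \<open>A clique of size \<open>t\<close> counts as generic up to degree \<open>h * t\<close>
  and as a near-star above \<open>(1 - h) * t\<close>. With small codegrees only about
  \<open>1 / h\<close> vertices can have degree \<open>h * t\<close>; \<open>m1\<close> allows twice
  as many.\<close>

definition dm :: nat where "dm = nat \<lfloor>h * real t\<rfloor>"
definition dh :: nat where "dh = nat \<lfloor>(1 - h) * real t\<rfloor>"
definition m1 :: nat where "m1 = nat \<lceil>2 / h\<rceil>"

lemma ht_ge: "100 \<le> h\<^sup>2 * real t" "16000 \<le> h * real t"
proof -
  show 1: "100 \<le> h\<^sup>2 * real t" using t_ge par(1) by (simp add: field_simps)
  have "100 \<le> h * (h * real t)" using 1 by (simp add: power2_eq_square mult.assoc)
  also have "\<dots> \<le> 1/160 * (h * real t)" using par by (intro mult_right_mono) auto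
  finally show "16000 \<le> h * real t" by simp
qed

lemma dm_bounds: "real dm \<le> h * real t" "h * real t < real dm + 1"
  using par(1) unfolding dm_def by (simp_all add: of_nat_nat)

lemma dh_bounds: "real dh \<le> (1 - h) * real t" "(1 - h) * real t < real dh + 1" "dh \<le> t"
proof -
  have "0 \<le> (1 - h) * real t" using par by simp
  then have e: "real dh = of_int \<lfloor>(1 - h) * real t\<rfloor>" by (simp add: dh_def)
  show 1: "real dh \<le> (1 - h) * real t" "(1 - h) * real t < real dh + 1" unfolding e by linarith+
  have "(1 - h) * real t \<le> 1 * real t" using par by (intro mult_right_mono) auto
  then show "dh \<le> t" using 1 by linarith
qed

lemma m1_bounds: "2 / h \<le> real m1" "real m1 + 1 \<le> 3 / h"
proof -
  have "0 \<le> 2 / h" using par by simp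
  then have e: "real m1 = of_int \<lceil>2 / h\<rceil>" by (simp add: m1_def)
  show "2 / h \<le> real m1" unfolding e by linarith
  have "real m1 \<le> 2 / h + 1" unfolding e by linarith
  moreover have "2 \<le> 1 / h" using par by (simp add: field_simps)
  ultimately show "real m1 + 1 \<le> 3 / h" by (simp add: field_simps)
qed

lemma e0_pos: "0 < e0" using kpos Lpos by (simp add: e0_def)

lemma ln_e0: "ln e0 \<le> - (L / 4) + 4 * (b * L)"
proof -
  have "ln e0 = ln 2 + ln (real k) + ln (real k) / 2 + ln L - L"
    using kpos Lpos by (simp add: e0_def ln_mult ln_div ln_sqrt) (simp add: L_def)
  moreover have "ln 2 \<le> b * L" by (rule lnc) auto
  ultimately show ?thesis using ln_k_le lnL bL by linarith
qed

lemma pp_pos: "0 < pp" using kpos Lpos by (simp add: pp_def add_pos_nonneg)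

lemma ln_pp: "ln pp \<le> ln (real k) - L + b * L" "ln pp \<le> - (L / 2) + 2 * (b * L)"
proof -
  have "ln pp \<le> ln (2 * real k / real n)" using pi_bounds(2) pp_pos kpos Lpos by (subst ln_le_cancel_iff) auto
  also have "\<dots> = ln 2 + ln (real k) - L" using kpos Lpos by (simp add: ln_mult ln_div L_def)
  finally have 1: "ln pp \<le> ln 2 + ln (real k) - L" .
  have "ln 2 \<le> b * L" by (rule lnc) auto
  then show "ln pp \<le> ln (real k) - L + b * L" using 1 by linarith
  then show "ln pp \<le> - (L / 2) + 2 * (b * L)" using ln_k_le by linarith
qed

lemma z0_small: "j \<le> exp L \<Longrightarrow> 0 < j \<Longrightarrow> j * (2 * z0) \<le> eps / 10^6"
proof (rule small_if)
  assume j: "j \<le> exp L" "0 < j"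
  show "0 < j * (2 * z0)" using j z0_bounds by simp
  have "ln j \<le> L" using j by (metis exp_gt_zero ln_exp ln_le_cancel_iff)
  moreover have "ln (j * (2 * z0)) = ln j + ln 2 - L\<^sup>2 / 16" using j by (simp add: z0_def ln_mult)
  moreover have "ln 2 \<le> b * L" by (rule lnc) auto
  moreover have "1000 * L \<le> L\<^sup>2" unfolding power2_eq_square using Lpos by (intro mult_right_mono) auto
  ultimately show "ln (j * (2 * z0)) \<le> - (b * L)" using bL by linarith
qed

lemma t_exp: "real t \<le> exp L"
  using rt(2) bL t3 by (intro le_expI) auto

text \<open>The first place where 1/4 matters. The model error \<open>e0\<close> is about
  \<open>n^(-1/4)\<close> and \<open>t\<close> is below \<open>n^(1/4 - a)\<close>, while
  \<open>t * r\<close> is only of order \<open>L\<close>. In the last term \<open>t^2 * pp\<close>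
  is about \<open>n^(- 2 * a)\<close>, which pays for
  \<open>inverse (q ^ dm) \<le> n^(8/5 * h)\<close> because \<open>a = 20 * h\<close>.\<close>

lemma EE_small: "real t * (real t * r * e0 / q + 2 * z0 + pp * r * inverse (q ^ dm) * (real t)\<^sup>2 * real l) \<le> 1/4"
proof -
  have t0: "0 < real t" using t3 by simp
  have ltr: "ln (real t) + ln r \<le> 2 * (b * L)"
  proof -
    have "ln (real t * r) \<le> ln (8 / 5 * L)" using rt(1) t0 q01 Lpos by (subst ln_le_cancel_iff) auto
    moreover have "ln (real t * r) = ln (real t) + ln r" using t0 q01 by (simp add: ln_mult)
    moreover have "ln (8 / 5 * L) = ln (8/5) + ln L" by (rule ln_mult_pos) (use Lpos in auto)
    moreover have "ln (8/5) \<le> b * L" by (rule lnc) auto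
    ultimately show ?thesis using lnL by linarith
  qed
  have 1: "real t * (real t * r * e0 / q) \<le> eps / 10^6"
  proof (rule small_if)
    have "ln (real t * (real t * r * e0 / q)) = ln (real t) + (ln (real t) + ln r) + ln e0 + lq"
      using t0 q01 e0_pos by (simp add: ln_mult ln_div lq_def)
    then show "ln (real t * (real t * r * e0 / q)) \<le> - (b * L)" using ltr rt(2) ln_e0 lq(2) bL by linarith
  qed (use t0 q01 e0_pos in auto)
  have 2: "real t * (2 * z0) \<le> eps / 10^6" by (rule z0_small[OF t_exp t0])
  have 3: "real t * (pp * r * inverse (q ^ dm) * (real t)\<^sup>2 * real l) \<le> eps / 10^6"
  proof (rule small_if)
    have l0: "0 < real l" using l_bounds by simp
    have "ln (real t * (pp * r * inverse (q ^ dm) * (real t)\<^sup>2 * real l)) = (ln (real t) + ln r) + ln pp + real dm * lq + 2 * ln (real t) + ln (real l)"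
      unfolding q_power(2) by (subst ln_five) (use t0 q01 pp_pos l0 in auto)
    moreover have "real dm * lq \<le> h * (real t * lq)" using mult_right_mono[OF dm_bounds(1), of lq] lq by simp
    moreover have "h * (real t * lq) \<le> h * (8 / 5 * L)" using tlq(2) par by (intro mult_left_mono) auto
    ultimately show "ln (real t * (pp * r * inverse (q ^ dm) * (real t)\<^sup>2 * real l)) \<le> - (b * L)"
      using ltr rt(2) ln_pp(2) ln_l bL by linarith
    show "0 < real t * (pp * r * inverse (q ^ dm) * (real t)\<^sup>2 * real l)" using t0 q01 pp_pos l0 by simp
  qed
  have "eps / 10^6 \<le> 1/12" using eps01 by simp
  then show ?thesis using 1 2 3 by (simp only: distrib_left)
qed

lemma EE_power: "EE t dm l ^ t \<le> exp (1/4)" "1 \<le> EE t dm l" "EE t dm l \<le> exp (1/4)"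
proof -
  let ?e = "real t * r * e0 / q + 2 * z0 + pp * r * inverse (q ^ dm) * (real t)\<^sup>2 * real l"
  have e0: "0 \<le> ?e" using q01 e0_pos z0_bounds pp_pos by (intro add_nonneg_nonneg mult_nonneg_nonneg divide_nonneg_nonneg) auto
  have "EE t dm l ^ t = exp (real t * ?e)" unfolding EE_def by (rule exp_of_nat_mult[symmetric])
  then show "EE t dm l ^ t \<le> exp (1/4)" using EE_small by simp
  show "1 \<le> EE t dm l" unfolding EE_def using e0 by simp
  have "1 * ?e \<le> real t * ?e" using t3 e0 by (intro mult_right_mono) auto
  then have "?e \<le> 1/4" using EE_small unfolding mult_1 by (rule order_trans)
  then show "EE t dm l \<le> exp (1/4)" unfolding EE_def by (simp only: exp_le_cancel_iff)
qed

text \<open>As \<open>t^2 / m\<close> is tiny, the falling factorial in \<open>Lam\<close> may be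
  replaced by the power \<open>m ^ t\<close>.\<close>

lemma gen_count: "m ^ t / fact t * q ^ (t choose 2) \<le> eps * exp (1/4)" "m ^ t / fact t * q ^ (t choose 2) \<le> 2 * eps"
proof -
  have "(real t)\<^sup>2 * 2 / m \<le> eps / 10^6"
  proof (rule small_if)
    have "ln ((real t)\<^sup>2 * 2 / m) = 2 * ln (real t) + ln 2 - ln m" using t3 ph_pos by (simp add: ln_mult ln_div ln_realpow)
    moreover have "ln 2 \<le> b * L" by (rule lnc) auto
    moreover have "h\<^sup>2 / 50 * L \<le> h * L"
    proof -
      have "h\<^sup>2 / 50 \<le> h" using par by (simp add: power2_eq_square)
      then show ?thesis using Lpos by (intro mult_right_mono) auto
    qed
    moreover have "- (h\<^sup>2 / 50 * L) \<le> ln ph" using phM by (simp add: L_def)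
    ultimately show "ln ((real t)\<^sup>2 * 2 / m) \<le> - (b * L)" using rt(2) ln_m ln_k_le bL by linarith
  qed (use t3 ph_pos in auto)
  then have e: "exp ((real t)\<^sup>2 * 2 / m) \<le> exp (1/4)" using eps01 by simp
  have g0: "0 \<le> m gchoose t"
  proof -
    have "0 \<le> (m / real t) ^ t" using ph_pos by simp
    also have "\<dots> \<le> m gchoose t" using tm ph_pos by (intro gbinomial_ge_n_over_k_pow_k) auto
    finally show ?thesis .
  qed
  have "m ^ t / fact t * q ^ (t choose 2) \<le> ((m gchoose t) * exp ((real t)\<^sup>2 * 2 / m)) * q ^ (t choose 2)"
    using tm ph_pos q01 by (intro mult_right_mono power_le_gchoose) auto
  also have "\<dots> = Lam n k p t * exp ((real t)\<^sup>2 * 2 / m)" by (simp add: Lam_def mult_ac)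
  also have "\<dots> \<le> eps * exp (1/4)" using t1 e eps01 g0 q01 by (intro mult_mono) auto
  finally show 1: "m ^ t / fact t * q ^ (t choose 2) \<le> eps * exp (1/4)" .
  have "exp (1/4::real) \<le> 1 + 1/4 + (1/4)\<^sup>2" by (rule exp_bound) auto
  then have "eps * exp (1/4) \<le> eps * 2" using eps01 by (intro mult_left_mono) (auto simp: power2_eq_square)
  then show "m ^ t / fact t * q ^ (t choose 2) \<le> 2 * eps" using 1 by simp
qed

lemma prob_gen: "Prs (ksets n k) p (\<lambda>H. \<exists>F\<subseteq>H. card F = t \<and> sparse_clique l F \<and> (\<forall>y\<in>{1..n}. fdeg F y \<le> dm)) \<le> 2 * eps"
proof -
  have "Prs (ksets n k) p (\<lambda>H. \<exists>F\<subseteq>H. card F = t \<and> sparse_clique l F \<and> (\<forall>y\<in>{1..n}. fdeg F y \<le> dm))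
     \<le> m ^ t / fact t * q ^ (t choose 2) * EE t dm l ^ t"
    by (rule prob_generic_clique) (use p01 in auto)
  also have "\<dots> \<le> (eps * exp (1/4)) * exp (1/4)"
    by (rule mult_mono[OF gen_count(1) EE_power(1)]) (use EE_power(2) eps01 in auto)
  also have "\<dots> = eps * exp (1/2)" by (simp add: exp_add[symmetric])
  also have "\<dots> \<le> eps * 2"
  proof -
    have "exp (1/2::real) \<le> 1 + 1/2 + (1/2)\<^sup>2" by (rule exp_bound) auto
    then show ?thesis using eps01 by (intro mult_left_mono) (auto simp: power2_eq_square)
  qed
  finally show ?thesis by simp
qed

lemma choose2_split: "(d + s) choose 2 = (d choose 2) + d * s + (s choose 2)"
proof -
  have "2 * ((d + s) choose 2) = 2 * ((d choose 2) + d * s + (s choose 2))"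
    unfolding distrib_left choose2_double by (cases d; cases s) (auto simp: algebra_simps)
  then show ?thesis by simp
qed

text \<open>By \<open>t_upper\<close> the inverse of \<open>q ^ (t / 2)\<close> is about
  \<open>m / t\<close>, and \<open>pp * m / t\<close> is about \<open>phi / t\<close>, which
  \<open>ph_over_t\<close> controls. A degree of about \<open>t / 2\<close> is thus just affordable
  for an exceptional vertex.\<close>

lemma ln_P: "1 + pp * inverse (q ^ ((t + 9) div 2)) \<le> exp (565 * (b * L))"
proof -
  let ?d = "(t + 9) div 2"
  have "pp * inverse (q ^ ?d) \<le> exp (564 * (b * L))"
  proof (rule le_expI)
    show "0 < pp * inverse (q ^ ?d)" using pp_pos q01 by simp
    have e: "ln (pp * inverse (q ^ ?d)) = ln pp + real ?d * lq" unfolding q_power(2) using pp_pos by (simp add: ln_mult)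
    have "real (2 * ?d) \<le> real (t + 9)" by (rule of_nat_mono) simp
    then have "real ?d \<le> (real t - 2) / 2 + 11 / 2" by (simp add: field_simps)
    then have "real ?d * lq \<le> ((real t - 2) / 2 + 11 / 2) * lq" using lq by (intro mult_right_mono) auto
    also have "\<dots> = ((real t - 2) * lq) / 2 + 11 / 2 * lq" by (simp add: field_simps)
    also have "\<dots> \<le> (2 * ln m - 2 * ln (real t) + 4 * (b * L)) / 2 + 11 / 2 * lq"
      using t_upper by (intro add_right_mono divide_right_mono) auto
    also have "(2 * ln m - 2 * ln (real t) + 4 * (b * L)) / 2 = ln m - ln (real t) + 2 * (b * L)" by simp
    finally have "real ?d * lq \<le> ln m - ln (real t) + 2 * (b * L) + 11 / 2 * lq" .
    then show "ln (pp * inverse (q ^ ?d)) \<le> 564 * (b * L)" unfolding e using ln_pp(1) ln_m ph_over_t lq(2) by linarith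
  qed
  moreover have "1 \<le> exp (564 * (b * L))" using bL(1) by simp
  ultimately have 1: "1 + pp * inverse (q ^ ?d) \<le> 2 * exp (564 * (b * L))" by linarith
  have "2 \<le> exp (b * L)" by (rule le_expI) (auto intro: lnc)
  then have "2 * exp (564 * (b * L)) \<le> exp (b * L) * exp (564 * (b * L))" by (intro mult_right_mono) auto
  also have "\<dots> = exp (565 * (b * L))" by (simp add: exp_add[symmetric])
  finally show ?thesis using 1 by linarith
qed

text \<open>Error factor for each edge off the centre, with the exceptional vertices
  included.\<close>

definition Gam :: real where "Gam = EE t dm l * (1 + pp * inverse (q ^ ((t + 9) div 2))) ^ m1"

lemma Gam_bounds: "1 \<le> Gam" "Gam \<le> exp (h\<^sup>2 * L / 90)"
proof -
  have P1: "1 \<le> 1 + pp * inverse (q ^ ((t + 9) div 2))" using pp_pos q01 by simp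
  then have "1 \<le> (1 + pp * inverse (q ^ ((t + 9) div 2))) ^ m1" by (rule one_le_power)
  then have "1 * 1 \<le> Gam" unfolding Gam_def using EE_power by (intro mult_mono) auto
  then show "1 \<le> Gam" by simp
  have "(1 + pp * inverse (q ^ ((t + 9) div 2))) ^ m1 \<le> exp (565 * (b * L)) ^ m1" using ln_P P1 by (intro power_mono) auto
  also have "\<dots> = exp (real m1 * (565 * (b * L)))" by (rule exp_of_nat_mult[symmetric])
  also have "\<dots> \<le> exp (h\<^sup>2 * L / 100)"
  proof -
    have "real m1 * (565 * (b * L)) \<le> (3 / h) * (565 * (b * L))" using m1_bounds(2) bL by (intro mult_right_mono) auto
    also have "\<dots> = 1695 * (b * 200000) / (200000 * h) * L" by simp
    also have "\<dots> = 1695 / 200000 * (h\<^sup>2 * L)" unfolding par(7) using par(1) by (simp add: power2_eq_square power3_eq_cube)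
    also have "\<dots> \<le> h\<^sup>2 * L / 100" using Lpos by simp
    finally show ?thesis by simp
  qed
  finally have "Gam \<le> exp (1/4) * exp (h\<^sup>2 * L / 100)" unfolding Gam_def using EE_power P1 by (intro mult_mono) auto
  also have "\<dots> \<le> exp (h\<^sup>2 * L / 90)"
  proof -
    have "exp (1::real) \<le> 10^6" using exp_le by simp
    then have "1 \<le> b * L" using lnc[of "exp 1"] by simp
    moreover have "b * L \<le> h\<^sup>2 / 10000000 * L" using par(9) Lpos by (intro mult_right_mono) auto
    ultimately have "1/4 \<le> h\<^sup>2 * L / 10000000" by simp
    then have "1/4 + h\<^sup>2 * L / 100 \<le> h\<^sup>2 * L / 90" by linarith
    then show ?thesis by (simp only: exp_add[symmetric] exp_le_cancel_iff)
  qed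
  finally show "Gam \<le> exp (h\<^sup>2 * L / 90)" .
qed

text \<open>Compared with the count \<open>A\<close> of generic cliques, giving \<open>x\<close>
  degree \<open>d\<close> multiplies by \<open>(u * q ^ (- (d - 1) / 2)) ^ d\<close>, where
  \<open>u = k / n\<close>. At \<open>d\<close> near \<open>t\<close> the base would be about
  \<open>phi / t\<close>; staying below \<open>(1 - h) * t\<close> leaves
  \<open>n^(- h / 5)\<close>. Since \<open>d\<close> exceeds \<open>h * t\<close>, the gain is
  \<open>n^(- h^2 * t / 5)\<close>, which beats \<open>2 ^ t\<close> and the losses in
  \<open>Gam\<close>.\<close>

lemma prob_pop:
  assumes d: "dm < d" "d \<le> dh"
  shows "Prs (ksets n k) p (\<lambda>H. \<exists>x\<in>{1..n}. \<exists>F\<subseteq>H. card F = d + (t - d) \<and> fdeg F x = d \<and> popular_clique l dm ((t + 9) div 2) m1 x F) \<le> exp (- (14 * L))"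
proof -
  define s where "s = t - d"
  have ds: "d + s = t" "d \<le> t" using d dh_bounds(3) by (auto simp: s_def)
  have d0: "0 < real d" "0 < d" using d by auto
  define u where "u = real k / real n"
  have u0: "0 < u" using kpos Lpos by (simp add: u_def)
  have phu: "ph = m * u" using Lpos kpos by (simp add: mbar_def u_def)
  define A where "A = m ^ t / fact t * q ^ (t choose 2)"
  define e2 where "e2 = 2 * eps"
  have e2: "0 < e2" "e2 \<le> 1" using eps01 by (auto simp: e2_def)
  have A0: "0 \<le> A" using ph_pos q01 by (simp add: A_def)
  have lnu: "ln u = ln (real k) - L" using kpos Lpos by (simp add: u_def ln_div L_def)
  have "Prs (ksets n k) p (\<lambda>H. \<exists>x\<in>{1..n}. \<exists>F\<subseteq>H. card F = d + s \<and> fdeg F x = d \<and> popular_clique l dm ((t + 9) div 2) m1 x F)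
    \<le> real n * (ph ^ d / fact d * (m ^ s / fact s * q ^ (d * s) * q ^ (s choose 2) * (EE (d + s) dm l * (1 + pp * inverse (q ^ ((t + 9) div 2))) ^ m1) ^ s))"
    by (rule prob_popular_clique) (use p01 in auto)
  also have "\<dots> = real n * (A * real (t choose d) * (u ^ d * inverse (q ^ (d choose 2))) * Gam ^ s)"
  proof -
    have "ph ^ d * m ^ s = m ^ t * u ^ d" unfolding phu ds(1)[symmetric] by (simp add: power_mult_distrib power_add mult_ac)
    moreover have "real (t choose d) = fact t / (fact d * fact s)" using ds by (simp add: binomial_fact s_def)
    moreover have "q ^ (t choose 2) = q ^ (d choose 2) * (q ^ (d * s) * q ^ (s choose 2))" unfolding ds(1)[symmetric] choose2_split by (simp add: power_add mult_ac)
    ultimately show ?thesis using q01 ds(1) unfolding Gam_def A_def by (simp add: field_simps)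
  qed
  also have "\<dots> \<le> real n * (e2 * 2 ^ t * exp (- (h\<^sup>2 * real t * L / 5)) * exp (h\<^sup>2 * L / 90) ^ t)"
  proof (intro mult_left_mono mult_mono)
    show "A \<le> e2" unfolding A_def e2_def by (rule gen_count)
    have "t choose d \<le> 2 ^ t" by (rule binomial_le_pow2)
    then show "real (t choose d) \<le> 2 ^ t" by (metis of_nat_le_iff of_nat_numeral of_nat_power)
    have "Gam ^ s \<le> Gam ^ t" using Gam_bounds(1) ds by (intro power_increasing) auto
    also have "\<dots> \<le> exp (h\<^sup>2 * L / 90) ^ t" using Gam_bounds by (intro power_mono) auto
    finally show "Gam ^ s \<le> exp (h\<^sup>2 * L / 90) ^ t" .
    show "u ^ d * inverse (q ^ (d choose 2)) \<le> exp (- (h\<^sup>2 * real t * L / 5))"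
    proof (rule le_expI)
      show "0 < u ^ d * inverse (q ^ (d choose 2))" using u0 q01 by simp
      have c2: "real (d choose 2) = real d * ((real d - 1) / 2)"
      proof -
        have "real (2 * (d choose 2)) = real (d * (d - 1))" by (simp only: choose2_double)
        then show ?thesis using d0 by (simp add: of_nat_diff)
      qed
      have "ln (u ^ d * inverse (q ^ (d choose 2))) = real d * ln u + real (d choose 2) * lq"
        unfolding q_power(2) using u0 by (simp add: ln_mult ln_realpow)
      also have "\<dots> = real d * (ln u + (real d - 1) / 2 * lq)" unfolding c2 by (simp add: algebra_simps)
      also have "\<dots> \<le> real d * (- (h * L / 5))"
      proof (rule mult_left_mono)
        \<comment> \<open>Half of the margin \<open>h\<close> absorbs the shift from
          \<open>t\<close> to \<open>t - 2\<close>, the form in which \<open>t_upper\<close> bounds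
          \<open>lq\<close>.\<close>
        have "real d - 1 \<le> (1 - h / 2) * (real t - 2)"
        proof -
          have "real d \<le> real dh" using d by simp
          then have "real d \<le> (1 - h) * real t" using dh_bounds(1) by linarith
          moreover have "(1 - h / 2) * (real t - 2) = (1 - h) * real t + h * real t / 2 - 2 + h" by (simp add: field_simps)
          ultimately show ?thesis using ht_ge(2) par(1) by linarith
        qed
        then have "(real d - 1) / 2 * lq \<le> ((1 - h / 2) * (real t - 2)) / 2 * lq" using lq by (intro mult_right_mono divide_right_mono) auto
        also have "\<dots> = (1 - h / 2) * (((real t - 2) * lq) / 2)" by simp
        also have "\<dots> \<le> (1 - h / 2) * ((2 * ln m - 2 * ln (real t) + 4 * (b * L)) / 2)"
          using t_upper par by (intro mult_left_mono divide_right_mono) auto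
        also have "\<dots> \<le> (1 - h / 2) * (L - ln (real k) + 13 * (b * L))"
        proof (rule mult_left_mono)
          show "(2 * ln m - 2 * ln (real t) + 4 * (b * L)) / 2 \<le> L - ln (real k) + 13 * (b * L)"
          proof -
            have "(2 * ln m - 2 * ln (real t) + 4 * (b * L)) / 2 = ln m - ln (real t) + 2 * (b * L)" by simp
            then show ?thesis using ln_m ph_over_t by linarith
          qed
        qed (use par(1,2) in simp)
        also have "\<dots> = (L - ln (real k) + 13 * (b * L)) - h * (L - ln (real k) + 13 * (b * L)) / 2"
        proof -
          have "(1 - h / 2) * y = y - h * y / 2" for y :: real by (simp add: left_diff_distrib)
          then show ?thesis .
        qed
        finally have 1: "(real d - 1) / 2 * lq \<le> (L - ln (real k) + 13 * (b * L)) - h * (L - ln (real k) + 13 * (b * L)) / 2" .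
        have "49 / 100 * L \<le> L - ln (real k) + 13 * (b * L)" using ln_k_le bL by linarith
        then have "h * (49 / 100 * L) \<le> h * (L - ln (real k) + 13 * (b * L))" using par by (intro mult_left_mono) auto
        then have "49 / 100 * (h * L) \<le> h * (L - ln (real k) + 13 * (b * L))" by simp
        then have "(real d - 1) / 2 * lq \<le> L - ln (real k) + 13 * (b * L) - 49 / 200 * (h * L)" using 1 by linarith
        then show "ln u + (real d - 1) / 2 * lq \<le> - (h * L / 5)" unfolding lnu using bL by linarith
      qed simp
      also have "\<dots> \<le> (h * real t) * (- (h * L / 5))"
      proof (rule mult_right_mono_neg)
        have "real dm + 1 \<le> real d" using d by simp
        then show "h * real t \<le> real d" using dm_bounds(2) by linarith
      qed (use bL in simp)
      also have "\<dots> = - (h\<^sup>2 * real t * L / 5)" by (simp add: power2_eq_square)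
      finally show "ln (u ^ d * inverse (q ^ (d choose 2))) \<le> - (h\<^sup>2 * real t * L / 5)" .
    qed
  qed (use q01 A0 u0 e2 Gam_bounds in auto)
  also have "\<dots> \<le> exp (- (14 * L))"
  proof (rule le_expI)
    show "0 < real n * (e2 * 2 ^ t * exp (- (h\<^sup>2 * real t * L / 5)) * exp (h\<^sup>2 * L / 90) ^ t)" using Lpos e2 by simp
    have "ln (real n * (e2 * 2 ^ t * exp (- (h\<^sup>2 * real t * L / 5)) * exp (h\<^sup>2 * L / 90) ^ t)) =
      L + ln e2 + real t * ln 2 - h\<^sup>2 * real t * L / 5 + real t * (h\<^sup>2 * L / 90)"
      using Lpos e2 by (simp add: ln_mult ln_realpow L_def)
    moreover have "ln e2 \<le> 0" using e2 by simp
    moreover have "real t * ln 2 \<le> real t * (h\<^sup>2 * L / 10000000)"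
    proof (rule mult_left_mono)
      have "ln 2 \<le> b * L" by (rule lnc) auto
      moreover have "b * L \<le> h\<^sup>2 / 10000000 * L" using par(9) Lpos by (intro mult_right_mono) auto
      ultimately show "ln 2 \<le> h\<^sup>2 * L / 10000000" by simp
    qed simp
    moreover have "real t * (h\<^sup>2 * L / 10000000) = (h\<^sup>2 * real t * L) / 10000000" "real t * (h\<^sup>2 * L / 90) = (h\<^sup>2 * real t * L) / 90" by auto
    moreover have "100 * L \<le> h\<^sup>2 * real t * L" using ht_ge(1) Lpos by (intro mult_right_mono) auto
    ultimately show "ln (real n * (e2 * 2 ^ t * exp (- (h\<^sup>2 * real t * L / 5)) * exp (h\<^sup>2 * L / 90) ^ t)) \<le> - (14 * L)" using Lpos by linarith
  qed
  finally show ?thesis by (simp add: s_def)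
qed

definition StrM :: "nat set set \<Rightarrow> bool" where
  "StrM H \<longleftrightarrow> (\<forall>A\<in>H. \<forall>B\<in>H. A \<noteq> B \<longrightarrow> card (A \<inter> B) \<le> l) \<and>
     (\<forall>F\<subseteq>H. clique F \<longrightarrow> t \<le> card F \<longrightarrow> (\<exists>x\<in>{1..n}. card {A \<in> F. x \<notin> A} < t - dh))"

text \<open>Generic cliques account for \<open>2 * eps\<close>; large intersections, large codegrees
  and intermediate degrees contribute at most \<open>eps / 10^6\<close> each.\<close>

lemma prob_StrM: "Prs (ksets n k) p (\<lambda>H. \<not> StrM H) \<le> 3 * eps"
proof -
  let ?K = "ksets n k"
  let ?E1 = "\<lambda>H. \<exists>A\<in>H. \<exists>B\<in>H. A \<noteq> B \<and> Suc l \<le> card (A \<inter> B)"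
  let ?E2 = "\<lambda>H. \<exists>x\<in>{1..n}. \<exists>y\<in>{1..n}. x \<noteq> y \<and> 10 \<le> card (H \<inter> (kstar n k x \<inter> kstar n k y))"
  let ?E3 = "\<lambda>H. \<exists>F\<subseteq>H. card F = t \<and> sparse_clique l F \<and> (\<forall>y\<in>{1..n}. fdeg F y \<le> dm)"
  let ?E4 = "\<lambda>d H. \<exists>x\<in>{1..n}. \<exists>F\<subseteq>H. card F = d + (t - d) \<and> fdeg F x = d \<and> popular_clique l dm ((t + 9) div 2) m1 x F"
  have num1: "2 * t + 9 * (m1 + 1)\<^sup>2 < 2 * (m1 + 1) * (dm + 1)"
  proof -
    have "9 * (real m1 + 1)\<^sup>2 \<le> 9 * (3 / h)\<^sup>2" using m1_bounds by (intro mult_left_mono power_mono) auto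
    also have "\<dots> = 81 / h\<^sup>2" by (simp add: power_divide)
    also have "\<dots> \<le> real t" using t_ge par(1) by (intro order_trans[OF _ t_ge]) (simp add: divide_right_mono)
    finally have "9 * (real m1 + 1)\<^sup>2 \<le> real t" .
    moreover have "0 < real t" using t3 by simp
    ultimately have "2 * real t + 9 * (real m1 + 1)\<^sup>2 < 4 * real t" by linarith
    also have "4 * real t = 2 * (2 / h) * (h * real t)" using par(1) by simp
    also have "\<dots> \<le> 2 * (real m1 + 1) * (real dm + 1)" using m1_bounds dm_bounds par by (intro mult_mono) auto
    finally have "real (2 * t + 9 * (m1 + 1)\<^sup>2) < real (2 * (m1 + 1) * (dm + 1))" by (simp add: algebra_simps)
    then show ?thesis by (simp only: of_nat_less_iff)
  qed
  have num2: "t - dh + 9 \<le> dh"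
  proof -
    have "(1 - h) * real t = real t - h * real t" by (simp add: left_diff_distrib)
    moreover have "h * real t \<le> 1/160 * real t" using par by (intro mult_right_mono) auto
    ultimately have "real t + 9 \<le> 2 * real dh" using dh_bounds(2) ht_ge(2) by linarith
    then have "real (t + 9) \<le> real (2 * dh)" by simp
    then have "t + 9 \<le> 2 * dh" by (simp only: of_nat_le_iff)
    then show ?thesis using dh_bounds(3) by arith
  qed
  have "Prs ?K p (\<lambda>H. \<not> StrM H) \<le> Prs ?K p (\<lambda>H. ?E1 H \<or> (?E2 H \<or> (?E3 H \<or> (\<exists>d\<in>{dm<..dh}. ?E4 d H))))"
  proof (rule Prs_mono, rule ccontr)
    fix H assume H: "H \<subseteq> ?K" "\<not> StrM H" and nn: "\<not> (?E1 H \<or> (?E2 H \<or> (?E3 H \<or> (\<exists>d\<in>{dm<..dh}. ?E4 d H))))"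
    note nn' = nn[unfolded de_Morgan_disj]
    have n1: "\<not> ?E1 H" by (rule conjunct1[OF nn'])
    have n2: "\<not> ?E2 H" by (rule conjunct1[OF conjunct2[OF nn']])
    have n3: "\<not> ?E3 H" by (rule conjunct1[OF conjunct2[OF conjunct2[OF nn']]])
    have n4: "\<not> (\<exists>d\<in>{dm<..dh}. ?E4 d H)" by (rule conjunct2[OF conjunct2[OF conjunct2[OF nn']]])
    have pairs: "card (A \<inter> B) \<le> l" if "A \<in> H" "B \<in> H" "A \<noteq> B" for A B using n1 that by (meson not_less_eq_eq)
    have codeg: "card {A \<in> H. x \<in> A \<and> y \<in> A} \<le> 9" if "x \<in> {1..n}" "y \<in> {1..n}" "x \<noteq> y" for x y
    proof -
      have "\<not> 10 \<le> card (H \<inter> (kstar n k x \<inter> kstar n k y))"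
      proof
        assume "10 \<le> card (H \<inter> (kstar n k x \<inter> kstar n k y))"
        with that have "?E2 H" by (intro bexI[of _ x] bexI[of _ y] conjI)
        with n2 show False by (rule notE)
      qed
      moreover have "H \<inter> (kstar n k x \<inter> kstar n k y) = {A \<in> H. x \<in> A \<and> y \<in> A}" using H(1) by (auto simp: kstar_def)
      ultimately show ?thesis by simp
    qed
    have concl: "\<exists>x\<in>{1..n}. card {A \<in> F. x \<notin> A} < t - dh" if F: "F \<subseteq> H" "clique F" "t \<le> card F" for F
    proof (rule structure_of_cliques[OF H(1) pairs codeg n3 _ num1 dh_bounds(3) num2 F])
      fix d assume "dm < d" "d \<le> dh"
      then have "d \<in> {dm<..dh}" by simp
      then have "?E4 d H \<Longrightarrow> (\<exists>d\<in>{dm<..dh}. ?E4 d H)" by (rule bexI[rotated])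
      then show "\<not> ?E4 d H" by (rule contrapos_nn[OF n4])
    qed
    have "StrM H" unfolding StrM_def by (intro conjI ballI allI impI pairs concl) assumption+
    then show False using H(2) by simp
  qed
  also have "\<dots> \<le> Prs ?K p ?E1 + (Prs ?K p ?E2 + (Prs ?K p ?E3 + Prs ?K p (\<lambda>H. \<exists>d\<in>{dm<..dh}. ?E4 d H)))"
    by (intro order_trans[OF Prs_disj] add_left_mono) (rule order_refl)
  also have "Prs ?K p (\<lambda>H. \<exists>d\<in>{dm<..dh}. ?E4 d H) \<le> (\<Sum>d\<in>{dm<..dh}. Prs ?K p (?E4 d))" by (rule Prs_Bex) auto
  also have "\<dots> \<le> (\<Sum>d\<in>{dm<..dh}. exp (- (14 * L)))" by (intro sum_mono prob_pop) auto
  also have "\<dots> = real (dh - dm) * exp (- (14 * L))" by simp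
  also have "\<dots> \<le> exp L * exp (- (14 * L))" using dh_bounds(3) t_exp by (intro mult_right_mono) (auto intro: order_trans[of _ "real t"])
  also have "\<dots> = exp (- (13 * L))" by (simp add: exp_add[symmetric])
  also have "\<dots> \<le> eps / 10^6" by (rule exp_small) (use bL Lpos in linarith)
  finally have "Prs ?K p (\<lambda>H. \<not> StrM H) \<le> Prs ?K p ?E1 + (Prs ?K p ?E2 + (Prs ?K p ?E3 + eps / 10^6))" by simp
  also have "\<dots> \<le> eps / 10^6 + (eps / 10^6 + (2 * eps + eps / 10^6))"
    by (intro add_mono prob_W1 prob_W2 prob_gen order_refl)
  also have "\<dots> \<le> 3 * eps" using eps01 by simp
  finally show ?thesis .
qed

end

section \<open>The typical maximum degree\<close>

lemma btail_antimono: "i \<le> j \<Longrightarrow> btail N p j \<le> btail N p i"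
  unfolding btail_def by (intro measure_pmf.finite_measure_mono) auto

lemma btail_0 [simp]: "btail N p 0 = 1"
proof -
  have "{0::nat..} = UNIV" by auto
  then show ?thesis unfolding btail_def by simp
qed

context nonL
begin

abbreviation "DD \<equiv> (n - 1) choose (k - 1)"

text \<open>The factor 27 bounds \<open>e^3\<close>, so the probability that a vertex has degree
  above \<open>J\<close> is at most \<open>exp (- 2)\<close> to the power \<open>J + 1\<close>; the
  summand \<open>3 * L\<close> makes this at most \<open>n^(-6)\<close> even for small
  \<open>phi\<close>.\<close>

definition J :: nat where "J = nat \<lceil>27 * ph + 3 * L\<rceil>"

lemma J_bounds: "27 * ph + 3 * L \<le> real J" "real J \<le> 27 * ph + 4 * L" "0 < J"
proof -
  have "0 \<le> 27 * ph + 3 * L" using ph_pos Lpos by simp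
  then have e: "real J = of_int \<lceil>27 * ph + 3 * L\<rceil>" by (simp add: J_def)
  show 1: "27 * ph + 3 * L \<le> real J" unfolding e by linarith
  have "real J \<le> 27 * ph + 3 * L + 1" unfolding e by linarith
  then show "real J \<le> 27 * ph + 4 * L" using Lpos by linarith
  show "0 < J" using 1 ph_pos Lpos by linarith
qed

lemma tail_Suc_J: "real n * (ph ^ Suc J / fact (Suc J)) \<le> exp (- (5 * L))"
proof -
  have "ph ^ Suc J / fact (Suc J) \<le> (exp 1 * ph / real (Suc J)) ^ Suc J" using ph_pos by (intro power_div_fact_le) auto
  also have "\<dots> \<le> exp (- 2) ^ Suc J"
  proof (rule power_mono)
    have "exp 1 * ph / real (Suc J) \<le> exp 1 * ph / (27 * ph)"
      using J_bounds(1) ph_pos Lpos by (intro divide_left_mono) auto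
    also have "\<dots> = exp 1 / 27" using ph_pos by simp
    also have "\<dots> \<le> exp (- 2)"
    proof -
      have "exp 1 * exp 1 * exp 1 \<le> (3::real) * 3 * 3" using exp_le by (intro mult_mono) auto
      moreover have "exp (- 2) * (exp 1 * exp 1) = (1::real)" by (simp only: exp_add[symmetric]) simp
      ultimately have "exp 1 / 27 * (exp 1 * exp 1) \<le> exp (- 2) * (exp 1 * exp 1 :: real)" by simp
      then show ?thesis by (simp only: mult_le_cancel_right_pos exp_gt_zero mult_pos_pos)
    qed
    finally show "exp 1 * ph / real (Suc J) \<le> exp (- 2)" .
  qed (use ph_pos in auto)
  also have "\<dots> = exp (real (Suc J) * (- 2))" by (rule exp_of_nat_mult[symmetric])
  also have "\<dots> \<le> exp (- (6 * L))"
  proof -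
    have "3 * L \<le> real (Suc J)" using J_bounds(1) ph_pos by simp
    then show ?thesis by simp
  qed
  finally have "exp L * (ph ^ Suc J / fact (Suc J)) \<le> exp L * exp (- (6 * L))" by (rule mult_left_mono) simp
  then have "real n * (ph ^ Suc J / fact (Suc J)) \<le> exp L * exp (- (6 * L))" by (simp only: Lpos(3))
  also have "\<dots> = exp (- (5 * L))" by (simp add: exp_add[symmetric])
  finally show ?thesis .
qed

lemma prob_above_J: "Prs (ksets n k) p (\<lambda>H. Suc J \<le> max_degree n H) \<le> eps / 10^6"
proof -
  have "Prs (ksets n k) p (\<lambda>H. Suc J \<le> max_degree n H) \<le> real n * (ph ^ Suc J / fact (Suc J))"
    by (rule prob_max_degree_ge) (use kpos kn p01 in auto)
  also have "\<dots> \<le> exp (- (5 * L))" by (rule tail_Suc_J)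
  also have "\<dots> \<le> eps / 10^6" by (rule exp_small) (use bL Lpos in linarith)
  finally show ?thesis .
qed

lemma btail_Suc_J: "real n * btail DD p (Suc J) \<le> exp (- (5 * L))"
proof -
  have one: "1 \<in> {1..n}" using kn by auto
  have "btail DD p (Suc J) = Prs (kstar n k 1) p (\<lambda>X. Suc J \<le> card X)"
    using one kpos p01 by (simp add: Prs_card_ge card_kstar)
  also have "\<dots> = Prs (kstar n k 1) p (\<lambda>X. Suc J \<le> card (X \<inter> kstar n k 1))" by (rule Prs_cong) (simp add: Int_absorb2)
  also have "\<dots> \<le> (real (card (kstar n k 1)) * p) ^ Suc J / fact (Suc J)" by (rule Prs_card_Int_ge) (use p01 in auto)
  also have "real (card (kstar n k 1)) * p = ph" using one kpos by (simp add: card_kstar phi_def mult.commute)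
  finally have "real n * btail DD p (Suc J) \<le> real n * (ph ^ Suc J / fact (Suc J))" by (intro mult_left_mono) auto
  then show ?thesis using tail_Suc_J by linarith
qed

lemma J_small: "real J \<le> exp (L / 3)" "16 * real J + 16 \<le> real DD"
proof -
  have 1: "27 * ph \<le> exp (L / 3) / 4"
  proof -
    have "27 * ph * 4 \<le> exp (L / 3)"
    proof (rule le_expI)
      have "27 * ph * 4 = 108 * ph" by simp
      moreover have "ln (108 * ph) = ln 108 + ln ph" by (rule ln_mult_pos) (use ph_pos in auto)
      ultimately have "ln (27 * ph * 4) = ln 108 + ln ph" by simp
      moreover have "ln 108 \<le> b * L" by (rule lnc) auto
      ultimately show "ln (27 * ph * 4) \<le> L / 3" using ln_ph(1) bL Lpos by linarith
    qed (use ph_pos in auto)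
    then show ?thesis by simp
  qed
  have 2: "4 * L \<le> exp (L / 3) / 4"
  proof -
    have "16 * L \<le> exp (L / 3)"
    proof (rule le_expI)
      have "ln (16 * L) = ln 16 + ln L" using Lpos by (simp add: ln_mult)
      moreover have "ln 16 \<le> b * L" by (rule lnc) auto
      ultimately show "ln (16 * L) \<le> L / 3" using lnL bL Lpos by linarith
    qed (use Lpos in auto)
    then show ?thesis by simp
  qed
  show 3: "real J \<le> exp (L / 3)" using J_bounds(2) 1 2 exp_ge_zero[of "L / 3"] by linarith
  have "34 * exp (L / 3) \<le> exp L"
  proof -
    have "34 \<le> exp (b * L)" by (rule le_expI) (auto intro: lnc)
    then have "34 * exp (L / 3) \<le> exp (b * L) * exp (L / 3)" by (intro mult_right_mono) auto
    also have "\<dots> = exp (b * L + L / 3)" by (simp add: exp_add)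
    also have "\<dots> \<le> exp L" unfolding exp_le_cancel_iff using bL Lpos by linarith
    finally show ?thesis .
  qed
  moreover have "1 \<le> exp (L / 3)" using Lpos by simp
  ultimately have "16 * real J + 16 \<le> real n - 1" using 3 Lpos(3) by linarith
  then show "16 * real J + 16 \<le> real DD" using D_ge by linarith
qed

text \<open>Take the largest \<open>ts\<close> such that the expected number of vertices of degree
  at least \<open>ts\<close> is \<open>n^(2 * h)\<close> or more. The second moment shows that this
  degree is attained, while maximality bounds the tail at \<open>Suc ts\<close> from above.\<close>

lemma ts_exists: "\<exists>ts\<le>J. real n * btail DD p (Suc ts) < exp (2 * (h * L)) \<and>
    Prs (ksets n k) p (\<lambda>H. max_degree n H < ts) \<le> eps / 10^5"
proof -
  let ?S = "{j. exp (2 * (h * L)) \<le> real n * btail DD p j}"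
  have e1: "exp (- (5 * L)) < exp (2 * (h * L))" using bL(5) Lpos by simp
  have up: "j \<le> J" if j: "j \<in> ?S" for j
  proof (rule ccontr)
    assume "\<not> j \<le> J"
    then have "btail DD p j \<le> btail DD p (Suc J)" by (intro btail_antimono) auto
    then have "real n * btail DD p j \<le> real n * btail DD p (Suc J)" by (intro mult_left_mono) auto
    moreover have "exp (2 * (h * L)) \<le> real n * btail DD p j" using j by (rule CollectD)
    ultimately show False using e1 btail_Suc_J by linarith
  qed
  have fin: "finite ?S" by (rule finite_subset[of _ "{..J}"]) (use up in auto)
  have "exp (2 * (h * L)) \<le> exp L" unfolding exp_le_cancel_iff using bL Lpos by linarith
  then have "0 \<in> ?S" using Lpos by simp
  then have ne: "?S \<noteq> {}" by blast
  define ts where "ts = Max ?S"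
  have tsS: "ts \<in> ?S" unfolding ts_def by (rule Max_in[OF fin ne])
  have tsJ: "ts \<le> J" by (rule up[OF tsS])
  have "Suc ts \<notin> ?S" using Max_ge[OF fin, of "Suc ts"] unfolding ts_def[symmetric] by auto
  then have s1: "real n * btail DD p (Suc ts) < exp (2 * (h * L))" by simp
  define tau where "tau = btail DD p ts"
  have nt: "exp (2 * (h * L)) \<le> real n * tau" using tsS by (simp add: tau_def)
  have tau0: "0 < tau"
  proof (rule ccontr)
    assume "\<not> 0 < tau"
    then have "real n * tau \<le> 0" by (simp add: mult_nonneg_nonpos)
    then show False using nt exp_gt_zero[of "2 * (h * L)"] by linarith
  qed
  define R where "R = 1 + 4 * real J / ph"
  have "Prs (ksets n k) p (\<lambda>H. max_degree n H < ts) \<le> Prs (ksets n k) p (\<lambda>H. \<forall>x\<in>{1..n}. \<not> ts \<le> card (H \<inter> kstar n k x))"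
  proof (rule Prs_mono)
    fix H assume H: "H \<subseteq> ksets n k" "max_degree n H < ts"
    show "\<forall>x\<in>{1..n}. \<not> ts \<le> card (H \<inter> kstar n k x)"
    proof
      fix x assume "x \<in> {1..n}"
      then have "card (star H x) \<le> max_degree n H" by (rule card_star_le_max_degree)
      then show "\<not> ts \<le> card (H \<inter> kstar n k x)" using H star_eq_Int[OF H(1), of x] by simp
    qed
  qed
  also have "\<dots> \<le> 1 / (real n * tau) + (exp (R\<^sup>2 * (ph * real k / real n)) - 1)"
  proof (rule prob_max_degree_less)
    have "8 * real ts + 8 \<le> real DD" using J_small(2) tsJ by linarith
    then have "real (8 * ts) < real DD" by simp
    then show "8 * ts < DD" by (simp only: of_nat_less_iff)
    have "4 * real ts / ph \<le> 4 * real J / ph" using tsJ ph_pos by (intro divide_right_mono) auto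
    then show "1 + 4 * real ts / ph \<le> R" by (simp add: R_def)
  qed (use kpos kn p01 tau0 in \<open>auto simp: tau_def\<close>)
  also have "\<dots> \<le> eps / 10^6 + 8 * (eps / 10^6)"
  proof (rule add_mono)
    have "1 / (real n * tau) \<le> 1 / exp (2 * (h * L))" using nt by (intro divide_left_mono mult_pos_pos) (use Lpos tau0 in auto)
    also have "\<dots> = exp (- (2 * (h * L)))" by (simp add: exp_minus inverse_eq_divide)
    also have "\<dots> \<le> eps / 10^6" by (rule exp_small) (use bL in linarith)
    finally show "1 / (real n * tau) \<le> eps / 10^6" .
    let ?y = "R\<^sup>2 * (ph * real k / real n)"
    have y: "?y \<le> 4 * (eps / 10^6)"
    proof -
      have Rle: "R \<le> 109 + 16 * L / ph"
      proof -
        have "4 * real J / ph \<le> 4 * (27 * ph + 4 * L) / ph" using J_bounds(2) ph_pos by (intro divide_right_mono) auto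
        also have "\<dots> = 108 + 16 * L / ph" using ph_pos by (simp add: field_simps)
        finally show ?thesis by (simp add: R_def)
      qed
      have R0: "0 \<le> R" using ph_pos by (simp add: R_def)
      have "R\<^sup>2 \<le> (109 + 16 * L / ph)\<^sup>2" using Rle R0 by (intro power_mono)
      \<comment> \<open>Separates a part of \<open>?y\<close> proportional to \<open>phi\<close>
        from one proportional to \<open>1 / phi\<close>; the latter is small because
        \<open>phi\<close> is at least \<open>n^(-1/3)\<close>.\<close>
      also have "\<dots> \<le> 2 * 109\<^sup>2 + 2 * (16 * L / ph)\<^sup>2"
      proof -
        have "0 \<le> (109 - 16 * L / ph)\<^sup>2" by simp
        then show ?thesis unfolding power2_sum power2_diff by linarith
      qed
      finally have "?y \<le> (2 * 109\<^sup>2 + 2 * (16 * L / ph)\<^sup>2) * (ph * real k / real n)"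
        using ph_pos by (intro mult_right_mono) auto
      also have "\<dots> = 23762 * (ph * real k / real n) + 512 * L\<^sup>2 * real k / (ph * real n)"
        using ph_pos Lpos by (simp add: field_simps power2_eq_square)
      also have "\<dots> \<le> eps / 10^6 + eps / 10^6"
      proof (rule add_mono)
        show "23762 * (ph * real k / real n) \<le> eps / 10^6"
        proof (rule small_if)
          have "ln (23762 * (ph * real k / real n)) = ln 23762 + ln ph + ln (real k) - L"
            using ph_pos kpos Lpos by (simp add: ln_mult ln_div L_def)
          moreover have "ln 23762 \<le> b * L" by (rule lnc) auto
          ultimately show "ln (23762 * (ph * real k / real n)) \<le> - (b * L)" using ln_ph ln_k_le bL Lpos by linarith
        qed (use ph_pos kpos Lpos in auto)
        show "512 * L\<^sup>2 * real k / (ph * real n) \<le> eps / 10^6"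
        proof (rule small_if)
          have "ln (512 * L\<^sup>2 * real k / (ph * real n)) = ln 512 + 2 * ln L + ln (real k) - ln ph - L"
            using ph_pos kpos Lpos by (simp add: ln_mult ln_div ln_realpow) (simp add: L_def)
          moreover have "ln 512 \<le> b * L" by (rule lnc) auto
          ultimately show "ln (512 * L\<^sup>2 * real k / (ph * real n)) \<le> - (b * L)" using ln_ph ln_k_le lnL bL Lpos by linarith
        qed (use ph_pos kpos Lpos in auto)
      qed
      finally have "?y \<le> eps / 10^6 + eps / 10^6" .
      moreover have "0 < eps / 10^6" using eps01 by simp
      ultimately show ?thesis by linarith
    qed
    have y0: "0 \<le> ?y" using ph_pos by simp
    have y1: "?y \<le> 1" using y eps01 by simp
    have "exp ?y \<le> 1 + ?y + ?y\<^sup>2" using y0 y1 by (rule exp_bound)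
    also have "?y\<^sup>2 \<le> ?y"
    proof -
      have "z\<^sup>2 \<le> z" if "0 \<le> z" "z \<le> 1" for z :: real using that by (simp add: power2_eq_square mult_left_le)
      then show ?thesis using y0 y1 .
    qed
    finally show "exp ?y - 1 \<le> 8 * (eps / 10^6)" using y by linarith
  qed
  also have "\<dots> \<le> eps / 10^5" using eps01 by simp
  finally show ?thesis using tsJ s1 by blast
qed

end

section \<open>Edges off the centre are not profitable\<close>

context Mreg
begin

lemma inv_ph: "- ln ph \<le> h * L / 8000"
proof -
  have "h\<^sup>2 / 50 \<le> h / 8000"
  proof -
    have "h * h \<le> (1/160) * h" using par by (intro mult_right_mono) auto
    then show ?thesis by (simp add: power2_eq_square)
  qed
  then have "h\<^sup>2 / 50 * L \<le> h / 8000 * L" using Lpos by (intro mult_right_mono) auto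
  then show ?thesis using phM unfolding L_def[symmetric] by linarith
qed

lemma ln_J: "ln (real J) \<le> ln ph + h * L / 1000"
proof -
  have "real J \<le> ph * exp (h * L / 1000)"
  proof -
    have "4 * L \<le> ph * (exp (h * L / 1000) / 2)"
    proof -
      have "8 * L / ph \<le> exp (h * L / 1000)"
      proof (rule le_expI)
        have "ln (8 * L / ph) = ln 8 + ln L - ln ph" using Lpos ph_pos by (simp add: ln_mult ln_div)
        moreover have "ln 8 \<le> b * L" by (rule lnc) auto
        ultimately show "ln (8 * L / ph) \<le> h * L / 1000" using lnL inv_ph bL by linarith
      qed (use Lpos ph_pos in auto)
      then show ?thesis using ph_pos by (simp add: field_simps)
    qed
    moreover have "27 * ph \<le> ph * (exp (h * L / 1000) / 2)"
    proof -
      have "54 \<le> exp (h * L / 1000)"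
      proof (rule le_expI)
        have "ln 54 \<le> b * L" by (rule lnc) auto
        then show "ln 54 \<le> h * L / 1000" using bL by linarith
      qed simp
      then have "27 \<le> exp (h * L / 1000) / 2" by simp
      then have "ph * 27 \<le> ph * (exp (h * L / 1000) / 2)" using ph_pos by (intro mult_left_mono) auto
      then show ?thesis by simp
    qed
    ultimately show ?thesis using J_bounds(2) by (simp add: field_simps)
  qed
  then have "ln (real J) \<le> ln (ph * exp (h * L / 1000))" using J_bounds(3) ph_pos by (subst ln_le_cancel_iff) auto
  then show ?thesis using ph_pos by (simp add: ln_mult)
qed

text \<open>The second place where 1/4 matters. Each member of \<open>G\<close> contributes
  \<open>m * J * q^T\<close>, and \<open>t_lower\<close> bounds \<open>q^T\<close> by about
  \<open>(J / m)^2\<close>. What is left is \<open>J^3 / m\<close>, about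
  \<open>phi^2 * k / n\<close>, which is at most about \<open>n^(- 2 * a)\<close>, that is
  \<open>n^(- 40 * h)\<close>. This outweighs the loss \<open>q ^ (- 2 * s)\<close> and the growth
  of the degree tail between \<open>Suc T\<close> and \<open>T - s\<close>.\<close>

lemma prob_partB_s:
  assumes T: "t \<le> T" "T \<le> J" and bt: "real n * btail DD p (Suc T) \<le> exp (2 * (h * L))" and s: "0 < s" "s < t - dh"
  shows "real n * (m ^ s / fact s * (real J ^ s * (q ^ s * EE s s l) ^ (T - 2 * s) * btail DD p (T - s))) \<le> exp (- (15 * (h * L))) * (1 / 2) ^ s"
proof -
  have sh: "real s \<le> h * real t + 1"
  proof -
    have "real s + real dh < real t" using s by linarith
    moreover have "(1 - h) * real t = real t - h * real t" by (simp add: left_diff_distrib)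
    ultimately show ?thesis using dh_bounds(2) by linarith
  qed
  have s_t: "2 * s \<le> t" "s \<le> t" "2 * s \<le> T"
  proof -
    have "h * real t \<le> 1/160 * real t" using par by (intro mult_right_mono) auto
    then have "2 * real s \<le> real t" using sh ht_ge(2) by linarith
    then show "2 * s \<le> t" by linarith
    then show "s \<le> t" "2 * s \<le> T" using T by auto
  qed
  have slq: "real s * lq \<le> 17 / 10 * (h * L)"
  proof -
    have "real s * lq \<le> (h * real t + 1) * lq" using sh lq by (intro mult_right_mono) auto
    also have "\<dots> = h * (real t * lq) + lq" by (simp add: algebra_simps)
    also have "\<dots> \<le> h * (8 / 5 * L) + lq" using tlq(2) par by (intro add_right_mono mult_left_mono) auto
    finally show ?thesis using lq(2) bL by linarith
  qed
  have T0: "0 < real T" "0 < T" using T t3 by auto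
  have lnT: "ln (real T) \<le> ln (real J)" "ln (real t) \<le> ln (real J)" using T T0 t3 by auto
  have lns: "ln (real s) \<le> L / 4 - a * L + 2 * (b * L)" "0 < real s"
  proof -
    show "0 < real s" using s by simp
    have "ln (real s) \<le> ln (real t)" using s s_t by auto
    then show "ln (real s) \<le> L / 4 - a * L + 2 * (b * L)" using rt(2) by linarith
  qed
  have JR: "ln (real J) + ln r \<le> 10 * (b * L) + h * L / 1000" using ln_J nl par(5) by (simp add: L_def)
  have EEb: "EE s s l ^ (T - 2 * s) \<le> exp (real s)"
  proof -
    let ?e = "real s * r * e0 / q + 2 * z0 + pp * r * inverse (q ^ s) * (real s)\<^sup>2 * real l"
    have l0: "0 < real l" using l_bounds by simp
    have e0': "0 \<le> ?e" using q01 e0_pos z0_bounds pp_pos by (intro add_nonneg_nonneg mult_nonneg_nonneg divide_nonneg_nonneg) auto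
    have 1: "real T * (r * e0 / q) \<le> eps / 10^6"
    proof (rule small_if)
      have "ln (real T * (r * e0 / q)) = ln (real T) + ln r + ln e0 + lq"
        using T0 q01 e0_pos by (simp add: ln_mult ln_div lq_def)
      then show "ln (real T * (r * e0 / q)) \<le> - (b * L)" using lnT JR ln_e0 lq(2) bL Lpos by linarith
    qed (use T0 q01 e0_pos in auto)
    have 2: "real T * (2 * z0) \<le> eps / 10^6"
    proof (rule z0_small)
      have "real T \<le> exp (L / 3)" using T J_small(1) by (intro order_trans[OF _ J_small(1)]) auto
      also have "\<dots> \<le> exp L" unfolding exp_le_cancel_iff using Lpos(2) by linarith
      finally show "real T \<le> exp L" .
    qed (rule T0)
    have 3: "real T * (pp * r * inverse (q ^ s) * real s * real l) \<le> eps / 10^6"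
    proof (rule small_if)
      have "ln (real T * (pp * r * inverse (q ^ s) * real s * real l)) = ln (real T) + ln r + ln pp + real s * lq + ln (real s) + ln (real l)"
        unfolding q_power(2) using T0 q01 pp_pos lns(2) l0 by (simp add: ln_mult)
      then show "ln (real T * (pp * r * inverse (q ^ s) * real s * real l)) \<le> - (b * L)"
        using lnT JR ln_pp(2) slq lns(1) ln_l bL Lpos by linarith
      show "0 < real T * (pp * r * inverse (q ^ s) * real s * real l)" using T0 q01 pp_pos lns(2) l0 by simp
    qed
    have "real (T - 2 * s) * ?e \<le> real T * ?e" using e0' by (intro mult_right_mono) auto
    also have "real T * ?e = real s * (real T * (r * e0 / q)) + real T * (2 * z0) + real s * (real T * (pp * r * inverse (q ^ s) * real s * real l))"
      by (simp add: algebra_simps power2_eq_square)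
    also have "\<dots> \<le> real s * (1/3) + real s * (1/3) + real s * (1/3)"
    proof (intro add_mono mult_left_mono)
      have e6: "eps / 10^6 \<le> 1/3" using eps01 by simp
      show "real T * (r * e0 / q) \<le> 1/3" "real T * (pp * r * inverse (q ^ s) * real s * real l) \<le> 1/3" using 1 3 e6 by linarith+
      have "1 \<le> real s" using s by simp
      then show "real T * (2 * z0) \<le> real s * (1/3)" using 2 e6 by linarith
    qed auto
    finally have "real (T - 2 * s) * ?e \<le> real s" by simp
    moreover have "EE s s l ^ (T - 2 * s) = exp (real (T - 2 * s) * ?e)" unfolding EE_def by (rule exp_of_nat_mult[symmetric])
    ultimately show ?thesis by simp
  qed
  have qb: "(q ^ s) ^ (T - 2 * s) \<le> exp (real s * (- (2 * ln m) + 2 * ln (real J) + 17 / 5 * (h * L)))"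
  proof -
    have "(q ^ s) ^ (T - 2 * s) = exp (- (real (s * (T - 2 * s)) * lq))" unfolding power_mult[symmetric] by (rule q_power(1))
    also have "\<dots> = exp (real s * (- (real (T - 2 * s) * lq)))" by simp
    also have "\<dots> \<le> exp (real s * (- (2 * ln m) + 2 * ln (real J) + 17 / 5 * (h * L)))"
    proof -
      have "real (T - 2 * s) = real T - 2 * real s" using s_t by (simp add: of_nat_diff)
      then have "real (T - 2 * s) * lq = (real T - 1) * lq + lq - 2 * (real s * lq)" by (simp add: algebra_simps)
      moreover have "(real t - 1) * lq \<le> (real T - 1) * lq" using T lq by (intro mult_right_mono) auto
      ultimately have "2 * ln m - 2 * ln (real J) - 17 / 5 * (h * L) \<le> real (T - 2 * s) * lq"
        using t_lower slq lq(1) lnT(2) by linarith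
      then have "- (real (T - 2 * s) * lq) \<le> - (2 * ln m) + 2 * ln (real J) + 17 / 5 * (h * L)" by linarith
      then have "real s * (- (real (T - 2 * s) * lq)) \<le> real s * (- (2 * ln m) + 2 * ln (real J) + 17 / 5 * (h * L))" by (intro mult_left_mono) auto
      then show ?thesis by (simp only: exp_le_cancel_iff)
    qed
    finally show ?thesis .
  qed
  define R where "R = exp (h * L / 1000)"
  have bts: "real n * btail DD p (T - s) \<le> exp (real (Suc s) * (h * L / 1000)) * exp (2 * (h * L))"
  proof -
    \<comment> \<open>The tail is controlled at \<open>Suc T\<close> by \<open>bt\<close>, so
      reaching the threshold \<open>T - s\<close> takes \<open>Suc s\<close> steps of ratio at most
      \<open>R\<close>.\<close>
    have ST: "Suc T - Suc s = T - s" by simp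
    have "btail DD p (Suc T - Suc s) \<le> R ^ Suc s * btail DD p (Suc T)"
    proof (rule btail_ratio_power)
      have c: "2 * real T + 2 \<le> real DD"
      proof -
        have "real T \<le> real J" using T by simp
        then show ?thesis using J_small(2) by linarith
      qed
      then have "real (Suc T) < real DD" by linarith
      then show "Suc T < DD" by (simp only: of_nat_less_iff)
      then show "Suc T \<le> DD" by simp
      show "Suc s \<le> Suc T" using s_t T by simp
      have DT: "real DD / 2 \<le> real (DD - Suc T)" using c \<open>Suc T < DD\<close> by (simp add: of_nat_diff)
      have D0: "0 < real DD" using c by linarith
      have "real (Suc T) / (real (DD - Suc T) * p) \<le> real (Suc T) / (real DD / 2 * p)"
        using DT p01 D0 \<open>Suc T < DD\<close> by (intro divide_left_mono mult_right_mono mult_pos_pos) auto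
      also have "\<dots> = 2 * real (Suc T) / ph" by (simp add: phi_def field_simps)
      also have "\<dots> \<le> 2 * (2 * real J) / ph" using T J_bounds(3) ph_pos by (intro divide_right_mono mult_left_mono) auto
      finally have "1 + real (Suc T) / (real (DD - Suc T) * p) \<le> 1 + 4 * real J / ph" by simp
      also have "\<dots> \<le> 1 + (108 + 16 * L / ph)"
      proof -
        have "4 * real J / ph \<le> 4 * (27 * ph + 4 * L) / ph" using J_bounds(2) ph_pos by (intro divide_right_mono) auto
        also have "\<dots> = 108 + 16 * L / ph" using ph_pos by (simp add: field_simps)
        finally show ?thesis by simp
      qed
      also have "\<dots> \<le> R"
      proof -
        have "32 * L / ph \<le> R" unfolding R_def
        proof (rule le_expI)
          have "ln (32 * L / ph) = ln 32 + ln L - ln ph" using Lpos ph_pos by (simp add: ln_mult ln_div)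
          moreover have "ln 32 \<le> b * L" by (rule lnc) auto
          ultimately show "ln (32 * L / ph) \<le> h * L / 1000" using lnL inv_ph bL by linarith
        qed (use Lpos ph_pos in auto)
        moreover have "218 \<le> R" unfolding R_def
        proof (rule le_expI)
          have "ln 218 \<le> b * L" by (rule lnc) auto
          then show "ln 218 \<le> h * L / 1000" using bL by linarith
        qed simp
        ultimately show ?thesis by simp
      qed
      finally show "1 + real (Suc T) / (real (DD - Suc T) * p) \<le> R" .
    qed (use p01 in auto)
    then have "real n * btail DD p (T - s) \<le> real n * (R ^ Suc s * btail DD p (Suc T))" unfolding ST by (intro mult_left_mono) auto
    also have "\<dots> = R ^ Suc s * (real n * btail DD p (Suc T))" by simp
    also have "\<dots> \<le> R ^ Suc s * exp (2 * (h * L))" using bt by (intro mult_left_mono) (auto simp: R_def)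
    also have "R ^ Suc s = exp (real (Suc s) * (h * L / 1000))" unfolding R_def by (rule exp_of_nat_mult[symmetric])
    finally show ?thesis .
  qed
  have mJ: "m ^ s / fact s * real J ^ s \<le> exp (real s * (ln m + ln (real J)))"
  proof -
    have "m ^ s / fact s * real J ^ s \<le> m ^ s / 1 * real J ^ s"
      using ph_pos by (intro mult_right_mono divide_left_mono) (auto simp: fact_ge_1)
    also have "\<dots> = exp (ln m) ^ s * exp (ln (real J)) ^ s" using ph_pos J_bounds(3) by simp
    also have "\<dots> = exp (real s * (ln m + ln (real J)))" by (simp only: exp_of_nat_mult[symmetric] exp_add[symmetric] distrib_left)
    finally show ?thesis .
  qed
  have "real n * (m ^ s / fact s * (real J ^ s * (q ^ s * EE s s l) ^ (T - 2 * s) * btail DD p (T - s)))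
     = (m ^ s / fact s * real J ^ s) * ((q ^ s) ^ (T - 2 * s) * EE s s l ^ (T - 2 * s)) * (real n * btail DD p (T - s))"
    by (simp add: power_mult_distrib mult_ac)
  also have "\<dots> \<le> exp (real s * (ln m + ln (real J))) * (exp (real s * (- (2 * ln m) + 2 * ln (real J) + 17 / 5 * (h * L))) * exp (real s)) *
     (exp (real (Suc s) * (h * L / 1000)) * exp (2 * (h * L)))"
  proof (rule mult_mono[OF _ bts])
    show "m ^ s / fact s * real J ^ s * ((q ^ s) ^ (T - 2 * s) * EE s s l ^ (T - 2 * s))
       \<le> exp (real s * (ln m + ln (real J))) * (exp (real s * (- (2 * ln m) + 2 * ln (real J) + 17 / 5 * (h * L))) * exp (real s))"
    proof (rule mult_mono[OF mJ])
      show "(q ^ s) ^ (T - 2 * s) * EE s s l ^ (T - 2 * s)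
       \<le> exp (real s * (- (2 * ln m) + 2 * ln (real J) + 17 / 5 * (h * L))) * exp (real s)"
        by (rule mult_mono[OF qb EEb]) (use q01 EE_pos[of s s l] in auto)
    qed (use q01 EE_pos[of s s l] in auto)
  qed auto
  also have "\<dots> = exp (real s * (3 * ln (real J) - ln m + 1 + 17 / 5 * (h * L) + h * L / 1000) + h * L / 1000 + 2 * (h * L))"
    unfolding exp_add[symmetric] by (rule arg_cong[where f = exp]) (simp add: field_simps)
  also have "\<dots> \<le> exp (real s * (- (36 * (h * L))) + h * L / 1000 + 2 * (h * L))"
  proof -
    have "1 \<le> b * L" using lnc[of "exp 1"] exp_le by simp
    then have "3 * ln (real J) - ln m + 1 + 17 / 5 * (h * L) + h * L / 1000 \<le> - (36 * (h * L))"
      using ln_J ln_m ln_ph(1) ln_k_le bL by linarith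
    then have "real s * (3 * ln (real J) - ln m + 1 + 17 / 5 * (h * L) + h * L / 1000) \<le> real s * (- (36 * (h * L)))" by (intro mult_left_mono) auto
    then show ?thesis by simp
  qed
  also have "\<dots> \<le> exp (- (15 * (h * L)) + real s * (- (18 * (h * L))))"
  proof -
    have "1 * (18 * (h * L)) \<le> real s * (18 * (h * L))" using s bL by (intro mult_right_mono) auto
    moreover have "real s * (- (36 * (h * L))) = - (real s * (18 * (h * L))) - real s * (18 * (h * L))" "real s * (- (18 * (h * L))) = - (real s * (18 * (h * L)))" by auto
    ultimately have "real s * (- (36 * (h * L))) + h * L / 1000 + 2 * (h * L) \<le> - (15 * (h * L)) + real s * (- (18 * (h * L)))" using bL by linarith
    then show ?thesis by (simp only: exp_le_cancel_iff)
  qed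
  also have "\<dots> = exp (- (15 * (h * L))) * exp (- (18 * (h * L))) ^ s" by (simp only: exp_add exp_of_nat_mult)
  also have "\<dots> \<le> exp (- (15 * (h * L))) * (1 / 2) ^ s"
  proof (intro mult_left_mono power_mono)
    have "exp (- (18 * (h * L))) \<le> eps / 10^6" by (rule exp_small) (use bL in linarith)
    then show "exp (- (18 * (h * L))) \<le> 1 / 2" using eps01 by simp
  qed auto
  finally show ?thesis .
qed

text \<open>Let \<open>G\<close> and \<open>Fx\<close> be the members of the clique off and at its
  centre \<open>x\<close>. The star of \<open>x\<close> contains \<open>Fx\<close> and, disjoint
  from it, the edges of \<open>H\<close> in \<open>miss n k x G\<close>. As the clique is at least
  as large as this star, at most \<open>card G\<close> such edges exist, which is the event of
  \<open>prob_near_star\<close>.\<close>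

lemma prob_not_EKR_M:
  assumes T: "t \<le> T" "T \<le> J" and bt: "real n * btail DD p (Suc T) \<le> exp (2 * (h * L))"
  shows "Prs (ksets n k) p (\<lambda>H. \<not> satisfies_EKR n H) \<le> 4 * eps + Prs (ksets n k) p (\<lambda>H. max_degree n H < T)"
proof -
  let ?K = "ksets n k"
  let ?E = "\<lambda>s H. \<exists>x\<in>{1..n}. \<exists>G\<subseteq>H. card G = s \<and> (\<forall>A\<in>G. x \<notin> A) \<and>
      (\<forall>A\<in>G. \<forall>B\<in>G. A \<noteq> B \<longrightarrow> card (A \<inter> B) \<le> l) \<and> card (H \<inter> miss n k x G) \<le> s \<and>
      T \<le> card (H \<inter> kstar n k x) + s \<and> card (H \<inter> kstar n k x) \<le> J"
  let ?S = "{1..<t - dh}"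
  have "Prs ?K p (\<lambda>H. \<not> satisfies_EKR n H) \<le>
     Prs ?K p (\<lambda>H. \<not> StrM H \<or> (max_degree n H < T \<or> (Suc J \<le> max_degree n H \<or> (\<exists>s\<in>?S. ?E s H))))"
  proof (rule Prs_mono)
    fix H assume H: "H \<subseteq> ?K" "\<not> satisfies_EKR n H"
    have finH: "finite H" using H(1) finite_subset by blast
    have "\<exists>s\<in>?S. ?E s H" if st: "StrM H" and dT: "T \<le> max_degree n H" and dJ: "max_degree n H \<le> J"
    proof -
      have "0 < n" using kn by simp
      from not_EKR_nontrivial[OF H(1) this H(2)] obtain F where F: "F \<subseteq> H" "clique F" "\<forall>x\<in>{1..n}. \<exists>A\<in>F. x \<notin> A" "max_degree n H \<le> card F"
        by (elim exE conjE)
      have finF: "finite F" using F(1) finH by (rule finite_subset)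
      have "t \<le> card F" using T(1) dT F(4) by linarith
      with st F(1,2) obtain x where x: "x \<in> {1..n}" "card {A \<in> F. x \<notin> A} < t - dh" unfolding StrM_def by metis
      define G where "G = {A \<in> F. x \<notin> A}"
      define Fx where "Fx = {A \<in> F. x \<in> A}"
      have cF: "card F = card G + card Fx"
      proof -
        have "F = G \<union> Fx" by (auto simp: G_def Fx_def)
        moreover have "card (G \<union> Fx) = card G + card Fx" using finF by (intro card_Un_disjoint) (auto simp: G_def Fx_def)
        ultimately show ?thesis by simp
      qed
      have "G \<noteq> {}" using F(3) x(1) by (auto simp: G_def)
      moreover have finG: "finite G" using finF by (simp add: G_def)
      ultimately have "card G \<noteq> 0" by simp
      then have sS: "card G \<in> ?S" using x(2) by (auto simp: G_def)
      have deg: "card (H \<inter> kstar n k x) \<le> max_degree n H" 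
        using card_star_le_max_degree[OF x(1), of H] by (simp only: star_eq_Int[OF H(1)])
      have FxH: "Fx \<subseteq> H \<inter> kstar n k x" using F(1) H(1) by (auto simp: Fx_def kstar_def)
      have GH: "G \<subseteq> H" using F(1) by (auto simp: G_def)
      have disj: "Fx \<inter> miss n k x G = {}"
      proof -
        have "A \<inter> B \<noteq> {}" if "A \<in> Fx" "B \<in> G" for A B
        proof -
          have "A \<noteq> B" "A \<in> F" "B \<in> F" using that by (auto simp: Fx_def G_def)
          then have "\<not> disjnt A B" using F(2) unfolding clique_def pairwise_def by metis
          then show ?thesis by (simp add: disjnt_def)
        qed
        then show ?thesis by (auto simp: miss_def)
      qed
      have "card (H \<inter> miss n k x G) + card Fx = card (H \<inter> miss n k x G \<union> Fx)"
        using finH finF disj by (intro card_Un_disjoint[symmetric]) (auto simp: Fx_def)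
      also have "\<dots> \<le> card (H \<inter> kstar n k x)"
        using finH FxH miss_subset[of n k x G] by (intro card_mono) auto
      finally have "card (H \<inter> miss n k x G) \<le> card G" using deg F(4) cF by linarith
      moreover have "card Fx \<le> card (H \<inter> kstar n k x)" using finH FxH by (intro card_mono) auto
      ultimately have "?E (card G) H" using x(1) GH dT dJ deg F(4) cF st
        by (intro bexI[of _ x] exI[of _ G] conjI) (auto simp: G_def StrM_def)
      then show ?thesis using sS by (rule bexI)
    qed
    then show "\<not> StrM H \<or> (max_degree n H < T \<or> (Suc J \<le> max_degree n H \<or> (\<exists>s\<in>?S. ?E s H)))"
      by (cases "StrM H"; cases "max_degree n H < T"; cases "Suc J \<le> max_degree n H") (simp_all only: not_less not_less_eq_eq simp_thms)
  qed
  also have "\<dots> \<le> Prs ?K p (\<lambda>H. \<not> StrM H) + (Prs ?K p (\<lambda>H. max_degree n H < T) + (Prs ?K p (\<lambda>H. Suc J \<le> max_degree n H) + Prs ?K p (\<lambda>H. \<exists>s\<in>?S. ?E s H)))"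
    by (intro order_trans[OF Prs_disj] add_left_mono) (rule order_refl)
  also have "\<dots> \<le> 3 * eps + (Prs ?K p (\<lambda>H. max_degree n H < T) + (eps / 10^6 + eps / 10^6))"
  proof (intro add_mono prob_StrM order_refl prob_above_J)
    have "Prs ?K p (\<lambda>H. \<exists>s\<in>?S. ?E s H) \<le> (\<Sum>s\<in>?S. Prs ?K p (?E s))" by (rule Prs_Bex) auto
    also have "\<dots> \<le> (\<Sum>s\<in>?S. exp (- (15 * (h * L))) * (1 / 2) ^ s)"
    proof (rule sum_mono)
      fix s assume s: "s \<in> ?S"
      have "2 * s \<le> T"
      proof -
        have "(1 - h) * real t = real t - h * real t" by (simp add: left_diff_distrib)
        moreover have "real s + real dh < real t" using s by auto
        moreover have "h * real t \<le> 1/160 * real t" using par by (intro mult_right_mono) auto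
        ultimately have "2 * real s \<le> real t" using dh_bounds(2) ht_ge(2) by linarith
        then show ?thesis using T by linarith
      qed
      then have "Prs ?K p (?E s) \<le> real n * (m ^ s / fact s * (real J ^ s * (q ^ s * EE s s l) ^ (T - 2 * s) * btail DD p (T - s)))"
        using p01 by (intro prob_near_star) auto
      also have "\<dots> \<le> exp (- (15 * (h * L))) * (1 / 2) ^ s" by (rule prob_partB_s[OF T bt]) (use s in auto)
      finally show "Prs ?K p (?E s) \<le> exp (- (15 * (h * L))) * (1 / 2) ^ s" .
    qed
    also have "\<dots> = exp (- (15 * (h * L))) * (\<Sum>s\<in>?S. (1 / 2) ^ s)" by (simp add: sum_distrib_left)
    also have "\<dots> \<le> exp (- (15 * (h * L))) * 2"
    proof (rule mult_left_mono)
      have "(\<Sum>s\<in>?S. (1 / 2 :: real) ^ s) \<le> (\<Sum>s<t - dh. (1 / 2) ^ s)" by (rule sum_mono2) auto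
      also have "\<dots> \<le> 2" by (simp add: sum_gp_strict)
      finally show "(\<Sum>s\<in>?S. (1 / 2 :: real) ^ s) \<le> 2" .
    qed simp
    also have "\<dots> \<le> exp (- (15 * (h * L))) * exp (b * L)"
    proof (rule mult_left_mono)
      show "2 \<le> exp (b * L)" by (rule le_expI) (auto intro: lnc)
    qed simp
    also have "\<dots> = exp (- (15 * (h * L)) + b * L)" by (rule exp_add[symmetric])
    also have "\<dots> \<le> eps / 10^6" by (rule exp_small) (use bL in linarith)
    finally show "Prs ?K p (\<lambda>H. \<exists>s\<in>?S. ?E s H) \<le> eps / 10^6" .
  qed
  also have "\<dots> \<le> 4 * eps + Prs ?K p (\<lambda>H. max_degree n H < T)" using eps01 by simp
  finally show ?thesis .
qed

end

section \<open>Polynomially small meeting probability\<close>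

text \<open>Only \<open>N\<close> of the \<open>D\<close> trials are observed. Since
  \<open>N * p \<le> 1\<close>, requiring no further success among them costs just the constant
  \<open>exp (- 2)\<close>.\<close>

lemma btail_ge:
  assumes p: "0 < p" "p \<le> 1/2" and j: "0 < j" "j \<le> N" "N \<le> D" and Np: "real N * p \<le> 1"
  shows "(real N * p / real j) ^ j * exp (- 2) \<le> btail D p j"
proof -
  have "(1 - p) ^ N \<le> (1 - p) ^ (N - j)" using p by (intro power_decreasing) auto
  moreover have "exp (- 2) \<le> (1 - p) ^ N"
  proof -
    have "p / (1 - p) \<le> 2 * p" using p by (simp add: field_simps)
    then have "exp (- (2 * p)) \<le> exp (- (p / (1 - p)))" by simp
    also have "\<dots> \<le> 1 - p" using p by (intro exp_neg_le_1_minus) auto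
    finally have "exp (- (2 * p)) ^ N \<le> (1 - p) ^ N" by (intro power_mono) auto
    moreover have "exp (- (2 * p)) ^ N = exp (real N * (- (2 * p)))" by (rule exp_of_nat_mult[symmetric])
    moreover have "- 2 \<le> real N * (- (2 * p))" using Np by simp
    ultimately show ?thesis by (smt (verit) exp_le_cancel_iff)
  qed
  ultimately have e: "exp (- 2) \<le> (1 - p) ^ (N - j)" by linarith
  have "(real N * p / real j) ^ j * exp (- 2) = (real N / real j) ^ j * p ^ j * exp (- 2)"
    by (simp add: power_mult_distrib power_divide)
  also have "\<dots> \<le> real (N choose j) * p ^ j * (1 - p) ^ (N - j)"
    using p j e binomial_ge_n_over_k_pow_k[of j N, where 'a = real] by (intro mult_mono) auto
  also have "\<dots> = Prs {..<N} p (\<lambda>X. card X = j)" using p by (subst Prs_card_eq) auto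
  also have "\<dots> = Prs {..<D} p (\<lambda>H. card (H \<inter> {..<N}) = j)" by (rule Prs_marginal[symmetric]) (use j in auto)
  also have "\<dots> \<le> Prs {..<D} p (\<lambda>H. j \<le> card H)"
  proof (rule Prs_mono)
    fix H assume "H \<subseteq> {..<D}" "card (H \<inter> {..<N}) = j"
    then show "j \<le> card H" using card_mono[of H "H \<inter> {..<N}"] finite_subset[of H "{..<D}"] by auto
  qed
  also have "\<dots> = btail D p j" using p by (subst Prs_card_ge) auto
  finally show ?thesis .
qed

definition nontrivial :: "nat \<Rightarrow> nat set set \<Rightarrow> bool" where
  "nontrivial n F \<longleftrightarrow> (\<forall>x\<in>{1..n}. \<exists>A\<in>F. x \<notin> A)"

lemma clique_subset: "clique F \<Longrightarrow> F' \<subseteq> F \<Longrightarrow> clique F'"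
  unfolding clique_def by (rule pairwise_subset)

text \<open>Union bound over all patterns. Their doubly exponential number is harmless because
  \<open>T\<close> will not exceed the constant \<open>KK a\<close>.\<close>

lemma prob_nontrivial_clique:
  fixes n k :: nat and p :: real
  assumes kn: "0 < k" "2 * k < n" and p01: "0 \<le> p" "p \<le> 1" and T: "3 \<le> T" and w: "w = (real k)\<^sup>2 / real n" "w \<le> 1"
  shows "Prs (ksets n k) p (\<lambda>H. \<exists>F\<subseteq>H. clique F \<and> card F = T \<and> nontrivial n F)
    \<le> 2 ^ (2 ^ T) * (mbar n k p ^ T * (w ^ (T choose 2) + w ^ T * (real k / real n) ^ (T - 3)))"
proof -
  let ?C = "{SS. proper_cover {..<T} SS}"
  let ?B = "mbar n k p ^ T * (w ^ (T choose 2) + w ^ T * (real k / real n) ^ (T - 3))"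
  have sub: "?C \<subseteq> Pow (Pow {..<T})" by (auto simp: proper_cover_def)
  then have fin: "finite ?C" by (rule finite_subset) simp
  have m0: "0 \<le> mbar n k p" using p01 by (simp add: mbar_def phi_def)
  have B0: "0 \<le> ?B" using m0 w by simp
  have "Prs (ksets n k) p (\<lambda>H. \<exists>F\<subseteq>H. clique F \<and> card F = T \<and> nontrivial n F)
     \<le> Prs (ksets n k) p (\<lambda>H. \<exists>SS\<in>?C. \<exists>F\<subseteq>H. realizes n k T SS F)"
  proof (rule Prs_mono)
    fix H assume H: "H \<subseteq> ksets n k" "\<exists>F\<subseteq>H. clique F \<and> card F = T \<and> nontrivial n F"
    then obtain F where F: "F \<subseteq> H" "clique F" "card F = T" "nontrivial n F" by blast
    have "\<exists>SS. proper_cover {..<T} SS \<and> realizes n k T SS F"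
      by (rule nontrivial_clique_realizes) (use F H in \<open>auto simp: nontrivial_def\<close>)
    then show "\<exists>SS\<in>?C. \<exists>F\<subseteq>H. realizes n k T SS F" using F(1) by blast
  qed
  also have "\<dots> \<le> (\<Sum>SS\<in>?C. Prs (ksets n k) p (\<lambda>H. \<exists>F\<subseteq>H. realizes n k T SS F))" by (rule Prs_Bex[OF fin])
  also have "\<dots> \<le> (\<Sum>SS\<in>?C. ?B)"
  proof (rule sum_mono)
    fix SS assume "SS \<in> ?C"
    then have SS: "proper_cover {..<T} SS" by simp
    have "Prs (ksets n k) p (\<lambda>H. \<exists>F\<subseteq>H. realizes n k T SS F)
      \<le> mbar n k p ^ T * (\<Prod>S\<in>SS. ((real k)\<^sup>2 / real n) * (real k / real n) ^ (card S - 2))"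
      by (rule prob_realizes[OF kn p01]) (use SS in \<open>auto simp: proper_cover_def\<close>)
    also have "\<dots> \<le> ?B"
    proof (rule mult_left_mono)
      have "real k / real n \<le> w" unfolding w using kn by (intro divide_right_mono) (auto simp: power2_eq_square)
      then show "(\<Prod>S\<in>SS. ((real k)\<^sup>2 / real n) * (real k / real n) ^ (card S - 2)) \<le> w ^ (T choose 2) + w ^ T * (real k / real n) ^ (T - 3)"
        unfolding w(1)[symmetric] using kn w by (intro proper_cover_weight[OF _ _ T SS]) auto
    qed (use m0 in simp)
    finally show "Prs (ksets n k) p (\<lambda>H. \<exists>F\<subseteq>H. realizes n k T SS F) \<le> ?B" .
  qed
  also have "\<dots> = real (card ?C) * ?B" by simp
  also have "\<dots> \<le> 2 ^ (2 ^ T) * ?B"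
  proof (rule mult_right_mono[OF _ B0])
    have "card ?C \<le> card (Pow (Pow {..<T}))" using sub by (intro card_mono) auto
    also have "\<dots> = 2 ^ (2 ^ T)" by (simp add: card_Pow)
    finally have "real (card ?C) \<le> real (2 ^ (2 ^ T))" by (rule of_nat_mono)
    then show "real (card ?C) \<le> 2 ^ (2 ^ T)" by simp
  qed
  finally show ?thesis .
qed

lemma prob_triples4:
  fixes n k :: nat and p :: real
  assumes kn: "0 < k" "2 * k < n" and p01: "0 \<le> p" "p \<le> 1"
  shows "Prs (ksets n k) p (\<lambda>H. \<exists>F\<subseteq>H. realizes n k 4 triples4 F) \<le> (phi n k p * ((real k)\<^sup>2 / real n)) ^ 4"
proof -
  have c3: "card ({..<4} - {i}) = 3" if "i < 4" for i :: nat using that by simp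
  have inj: "inj_on (\<lambda>i. {..<4} - {i}) {..<4::nat}"
  proof (rule inj_onI)
    fix x y :: nat assume "x \<in> {..<4}" "y \<in> {..<4}" "{..<4} - {x} = {..<4} - {y}"
    then show "x = y" by blast
  qed
  have "Prs (ksets n k) p (\<lambda>H. \<exists>F\<subseteq>H. realizes n k 4 triples4 F)
      \<le> mbar n k p ^ 4 * (\<Prod>S\<in>triples4. ((real k)\<^sup>2 / real n) * (real k / real n) ^ (card S - 2))"
    by (rule prob_realizes[OF kn p01]) (auto simp: triples4_def c3)
  also have "(\<Prod>S\<in>triples4. ((real k)\<^sup>2 / real n) * (real k / real n) ^ (card S - 2))
      = (\<Prod>i<(4::nat). ((real k)\<^sup>2 / real n) * (real k / real n) ^ (card ({..<4} - {i}) - 2))"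
    unfolding triples4_def by (subst prod.reindex[OF inj]) simp
  also have "\<dots> = (\<Prod>i<(4::nat). ((real k)\<^sup>2 / real n) * (real k / real n))"
    by (intro prod.cong refl) (simp add: c3)
  also have "\<dots> = (((real k)\<^sup>2 / real n) * (real k / real n)) ^ 4" by (simp only: prod_constant card_lessThan)
  also have "mbar n k p ^ 4 * \<dots> = (phi n k p * ((real k)\<^sup>2 / real n)) ^ 4"
  proof -
    have "mbar n k p * (real k / real n) = phi n k p" using kn by (simp add: mbar_def)
    then have "mbar n k p * (((real k)\<^sup>2 / real n) * (real k / real n)) = phi n k p * ((real k)\<^sup>2 / real n)" by (metis mult.assoc mult.commute)
    then show ?thesis by (simp only: power_mult_distrib[symmetric])
  qed
  finally show ?thesis .
qed

text \<open>When \<open>q\<close> is polynomially small, each member of a nontrivial clique saves a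
  power of \<open>n\<close> whose exponent is a multiple of \<open>b\<close>, so about
  \<open>1 / b\<close> members outweigh every power of \<open>n\<close> that occurs.
  \<open>CC\<close> dominates the combinatorial constants for sizes up to \<open>KK a\<close>, so
  that one largeness condition on \<open>n\<close> serves for all of them.\<close>

definition KK :: "real \<Rightarrow> nat" where "KK a = nat \<lceil>1 / bb a\<rceil> + 4"
definition CC :: "real \<Rightarrow> real" where "CC a = 2 ^ (2 ^ KK a) * 2 ^ (KK a * KK a) * fact (KK a) * 6"

lemma CC_ge: "2 ^ (2 ^ KK a) \<le> CC a" "2 ^ (KK a * KK a) \<le> CC a" "real (KK a) \<le> CC a" "real (KK a) ^ KK a \<le> CC a" "1 \<le> CC a" "6 \<le> CC a"
proof -
  define x :: real where "x = 2 ^ (2 ^ KK a)"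
  define y :: real where "y = 2 ^ (KK a * KK a)"
  define z :: real where "z = fact (KK a)"
  have one: "1 \<le> x" "1 \<le> y" "1 \<le> z" by (auto simp: x_def y_def z_def fact_ge_1)
  have e: "CC a = x * y * z * 6" by (simp add: CC_def x_def y_def z_def)
  have "x * 1 * 1 * 1 \<le> x * y * z * 6" "1 * y * 1 * 1 \<le> x * y * z * 6" "1 * 1 * 1 * 6 \<le> x * y * z * 6"
    using one by (intro mult_mono; simp)+
  then have xy: "x \<le> CC a" "y \<le> CC a" and six: "6 \<le> CC a" unfolding e by auto
  have K: "KK a < 2 ^ KK a" by (rule less_exp)
  have "real (KK a) ^ KK a \<le> (2 ^ KK a) ^ KK a" using of_nat_mono[OF less_imp_le[OF K], where 'a = real] by (intro power_mono) auto
  also have "\<dots> = y" by (simp add: y_def power_mult)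
  finally show 1: "real (KK a) ^ KK a \<le> CC a" using xy by linarith
  have "real (KK a) ^ 1 \<le> real (KK a) ^ KK a" by (rule power_increasing) (auto simp: KK_def)
  then have "real (KK a) \<le> real (KK a) ^ KK a" by (simp only: power_one_right)
  then show "real (KK a) \<le> CC a" using 1 by linarith
  show "2 ^ (2 ^ KK a) \<le> CC a" "2 ^ (KK a * KK a) \<le> CC a" using xy by (auto simp: x_def y_def)
  show "1 \<le> CC a" "6 \<le> CC a" using six by auto
qed

text \<open>Here \<open>lk = ln k\<close>, \<open>y = - ln phi\<close> and
  \<open>tau = T - 2\<close>. Hypothesis \<open>A\<close> expresses that \<open>Lam\<close> is
  small, \<open>B\<close> that degree \<open>T + 1\<close> is rare, and the conclusion bounds the
  logarithmic weight of the near-pencil. \<open>A\<close> is used twice: directly, to reduce the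
  weight to \<open>lk - tau * y\<close>, and after multiplication by \<open>tau\<close>, to
  eliminate \<open>tau * lk\<close>.\<close>

lemma small_weight_bound:
  fixes tau y lk L bL :: real
  assumes tau: "2 \<le> tau" and L: "0 < L" "0 \<le> bL" and A: "2 * (tau * lk) \<le> 3 * bL + 2 * y + tau * L - L"
    and B: "987/1000 * L \<le> tau * y + 3 * y"
  shows "2 * (tau * lk) + lk - tau * y - 2 * y - tau * L + L \<le> - (9/200 * L) + 4 * bL"
proof -
  have y0: "0 \<le> y"
  proof (rule ccontr)
    assume "\<not> 0 \<le> y"
    then have "(tau + 3) * y \<le> 0" using tau by (intro mult_nonneg_nonpos) auto
    moreover have "(tau + 3) * y = tau * y + 3 * y" by (simp add: distrib_right)
    ultimately show False using B L by linarith
  qed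
  have "2 * y \<le> tau * y" using tau y0 by (rule mult_right_mono)
  then have c: "59/100 * L \<le> tau * y + y" using B L by linarith
  let ?v = "2 * (tau * lk) + lk - tau * y - 2 * y - tau * L + L"
  have "?v \<le> lk - tau * y + 3 * bL" using A by linarith
  then have "tau * ?v \<le> tau * (lk - tau * y + 3 * bL)" using tau by (intro mult_left_mono) auto
  also have "\<dots> = tau * lk - tau * (tau * y) + 3 * (tau * bL)" by (simp add: algebra_simps)
  also have "\<dots> \<le> (tau - 1) * (L / 2 - (tau * y + y)) + 3 / 2 * bL + 3 * (tau * bL)"
  proof -
    have "(tau - 1) * (L / 2 - (tau * y + y)) = tau * L / 2 - L / 2 - tau * (tau * y) + y" by (simp add: field_simps)
    then show ?thesis using A by linarith
  qed
  also have "\<dots> \<le> (tau - 1) * (- (9/100 * L)) + 3 / 2 * bL + 3 * (tau * bL)"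
    using c tau by (intro add_right_mono mult_left_mono) auto
  also have "\<dots> \<le> tau * (- (9/200 * L) + 4 * bL)"
  proof -
    have 1: "2 * L \<le> tau * L" "2 * bL \<le> tau * bL" using tau L by (auto intro: mult_right_mono)
    have e: "(tau - 1) * (- (9/100 * L)) = - (9/100 * (tau * L)) + 9/100 * L" "tau * (- (9/200 * L) + 4 * bL) = - (9/200 * (tau * L)) + 4 * (tau * bL)"
      by (simp_all add: field_simps)
    show ?thesis unfolding e using 1 L by linarith
  qed
  finally show ?thesis using tau by (simp add: mult_le_cancel_left_pos)
qed

lemma nat_floor_bounds: "0 \<le> x \<Longrightarrow> real (nat \<lfloor>x\<rfloor>) \<le> x" "0 \<le> x \<Longrightarrow> x - 1 \<le> real (nat \<lfloor>x\<rfloor>)"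
proof -
  assume "0 \<le> x"
  then have e: "real (nat \<lfloor>x\<rfloor>) = of_int \<lfloor>x\<rfloor>" by simp
  show "real (nat \<lfloor>x\<rfloor>) \<le> x" "x - 1 \<le> real (nat \<lfloor>x\<rfloor>)" unfolding e by linarith+
qed

lemma real_choose2: "real (T choose 2) = real T * (real T - 1) / 2"
proof -
  have "real (2 * (T choose 2)) = real (T * (T - 1))" by (simp only: choose2_double)
  then show ?thesis by (cases T) (auto simp: field_simps)
qed

locale Sbase = nonL +
  assumes qS: "ln (meet_prob n k) < - (dd3 a * ln (real n))" and bigD: "ln (CC a) \<le> bb a * ln (real n)"
begin

abbreviation "K1 \<equiv> KK a"
definition w :: real where "w = (real k)\<^sup>2 / real n"

lemma lnCC: "0 < y \<Longrightarrow> y \<le> CC a \<Longrightarrow> ln y \<le> b * L"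
proof -
  assume y: "0 < y" "y \<le> CC a"
  then have "ln y \<le> ln (CC a)" by (subst ln_le_cancel_iff) auto
  then show ?thesis using bigD by (simp add: L_def)
qed

lemma K1_ge: "1 \<le> b * (real K1 - 4)" "4 \<le> K1" "L \<le> (real K1 - 1) * (b * L)" "L \<le> real K1 * (b * L)"
proof -
  have "1 / b \<le> real (nat \<lceil>1 / b\<rceil>)" by (rule real_nat_ceiling_ge)
  then have "1 / b \<le> real K1 - 4" by (simp add: KK_def)
  then show 1: "1 \<le> b * (real K1 - 4)" using par(4) by (simp add: field_simps)
  show "4 \<le> K1" by (simp add: KK_def)
  have "1 * L \<le> (b * (real K1 - 4)) * L" using 1 Lpos by (intro mult_right_mono) auto
  moreover have "(b * (real K1 - 4)) * L = real K1 * (b * L) - 4 * (b * L)" "(real K1 - 1) * (b * L) = real K1 * (b * L) - b * L" by (simp_all add: algebra_simps)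
  ultimately show "L \<le> (real K1 - 1) * (b * L)" "L \<le> real K1 * (b * L)" using bL(1) by linarith+
qed

lemma qS': "ln q < - (100 * (b * L))" using qS par(6) by (simp add: L_def)

lemma q_half: "q < 1/2" "1/2 < r"
proof -
  have "ln 2 \<le> b * L" by (rule lnc) auto
  then have "ln q < - ln 2" using qS' bL(1) by linarith
  also have "- ln 2 = ln (1/2::real)" by (simp add: ln_div)
  finally show "q < 1/2" using r01(4) by (subst (asm) ln_less_cancel_iff) auto
  then show "1/2 < r" using r01(3) by simp
qed

lemma w_bounds: "0 < w" "w \<le> 2 * q" "w \<le> 1" "ln w \<le> ln 2 + ln q" "ln w \<le> - (99 * (b * L))" "ln w = 2 * ln (real k) - L"
proof -
  show w0: "0 < w" using kpos Lpos by (simp add: w_def)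
  have "r \<le> exp (- w)" using dprob_le_exp[OF kn] by (simp add: w_def)
  then have "exp w * r \<le> exp w * exp (- w)" by (intro mult_left_mono) auto
  then have "exp w * r \<le> 1" by (simp add: exp_minus)
  moreover have "(1 + w) * r \<le> exp w * r" using exp_ge_add_one_self[of w] r01 by (intro mult_right_mono) auto
  ultimately have "w * r \<le> q" using r01(3) by (simp add: algebra_simps)
  moreover have "w * (1/2) \<le> w * r" using w0 q_half by (intro mult_left_mono) auto
  ultimately show w2: "w \<le> 2 * q" by linarith
  then show "w \<le> 1" using q_half by linarith
  have "ln w \<le> ln (2 * q)" using w0 w2 by (subst ln_le_cancel_iff) auto
  also have "\<dots> = ln 2 + ln q" by (rule ln_mult_pos) (use r01 in auto)
  finally show l: "ln w \<le> ln 2 + ln q" .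
  have "ln 2 \<le> b * L" by (rule lnc) auto
  then show "ln w \<le> - (99 * (b * L))" using l qS' by linarith
  show "ln w = 2 * ln (real k) - L" unfolding w_def using kpos Lpos by (simp add: ln_div ln_realpow L_def)
qed

lemma ln_phS: "ln ph \<le> 11 * (b * L)"
proof -
  have "ln (1/2) \<le> ln r" using q_half by (subst ln_le_cancel_iff) auto
  then have "- ln 2 \<le> ln r" by (simp add: ln_div)
  moreover have "ln 2 \<le> b * L" by (rule lnc) auto
  moreover have "ln r + ln ph \<le> 10 * (b * L)" using nl par(5) by (simp add: L_def)
  ultimately show ?thesis by linarith
qed

lemma prob_conf4: "Prs (ksets n k) p (\<lambda>H. \<exists>F\<subseteq>H. realizes n k 4 triples4 F) \<le> eps / 10^6"
proof -
  have "Prs (ksets n k) p (\<lambda>H. \<exists>F\<subseteq>H. realizes n k 4 triples4 F) \<le> (ph * w) ^ 4"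
    unfolding w_def by (rule prob_triples4) (use kpos kn p01 in auto)
  also have "\<dots> \<le> eps / 10^6"
  proof (rule small_if)
    have "ln ((ph * w) ^ 4) = 4 * ln ph + 4 * ln w" using ph_pos w_bounds(1) by (simp add: ln_mult ln_realpow)
    then show "ln ((ph * w) ^ 4) \<le> - (b * L)" using ln_phS w_bounds(5) bL(1) by linarith
  qed (use ph_pos w_bounds(1) in auto)
  finally show ?thesis .
qed

text \<open>Weights of the two extremal patterns, all pairs of edges meeting in vertices of their
  own and the near-pencil, each multiplied by the bound on the number of patterns.\<close>

definition V1 :: "nat \<Rightarrow> real" where "V1 T = 2 ^ (2 ^ T) * (m ^ T * w ^ (T choose 2))"
definition V2 :: "nat \<Rightarrow> real" where "V2 T = 2 ^ (2 ^ T) * (m ^ T * w ^ T * (real k / real n) ^ (T - 3))"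

lemma V_pos: "0 < V1 T" "0 < V2 T"
  using ph_pos w_bounds(1) kpos Lpos by (auto simp: V1_def V2_def)

lemma prob_V:
  assumes "3 \<le> T"
  shows "Prs (ksets n k) p (\<lambda>H. \<exists>F\<subseteq>H. clique F \<and> card F = T \<and> nontrivial n F) \<le> V1 T + V2 T"
proof -
  have "Prs (ksets n k) p (\<lambda>H. \<exists>F\<subseteq>H. clique F \<and> card F = T \<and> nontrivial n F)
    \<le> 2 ^ (2 ^ T) * (m ^ T * (w ^ (T choose 2) + w ^ T * (real k / real n) ^ (T - 3)))"
    by (rule prob_nontrivial_clique) (use kpos kn p01 assms w_bounds(3) in \<open>auto simp: w_def\<close>)
  also have "\<dots> = V1 T + V2 T" by (simp add: V1_def V2_def algebra_simps)
  finally show ?thesis .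
qed

lemma ln_X: "T \<le> K1 \<Longrightarrow> ln (2 ^ (2 ^ T)) \<le> b * L"
proof (rule lnCC)
  assume "T \<le> K1"
  then have "(2::real) ^ (2 ^ T) \<le> 2 ^ (2 ^ K1)" by (intro power_increasing) auto
  then show "2 ^ (2 ^ T) \<le> CC a" using CC_ge(1)[of a] by linarith
qed simp

lemma ln_V:
  assumes "3 \<le> T"
  shows "ln (V1 T) = ln (2 ^ (2 ^ T)) + real T / 2 * (2 * ln m + (real T - 1) * ln w)"
    and "ln (V2 T) = ln (2 ^ (2 ^ T)) + (real T * ln ph + real T * ln w + 3 * L - 3 * ln (real k))"
proof -
  define X :: real where "X = 2 ^ (2 ^ T)"
  have X0: "0 < X" by (simp add: X_def)
  have "ln (X * (m ^ T * w ^ (T choose 2))) = ln X + (real T * ln m + real (T choose 2) * ln w)"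
    using X0 ph_pos w_bounds(1) by (simp add: ln_mult ln_realpow)
  then show "ln (V1 T) = ln (2 ^ (2 ^ T)) + real T / 2 * (2 * ln m + (real T - 1) * ln w)"
    unfolding V1_def X_def real_choose2 by (simp add: field_simps)
  have "ln (X * (m ^ T * w ^ T * (real k / real n) ^ (T - 3))) = ln X + (real T * ln m + real T * ln w + real (T - 3) * (ln (real k) - L))"
    using X0 ph_pos w_bounds(1) kpos Lpos by (simp add: ln_mult ln_realpow ln_div L_def)
  also have "real (T - 3) = real T - 3" using assms by (simp add: of_nat_diff)
  also have "real T * ln m + real T * ln w + (real T - 3) * (ln (real k) - L) = real T * ln ph + real T * ln w + 3 * L - 3 * ln (real k)"
    unfolding ln_m by (simp add: algebra_simps)
  finally show "ln (V2 T) = ln (2 ^ (2 ^ T)) + (real T * ln ph + real T * ln w + 3 * L - 3 * ln (real k))" unfolding V2_def X_def .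
qed

lemma V_K1: "V1 K1 + V2 K1 \<le> 2 * (eps / 10^6)"
proof -
  have K3: "3 \<le> K1" using K1_ge(2) by simp
  have k1: "0 \<le> ln (real k)" using kpos by simp
  have "V1 K1 \<le> eps / 10^6"
  proof (rule small_if)
    have "(real K1 - 1) * ln w \<le> (real K1 - 1) * (- (99 * (b * L)))" using w_bounds(5) K3 by (intro mult_left_mono) auto
    also have "\<dots> = - (99 * ((real K1 - 1) * (b * L)))" by simp
    finally have "2 * ln m + (real K1 - 1) * ln w \<le> - (90 * L)" using K1_ge(3) ln_m ln_phS k1 bL Lpos by linarith
    then have "real K1 / 2 * (2 * ln m + (real K1 - 1) * ln w) \<le> real K1 / 2 * (- (90 * L))" by (intro mult_left_mono) auto
    also have "\<dots> \<le> - (90 * L)"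
    proof -
      have "2 * L \<le> real K1 * L" using K3 Lpos by (intro mult_right_mono) auto
      then show ?thesis by (simp add: mult.commute)
    qed
    finally show "ln (V1 K1) \<le> - (b * L)" unfolding ln_V[OF K3] using ln_X[OF order_refl] bL Lpos by linarith
  qed (rule V_pos)
  moreover have "V2 K1 \<le> eps / 10^6"
  proof (rule small_if)
    have "real K1 * (ln ph + ln w) \<le> real K1 * (- (88 * (b * L)))" using ln_phS w_bounds(5) by (intro mult_left_mono) auto
    then have "real K1 * ln ph + real K1 * ln w \<le> - (88 * (real K1 * (b * L)))" by (simp add: distrib_left)
    then show "ln (V2 K1) \<le> - (b * L)" unfolding ln_V[OF K3] using ln_X[OF order_refl] K1_ge(4) k1 bL Lpos by linarith
  qed (rule V_pos)
  ultimately show ?thesis by linarith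
qed

lemma large_nontrivial_clique:
  assumes "H \<subseteq> ksets n k" "F \<subseteq> H" "clique F" "nontrivial n F" "3 \<le> T" "T \<le> card F"
  shows "(\<exists>F\<subseteq>H. realizes n k 4 triples4 F) \<or> (\<exists>F\<subseteq>H. clique F \<and> card F = T \<and> nontrivial n F)"
proof (cases "\<exists>F'\<subseteq>F. realizes n k 4 triples4 F'")
  case True
  then show ?thesis using assms(2) by blast
next
  case False
  have "\<exists>F'\<subseteq>F. card F' = T \<and> (\<forall>x\<in>{1..n}. \<exists>A\<in>F'. x \<notin> A)"
    by (rule nontrivial_subclique[OF _ _ assms(5,6) False]) (use assms in \<open>auto simp: nontrivial_def\<close>)
  then obtain F' where "F' \<subseteq> F" "card F' = T" "nontrivial n F'" unfolding nontrivial_def by blast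
  then show ?thesis using assms(2) clique_subset[OF assms(3)] by blast
qed

lemma prob_StrS: "Prs (ksets n k) p (\<lambda>H. \<exists>F\<subseteq>H. clique F \<and> K1 \<le> card F \<and> nontrivial n F) \<le> 3 * (eps / 10^6)"
proof -
  have K3: "3 \<le> K1" using K1_ge(2) by simp
  have "Prs (ksets n k) p (\<lambda>H. \<exists>F\<subseteq>H. clique F \<and> K1 \<le> card F \<and> nontrivial n F)
    \<le> Prs (ksets n k) p (\<lambda>H. (\<exists>F\<subseteq>H. realizes n k 4 triples4 F) \<or> (\<exists>F\<subseteq>H. clique F \<and> card F = K1 \<and> nontrivial n F))"
    by (rule Prs_mono) (use large_nontrivial_clique K3 in blast)
  also have "\<dots> \<le> eps / 10^6 + (V1 K1 + V2 K1)" by (rule order_trans[OF Prs_disj]) (intro add_mono prob_conf4 prob_V K3)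
  finally show ?thesis using V_K1 by linarith
qed

end

locale Sreg = Sbase +
  fixes t :: nat
  assumes t1: "Lam n k p t \<le> eps" and t3: "3 \<le> t" and tm: "2 * real t \<le> mbar n k p"
begin

text \<open>For \<open>phi\<close> below 1 the tail at \<open>T + 1\<close> is about
  \<open>phi^(T + 1)\<close>, so \<open>bt\<close> says
  \<open>n * phi^(T + 1) \<le> n^(2 * h)\<close> up to constants. To apply \<open>btail_ge\<close>,
  the number of trials is cut to \<open>N\<close>, at most \<open>1 / p\<close>; then
  \<open>y\<close>, half of the minimum of \<open>phi\<close> and 1, is a lower bound for
  \<open>N * p\<close> whether or not the cut is effective.\<close>

lemma degree_bound:
  assumes T: "T < K1" and bt: "real n * btail DD p (Suc T) \<le> exp (2 * (h * L))"
  shows "(real T + 1) * ln ph \<le> - L + 2 * (h * L) + 5 * (b * L)"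
proof -
  have ln2: "ln 2 \<le> b * L" by (rule lnc) auto
  have nhalf: "real n / 2 \<le> real DD" using D_ge kn k2 by linarith
  have eb: "real K1 \<le> exp (b * L)" by (rule le_expI) (use K1_ge(2) CC_ge(3)[of a] in \<open>auto intro: lnCC\<close>)
  have lnn: "exp (L - b * L) \<le> real n / 2"
  proof -
    have "L - b * L \<le> ln (real n / 2)" using ln2 Lpos by (simp add: ln_div L_def)
    then have "exp (L - b * L) \<le> exp (ln (real n / 2))" by (simp only: exp_le_cancel_iff)
    then show ?thesis using Lpos by simp
  qed
  have pe: "p \<le> exp (12 * (b * L) - L)"
  proof -
    have "p = ph / real DD" using D_ge kn k2 by (simp add: phi_def)
    also have "\<dots> \<le> ph / exp (L - b * L)" using nhalf lnn ph_pos Lpos(4) exp_gt_zero[of "L - b * L"] by (intro divide_left_mono mult_pos_pos) linarith+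
    also have "\<dots> \<le> exp (11 * (b * L)) / exp (L - b * L)"
    proof (rule divide_right_mono)
      show "ph \<le> exp (11 * (b * L))" by (rule le_expI) (use ln_phS ph_pos in auto)
    qed simp
    also have "\<dots> = exp (11 * (b * L) - (L - b * L))" by (simp only: exp_diff)
    also have "\<dots> = exp (12 * (b * L) - L)" by (rule arg_cong[where f = exp]) linarith
    finally show ?thesis .
  qed
  define N where "N = min DD (nat \<lfloor>1 / p\<rfloor>)"
  have ip: "exp (L - 12 * (b * L)) \<le> 1 / p"
  proof -
    have "exp (L - 12 * (b * L)) * p \<le> exp (L - 12 * (b * L)) * exp (12 * (b * L) - L)" using pe by (intro mult_left_mono) auto
    also have "\<dots> = 1" by (simp add: exp_add[symmetric])
    finally show ?thesis using p01 by (simp add: field_simps)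
  qed
  have big: "2 * exp (b * L) \<le> exp (L - 12 * (b * L))" "exp (b * L) \<le> exp (L - b * L)"
  proof -
    have "2 \<le> exp (b * L)" by (rule le_expI) (use ln2 in auto)
    then have "2 * exp (b * L) \<le> exp (b * L) * exp (b * L)" by (intro mult_right_mono) auto
    also have "\<dots> = exp (b * L + b * L)" by (rule exp_add[symmetric])
    also have "\<dots> \<le> exp (L - 12 * (b * L))" unfolding exp_le_cancel_iff using bL Lpos by linarith
    finally show "2 * exp (b * L) \<le> exp (L - 12 * (b * L))" .
    show "exp (b * L) \<le> exp (L - b * L)" unfolding exp_le_cancel_iff using bL Lpos by linarith
  qed
  have ip2: "2 * real K1 \<le> 1 / p" using ip big(1) eb by linarith
  have fl: "real (nat \<lfloor>1 / p\<rfloor>) \<le> 1 / p" "1 / p - 1 \<le> real (nat \<lfloor>1 / p\<rfloor>)" using p01 by (auto intro!: nat_floor_bounds)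
  have four: "4 \<le> real K1" using K1_ge(2) by simp
  have p2: "p \<le> 1/2"
  proof -
    have "2 \<le> 1 / p" using ip2 four by linarith
    then show ?thesis using p01 by (simp add: field_simps)
  qed
  have TK: "real (Suc T) \<le> real K1" using T by simp
  have "real (Suc T) \<le> real (nat \<lfloor>1 / p\<rfloor>)" using fl(2) ip2 TK four by linarith
  moreover have "real (Suc T) \<le> real DD" using TK eb big(2) lnn nhalf by linarith
  ultimately have jN: "Suc T \<le> N" unfolding N_def by simp
  have Np: "real N * p \<le> 1"
  proof -
    have "real N \<le> 1 / p" using fl(1) unfolding N_def by linarith
    then show ?thesis using p01 by (simp add: field_simps)
  qed
  define y where "y = min ph 1 / 2"
  have y0: "0 < y" using ph_pos by (simp add: y_def)
  have yN: "y \<le> real N * p"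
  proof (cases "DD \<le> nat \<lfloor>1 / p\<rfloor>")
    case True
    then have "real N * p = ph" by (simp add: N_def phi_def mult.commute)
    then show ?thesis using ph_pos by (simp add: y_def)
  next
    case False
    then have "real N = real (nat \<lfloor>1 / p\<rfloor>)" by (simp add: N_def)
    moreover have "1 / p / 2 \<le> 1 / p - 1"
    proof -
      have "v / 2 \<le> v - 1" if "2 \<le> v" for v :: real using that by linarith
      moreover have "2 \<le> 1 / p" using ip2 four by linarith
      ultimately show ?thesis by blast
    qed
    ultimately have "1 / p / 2 \<le> real N" using order_trans[OF _ fl(2), of "1 / p / 2"] by (simp only:)
    then have "1 / p / 2 * p \<le> real N * p" using p01 by (intro mult_right_mono) auto
    then show ?thesis using p01 by (simp add: y_def)
  qed
  have "real n * ((y / real (Suc T)) ^ Suc T * exp (- 2)) \<le> real n * ((real N * p / real (Suc T)) ^ Suc T * exp (- 2))"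
    using y0 yN by (intro mult_left_mono mult_right_mono power_mono divide_right_mono) auto
  also have "\<dots> \<le> real n * btail DD p (Suc T)"
    using p01 p2 jN Np by (intro mult_left_mono btail_ge) (auto simp: N_def)
  also note bt
  finally have "ln (real n * ((y / real (Suc T)) ^ Suc T * exp (- 2))) \<le> ln (exp (2 * (h * L)))"
    using y0 Lpos by (subst ln_le_cancel_iff) (auto simp del: power_Suc)
  moreover have "ln (real n * ((y / real (Suc T)) ^ Suc T * exp (- 2))) = L + (real (Suc T) * (ln y - ln (real (Suc T))) - 2)"
    using y0 Lpos by (simp add: ln_mult ln_realpow ln_div L_def del: power_Suc of_nat_Suc)
  ultimately have 1: "L + real (Suc T) * ln y - real (Suc T) * ln (real (Suc T)) - 2 \<le> 2 * (h * L)" by (simp add: right_diff_distrib del: of_nat_Suc)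
  have 2: "real (Suc T) * ln (real (Suc T)) \<le> b * L"
  proof -
    have "real (Suc T) ^ Suc T \<le> real K1 ^ Suc T" using TK by (intro power_mono) auto
    also have "\<dots> \<le> real K1 ^ K1" using T four by (intro power_increasing) auto
    finally have "real (Suc T) ^ Suc T \<le> CC a" using CC_ge(4)[of a] by linarith
    then have "ln (real (Suc T) ^ Suc T) \<le> b * L" by (intro lnCC) (auto simp del: power_Suc)
    then show ?thesis by (simp add: ln_realpow del: power_Suc of_nat_Suc)
  qed
  have 3: "real (Suc T) * ln 2 \<le> b * L"
  proof -
    have "(2::real) ^ Suc T \<le> 2 ^ (K1 * K1)" using T four by (intro power_increasing) (auto intro: order_trans[of _ K1])
    then have "(2::real) ^ Suc T \<le> CC a" using CC_ge(2)[of a] by linarith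
    then have "ln ((2::real) ^ Suc T) \<le> b * L" by (intro lnCC) (auto simp del: power_Suc)
    then show ?thesis by (simp add: ln_realpow del: power_Suc of_nat_Suc)
  qed
  have lny: "ln y = ln (min ph 1) - ln 2" using ph_pos by (simp add: y_def ln_div)
  have one: "1 \<le> b * L" using lnc[of "exp 1"] exp_le by simp
  have 4: "real (Suc T) * ln (min ph 1) \<le> - L + 2 * (h * L) + 5 * (b * L)"
    using 1 2 3 one unfolding lny right_diff_distrib by linarith
  \<comment> \<open>With minimum 1 the logarithm would vanish and the inequality would bound 0 by a
    negative number; so the minimum is \<open>phi\<close>.\<close>
  have "min ph 1 < 1"
  proof (rule ccontr)
    assume "\<not> min ph 1 < 1"
    then have "min ph 1 = 1" by simp
    then show False using 4 bL Lpos by simp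
  qed
  then have "min ph 1 = ph" by simp
  then show ?thesis using 4 by (simp add: add.commute)
qed

text \<open>Combines \<open>Lam_le_imp\<close> at \<open>t\<close> with
  \<open>w \<le> 2 * q\<close>; every edge beyond \<open>t\<close> contributes one more factor
  \<open>q\<close>.\<close>

lemma weight_bound:
  assumes T: "t \<le> T" "T < K1"
  shows "2 * ln m + (real T - 1) * ln w \<le> 3 * (b * L) + (real T - real t) * ln q"
proof -
  have "(m / real t)\<^sup>2 * q ^ (t - 1) \<le> 1"
    by (rule Lam_le_imp) (use t1 t3 tm eps01 r01 in auto)
  then have "ln ((m / real t)\<^sup>2 * q ^ (t - 1)) \<le> 0" using ph_pos t3 r01 by simp
  also have "ln ((m / real t)\<^sup>2 * q ^ (t - 1)) = 2 * ln m - 2 * ln (real t) + (real t - 1) * ln q"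
    using ph_pos t3 r01(4) by (simp add: ln_mult ln_realpow ln_div of_nat_diff algebra_simps)
  finally have 1: "2 * ln m - 2 * ln (real t) + (real t - 1) * ln q \<le> 0" .
  have "(real T - 1) * ln w \<le> (real T - 1) * (ln 2 + ln q)" using w_bounds(4) T t3 by (intro mult_left_mono) auto
  also have "\<dots> = (real T - 1) * ln 2 + (real t - 1) * ln q + (real T - real t) * ln q" by (simp add: algebra_simps)
  finally have 2: "(real T - 1) * ln w \<le> (real T - 1) * ln 2 + (real t - 1) * ln q + (real T - real t) * ln q" .
  have "ln (real t) \<le> b * L" using t3 T CC_ge(3)[of a] by (intro lnCC) auto
  moreover have "(real T - 1) * ln 2 \<le> b * L"
  proof -
    have "(2::real) ^ T \<le> 2 ^ (K1 * K1)" using T by (intro power_increasing) (auto intro: order_trans[of _ K1])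
    then have "(2::real) ^ T \<le> CC a" using CC_ge(2)[of a] by linarith
    then have "ln ((2::real) ^ T) \<le> b * L" by (intro lnCC) auto
    then have "real T * ln 2 \<le> b * L" by (simp add: ln_realpow)
    moreover have "0 < ln (2::real)" by simp
    ultimately show ?thesis unfolding left_diff_distrib by linarith
  qed
  ultimately show ?thesis using 1 2 by linarith
qed

text \<open>At \<open>T = t\<close> the weight is \<open>Lam\<close> itself up to constants, hence
  only a multiple of \<open>eps\<close>. For larger \<open>T\<close> the surplus factor
  \<open>q\<close> is polynomially small.\<close>

lemma V1_bound:
  assumes T: "t \<le> T" "T < K1"
  shows "V1 T \<le> CC a * eps / 2"
proof (cases "T = t")
  case False
  have T3: "3 \<le> T" using T t3 by simp
  have "(real T - real t) * ln q \<le> 1 * ln q" using False T r01 by (intro mult_right_mono_neg) auto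
  then have "2 * ln m + (real T - 1) * ln w \<le> - (97 * (b * L))" using weight_bound[OF T] qS' by linarith
  then have "real T / 2 * (2 * ln m + (real T - 1) * ln w) \<le> real T / 2 * (- (97 * (b * L)))" by (intro mult_left_mono) auto
  also have "\<dots> \<le> 1 * (- (97 * (b * L)))" using T3 bL(1) by (intro mult_right_mono_neg) auto
  finally have "V1 T \<le> eps / 10^6" using ln_V(1)[OF T3] ln_X[of T] T bL(1) by (intro small_if V_pos) linarith
  moreover have "6 * eps \<le> CC a * eps" using CC_ge(6)[of a] eps01 by (intro mult_right_mono) auto
  moreover have "eps / 10^6 \<le> eps" using eps01 by simp
  ultimately show ?thesis using eps01 by linarith
next
  case True
  have ge: "m ^ T / fact T \<le> (m gchoose T) * exp ((real T)\<^sup>2 * 2 / m)"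
    by (rule power_le_gchoose) (use ph_pos tm True in auto)
  have "(real T)\<^sup>2 * 2 / m \<le> 1"
  proof -
    have "(real T)\<^sup>2 * 2 \<le> m"
    proof -
      have "ln ((real T)\<^sup>2 * 2) = 2 * ln (real T) + ln 2" using True t3 by (simp add: ln_mult ln_realpow)
      moreover have "ln (real T) \<le> b * L" using t3 T CC_ge(3)[of a] by (intro lnCC) auto
      moreover have "ln 2 \<le> b * L" by (rule lnc) auto
      ultimately have "ln ((real T)\<^sup>2 * 2) \<le> ln m" using ln_m_ge bL Lpos by linarith
      then show ?thesis using True t3 ph_pos by (subst (asm) ln_le_cancel_iff) auto
    qed
    then show ?thesis using ph_pos by (simp add: field_simps)
  qed
  then have "exp ((real T)\<^sup>2 * 2 / m) \<le> exp 1" by simp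
  also have "\<dots> \<le> 3" by (rule exp_le)
  finally have e3: "exp ((real T)\<^sup>2 * 2 / m) \<le> 3" .
  have g0: "0 < m gchoose T"
  proof -
    have "0 < m ^ T / fact T" using ph_pos by simp
    then have "0 < (m gchoose T) * exp ((real T)\<^sup>2 * 2 / m)" using ge by linarith
    then show ?thesis by (simp add: zero_less_mult_iff)
  qed
  have lam: "(m gchoose T) * q ^ (T choose 2) \<le> eps" using t1 True by (simp add: Lam_def)
  have "m ^ T * w ^ (T choose 2) \<le> (fact T * ((m gchoose T) * 3)) * (2 ^ (K1 * K1) * q ^ (T choose 2))"
  proof (rule mult_mono)
    have "m ^ T / fact T \<le> (m gchoose T) * 3" using ge e3 g0 by (elim order_trans) (intro mult_left_mono, auto)
    then show "m ^ T \<le> fact T * ((m gchoose T) * 3)" by (simp add: field_simps)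
    have "w ^ (T choose 2) \<le> (2 * q) ^ (T choose 2)" using w_bounds by (intro power_mono) auto
    also have "\<dots> = 2 ^ (T choose 2) * q ^ (T choose 2)" by (rule power_mult_distrib)
    also have "\<dots> \<le> 2 ^ (K1 * K1) * q ^ (T choose 2)"
    proof (intro mult_right_mono power_increasing)
      have "T choose 2 \<le> T * (T - 1)" using choose2_double[of T] by simp
      also have "\<dots> \<le> K1 * K1" using T by (intro mult_mono) auto
      finally show "T choose 2 \<le> K1 * K1" .
    qed (use r01 in auto)
    finally show "w ^ (T choose 2) \<le> 2 ^ (K1 * K1) * q ^ (T choose 2)" .
  qed (use g0 w_bounds r01 in auto)
  also have "\<dots> = (fact T * 3 * 2 ^ (K1 * K1)) * ((m gchoose T) * q ^ (T choose 2))" by simp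
  also have "\<dots> \<le> (fact K1 * 3 * 2 ^ (K1 * K1)) * eps"
    using lam T eps01 g0 r01(4) by (intro mult_mono fact_mono) auto
  finally have fin: "m ^ T * w ^ (T choose 2) \<le> (fact K1 * 3 * 2 ^ (K1 * K1)) * eps" .
  have "V1 T \<le> 2 ^ (2 ^ K1) * ((fact K1 * 3 * 2 ^ (K1 * K1)) * eps)"
    unfolding V1_def by (rule mult_mono[OF _ fin]) (use T ph_pos w_bounds(1) in auto)
  also have "\<dots> = CC a * eps / 2" by (simp add: CC_def)
  finally show ?thesis .
qed

text \<open>For \<open>T = 3\<close> both extremal patterns consist of the three pairs. For larger
  \<open>T\<close> the near-pencil contains a star on \<open>T - 1\<close> edges, which smallness of
  \<open>Lam\<close> does not exclude by itself; the scarcity of high degrees from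
  \<open>degree_bound\<close> enters as a second constraint.\<close>

lemma V2_bound:
  assumes T: "t \<le> T" "T < K1" and bt: "real n * btail DD p (Suc T) \<le> exp (2 * (h * L))"
  shows "V2 T \<le> CC a * eps / 2"
proof (cases "T = 3")
  case True
  then have "V2 T = V1 T" by (simp add: V1_def V2_def choose_two mult.assoc)
  then show ?thesis using V1_bound[OF T] by simp
next
  case False
  define tau where "tau = real T - 2"
  have tau: "2 \<le> tau" using False T t3 by (simp add: tau_def)
  have T3: "3 \<le> T" using T t3 by simp
  have Tt: "real T = tau + 2" by (simp add: tau_def)
  have "(real T - real t) * ln q \<le> 0" using T r01 by (intro mult_nonneg_nonpos) auto
  then have "2 * ln m + (tau + 1) * ln w \<le> 3 * (b * L)" using weight_bound[OF T] unfolding Tt by (simp add: add.commute)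
  then have A: "2 * (tau * ln (real k)) \<le> 3 * (b * L) + 2 * (- ln ph) + tau * L - L"
    unfolding ln_m w_bounds(6) by (simp add: algebra_simps)
  have B: "987/1000 * L \<le> tau * (- ln ph) + 3 * (- ln ph)"
  proof -
    have "(tau + 3) * ln ph \<le> - L + 2 * (h * L) + 5 * (b * L)" using degree_bound[OF T(2) bt] unfolding Tt by (simp add: add.commute)
    then have "tau * ln ph + 3 * ln ph \<le> - L + 2 * (h * L) + 5 * (b * L)" by (simp add: distrib_right)
    then show ?thesis using bL Lpos unfolding mult_minus_right by linarith
  qed
  have "2 * (tau * ln (real k)) + ln (real k) - tau * (- ln ph) - 2 * (- ln ph) - tau * L + L \<le> - (9/200 * L) + 4 * (b * L)"
    by (rule small_weight_bound[OF tau _ _ A B]) (use Lpos bL in auto)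
  moreover have "real T * ln ph + real T * ln w + 3 * L - 3 * ln (real k) = 2 * (tau * ln (real k)) + ln (real k) - tau * (- ln ph) - 2 * (- ln ph) - tau * L + L"
    unfolding Tt w_bounds(6) by (simp add: algebra_simps)
  ultimately have "V2 T \<le> eps / 10^6" using ln_V(2)[OF T3] ln_X[of T] T bL Lpos by (intro small_if V_pos) linarith
  moreover have "6 * eps \<le> CC a * eps" using CC_ge(6)[of a] eps01 by (intro mult_right_mono) auto
  moreover have "eps / 10^6 \<le> eps" using eps01 by simp
  ultimately show ?thesis using eps01 by linarith
qed

lemma prob_not_EKR_S:
  assumes T: "t \<le> T" and bt: "real n * btail DD p (Suc T) \<le> exp (2 * (h * L))"
  shows "Prs (ksets n k) p (\<lambda>H. \<not> satisfies_EKR n H) \<le> (CC a + 1) * eps + Prs (ksets n k) p (\<lambda>H. max_degree n H < T)"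
proof -
  let ?K = "ksets n k"
  \<comment> \<open>Patterns are counted only up to size \<open>KK a\<close>, where their number is
    constant. A larger nontrivial clique contains one of size \<open>T'\<close> unless
    \<open>triples4\<close> occurs.\<close>
  define T' where "T' = min T K1"
  have T'3: "3 \<le> T'" using T t3 K1_ge(2) by (simp add: T'_def)
  have "Prs ?K p (\<lambda>H. \<not> satisfies_EKR n H) \<le> Prs ?K p (\<lambda>H. max_degree n H < T \<or>
      ((\<exists>F\<subseteq>H. realizes n k 4 triples4 F) \<or> (\<exists>F\<subseteq>H. clique F \<and> card F = T' \<and> nontrivial n F)))"
  proof (rule Prs_mono)
    fix H assume H: "H \<subseteq> ?K" "\<not> satisfies_EKR n H"
    have "0 < n" using kn by simp
    from not_EKR_nontrivial[OF H(1) this H(2)] obtain F where F: "F \<subseteq> H" "clique F" "nontrivial n F" "max_degree n H \<le> card F"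
      unfolding nontrivial_def by (elim exE conjE)
    show "max_degree n H < T \<or> ((\<exists>F\<subseteq>H. realizes n k 4 triples4 F) \<or> (\<exists>F\<subseteq>H. clique F \<and> card F = T' \<and> nontrivial n F))"
    proof (cases "max_degree n H < T")
      case False
      then have "T' \<le> card F" using F(4) by (simp add: T'_def)
      then have "(\<exists>F\<subseteq>H. realizes n k 4 triples4 F) \<or> (\<exists>F\<subseteq>H. clique F \<and> card F = T' \<and> nontrivial n F)"
        by (rule large_nontrivial_clique[OF H(1) F(1,2,3) T'3])
      then show ?thesis by (rule disjI2)
    qed simp
  qed
  also have "\<dots> \<le> Prs ?K p (\<lambda>H. max_degree n H < T) + (eps / 10^6 + (V1 T' + V2 T'))"
    by (rule order_trans[OF Prs_disj], rule add_left_mono, rule order_trans[OF Prs_disj]) (intro add_mono prob_conf4 prob_V T'3)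
  also have "V1 T' + V2 T' \<le> CC a * eps"
  proof (cases "T < K1")
    case True
    then have "T' = T" by (simp add: T'_def)
    then show ?thesis using V1_bound[OF T True] V2_bound[OF T True bt] by simp
  next
    case False
    then have "T' = K1" by (simp add: T'_def)
    moreover have "6 * eps \<le> CC a * eps" using CC_ge(6)[of a] eps01 by (intro mult_right_mono) auto
    moreover have "eps / 10^6 \<le> eps" using eps01 by simp
    ultimately show ?thesis using V_K1 eps01 by (simp only:)
  qed
  finally have "Prs ?K p (\<lambda>H. \<not> satisfies_EKR n H) \<le> Prs ?K p (\<lambda>H. max_degree n H < T) + (eps / 10^6 + CC a * eps)" by simp
  moreover have "eps / 10^6 \<le> eps" using eps01 by simp
  ultimately show ?thesis by (simp add: distrib_right)
qed

end

section \<open>Dense hypergraphs\<close>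

text \<open>A common statement for both sparser regimes that makes no assumption on
  \<open>Lam\<close> at the maximum degree; instead, a suitable \<open>t\<close> is found directly.
  Counting members off each vertex against an absolute number \<open>tau\<close> makes the statement
  robust under thinning.\<close>

lemma (in nonL) prob_structure_dense:
  assumes bigD: "ln (CC a) \<le> bb a * ln (real n)" and ph1: "0 \<le> ln ph"
  shows "\<exists>tau::nat. real tau \<le> exp (2 * (b * L)) / r \<and>
    Prs (ksets n k) p (\<lambda>H. \<exists>F\<subseteq>H. clique F \<and> tau \<le> card F \<and> (\<forall>x\<in>{1..n}. tau \<le> card {A \<in> F. x \<notin> A})) \<le> 3 * eps"
proof (cases "- (dd3 a * ln (real n)) \<le> ln q")
  case False
  interpret S: Sbase n k p eps a by unfold_locales (use False bigD in auto)
  have "real (KK a) \<le> exp (b * L)"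
  proof (rule le_expI)
    show "0 < real (KK a)" using S.K1_ge(2) by simp
    then show "ln (real (KK a)) \<le> b * L" by (rule S.lnCC) (rule CC_ge)
  qed
  also have "\<dots> \<le> exp (2 * (b * L))" unfolding exp_le_cancel_iff using bL(1) by linarith
  also have "\<dots> \<le> exp (2 * (b * L)) / r"
  proof -
    have "exp (2 * (b * L)) / 1 \<le> exp (2 * (b * L)) / r" using r01(1,2) by (intro divide_left_mono) auto
    then show ?thesis by simp
  qed
  finally have 1: "real (KK a) \<le> exp (2 * (b * L)) / r" .
  have "Prs (ksets n k) p (\<lambda>H. \<exists>F\<subseteq>H. clique F \<and> KK a \<le> card F \<and> (\<forall>x\<in>{1..n}. KK a \<le> card {A \<in> F. x \<notin> A}))
     \<le> Prs (ksets n k) p (\<lambda>H. \<exists>F\<subseteq>H. clique F \<and> KK a \<le> card F \<and> nontrivial n F)"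
  proof (rule Prs_mono, elim exE conjE)
    fix H F assume F: "F \<subseteq> H" "clique F" "KK a \<le> card F" "\<forall>x\<in>{1..n}. KK a \<le> card {A \<in> F. x \<notin> A}"
    have "nontrivial n F" unfolding nontrivial_def
    proof
      fix x assume "x \<in> {1..n}"
      then have "card {A \<in> F. x \<notin> A} \<noteq> 0" using F(4) S.K1_ge(2) by fastforce
      then have "{A \<in> F. x \<notin> A} \<noteq> {}" by (metis card.empty)
      then show "\<exists>A\<in>F. x \<notin> A" by blast
    qed
    then show "\<exists>F\<subseteq>H. clique F \<and> KK a \<le> card F \<and> nontrivial n F" using F by blast
  qed
  also have "\<dots> \<le> 3 * (eps / 10^6)" by (rule S.prob_StrS)
  also have "\<dots> \<le> 3 * eps" using eps01 by simp
  finally show ?thesis using 1 by blast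
next
  case True
  have lnm: "L / 2 - b * L \<le> ln m" "ln m \<le> 5 / 4 * L"
  proof -
    have "0 \<le> ln (real k)" using kpos by simp
    then show "L / 2 - b * L \<le> ln m" "ln m \<le> 5 / 4 * L" using ln_m ph1 ln_k_le ln_ph(1) bL by linarith+
  qed
  have lnq: "ln q \<le> - r" using ln_le_minus_one[OF r01(4)] r01(3) by linarith
  \<comment> \<open>As \<open>q \<le> exp (- r)\<close> and \<open>ln m \<le> 5/4 * L\<close>, the
    quantity \<open>m^2 * q ^ (N0 - 1)\<close> is already small once \<open>N0 * r\<close> reaches
    \<open>4 * L\<close>.\<close>
  define N0 where "N0 = nat \<lceil>4 * L / r\<rceil>"
  have Lr: "L \<le> L / r" using r01(1,2) Lpos by (simp add: field_simps)
  have N0: "4 * L / r \<le> real N0" "real N0 \<le> 5 * (L / r)"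
  proof -
    have c: "0 \<le> 4 * L / r" using r01(1) Lpos by simp
    then have e: "real N0 = of_int \<lceil>4 * L / r\<rceil>" by (simp add: N0_def)
    show "4 * L / r \<le> real N0" unfolding e by linarith
    have "real N0 \<le> 4 * L / r + 1" unfolding e by linarith
    then show "real N0 \<le> 5 * (L / r)" using Lr Lpos by simp
  qed
  have Nm: "2 * real N0 \<le> m"
  proof -
    have "10 * L / r \<le> exp (ln m)"
    proof (rule le_expI)
      have "ln (10 * L / r) = ln 10 + ln L - ln r" using Lpos r01(1) by (simp add: ln_mult ln_div)
      moreover have "ln 10 \<le> b * L" by (rule lnc) auto
      ultimately show "ln (10 * L / r) \<le> ln m" using lnL ln_r(1) lnm(1) bL by linarith
    qed (use Lpos r01(1) in simp)
    then show ?thesis using N0(2) ph_pos by simp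
  qed
  have N04: "4000 \<le> real N0" using N0(1) Lr Lpos by simp
  have LN: "Lam n k p N0 \<le> eps"
  proof -
    have "Lam n k p N0 \<le> m ^ N0 / fact N0 * q ^ (N0 choose 2)"
      unfolding Lam_def using ph_pos Nm r01(4) by (intro mult_right_mono gchoose_le_power) auto
    also have "\<dots> \<le> m ^ N0 / 1 * q ^ (N0 choose 2)"
      using ph_pos r01(4) by (intro mult_right_mono divide_left_mono) (auto simp: fact_ge_1)
    also have "\<dots> \<le> eps / 10^6"
    proof (rule small_if)
      show "0 < m ^ N0 / 1 * q ^ (N0 choose 2)" using ph_pos r01(4) by simp
      have "ln (m ^ N0 / 1 * q ^ (N0 choose 2)) = real N0 * ln m + real (N0 choose 2) * ln q"
        using ph_pos r01(4) by (simp add: ln_mult ln_realpow)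
      also have "\<dots> = real N0 / 2 * (2 * ln m + (real N0 - 1) * ln q)" unfolding real_choose2 by (simp add: field_simps)
      also have "\<dots> \<le> real N0 / 2 * (- L)"
      proof (rule mult_left_mono)
        have "(real N0 - 1) * ln q \<le> (real N0 - 1) * (- r)" using lnq N04 by (intro mult_left_mono) auto
        also have "\<dots> = r - real N0 * r" by (simp add: algebra_simps)
        finally have "(real N0 - 1) * ln q \<le> r - real N0 * r" .
        moreover have "4 * L \<le> real N0 * r" using N0(1) r01(1) by (simp add: field_simps)
        ultimately show "2 * ln m + (real N0 - 1) * ln q \<le> - L" using lnm(2) r01(2) Lpos by linarith
      qed simp
      also have "\<dots> \<le> 1 * (- L)" using N04 Lpos by (intro mult_right_mono_neg) auto
      finally show "ln (m ^ N0 / 1 * q ^ (N0 choose 2)) \<le> - (b * L)" using bL Lpos by linarith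
    qed
    also have "\<dots> \<le> eps" using eps01 by simp
    finally show ?thesis .
  qed
  define t where "t = (LEAST t. Lam n k p t \<le> eps)"
  have t1: "Lam n k p t \<le> eps" unfolding t_def by (rule LeastI[of "\<lambda>t. Lam n k p t \<le> eps", OF LN])
  have t2: "eps < Lam n k p s" if "s < t" for s using not_less_Least[OF that[unfolded t_def]] by simp
  have tN: "t \<le> N0" unfolding t_def by (rule Least_le[of "\<lambda>t. Lam n k p t \<le> eps", OF LN])
  have tm: "2 * real t \<le> m" using tN Nm by linarith
  have t3: "3 \<le> t"
  proof (rule ccontr)
    assume "\<not> 3 \<le> t"
    then have t: "t \<le> 2" by simp
    have "t \<noteq> 0"
    proof
      assume "t = 0"
      then show False using t1 eps01 by (simp add: Lam_def numeral_2_eq_2)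
    qed
    then have t0: "0 < t" by simp
    have "(m / real t)\<^sup>2 * q ^ (t - 1) \<le> 1"
      by (rule Lam_le_imp) (use t1 t0 tm eps01 r01(4) in auto)
    then have "ln ((m / real t)\<^sup>2 * q ^ (t - 1)) \<le> 0" using ph_pos t0 r01(4) by simp
    also have "ln ((m / real t)\<^sup>2 * q ^ (t - 1)) = 2 * ln m - 2 * ln (real t) + real (t - 1) * ln q"
      using ph_pos t0 r01(4) by (simp add: ln_mult ln_realpow ln_div)
    finally have 1: "2 * ln m - 2 * ln (real t) + real (t - 1) * ln q \<le> 0" .
    have "ln (real t) \<le> ln 2" using t t0 by simp
    moreover have "ln 2 \<le> b * L" by (rule lnc) auto
    moreover have "1 * ln q \<le> real (t - 1) * ln q" using t r01(4,5) by (intro mult_right_mono_neg) auto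
    moreover have "- (100 * (b * L)) \<le> ln q" using True par(6) by (simp add: L_def)
    ultimately show False using 1 lnm(1) bL Lpos by linarith
  qed
  interpret M: Mreg n k p eps a t
  proof
    have "0 \<le> (hh a)\<^sup>2 / 50 * ln (real n)" using Lpos by (simp add: L_def)
    then show "- ((hh a)\<^sup>2 / 50 * ln (real n)) \<le> ln ph" using ph1 by linarith
  qed (use True t1 t2 t3 tm in auto)
  have "5 * (L / r) \<le> exp (2 * (b * L)) / r"
  proof -
    have "5 * L \<le> exp (2 * (b * L))"
    proof (rule le_expI)
      have "ln (5 * L) = ln 5 + ln L" using Lpos by (simp add: ln_mult)
      moreover have "ln 5 \<le> b * L" by (rule lnc) auto
      ultimately show "ln (5 * L) \<le> 2 * (b * L)" using lnL by linarith
    qed (use Lpos in simp)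
    then have "5 * L / r \<le> exp (2 * (b * L)) / r" using r01(1) by (intro divide_right_mono) auto
    then show ?thesis by simp
  qed
  moreover have "real t \<le> real N0" using tN by simp
  ultimately have 1: "real t \<le> exp (2 * (b * L)) / r" using N0(2) by linarith
  have "Prs (ksets n k) p (\<lambda>H. \<exists>F\<subseteq>H. clique F \<and> t \<le> card F \<and> (\<forall>x\<in>{1..n}. t \<le> card {A \<in> F. x \<notin> A}))
     \<le> Prs (ksets n k) p (\<lambda>H. \<not> M.StrM H)"
  proof (rule Prs_mono, elim exE conjE, rule notI)
    fix H F assume F: "F \<subseteq> H" "clique F" "t \<le> card F" "\<forall>x\<in>{1..n}. t \<le> card {A \<in> F. x \<notin> A}" and "M.StrM H"
    then obtain x where x: "x \<in> {1..n}" "card {A \<in> F. x \<notin> A} < t - M.dh" unfolding M.StrM_def by metis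
    have "t \<le> card {A \<in> F. x \<notin> A}" using F(4) x(1) by (rule bspec)
    then show False using x(2) by linarith
  qed
  also have "\<dots> \<le> 3 * eps" by (rule M.prob_StrM)
  finally show ?thesis using 1 by blast
qed

section \<open>Stars win in the dense regime\<close>

locale Lreg = base +
  assumes ll: "dd2 a * ln (real n) \<le> ln (dprob n k) + ln (phi n k p)" and bigD: "ln (CC a) \<le> bb a * ln (real n)"
begin

definition z :: real where "z = r * ph"

lemma z_bounds: "exp (10 * (b * L)) \<le> z" "0 < z" "1000000 * L \<le> z" "ln z \<le> z / 100 + L" "ln ph \<le> ln z + L / 4"
proof -
  have lnz: "ln z = ln r + ln ph" unfolding z_def by (rule ln_mult_pos[OF r01(1) ph_pos(1)])
  show z0: "0 < z" using r01(1) ph_pos by (simp add: z_def)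
  have "10 * (b * L) \<le> ln z" using ll par(5) lnz by (simp add: L_def)
  then have "exp (10 * (b * L)) \<le> exp (ln z)" by (simp only: exp_le_cancel_iff)
  then show 1: "exp (10 * (b * L)) \<le> z" using z0 by simp
  have "1000000 * L \<le> exp (b * L) * exp (b * L)"
  proof (rule mult_mono)
    show "1000000 \<le> exp (b * L)" by (rule le_expI) (use lnC(3) in simp_all)
    show "L \<le> exp (b * L)" by (rule le_expI) (use lnL Lpos in auto)
  qed (use Lpos in auto)
  also have "\<dots> = exp (b * L + b * L)" by (rule exp_add[symmetric])
  also have "\<dots> \<le> exp (10 * (b * L))" unfolding exp_le_cancel_iff using bL(1) by linarith
  finally show "1000000 * L \<le> z" using 1 by linarith
  have "ln (z / 100) \<le> z / 100 - 1" using z0 by (intro ln_le_minus_one) auto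
  moreover have "ln (z / 100) = ln z - ln 100" using z0 by (simp add: ln_div)
  moreover have "ln 100 \<le> b * L" by (rule lnc) auto
  ultimately show "ln z \<le> z / 100 + L" using bL Lpos by linarith
  have "0 < a * L" using a01 Lpos by simp
  then show "ln ph \<le> ln z + L / 4" using lnz ln_r(1) by linarith
qed

lemma ln_m_z: "ln m \<le> z / 100 + 3 * L"
proof -
  have "0 \<le> ln (real k)" using kpos by simp
  then show ?thesis using z_bounds(4,5) ln_m Lpos by linarith
qed

text \<open>The factor \<open>s\<close> puts \<open>r * phi * s\<close> exactly at
  \<open>n^(10 * b)\<close>, the boundary at which \<open>prob_structure_dense\<close> still
  applies. A clique with \<open>phi / 20\<close> members off each vertex keeps more than
  \<open>phi * s / 40\<close>, hence at least \<open>tau\<close>, of them for all \<open>n\<close>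
  vertices at once with probability at least 1/2. So the bound \<open>3 * eps\<close> at the lower
  density doubles.\<close>

lemma prob_BadL: "Prs (ksets n k) p (\<lambda>H. \<exists>F\<subseteq>H. clique F \<and> (\<forall>x\<in>{1..n}. ph / 20 \<le> real (card {A \<in> F. x \<notin> A}))) \<le> 6 * eps"
proof -
  let ?K = "ksets n k"
  define s where "s = exp (10 * (b * L)) / z"
  have s: "0 < s" "s \<le> 1" using z_bounds(1,2) by (auto simp: s_def)
  have phs: "phi n k (p * s) = ph * s" by (simp add: phi_def)
  have phs': "ph * s = exp (10 * (b * L)) / r" using r01(1) ph_pos by (simp add: s_def z_def)
  have lnphs: "ln (ph * s) = 10 * (b * L) - ln r" unfolding phs' using r01(1) by (simp add: ln_div)
  interpret N: nonL n k "p * s" eps a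
  proof
    show "0 < p * s" using p01 s by simp
    show "p * s \<le> 1" using p01 s by (simp add: mult_le_one)
    show "ln r + ln (phi n k (p * s)) \<le> d2 * ln (real n)" unfolding phs lnphs using par(5) by (simp add: L_def)
    show "- (ln (real n) / 3) \<le> ln (phi n k (p * s))" unfolding phs lnphs using bL(1) ln_r(2) Lpos by (simp add: L_def)
  qed (use k2 kn kL a01 eps01 bigA bigB bigC in auto)
  have "0 \<le> ln (phi n k (p * s))" unfolding phs lnphs using bL(1) ln_r(2) by linarith
  from N.prob_structure_dense[OF bigD this] obtain tau where tau: "real tau \<le> exp (2 * (b * L)) / r"
    and Q: "Prs ?K (p * s) (\<lambda>H. \<exists>F\<subseteq>H. clique F \<and> tau \<le> card F \<and> (\<forall>x\<in>{1..n}. tau \<le> card {A \<in> F. x \<notin> A})) \<le> 3 * eps"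
    by blast
  let ?Q = "\<lambda>H. \<exists>F\<subseteq>H. clique F \<and> tau \<le> card F \<and> (\<forall>x\<in>{1..n}. tau \<le> card {A \<in> F. x \<notin> A})"
  have big: "40 * exp (2 * (b * L)) \<le> exp (10 * (b * L))"
  proof -
    have "40 \<le> exp (b * L)" by (rule le_expI) (auto intro: lnc)
    then have "40 * exp (2 * (b * L)) \<le> exp (b * L) * exp (2 * (b * L))" by (intro mult_right_mono) auto
    also have "\<dots> = exp (b * L + 2 * (b * L))" by (rule exp_add[symmetric])
    also have "\<dots> \<le> exp (10 * (b * L))" unfolding exp_le_cancel_iff using bL(1) by linarith
    finally show ?thesis .
  qed
  have taus: "real tau \<le> ph * s / 40"
  proof -
    have "40 * exp (2 * (b * L)) / r \<le> exp (10 * (b * L)) / r" using big r01(1) by (intro divide_right_mono) auto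
    then show ?thesis using tau unfolding phs' by simp
  qed
  have phs_big: "320 * L \<le> ph * s"
  proof -
    have "1000000 * L \<le> exp (b * L) * exp (b * L)"
    proof (rule mult_mono)
      show "1000000 \<le> exp (b * L)" by (rule le_expI) (use lnC(3) in simp_all)
      show "L \<le> exp (b * L)" by (rule le_expI) (use lnL Lpos in auto)
    qed (use Lpos in auto)
    also have "\<dots> = exp (b * L + b * L)" by (rule exp_add[symmetric])
    also have "\<dots> \<le> exp (10 * (b * L))" unfolding exp_le_cancel_iff using bL(1) by linarith
    also have "\<dots> \<le> exp (10 * (b * L)) / r"
    proof -
      have "exp (10 * (b * L)) / 1 \<le> exp (10 * (b * L)) / r" using r01(1,2) by (intro divide_left_mono) auto
      then show ?thesis by simp
    qed
    finally show ?thesis unfolding phs' using Lpos by linarith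
  qed
  have "Prs ?K p (\<lambda>H. \<exists>F\<subseteq>H. clique F \<and> (\<forall>x\<in>{1..n}. ph / 20 \<le> real (card {A \<in> F. x \<notin> A}))) \<le> 2 * Prs ?K (p * s) ?Q"
  proof (rule Prs_thin_le)
    fix H assume H: "H \<subseteq> ?K" and "\<exists>F\<subseteq>H. clique F \<and> (\<forall>x\<in>{1..n}. ph / 20 \<le> real (card {A \<in> F. x \<notin> A}))"
    then obtain F where F: "F \<subseteq> H" "clique F" "\<And>x. x \<in> {1..n} \<Longrightarrow> ph / 20 \<le> real (card {A \<in> F. x \<notin> A})" by blast
    have finH: "finite H" using H finite_subset by blast
    let ?S = "\<lambda>x. {A \<in> F. x \<notin> A}"
    have "Prs H s (\<lambda>H'. \<not> ?Q H') \<le> Prs H s (\<lambda>H'. \<exists>x\<in>{1..n}. real (card (H' \<inter> ?S x)) \<le> ph * s / 20 / 2)"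
    proof (rule Prs_mono, rule ccontr)
      fix H' assume H': "H' \<subseteq> H" "\<not> ?Q H'" "\<not> (\<exists>x\<in>{1..n}. real (card (H' \<inter> ?S x)) \<le> ph * s / 20 / 2)"
      have fH': "finite H'" using H'(1) finH by (rule finite_subset)
      have ge: "tau \<le> card (H' \<inter> ?S x)" if "x \<in> {1..n}" for x
      proof -
        have "\<not> real (card (H' \<inter> ?S x)) \<le> ph * s / 20 / 2" using H'(3) that by blast
        then show ?thesis using taus by linarith
      qed
      have S: "{A \<in> H' \<inter> F. x \<notin> A} = H' \<inter> ?S x" for x by blast
      have "1 \<in> {1..n}" using kn by simp
      from ge[OF this] have "tau \<le> card (H' \<inter> F)" using fH' by (elim order_trans) (intro card_mono, auto)
      moreover have "clique (H' \<inter> F)" by (rule clique_subset[OF F(2)]) simp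
      moreover have "\<forall>x\<in>{1..n}. tau \<le> card {A \<in> H' \<inter> F. x \<notin> A}" unfolding S using ge by blast
      ultimately have "?Q H'" by (intro exI[of _ "H' \<inter> F"] conjI) simp_all
      then show False using H'(2) by contradiction
    qed
    also have "\<dots> \<le> (\<Sum>x\<in>{1..n}. Prs H s (\<lambda>H'. real (card (H' \<inter> ?S x)) \<le> ph * s / 20 / 2))" by (rule Prs_Bex) simp
    also have "\<dots> \<le> (\<Sum>x\<in>{1..n}. exp (- (2 * L)))"
    proof (rule sum_mono)
      fix x assume x: "x \<in> {1..n}"
      have "Prs H s (\<lambda>H'. real (card (H' \<inter> ?S x)) \<le> ph * s / 20 / 2) \<le> exp (- (ph * s / 20) / 8)"
      proof (rule Prs_card_Int_lower_tail)
        have "ph / 20 * s \<le> real (card (?S x)) * s" using F(3)[OF x] s by (intro mult_right_mono) auto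
        then show "ph * s / 20 \<le> real (card (?S x)) * s" by simp
      qed (use finH F(1) s ph_pos in auto)
      also have "\<dots> \<le> exp (- (2 * L))" using phs_big by simp
      finally show "Prs H s (\<lambda>H'. real (card (H' \<inter> ?S x)) \<le> ph * s / 20 / 2) \<le> exp (- (2 * L))" .
    qed
    also have "\<dots> = exp L * exp (- (2 * L))" using Lpos(3) by simp
    also have "\<dots> = exp (- L)" by (simp add: exp_add[symmetric])
    also have "\<dots> \<le> eps / 10^6" by (rule exp_small) (use bL Lpos in linarith)
    also have "\<dots> \<le> 1/2" using eps01 by simp
    finally show "1/2 \<le> Prs H s ?Q" unfolding Prs_compl by simp
  qed (use p01 s in auto)
  then show ?thesis using Q by linarith
qed

definition m0 :: nat where "m0 = nat \<lceil>10 * L\<rceil>"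

lemma m0_bounds: "10 * L \<le> real m0" "real m0 \<le> 11 * L"
proof -
  have "0 \<le> 10 * L" using Lpos by simp
  then have e: "real m0 = of_int \<lceil>10 * L\<rceil>" by (simp add: m0_def)
  show "10 * L \<le> real m0" unfolding e by linarith
  have "real m0 \<le> 10 * L + 1" unfolding e by linarith
  then show "real m0 \<le> 11 * L" using Lpos by linarith
qed

lemma w2L: "(real k)\<^sup>2 / real n \<le> L / 4"
proof -
  have "(1/4 - 2 * a) * (real n * L) \<le> 1/4 * (real n * L)" using a01 Lpos by (intro mult_right_mono) auto
  moreover have "(real k)\<^sup>2 \<le> (1/4 - 2 * a) * (real n * L)" using kL by (simp only: L_def mult.assoc)
  ultimately have "(real k)\<^sup>2 \<le> 1/4 * (real n * L)" by linarith
  then show ?thesis using Lpos by (simp add: field_simps)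
qed

lemma num: "2 * real k + real m0 * real k + 4 * (real k)^3 / (real n - 2 * real k) \<le> real n / 2"
proof -
  have d: "real n / 2 \<le> real n - 2 * real k" using k_le_an(2) by linarith
  have "4 * (real k)^3 / (real n - 2 * real k) \<le> 4 * (real k)^3 / (real n / 2)"
    using d Lpos by (intro divide_left_mono mult_pos_pos) auto
  also have "\<dots> = 8 * real k * ((real k)\<^sup>2 / real n)" by (simp add: power2_eq_square power3_eq_cube)
  also have "\<dots> \<le> 8 * real k * (L / 4)" using w2L by (intro mult_left_mono) auto
  finally have 1: "4 * (real k)^3 / (real n - 2 * real k) \<le> 2 * (real k * L)" by simp
  have 2: "real m0 * real k \<le> 11 * (real k * L)" using mult_right_mono[OF m0_bounds(2), of "real k"] by (simp add: mult_ac)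
  have 3: "1000 * real k \<le> real k * L" using mult_left_mono[OF Lpos(1), of "real k"] by (simp add: mult_ac)
  have "30 * (real k * L) \<le> exp L"
  proof (rule le_expI)
    have "ln (30 * (real k * L)) = ln 30 + ln (real k) + ln L" using kpos Lpos by (simp add: ln_mult)
    moreover have "ln 30 \<le> b * L" by (rule lnc) auto
    ultimately show "ln (30 * (real k * L)) \<le> L" using ln_k_le lnL bL Lpos by linarith
  qed (use kpos Lpos in simp)
  then show ?thesis using 1 2 3 kpos(2) unfolding Lpos(3) by linarith
qed

text \<open>With this choice \<open>1 + lam\<close> is at most \<open>z / 4\<close>, the number of
  blocked edges per member that \<open>prob_few\<close> guarantees. Selecting one of
  \<open>1 + lam\<close> members therefore does not weaken the comparison with
  \<open>card G\<close>.\<close>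

definition lam :: nat where "lam = nat \<lfloor>z / 8\<rfloor>"

lemma lam_bounds: "real lam \<le> z / 8" "z / 8 \<le> real (Suc lam)"
proof -
  have "0 \<le> z / 8" using z_bounds(2) by simp
  then have "real lam \<le> z / 8" "z / 8 - 1 \<le> real lam" unfolding lam_def by (rule nat_floor_bounds)+
  then show "real lam \<le> z / 8" "z / 8 \<le> real (Suc lam)" by simp_all
qed

lemma prob_many: "Prs (ksets n k) p (\<lambda>H. \<exists>B\<in>H. Suc lam \<le> card {C \<in> H. C \<noteq> B \<and> m0 \<le> card (B \<inter> C)}) \<le> eps / 10^6"
proof -
  let ?w = "(real k)\<^sup>2 / real n"
  define e where "e = ?w ^ m0 / fact m0"
  have m00: "0 < m0" using m0_bounds(1) Lpos by (cases m0) auto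
  have e0: "0 < e" using kpos Lpos by (simp add: e_def)
  have eb: "e \<le> exp (- (20 * L))"
  proof -
    have "e \<le> (exp 1 * ?w / real m0) ^ m0" unfolding e_def using m00 by (intro power_div_fact_le) auto
    also have "\<dots> \<le> exp (- 2) ^ m0"
    proof (rule power_mono)
      have "exp 1 * ?w \<le> exp 1 * (L / 4)" by (rule mult_left_mono[OF w2L]) simp
      then have "exp 1 * ?w / real m0 \<le> exp 1 * (L / 4) / (10 * L)"
        by (rule frac_le[rotated 1]) (use m0_bounds(1) Lpos in auto)
      also have "\<dots> = exp 1 / 40" using Lpos by simp
      also have "\<dots> \<le> exp (- 2)"
      proof -
        have "exp 1 * exp 1 * exp 1 \<le> (3::real) * 3 * 3" using exp_le by (intro mult_mono) auto
        moreover have "exp (- 2) * (exp 1 * exp 1) = (1::real)" by (simp only: exp_add[symmetric]) simp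
        ultimately have "exp 1 / 40 * (exp 1 * exp 1) \<le> exp (- 2) * (exp 1 * exp 1 :: real)" by simp
        then show ?thesis by (simp only: mult_le_cancel_right_pos exp_gt_zero mult_pos_pos)
      qed
      finally show "exp 1 * ?w / real m0 \<le> exp (- 2)" .
    qed auto
    also have "\<dots> = exp (real m0 * (- 2))" by (rule exp_of_nat_mult[symmetric])
    also have "\<dots> \<le> exp (- (20 * L))" unfolding exp_le_cancel_iff using m0_bounds(1) by simp
    finally show ?thesis .
  qed
  let ?j = "Suc lam"
  have j0: "0 < real ?j" by simp
  have "Prs (ksets n k) p (\<lambda>H. \<exists>B\<in>H. ?j \<le> card {C \<in> H. C \<noteq> B \<and> m0 \<le> card (B \<inter> C)}) \<le> m * ((m * e) ^ ?j / fact ?j)"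
    unfolding e_def by (rule prob_many_large_intersections) (use kpos kn p01 in auto)
  also have "\<dots> \<le> m * (exp 1 * (m * e) / real ?j) ^ ?j"
    using ph_pos e0 by (intro mult_left_mono power_div_fact_le) auto
  also have "\<dots> \<le> m * exp (- L) ^ ?j"
  proof (intro mult_left_mono power_mono)
    have "exp 1 * (m * e) / real ?j \<le> exp 1 * (m * e) / (z / 8)"
      using lam_bounds(2) z_bounds(2) ph_pos e0 by (intro divide_left_mono mult_pos_pos) auto
    also have "\<dots> = exp 1 * 8 * (real n / (real k * r)) * e" using ph_pos r01(1) kpos by (simp add: z_def mbar_def field_simps)
    also have "\<dots> \<le> exp (- L)"
    proof (rule le_expI)
      show "0 < exp 1 * 8 * (real n / (real k * r)) * e" using e0 kpos r01(1) Lpos by simp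
      have "ln (exp 1 * 8 * (real n / (real k * r)) * e) = 1 + ln 8 + (L - (ln (real k) + ln r)) + ln e"
        using e0 kpos r01(1) Lpos by (simp add: ln_mult ln_div L_def)
      moreover have "ln e \<le> - (20 * L)"
      proof -
        have "ln e \<le> ln (exp (- (20 * L)))" using e0 eb by (subst ln_le_cancel_iff) auto
        then show ?thesis by simp
      qed
      moreover have "ln 8 \<le> b * L" by (rule lnc) auto
      moreover have "0 \<le> ln (real k)" using kpos by simp
      ultimately show "ln (exp 1 * 8 * (real n / (real k * r)) * e) \<le> - L" using ln_r(1) bL Lpos by linarith
    qed
    finally show "exp 1 * (m * e) / real ?j \<le> exp (- L)" .
  qed (use ph_pos e0 in auto)
  also have "\<dots> = m * exp (real ?j * (- L))" by (simp only: exp_of_nat_mult)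
  also have "\<dots> \<le> eps / 10^6"
  proof (rule small_if)
    have "ln (m * exp (real ?j * (- L))) = ln m + ln (exp (real ?j * (- L)))" by (rule ln_mult_pos) (use ph_pos in auto)
    then have 1: "ln (m * exp (real ?j * (- L))) = ln m - real ?j * L" by simp
    have "z / 8 * 8 \<le> real ?j * L" using lam_bounds(2) z_bounds(2) Lpos by (intro mult_mono) auto
    then show "ln (m * exp (real ?j * (- L))) \<le> - (b * L)" unfolding 1 using ln_m_z z_bounds(3) bL Lpos by linarith
  qed (use ph_pos in simp)
  finally show ?thesis .
qed

text \<open>The largest \<open>u\<close> with \<open>u * r \<le> 1/2\<close>, the range of the
  Bonferroni bound in \<open>card_miss_ge\<close>, or 1 if \<open>r\<close> exceeds 1/2.\<close>

definition um :: nat where "um = max 1 (nat \<lfloor>1 / (2 * r)\<rfloor>)"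

lemma um_bounds: "1 \<le> um" "u \<le> um \<Longrightarrow> u = 1 \<or> u = 0 \<or> real u * r \<le> 1/2" "real um \<le> exp L" "1/4 \<le> real um * r"
proof -
  let ?v = "1 / (2 * r)"
  have v0: "0 < ?v" using r01(1) by simp
  have f: "real (nat \<lfloor>?v\<rfloor>) \<le> ?v" "?v - 1 \<le> real (nat \<lfloor>?v\<rfloor>)" using v0 by (auto intro!: nat_floor_bounds)
  have vr: "?v * r = 1/2" using r01(1) by simp
  show "1 \<le> um" by (simp add: um_def)
  show "u = 1 \<or> u = 0 \<or> real u * r \<le> 1/2" if "u \<le> um"
  proof (cases "u \<le> 1")
    case False
    then have "u \<le> nat \<lfloor>?v\<rfloor>" using that by (simp add: um_def)
    then have "real u \<le> ?v" using f(1) by linarith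
    then have "real u * r \<le> ?v * r" using r01(1) by (intro mult_right_mono) auto
    then show ?thesis unfolding vr by simp
  qed auto
  have "1 / r \<le> exp L"
  proof (rule le_expI)
    have "0 < a * L" using a01 Lpos by simp
    then show "ln (1 / r) \<le> L" using r01(1) ln_r(1) Lpos by (simp add: ln_div)
  qed (use r01(1) in simp)
  moreover have "?v \<le> 1 / r" using r01(1) by (simp add: field_simps)
  ultimately have "real (nat \<lfloor>?v\<rfloor>) \<le> exp L" using f(1) by linarith
  then show "real um \<le> exp L" using Lpos(2) by (simp add: um_def of_nat_max)
  have um1: "1 \<le> real um" "real (nat \<lfloor>?v\<rfloor>) \<le> real um" by (auto simp: um_def)
  have "?v / 2 \<le> real um"
  proof -
    have "y / 2 \<le> c" if "y - 1 \<le> c" "1 \<le> c" for y c :: real using that by linarith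
    moreover have "?v - 1 \<le> real um" using f(2) um1(2) by (rule order_trans)
    ultimately show ?thesis using um1(1) by blast
  qed
  then have "?v / 2 * r \<le> real um * r" using r01(1) by (intro mult_right_mono) auto
  then show "1/4 \<le> real um * r" using r01(1) by simp
qed

text \<open>The union over \<open>G\<close> costs \<open>m ^ u\<close>, and \<open>ln m\<close> is
  at most \<open>z / 100 + 3 * L\<close>, so the Chernoff factor \<open>exp (- u * z / 16)\<close>
  prevails.\<close>

lemma prob_few: "Prs (ksets n k) p (\<lambda>H. \<exists>u\<in>{1..um}. \<exists>x\<in>{1..n}. \<exists>G\<subseteq>H. card G = u \<and> (\<forall>A\<in>G. x \<notin> A) \<and>
      (\<forall>A\<in>G. \<forall>B\<in>G. A \<noteq> B \<longrightarrow> card (A \<inter> B) < m0) \<and> real (card (H \<inter> miss n k x G)) \<le> real u * r * ph / 4) \<le> eps / 10^6"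
proof -
  let ?E = "\<lambda>u H. \<exists>x\<in>{1..n}. \<exists>G\<subseteq>H. card G = u \<and> (\<forall>A\<in>G. x \<notin> A) \<and>
      (\<forall>A\<in>G. \<forall>B\<in>G. A \<noteq> B \<longrightarrow> card (A \<inter> B) < m0) \<and> real (card (H \<inter> miss n k x G)) \<le> real u * r * ph / 4"
  have "Prs (ksets n k) p (\<lambda>H. \<exists>u\<in>{1..um}. ?E u H) \<le> (\<Sum>u\<in>{1..um}. Prs (ksets n k) p (?E u))" by (rule Prs_Bex) simp
  also have "\<dots> \<le> (\<Sum>u\<in>{1..um}. exp (- (3 * L)))"
  proof (rule sum_mono)
    fix u assume u: "u \<in> {1..um}"
    have "Prs (ksets n k) p (?E u) \<le> real n * (m ^ u * exp (- (real u * r * ph / 16)))"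
      by (rule prob_few_misses) (use kpos kn p01 num u um_bounds(2)[of u] in auto)
    also have "\<dots> = exp L * (exp (real u * ln m) * exp (real u * (- (z / 16))))"
      using Lpos(3) ph_pos by (simp add: exp_of_nat_mult z_def)
    also have "\<dots> = exp (L + real u * (ln m - z / 16))" by (simp add: exp_add[symmetric] right_diff_distrib)
    also have "\<dots> \<le> exp (L + 1 * (- (4 * L)))" unfolding exp_le_cancel_iff
    proof (intro add_left_mono)
      have lm: "ln m - z / 16 \<le> - (4 * L)" using ln_m_z z_bounds(3) Lpos by linarith
      then have "real u * (ln m - z / 16) \<le> real u * (- (4 * L))" by (intro mult_left_mono) auto
      also have "\<dots> \<le> 1 * (- (4 * L))" using u Lpos by (intro mult_right_mono_neg) auto
      finally show "real u * (ln m - z / 16) \<le> 1 * (- (4 * L))" .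
    qed
    finally show "Prs (ksets n k) p (?E u) \<le> exp (- (3 * L))" by simp
  qed
  also have "\<dots> = real um * exp (- (3 * L))" by simp
  also have "\<dots> \<le> exp L * exp (- (3 * L))" using um_bounds(3) by (intro mult_right_mono) auto
  also have "\<dots> = exp (L + - (3 * L))" by (rule exp_add[symmetric])
  also have "\<dots> \<le> eps / 10^6" by (rule exp_small) (use bL Lpos in linarith)
  finally show ?thesis .
qed

text \<open>From \<open>G\<close> a subfamily with pairwise intersections below \<open>m0\<close> is
  selected, as large as greedy choice and \<open>um\<close> permit. If size \<open>um\<close> is
  reached, then \<open>um * r \<ge> 1/4\<close> gives
  \<open>um * r * phi / 4 \<ge> phi / 16\<close>, more than \<open>card G\<close>. Otherwise about
  one in \<open>1 + lam\<close> members is selected, and \<open>1 + lam \<le> z / 4\<close>. Either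
  way the subfamily blocks no more edges than \<open>G\<close> does, hence at most
  \<open>card G\<close>, which is too few.\<close>

lemma few_misses_contradiction:
  assumes H: "H \<subseteq> ksets n k" and x: "x \<in> {1..n}" and G: "G \<subseteq> H" "\<And>A. A \<in> G \<Longrightarrow> x \<notin> A" "G \<noteq> {}"
    and Gs: "real (card G) \<le> ph / 20" and miss: "card (H \<inter> miss n k x G) \<le> card G"
    and nomany: "\<not> (\<exists>B\<in>H. Suc lam \<le> card {C \<in> H. C \<noteq> B \<and> m0 \<le> card (B \<inter> C)})"
  shows "\<exists>u\<in>{1..um}. \<exists>x\<in>{1..n}. \<exists>G\<subseteq>H. card G = u \<and> (\<forall>A\<in>G. x \<notin> A) \<and>
      (\<forall>A\<in>G. \<forall>B\<in>G. A \<noteq> B \<longrightarrow> card (A \<inter> B) < m0) \<and> real (card (H \<inter> miss n k x G)) \<le> real u * r * ph / 4"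
proof -
  have finH: "finite H" using H finite_subset by blast
  have finG: "finite G" using G(1) finH by (rule finite_subset)
  have s1: "1 \<le> card G" using G(3) finG by (simp add: Suc_le_eq card_gt_0_iff)
  have "\<exists>u\<in>{1..um}. (u - 1) * (1 + lam) < card G \<and> real (card G) \<le> real u * r * ph / 4"
  proof (cases "(um - 1) * (1 + lam) < card G")
    case True
    have "1/4 * ph \<le> real um * r * ph" using um_bounds(4) ph_pos by (intro mult_right_mono) auto
    then have "real (card G) \<le> real um * r * ph / 4" using Gs ph_pos by linarith
    then show ?thesis using True um_bounds(1) by (intro bexI[of _ um]) auto
  next
    case False
    \<comment> \<open>Subtracting one before dividing makes \<open>v + 1\<close> the quotient
      \<open>card G / (1 + lam)\<close> rounded up, the size that greedy selection attains.\<close>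
    define v where "v = (card G - 1) div (1 + lam)"
    have vl: "v * (1 + lam) \<le> card G - 1" unfolding v_def by (rule div_times_less_eq_dividend)
    have vu: "card G \<le> (v + 1) * (1 + lam)"
    proof -
      have "card G - 1 = v * (1 + lam) + (card G - 1) mod (1 + lam)" unfolding v_def by (rule div_mult_mod_eq[symmetric])
      moreover have "(card G - 1) mod (1 + lam) < 1 + lam" by (rule mod_less_divisor) simp
      ultimately have "card G - 1 < v * (1 + lam) + (1 + lam)" by linarith
      then show ?thesis by (simp add: algebra_simps)
    qed
    have "v < um"
    proof (rule ccontr)
      assume "\<not> v < um"
      then have "(um - 1) * (1 + lam) \<le> v * (1 + lam)" by (intro mult_right_mono) auto
      then show False using vl False s1 by linarith
    qed
    moreover have "(v + 1 - 1) * (1 + lam) < card G" using vl s1 by simp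
    moreover have "real (card G) \<le> real (v + 1) * r * ph / 4"
    proof -
      have "real (card G) \<le> real ((v + 1) * (1 + lam))" using vu by (rule of_nat_mono)
      also have "\<dots> = real (v + 1) * (1 + real lam)" by (simp only: of_nat_mult of_nat_add of_nat_1)
      also have "\<dots> \<le> real (v + 1) * (z / 4)" using lam_bounds(1) z_bounds(3) Lpos by (intro mult_left_mono) auto
      finally show ?thesis by (simp add: z_def mult.assoc)
    qed
    ultimately show ?thesis by (intro bexI[of _ "v + 1"]) auto
  qed
  then obtain u where u: "u \<in> {1..um}" "(u - 1) * (1 + lam) < card G" "real (card G) \<le> real u * r * ph / 4" by blast
  have "\<exists>G'\<subseteq>G. card G' = u \<and> (\<forall>B\<in>G'. \<forall>C\<in>G'. B \<noteq> C \<longrightarrow> \<not> m0 \<le> card (B \<inter> C))"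
  proof (rule greedy_independent[OF finG])
    fix B assume B: "B \<in> G"
    have "card {C \<in> G. C \<noteq> B \<and> m0 \<le> card (B \<inter> C)} \<le> card {C \<in> H. C \<noteq> B \<and> m0 \<le> card (B \<inter> C)}"
      using finH G(1) by (intro card_mono) auto
    also have "\<dots> \<le> lam" using nomany B G(1) by (meson not_less_eq_eq subsetD)
    finally show "card {C \<in> G. C \<noteq> B \<and> m0 \<le> card (B \<inter> C)} \<le> lam" .
  qed (use u(2) in \<open>auto simp: Int_commute\<close>)
  then obtain G' where G': "G' \<subseteq> G" "card G' = u" "\<forall>B\<in>G'. \<forall>C\<in>G'. B \<noteq> C \<longrightarrow> \<not> m0 \<le> card (B \<inter> C)" by blast
  have "H \<inter> miss n k x G' \<subseteq> H \<inter> miss n k x G" using G'(1) by (auto simp: miss_def)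
  then have "card (H \<inter> miss n k x G') \<le> card (H \<inter> miss n k x G)" using finH by (intro card_mono) auto
  then have "real (card (H \<inter> miss n k x G')) \<le> real u * r * ph / 4" using miss u(3) by linarith
  then show ?thesis using u(1) x G' G(1,2) by (intro bexI[of _ u] bexI[of _ x] exI[of _ G']) (auto simp: not_le)
qed

lemma prob_not_EKR_L: "Prs (ksets n k) p (\<lambda>H. \<not> satisfies_EKR n H) \<le> 7 * eps"
proof -
  let ?K = "ksets n k"
  let ?B = "\<lambda>H. \<exists>F\<subseteq>H. clique F \<and> (\<forall>x\<in>{1..n}. ph / 20 \<le> real (card {A \<in> F. x \<notin> A}))"
  let ?Many = "\<lambda>H. \<exists>B\<in>H. Suc lam \<le> card {C \<in> H. C \<noteq> B \<and> m0 \<le> card (B \<inter> C)}"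
  let ?Few = "\<lambda>H. \<exists>u\<in>{1..um}. \<exists>x\<in>{1..n}. \<exists>G\<subseteq>H. card G = u \<and> (\<forall>A\<in>G. x \<notin> A) \<and>
      (\<forall>A\<in>G. \<forall>B\<in>G. A \<noteq> B \<longrightarrow> card (A \<inter> B) < m0) \<and> real (card (H \<inter> miss n k x G)) \<le> real u * r * ph / 4"
  have "Prs ?K p (\<lambda>H. \<not> satisfies_EKR n H) \<le> Prs ?K p (\<lambda>H. ?B H \<or> (?Many H \<or> ?Few H))"
  proof (rule Prs_mono)
    fix H assume H: "H \<subseteq> ?K" "\<not> satisfies_EKR n H"
    have finH: "finite H" using H(1) finite_subset by blast
    have "0 < n" using kn by simp
    from not_EKR_nontrivial[OF H(1) this H(2)] obtain F where F: "F \<subseteq> H" "clique F" "\<forall>x\<in>{1..n}. \<exists>A\<in>F. x \<notin> A" "max_degree n H \<le> card F"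
      by (elim exE conjE)
    have finF: "finite F" using F(1) finH by (rule finite_subset)
    have "?Few H" if nb: "\<not> ?B H" and nm: "\<not> ?Many H"
    proof -
      have "\<exists>x\<in>{1..n}. \<not> ph / 20 \<le> real (card {A \<in> F. x \<notin> A})" using nb F(1,2) by blast
      then obtain x where x: "x \<in> {1..n}" "\<not> ph / 20 \<le> real (card {A \<in> F. x \<notin> A})" by blast
      define G where "G = {A \<in> F. x \<notin> A}"
      define Fx where "Fx = {A \<in> F. x \<in> A}"
      have cF: "card F = card G + card Fx"
      proof -
        have "F = G \<union> Fx" by (auto simp: G_def Fx_def)
        moreover have "card (G \<union> Fx) = card G + card Fx" using finF by (intro card_Un_disjoint) (auto simp: G_def Fx_def)
        ultimately show ?thesis by simp
      qed
      have deg: "card (H \<inter> kstar n k x) \<le> max_degree n H"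
        using card_star_le_max_degree[OF x(1), of H] by (simp only: star_eq_Int[OF H(1)])
      have FxH: "Fx \<subseteq> H \<inter> kstar n k x" using F(1) H(1) by (auto simp: Fx_def kstar_def)
      have disj: "Fx \<inter> miss n k x G = {}"
      proof -
        have "A \<inter> B \<noteq> {}" if "A \<in> Fx" "B \<in> G" for A B
        proof -
          have "A \<noteq> B" "A \<in> F" "B \<in> F" using that by (auto simp: Fx_def G_def)
          then have "\<not> disjnt A B" using F(2) unfolding clique_def pairwise_def by metis
          then show ?thesis by (simp add: disjnt_def)
        qed
        then show ?thesis by (auto simp: miss_def)
      qed
      have "card (H \<inter> miss n k x G) + card Fx = card (H \<inter> miss n k x G \<union> Fx)"
        using finH finF disj by (intro card_Un_disjoint[symmetric]) (auto simp: Fx_def)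
      also have "\<dots> \<le> card (H \<inter> kstar n k x)"
        using finH FxH miss_subset[of n k x G] by (intro card_mono) auto
      finally have miss: "card (H \<inter> miss n k x G) \<le> card G" using deg F(4) cF by linarith
      show ?thesis
      proof (rule few_misses_contradiction[OF H(1) x(1) _ _ _ _ miss nm])
        show "real (card G) \<le> ph / 20" using x(2) by (simp add: G_def)
        show "G \<noteq> {}" using F(3) x(1) by (auto simp: G_def)
        show "G \<subseteq> H" using F(1) by (auto simp: G_def)
      qed (auto simp: G_def)
    qed
    then show "?B H \<or> (?Many H \<or> ?Few H)" by (simp only: disj_imp) iprover
  qed
  also have "\<dots> \<le> Prs ?K p ?B + (Prs ?K p ?Many + Prs ?K p ?Few)"
    by (rule order_trans[OF Prs_disj]) (intro add_left_mono Prs_disj)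
  also have "\<dots> \<le> 6 * eps + (eps / 10^6 + eps / 10^6)" by (intro add_mono prob_BadL prob_many prob_few)
  also have "\<dots> \<le> 7 * eps" using eps01 by simp
  finally show ?thesis .
qed

end

section \<open>Assembling the regimes\<close>

lemma prob_max_degree_pos:
  assumes kn: "0 < k" "2 * k < n" and p01: "0 \<le> p" "p \<le> 1"
  shows "Prs (ksets n k) p (\<lambda>H. 1 \<le> max_degree n H) \<le> mbar n k p"
proof -
  let ?K = "ksets n k"
  have n0: "0 < n" using kn by simp
  have "Prs ?K p (\<lambda>H. 1 \<le> max_degree n H) \<le> Prs ?K p (\<lambda>H. 1 \<le> card (H \<inter> ?K))"
  proof (rule Prs_mono)
    fix H assume H: "H \<subseteq> ?K" "1 \<le> max_degree n H"
    have finH: "finite H" using H(1) finite_subset by blast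
    obtain x where "1 \<le> card (star H x)" using H(2) le_max_degree_iff[OF n0] by blast
    also have "card (star H x) \<le> card H" using finH by (intro card_mono) (auto simp: star_def)
    also have "H = H \<inter> ?K" using H(1) by blast
    finally show "1 \<le> card (H \<inter> ?K)" .
  qed
  also have "\<dots> \<le> (real (card ?K) * p) ^ 1 / fact 1" by (rule Prs_card_Int_ge) (use p01 in auto)
  also have "\<dots> = mbar n k p" using kn by (simp add: mbar_eq card_ksets mult.commute)
  finally show ?thesis .
qed

text \<open>Two edges of a star form a clique, so degree 2 is no likelier than an intersecting pair.
  This is used to see that \<open>Lam\<close> at 2 still exceeds \<open>eps\<close>.\<close>

lemma prob_max_degree_ge2:
  assumes kn: "0 < k" "2 * k < n" and p01: "0 \<le> p" "p \<le> 1"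
  shows "Prs (ksets n k) p (\<lambda>H. 2 \<le> max_degree n H) \<le> (mbar n k p)\<^sup>2 * meet_prob n k / 2"
proof -
  let ?K = "ksets n k"
  define N where "N = real (n choose k)"
  have n0: "0 < n" using kn by simp
  have N0: "0 < N" using kn by (simp add: N_def)
  have q0: "0 < meet_prob n k" using meet_prob_bounds[OF kn] by simp
  let ?FF = "{F. F \<subseteq> ?K \<and> card F = 2 \<and> clique F}"
  define M where "M = (\<lambda>i::nat. if i = 0 then N else N * meet_prob n k)"
  have cFF: "real (card ?FF) \<le> (\<Prod>i<2. M i) / fact 2"
  proof (rule card_down_closed_le)
    fix F assume F: "F \<subseteq> ?K" "clique F" "card F < 2"
    have finF: "finite F" using F(1) finite_subset by blast
    show "real (card {b \<in> ?K - F. clique (insert b F)}) \<le> M (card F)"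
    proof (cases "card F = 0")
      case True
      have "card {b \<in> ?K - F. clique (insert b F)} \<le> card ?K" by (rule card_mono) auto
      then show ?thesis using True by (simp add: M_def N_def card_ksets)
    next
      case False
      then have "card F = 1" using F(3) by simp
      then obtain A where A: "F = {A}" by (rule card_1_singletonE)
      have AK: "A \<in> ?K" using F(1) A by simp
      let ?D = "{B \<in> ?K. B \<inter> A = {}}"
      have "{b \<in> ?K - F. clique (insert b F)} \<subseteq> ?K - ?D"
      proof
        fix B assume B: "B \<in> {b \<in> ?K - F. clique (insert b F)}"
        then have "\<not> disjnt B A" unfolding clique_def A pairwise_def by blast
        then show "B \<in> ?K - ?D" using B by (auto simp: disjnt_def)
      qed
      then have "card {b \<in> ?K - F. clique (insert b F)} \<le> card (?K - ?D)" by (intro card_mono) auto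
      also have "card (?K - ?D) = card ?K - card ?D" by (rule card_Diff_subset) (auto intro: finite_subset)
      finally have "real (card {b \<in> ?K - F. clique (insert b F)}) \<le> real (card ?K - card ?D)" by (rule of_nat_mono)
      also have "\<dots> = real (card ?K) - real (card ?D)" by (rule of_nat_diff) (intro card_mono, auto)
      also have "real (card ?D) = real ((n - k) choose k)" using card_ksets_disjoint[of A n k] ksetsD[OF AK] by simp
      also have "real (card ?K) - real ((n - k) choose k) = N * meet_prob n k"
        using meet_prob_eq[of k n] kn N0 by (simp add: card_ksets N_def dprob_def field_simps)
      finally show ?thesis using False by (simp add: M_def)
    qed
  qed (use N0 q0 in \<open>auto simp: M_def intro: clique_subset\<close>)
  have "Prs ?K p (\<lambda>H. 2 \<le> max_degree n H) \<le> Prs ?K p (\<lambda>H. \<exists>F\<in>?FF. F \<subseteq> H)"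
  proof (rule Prs_mono)
    fix H assume H: "H \<subseteq> ?K" "2 \<le> max_degree n H"
    obtain x where "2 \<le> card (star H x)" using H(2) le_max_degree_iff[OF n0] by blast
    then obtain F where F: "F \<subseteq> star H x" "card F = 2" using obtain_subset_with_card_n by metis
    then have "F \<subseteq> H" "clique F" by (auto simp: star_def clique_def pairwise_def disjnt_def)
    then show "\<exists>F\<in>?FF. F \<subseteq> H" using F(2) H(1) by blast
  qed
  also have "\<dots> \<le> real (card ?FF) * p ^ 2"
    by (rule Prs_exists_superset) (use p01 in \<open>auto intro: finite_subset[of _ "Pow ?K"]\<close>)
  also have "\<dots> \<le> (\<Prod>i<2. M i) / fact 2 * p ^ 2" using cFF by (intro mult_right_mono) auto
  also have "\<dots> = (mbar n k p)\<^sup>2 * meet_prob n k / 2"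
    using kn by (simp add: M_def mbar_eq N_def numeral_2_eq_2 power2_eq_square)
  finally show ?thesis .
qed

context base
begin

text \<open>The hypothesis concerns \<open>Lam\<close> at a random argument and is turned around: if
  \<open>Lam\<close> exceeds \<open>eps\<close> at all sizes below \<open>t\<close>, then the
  maximum degree is at least \<open>t\<close> with probability \<open>1 - eps\<close>. Comparing
  this with first moment bounds gives in turn lower bounds for \<open>m\<close>, for
  \<open>phi\<close> and for the least \<open>t\<close>.\<close>

lemma prob_not_EKR_base:
  assumes bigD: "ln (CC a) \<le> bb a * ln (real n)"
    and hyp: "Prs (ksets n k) p (\<lambda>H. eps < Lam n k p (max_degree n H)) \<le> eps"
  shows "Prs (ksets n k) p (\<lambda>H. \<not> satisfies_EKR n H) \<le> (CC a + 10) * eps"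
proof (cases "dd2 a * ln (real n) \<le> ln r + ln ph")
  case True
  interpret Lr: Lreg n k p eps a by unfold_locales (use True bigD in auto)
  have "16 * eps \<le> (CC a + 10) * eps" using CC_ge(6)[of a] eps01 by (intro mult_right_mono) auto
  then show ?thesis using Lr.prob_not_EKR_L eps01 by linarith
next
  case False
  let ?K = "ksets n k"
  have below: "Prs ?K p (\<lambda>H. max_degree n H < t) \<le> eps" if "\<And>s. s < t \<Longrightarrow> eps < Lam n k p s" for t
    by (rule order_trans[OF Prs_mono hyp]) (rule that)
  have above: "9/10 \<le> Prs ?K p (\<lambda>H. t \<le> max_degree n H)" if "\<And>s. s < t \<Longrightarrow> eps < Lam n k p s" for t
  proof -
    have "Prs ?K p (\<lambda>H. \<not> t \<le> max_degree n H) \<le> eps" using below[OF that] by (simp add: not_le)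
    then show ?thesis using eps01 unfolding Prs_compl by linarith
  qed
  have L0: "eps < Lam n k p 0" using eps01 by (simp add: Lam_def numeral_2_eq_2)
  have m1: "9/10 \<le> m"
  proof -
    have "9/10 \<le> Prs ?K p (\<lambda>H. 1 \<le> max_degree n H)" by (rule above) (use L0 in auto)
    also have "\<dots> \<le> m" by (rule prob_max_degree_pos) (use kpos kn p01 in auto)
    finally show ?thesis .
  qed
  have L1: "eps < Lam n k p 1" using m1 eps01 by (simp add: Lam_def numeral_2_eq_2)
  have L2: "eps < Lam n k p 2"
  proof -
    have "9/10 \<le> Prs ?K p (\<lambda>H. 2 \<le> max_degree n H)"
    proof (rule above)
      fix s :: nat assume "s < 2"
      then have "s = 0 \<or> s = 1" by linarith
      then show "eps < Lam n k p s" using L0 L1 by blast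
    qed
    also have "\<dots> \<le> m\<^sup>2 * q / 2" by (rule prob_max_degree_ge2) (use kpos kn p01 in auto)
    finally have 1: "9/5 \<le> m\<^sup>2 * q" by simp
    also have "\<dots> \<le> m\<^sup>2 * 1" using r01(5) by (intro mult_left_mono) auto
    finally have "(5/4)\<^sup>2 \<le> m\<^sup>2" by (simp add: power2_eq_square)
    then have "5/4 \<le> m" by (rule power2_le_imp_le) (use ph_pos in simp)
    then have "m * (m / 5) \<le> m * (m - 1)" using ph_pos by (intro mult_left_mono) auto
    then have "m\<^sup>2 / 5 * q \<le> m * (m - 1) * q" using r01(4) by (intro mult_right_mono) (auto simp: power2_eq_square)
    moreover have "Lam n k p 2 = m * (m - 1) * q / 2" by (simp add: Lam_def gbinomial_prod_rev numeral_2_eq_2)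
    ultimately show ?thesis using 1 eps01 by simp
  qed
  have L012: "eps < Lam n k p s" if "s < 3" for s
  proof -
    have "s = 0 \<or> s = 1 \<or> s = 2" using that by linarith
    then show ?thesis using L0 L1 L2 by blast
  qed
  have phge: "- (ln (real n) / 3) \<le> ln ph"
  proof -
    have "9/10 \<le> Prs ?K p (\<lambda>H. 3 \<le> max_degree n H)" by (rule above) (rule L012)
    also have "\<dots> \<le> real n * (ph ^ 3 / fact 3)" by (rule prob_max_degree_ge) (use kpos kn p01 in auto)
    finally have "9/10 * 6 \<le> real n * ph ^ 3" by (simp add: fact_numeral)
    then have "1 \<le> real n * ph ^ 3" by simp
    then have "0 \<le> ln (real n * ph ^ 3)" by simp
    also have "\<dots> = ln (real n) + 3 * ln ph" using ph_pos Lpos by (simp add: ln_mult ln_realpow)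
    finally show ?thesis by simp
  qed
  interpret N: nonL n k p eps a by unfold_locales (use False phge in auto)
  \<comment> \<open>Both events have probability above 1/2, so they occur together; this yields a
    size at most \<open>J\<close> at which \<open>Lam\<close> is small.\<close>
  have "\<exists>H. Lam n k p (max_degree n H) \<le> eps \<and> max_degree n H \<le> N.J"
  proof (rule ccontr)
    assume c: "\<not> ?thesis"
    have "Prs ?K p (\<lambda>H. \<not> eps < Lam n k p (max_degree n H)) \<le> Prs ?K p (\<lambda>H. Suc N.J \<le> max_degree n H)"
      by (rule Prs_mono) (use c in \<open>auto simp: not_less not_less_eq_eq\<close>)
    also have "\<dots> \<le> eps / 10^6" by (rule N.prob_above_J)
    also have "\<dots> \<le> 1/10" using eps01 by simp
    finally show False using hyp eps01 unfolding Prs_compl by linarith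
  qed
  then obtain t0 where t0: "Lam n k p t0 \<le> eps" "t0 \<le> N.J" by blast
  define t where "t = (LEAST t. Lam n k p t \<le> eps)"
  have t1: "Lam n k p t \<le> eps" unfolding t_def by (rule LeastI[of "\<lambda>t. Lam n k p t \<le> eps", OF t0(1)])
  have t2: "eps < Lam n k p s" if "s < t" for s using not_less_Least[OF that[unfolded t_def]] by simp
  have tJ: "t \<le> N.J" using Least_le[of "\<lambda>t. Lam n k p t \<le> eps" t0] t0 unfolding t_def by linarith
  have t3: "3 \<le> t"
  proof (rule ccontr)
    assume "\<not> 3 \<le> t"
    then show False using L012[of t] t1 by simp
  qed
  have tm: "2 * real t \<le> m"
  proof -
    have "108 * ph \<le> m"
    proof -
      have "ln (108 * ph) = ln 108 + ln ph" by (rule ln_mult_pos) (use ph_pos in auto)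
      moreover have "ln 108 \<le> b * L" by (rule lnc) auto
      ultimately have "ln (108 * ph) \<le> ln m" using ln_m ln_k_le bL Lpos by linarith
      then show ?thesis using ph_pos by (subst (asm) ln_le_cancel_iff) auto
    qed
    moreover have "16 * L \<le> m"
    proof -
      have "ln (16 * L) = ln 16 + ln L" by (rule ln_mult_pos) (use Lpos in auto)
      moreover have "ln 16 \<le> b * L" by (rule lnc) auto
      ultimately have "ln (16 * L) \<le> ln m" using N.ln_m_ge lnL bL Lpos by linarith
      then show ?thesis using ph_pos Lpos by (subst (asm) ln_le_cancel_iff) auto
    qed
    moreover have "real t \<le> real N.J" using tJ by simp
    ultimately show ?thesis using N.J_bounds(2) by linarith
  qed
  obtain ts where ts: "ts \<le> N.J" "real n * btail N.DD p (Suc ts) < exp (2 * (h * L))"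
    "Prs ?K p (\<lambda>H. max_degree n H < ts) \<le> eps / 10^5" using N.ts_exists by blast
  \<comment> \<open>Size \<open>t\<close> makes generic cliques unlikely and \<open>ts\<close>
    controls the degree tail; the maximum degree typically reaches both.\<close>
  define T where "T = max t ts"
  have tT: "t \<le> T" and TJ: "T \<le> N.J" using tJ ts(1) by (auto simp: T_def)
  have dT: "Prs ?K p (\<lambda>H. max_degree n H < T) \<le> 2 * eps"
  proof -
    have "Prs ?K p (\<lambda>H. max_degree n H < t) \<le> eps" by (rule below) (rule t2)
    moreover have "eps / 10^5 \<le> eps" using eps01 by simp
    ultimately show ?thesis using ts(3) eps01 unfolding T_def by (cases "t \<le> ts") (auto simp: max_def)
  qed
  have bt: "real n * btail N.DD p (Suc T) \<le> exp (2 * (h * L))"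
  proof -
    have "btail N.DD p (Suc T) \<le> btail N.DD p (Suc ts)" by (rule btail_antimono) (simp add: T_def)
    then have "real n * btail N.DD p (Suc T) \<le> real n * btail N.DD p (Suc ts)" by (intro mult_left_mono) auto
    then show ?thesis using ts(2) by linarith
  qed
  show ?thesis
  proof (cases "- (dd3 a * ln (real n)) \<le> ln q")
    case False
    interpret S: Sreg n k p eps a t by unfold_locales (use False bigD t1 t3 tm in auto)
    have "(CC a + 10) * eps = (CC a + 1) * eps + 9 * eps" by (simp add: algebra_simps)
    then show ?thesis using S.prob_not_EKR_S[OF tT bt] dT eps01 by linarith
  next
    case True
    interpret M0: Mreg0 n k p eps a t by unfold_locales (use True t1 t2 t3 tm in auto)
    \<comment> \<open>As \<open>K\<close> is at most \<open>t\<close>, degree \<open>K\<close>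
      typically occurs, so \<open>n * phi^K\<close> is at least 9/10. With \<open>K\<close> at least
      \<open>75 / h^2\<close> and the generous loss \<open>3/2 * L\<close> this gives the exponent
      \<open>h^2 / 50\<close> of \<open>phM\<close>.\<close>
    define K where "K = nat \<lceil>75 / h\<^sup>2\<rceil>"
    have h2: "1 \<le> 1 / h\<^sup>2"
    proof -
      have "h\<^sup>2 \<le> 1" using par(1,2) by (simp add: power_le_one)
      then show ?thesis using par(1) by simp
    qed
    have Ke: "75 / h\<^sup>2 \<le> real K" unfolding K_def by (rule real_nat_ceiling_ge)
    have "real K \<le> 75 / h\<^sup>2 + 1" unfolding K_def using par(1) by (simp add: of_nat_nat)
    also have "\<dots> \<le> 100 / h\<^sup>2"
    proof -
      have "75 * y + 1 \<le> 100 * y" if "1 \<le> y" for y :: real using that by linarith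
      from this[OF h2] show ?thesis by simp
    qed
    also have "\<dots> \<le> real t" by (rule M0.t_ge)
    finally have Kt: "K \<le> t" by simp
    have "9/10 \<le> Prs ?K p (\<lambda>H. K \<le> max_degree n H)" by (rule above) (use Kt t2 in auto)
    also have "\<dots> \<le> real n * (ph ^ K / fact K)" by (rule prob_max_degree_ge) (use kpos kn p01 in auto)
    also have "\<dots> \<le> real n * (ph ^ K / 1)" using ph_pos by (intro mult_left_mono divide_left_mono) (auto simp: fact_ge_1)
    finally have "ln (9/10) \<le> ln (real n * (ph ^ K / 1))" using ph_pos Lpos by (subst ln_le_cancel_iff) auto
    also have "\<dots> = L + real K * ln ph" using ph_pos Lpos by (simp add: ln_mult ln_realpow L_def)
    finally have lk: "- L - 1 \<le> real K * ln ph"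
    proof -
      assume A: "ln (9/10) \<le> L + real K * ln ph"
      have "1 - 1 / (9/10) \<le> ln (9/10::real)" using ln_ge_iff ln_le_minus_one[of "1 / (9/10::real)"] by (simp add: ln_div)
      then show ?thesis using A by simp
    qed
    have phM: "- (h\<^sup>2 / 50 * ln (real n)) \<le> ln ph"
    proof (cases "0 \<le> ln ph")
      case True
      have "0 \<le> h\<^sup>2 / 50 * ln (real n)" using Lpos by (simp add: L_def)
      then show ?thesis using True by linarith
    next
      case False
      then have "real K * ln ph \<le> 75 / h\<^sup>2 * ln ph" using Ke by (intro mult_right_mono_neg) auto
      then have "- (3/2 * L) \<le> 75 / h\<^sup>2 * ln ph" using lk Lpos by linarith
      then have "- (3/2 * L) * (h\<^sup>2 / 75) \<le> 75 / h\<^sup>2 * ln ph * (h\<^sup>2 / 75)" by (intro mult_right_mono) auto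
      also have "\<dots> = ln ph" using par(1) by simp
      finally show ?thesis by (simp add: L_def mult.commute)
    qed
    interpret M: Mreg n k p eps a t by unfold_locales (use phM in auto)
    have "16 * eps \<le> (CC a + 10) * eps" using CC_ge(6)[of a] eps01 by (intro mult_right_mono) auto
    then show ?thesis using M.prob_not_EKR_M[OF tT TJ bt] dT eps01 by linarith
  qed
qed

end

text \<open>Removes the degenerate cases: \<open>k = 1\<close> is trivial, and \<open>p = 0\<close>
  contradicts \<open>hyp\<close>, because all degrees vanish and \<open>Lam\<close> at 0 equals
  1.\<close>

lemma prob_not_EKR:
  fixes n k :: nat and p eps a :: real
  assumes kn: "0 < k" "2 * k < n" and kL: "(real k)\<^sup>2 \<le> (1/4 - 2 * a) * real n * ln (real n)"
    and p01: "0 \<le> p" "p \<le> 1" and a01: "0 < a" "a \<le> 1/8" and eps01: "0 < eps" "eps < 1/10"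
    and big: "ln (ln (real n)) \<le> bb a * ln (real n)" "ln (10^6 / (eps * a)) \<le> bb a * ln (real n)"
      "1000 \<le> ln (real n)" "ln (CC a) \<le> bb a * ln (real n)"
    and hyp: "Prs (ksets n k) p (\<lambda>H. eps < Lam n k p (max_degree n H)) \<le> eps"
  shows "Prs (ksets n k) p (\<lambda>H. \<not> satisfies_EKR n H) \<le> (CC a + 10) * eps"
proof (cases "k = 1")
  case True
  have "0 < n" using kn by simp
  then have "satisfies_EKR n H" if "H \<subseteq> ksets n k" for H using that satisfies_EKR_singletons[of H n] unfolding True by blast
  then have "Prs (ksets n k) p (\<lambda>H. \<not> satisfies_EKR n H) \<le> Prs (ksets n k) p (\<lambda>H. False)" by (intro Prs_mono) blast
  also have "\<dots> = 0" by simp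
  also have "0 \<le> (CC a + 10) * eps" using CC_ge(5)[of a] eps01 by simp
  finally show ?thesis .
next
  case False
  have "p \<noteq> 0"
  proof
    assume p: "p = 0"
    have "Prs (ksets n k) p (\<lambda>H. 1 \<le> max_degree n H) \<le> 0"
      using prob_max_degree_pos[OF kn p01] p by (simp add: mbar_def phi_def)
    moreover have "Prs (ksets n k) p (\<lambda>H. \<not> 1 \<le> max_degree n H) \<le> eps"
    proof (rule order_trans[OF Prs_mono hyp])
      fix H assume "\<not> 1 \<le> max_degree n H"
      then have "max_degree n H = 0" by simp
      then show "eps < Lam n k p (max_degree n H)" using eps01 by (simp add: Lam_def numeral_2_eq_2)
    qed
    ultimately show False using eps01 unfolding Prs_compl by linarith
  qed
  then interpret base n k p eps a by unfold_locales (use assms False in auto)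
  show ?thesis by (rule prob_not_EKR_base) (use big hyp in auto)
qed

theorem theorem1p2:
  fixes c :: real and k :: "nat \<Rightarrow> nat" and p :: "nat \<Rightarrow> real" and eps :: "nat \<Rightarrow> real"
  assumes "c < 1/4"
    and "\<forall>\<^sub>F n in sequentially. 0 < k n \<and> 2 * k n < n"
    and "\<forall>\<^sub>F n in sequentially. real (k n) < sqrt (c * real n * ln (real n))"
    and "\<forall>\<^sub>F n in sequentially. 0 \<le> p n \<and> p n \<le> 1"
    and "eps \<longlonglongrightarrow> 0"
    and "(\<lambda>n. measure_pmf.prob (random_kgraph n (k n) (p n))
            {H. Lam n (k n) (p n) (max_degree n H) > eps n}) \<longlonglongrightarrow> 0"
  shows "(\<lambda>n. measure_pmf.prob (random_kgraph n (k n) (p n)) {H. satisfies_EKR n H}) \<longlonglongrightarrow> 1"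
proof (rule tendstoI)
  fix e :: real assume e: "0 < e"
  \<comment> \<open>The maximum with 0 keeps \<open>a\<close> at most 1/8 also for negative
    \<open>c\<close>.\<close>
  define a where "a = (1/4 - max c 0) / 2"
  have a01: "0 < a" "a \<le> 1/8" using assms(1) by (auto simp: a_def)
  have ca: "c \<le> 1/4 - 2 * a"
  proof -
    have "2 * a = 1/4 - max c 0" by (simp add: a_def)
    then show ?thesis using max.cobounded1[of c 0] by linarith
  qed
  define C where "C = CC a + 10"
  have C0: "0 < C" using CC_ge(5)[of a] by (simp add: C_def)
  define e0 where "e0 = min (1/20) (e / (2 * C))"
  have e0: "0 < e0" "e0 < 1/10" using e C0 by (auto simp: e0_def)
  have Ce: "C * e0 < e"
  proof -
    have "C * e0 \<le> C * (e / (2 * C))" using C0 by (intro mult_left_mono) (auto simp: e0_def)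
    also have "\<dots> < e" using C0 e by simp
    finally show ?thesis .
  qed
  have b0: "0 < bb a" using a01 by (simp add: bb_def dd2_def dd3_def hh_def)
  have top: "filterlim (\<lambda>n. ln (real n)) at_top sequentially" by real_asymp
  have big: "\<forall>\<^sub>F n in sequentially. x \<le> bb a * ln (real n)" for x
  proof -
    have "\<forall>\<^sub>F n in sequentially. x / bb a \<le> ln (real n)" using top by (simp add: filterlim_at_top)
    then show ?thesis by eventually_elim (use b0 in \<open>simp add: field_simps\<close>)
  qed
  have bigC: "\<forall>\<^sub>F n in sequentially. 1000 \<le> ln (real n)" using top by (simp add: filterlim_at_top)
  have bigA: "\<forall>\<^sub>F n in sequentially. ln (ln (real n)) \<le> bb a * ln (real n)" using b0 by real_asymp
  have ev1: "\<forall>\<^sub>F n in sequentially. eps n < e0" using assms(5) e0(1) by (rule order_tendstoD)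
  have ev2: "\<forall>\<^sub>F n in sequentially. measure_pmf.prob (random_kgraph n (k n) (p n))
      {H. Lam n (k n) (p n) (max_degree n H) > eps n} < e0" using assms(6) e0(1) by (rule order_tendstoD)
  show "\<forall>\<^sub>F n in sequentially. dist (measure_pmf.prob (random_kgraph n (k n) (p n)) {H. satisfies_EKR n H}) 1 < e"
    using assms(2,3,4) bigA bigC big[of "ln (10^6 / (e0 * a))"] big[of "ln (CC a)"] ev1 ev2
  proof eventually_elim
    case (elim n)
    have sq: "(real (k n))\<^sup>2 \<le> c * real n * ln (real n)"
    proof -
      have "(real (k n))\<^sup>2 \<le> (sqrt (c * real n * ln (real n)))\<^sup>2" using elim(2) by (intro power_mono) auto
      \<comment> \<open>A positive root shows that its argument is positive, so that squaring undoes
        the root.\<close>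
      moreover have "0 < sqrt (c * real n * ln (real n))" using elim(2) by (rule le_less_trans[rotated]) simp
      ultimately show ?thesis by simp
    qed
    also have "\<dots> \<le> (1/4 - 2 * a) * real n * ln (real n)" using ca elim(5) by (intro mult_right_mono) auto
    finally have kL: "(real (k n))\<^sup>2 \<le> (1/4 - 2 * a) * real n * ln (real n)" .
    have "Prs (ksets n (k n)) (p n) (\<lambda>H. \<not> satisfies_EKR n H) \<le> (CC a + 10) * e0"
    proof (rule prob_not_EKR[OF _ _ kL _ _ a01 e0])
      have "Prs (ksets n (k n)) (p n) (\<lambda>H. e0 < Lam n (k n) (p n) (max_degree n H))
         \<le> Prs (ksets n (k n)) (p n) (\<lambda>H. eps n < Lam n (k n) (p n) (max_degree n H))"
        by (rule Prs_mono) (use elim(8) in linarith)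
      also have "\<dots> \<le> e0" using elim(9) unfolding random_kgraph_eq_rsub by simp
      finally show "Prs (ksets n (k n)) (p n) (\<lambda>H. e0 < Lam n (k n) (p n) (max_degree n H)) \<le> e0" .
    qed (use elim in auto)
    then have "1 - Prs (ksets n (k n)) (p n) (\<lambda>H. satisfies_EKR n H) < e" using Ce unfolding Prs_compl C_def by linarith
    moreover have "Prs (ksets n (k n)) (p n) (\<lambda>H. satisfies_EKR n H) \<le> 1" by simp
    ultimately show ?case unfolding random_kgraph_eq_rsub dist_real_def by linarith
  qed
qed

end
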